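(* Let $\theta>0$ and let $G=(G_t)_{t\ge 0}$ be a centered Gaussian process satisfying the Gaussian noise hypothesis stated in the context, with parameter $\beta\in(\frac12,1)$. Let $X$ be the Ornstein–Uhlenbeck process $\mathrm{d}X_t=-\theta X_t\,\mathrm{d}t+\mathrm{d}G_t$, $X_0=0$. Then the least squares estimator $\hat\theta_T$ and the second moment estimator $\tilde\theta_T$ (both defined in the context) are strongly consistent, i.e. $$\lim_{T\to\infty}\hat\theta_T=\theta,\qquad \lim_{T\to\infty}\tilde\theta_T=\theta,\qquad\text{almost surely.}$$
   Context: $G=(G_t)_{t\ge0}$ is a continuous one-dimensional centered Gaussian process on a complete probability space $(\Omega,\mathcal F,P)$, with $\mathcal F$ generated by $G$ and with continuous covariance function $R(t,s)=\mathbb E[G_tG_s]$. Gaussian noise hypothesis: for $\beta\in(\frac12,1)$, for any $t\ne s\in[0,\infty)$, $$\frac{\partial^2}{\partial t\,\partial s}R(t,s)=C_\beta|t-s|^{2\beta-2}+\Psi(t,s),\qquad |\Psi(t,s)|\le C'_\beta|ts|^{\beta-1},$$ where the constants $\beta$, $C_\beta>0$, $C'_\beta\ge0$ do not depend on $T$; moreover $R(0,t)=0$ for all $t\ge0$. The volatility is normalized to $\sigma=1$. The solution is $X_t=\int_0^te^{-\theta(t-s)}\,\mathrm dG_s$. The least squares estimator is $$\hat\theta_T=-\frac{\int_0^TX_t\,\mathrm dX_t}{\int_0^TX_t^2\,\mathrm dt}=\theta-\frac{\int_0^TX_t\,\mathrm dG_t}{\int_0^TX_t^2\,\mathrm dt},$$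 where the integral with respect to $G$ is the Skorohod (divergence-type) integral of Malliavin calculus for the Gaussian process $G$. The second moment estimator is $$\tilde\theta_T=\Big(\frac{1}{C_\beta\Gamma(2\beta-1)T}\int_0^TX_t^2\,\mathrm dt\Big)^{-\frac1{2\beta}}.$$
   Formalization: Adds that ∂R/∂s(t,s) exists and is continuous in t also at t=s, so the mixed derivative is the density of the covariance; without it, fractional plus independent Brownian motion satisfies the hypothesis but the second moment estimator is inconsistent. *)

theory Defs
  imports "HOL-Probability.Probability"
begin

section \<open>The Gaussian noise\<close>

text \<open>Degenerate (almost surely vanishing) variables count as Gaussian.\<close>

definition centered_gaussian :: "'a measure \<Rightarrow> ('a \<Rightarrow> real) \<Rightarrow> bool" where
  "centered_gaussian M Z \<longleftrightarrow> Z \<in> borel_measurable M \<and>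
     ((AE \<omega> in M. Z \<omega> = 0) \<or> (\<exists>\<sigma>>0. distributed M lborel Z (\<lambda>x. ennreal (normal_density 0 \<sigma> x))))"

definition centered_gaussian_process :: "'a measure \<Rightarrow> (real \<Rightarrow> 'a \<Rightarrow> real) \<Rightarrow> bool" where
  "centered_gaussian_process M G \<longleftrightarrow>
     (\<forall>S c. finite S \<and> S \<subseteq> {0..} \<longrightarrow> centered_gaussian M (\<lambda>\<omega>. \<Sum>t\<in>S. c t * G t \<omega>))"

definition covariance :: "'a measure \<Rightarrow> (real \<Rightarrow> 'a \<Rightarrow> real) \<Rightarrow> real \<Rightarrow> real \<Rightarrow> real" where
  "covariance M G t s = (LINT \<omega>|M. G t \<omega> * G s \<omega>)"

text \<open>The \<open>\<sigma>\<close>-algebra of a complete space is generated by \<open>G\<close> when it is the one generated by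
  the variables \<open>G t\<close> together with the null sets.\<close>

definition generated_by :: "'a measure \<Rightarrow> (real \<Rightarrow> 'a \<Rightarrow> real) \<Rightarrow> bool" where
  "generated_by M G \<longleftrightarrow>
     (\<forall>A\<in>sets M. \<exists>B\<in>sigma_sets (space M) {G t -` S \<inter> space M | t S. t \<ge> 0 \<and> S \<in> sets borel}.
        AE \<omega> in M. \<omega> \<in> A \<longleftrightarrow> \<omega> \<in> B)"

text \<open>
  The mixed derivative of the covariance is \<open>C\<^sub>\<beta> \<bar>t - s\<bar>\<^bsup>2\<beta>-2\<^esup> + \<Psi>(t,s)\<close> off the diagonal; \<open>R'\<close> is
  the first-order derivative \<open>\<partial>R/\<partial>s\<close>. Two conventions are fixed here.

  First, the times are positive, because the bound on \<open>\<Psi>\<close> is infinite on the axes (whereas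
  \<open>0 powr (\<beta> - 1) = 0\<close> in HOL).

  Second, \<open>t \<mapsto> \<partial>R/\<partial>s (t, s)\<close> exists and is continuous also at \<open>t = s\<close>. For \<open>t \<noteq> s\<close> this follows from
  the existence of the mixed derivative. Together with \<open>R(0, t) = 0\<close> it says that the mixed
  derivative is the density of the covariance, i.e. that \<open>R\<close> is recovered by integrating it over
  \<open>[0,t] \<times> [0,s]\<close>. Without it, an independent Brownian motion could be added to
  \<open>G\<close>, since \<open>min t s\<close> has vanishing mixed derivative off the diagonal.\<close>

definition noise_hypothesis ::
    "(real \<Rightarrow> real \<Rightarrow> real) \<Rightarrow> real \<Rightarrow> real \<Rightarrow> real \<Rightarrow> (real \<Rightarrow> real \<Rightarrow> real) \<Rightarrow> bool" where
  "noise_hypothesis R \<beta> C C' \<Psi> \<longleftrightarrow>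
     1/2 < \<beta> \<and> \<beta> < 1 \<and> 0 < C \<and> 0 \<le> C' \<and>
     (\<exists>R'. (\<forall>t>0. \<forall>s>0. ((\<lambda>s. R t s) has_real_derivative R' t s) (at s)) \<and>
           (\<forall>s>0. continuous_on {0<..} (\<lambda>t. R' t s)) \<and>
           (\<forall>t>0. \<forall>s>0. t \<noteq> s \<longrightarrow>
              ((\<lambda>t. R' t s) has_real_derivative C * \<bar>t - s\<bar> powr (2 * \<beta> - 2) + \<Psi> t s) (at t))) \<and>
     (\<forall>t>0. \<forall>s>0. t \<noteq> s \<longrightarrow> \<bar>\<Psi> t s\<bar> \<le> C' * \<bar>t * s\<bar> powr (\<beta> - 1)) \<and>
     (\<forall>t\<ge>0. R 0 t = 0)"

definition gaussian_noise ::
    "'a measure \<Rightarrow> (real \<Rightarrow> 'a \<Rightarrow> real) \<Rightarrow> real \<Rightarrow> real \<Rightarrow> real \<Rightarrow> (real \<Rightarrow> real \<Rightarrow> real) \<Rightarrow> bool" where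
  "gaussian_noise M G \<beta> C C' \<Psi> \<longleftrightarrow>
     prob_space M \<and> complete_measure M \<and> centered_gaussian_process M G \<and> generated_by M G \<and>
     (AE \<omega> in M. continuous_on {0..} (\<lambda>t. G t \<omega>)) \<and>
     continuous_on ({0..} \<times> {0..}) (\<lambda>(t, s). covariance M G t s) \<and>
     noise_hypothesis (covariance M G) \<beta> C C' \<Psi>"

section \<open>Malliavin calculus for the noise\<close>

definition square_integrable :: "'b measure \<Rightarrow> ('b \<Rightarrow> real) \<Rightarrow> bool" where
  "square_integrable N f \<longleftrightarrow> f \<in> borel_measurable N \<and> integrable N (\<lambda>x. (f x)\<^sup>2)"

definition L2_limit :: "'b measure \<Rightarrow> (nat \<Rightarrow> 'b \<Rightarrow> real) \<Rightarrow> ('b \<Rightarrow> real) \<Rightarrow> bool" where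
  "L2_limit N f g \<longleftrightarrow> (\<forall>n. square_integrable N (f n)) \<and> square_integrable N g \<and>
     (\<lambda>n. LINT x|N. (f n x - g x)\<^sup>2) \<longlonglongrightarrow> 0"

text \<open>
  The Hilbert space \<open>\<HH>\<close>, the completion of the step functions on \<open>[0,\<infinity>)\<close> for the inner product
  \<open>\<langle>1\<^bsub>[a,b)\<^esub>, 1\<^bsub>[c,d)\<^esub>\<rangle> = E[(G\<^sub>b - G\<^sub>a)(G\<^sub>d - G\<^sub>c)]\<close>, is realised by its image under the isonormal
  isometry \<open>h \<mapsto> G(h)\<close>: the closure in \<open>L\<^sup>2(\<Omega>)\<close> of the linear span of the \<open>G t\<close>. So \<open>h\<close> is
  represented by the random variable \<open>G(h)\<close>, \<open>1\<^bsub>[a,b)\<^esub>\<close> by \<open>G b - G a\<close>, and \<open>\<langle>g, h\<rangle> = E[G(g) G(h)]\<close>.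

  Accordingly \<open>u \<in> L\<^sup>2(\<Omega>; \<HH>)\<close> is represented by the function \<open>(\<omega>, \<omega>') \<mapsto> G(u(\<omega>))(\<omega>')\<close> in
  \<open>L\<^sup>2(\<Omega> \<times> \<Omega>)\<close>, so that \<open>E\<langle>u, v\<rangle>\<close> is an \<open>L\<^sup>2\<close> inner product over \<open>M \<Otimes>\<^sub>M M\<close>.\<close>

definition noise_space :: "'a measure \<Rightarrow> (real \<Rightarrow> 'a \<Rightarrow> real) \<Rightarrow> ('a \<Rightarrow> real) set" where
  "noise_space M G = {Z. \<exists>S c. (\<forall>n. finite (S n) \<and> S n \<subseteq> {0..}) \<and>
     L2_limit M (\<lambda>n \<omega>. \<Sum>t\<in>S n. c n t * G t \<omega>) Z}"

text \<open>A function of \<open>n\<close> real variables is a function on sequences that depends only on the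
  coordinates below \<open>n\<close>; such a function is in \<open>C\<^sub>b\<^sup>\<infinity>\<close> when its iterated partial derivatives of
  all orders exist and are continuous and bounded.\<close>

definition partial :: "nat \<Rightarrow> ((nat \<Rightarrow> real) \<Rightarrow> real) \<Rightarrow> (nat \<Rightarrow> real) \<Rightarrow> real" where
  "partial i f x = deriv (\<lambda>y. f (x(i := y))) (x i)"

definition smooth_bounded :: "nat \<Rightarrow> ((nat \<Rightarrow> real) \<Rightarrow> real) \<Rightarrow> bool" where
  "smooth_bounded n f \<longleftrightarrow> (\<forall>x y. (\<forall>i<n. x i = y i) \<longrightarrow> f x = f y) \<and>
     (\<forall>is. set is \<subseteq> {..<n} \<longrightarrow>
        continuous_on UNIV (foldr partial is f) \<and> bounded (range (foldr partial is f)) \<and>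
        (\<forall>i<n. \<forall>x. (\<lambda>y. foldr partial is f (x(i := y))) field_differentiable at (x i)))"

text \<open>The smooth functional \<open>F = f (G(h\<^sub>0), \<dots>, G(h\<^bsub>n-1\<^esub>))\<close>, given by \<open>Z i = G(h\<^sub>i)\<close>, and its
  derivative \<open>DF = \<Sum>i<n. \<partial>\<^sub>i f (G(h\<^sub>0), \<dots>, G(h\<^bsub>n-1\<^esub>)) h\<^sub>i\<close>.\<close>

definition smooth_functional ::
    "((nat \<Rightarrow> real) \<Rightarrow> real) \<Rightarrow> (nat \<Rightarrow> 'a \<Rightarrow> real) \<Rightarrow> 'a \<Rightarrow> real" where
  "smooth_functional f Z \<omega> = f (\<lambda>i. Z i \<omega>)"

definition smooth_deriv ::
    "nat \<Rightarrow> ((nat \<Rightarrow> real) \<Rightarrow> real) \<Rightarrow> (nat \<Rightarrow> 'a \<Rightarrow> real) \<Rightarrow> 'a \<times> 'a \<Rightarrow> real" where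
  "smooth_deriv n f Z = (\<lambda>(\<omega>, \<omega>'). \<Sum>i<n. partial i f (\<lambda>j. Z j \<omega>) * Z i \<omega>')"

text \<open>\<open>F\<close> belongs to the domain \<open>D\<^bsup>1,2\<^esup>\<close> of the closure of this operator, with \<open>DF = V\<close>.\<close>

definition malliavin_deriv ::
    "'a measure \<Rightarrow> (real \<Rightarrow> 'a \<Rightarrow> real) \<Rightarrow> ('a \<Rightarrow> real) \<Rightarrow> ('a \<times> 'a \<Rightarrow> real) \<Rightarrow> bool" where
  "malliavin_deriv M G F V \<longleftrightarrow>
     (\<exists>n f Z. (\<forall>k. smooth_bounded (n k) (f k) \<and> (\<forall>i<n k. Z k i \<in> noise_space M G)) \<and>
        L2_limit M (\<lambda>k. smooth_functional (f k) (Z k)) F \<and>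
        L2_limit (M \<Otimes>\<^sub>M M) (\<lambda>k. smooth_deriv (n k) (f k) (Z k)) V)"

text \<open>\<open>\<delta>(u) = Y\<close>, where \<open>\<delta>\<close> is the adjoint of \<open>D\<close>: \<open>E[F Y] = E\<langle>DF, u\<rangle>\<close> for all \<open>F\<close> in \<open>D\<^bsup>1,2\<^esup>\<close>.\<close>

definition divergence ::
    "'a measure \<Rightarrow> (real \<Rightarrow> 'a \<Rightarrow> real) \<Rightarrow> ('a \<times> 'a \<Rightarrow> real) \<Rightarrow> ('a \<Rightarrow> real) \<Rightarrow> bool" where
  "divergence M G u Y \<longleftrightarrow> square_integrable (M \<Otimes>\<^sub>M M) u \<and> square_integrable M Y \<and>
     (\<forall>F V. malliavin_deriv M G F V \<longrightarrow>
        (LINT \<omega>|M. F \<omega> * Y \<omega>) = (LINT p|(M \<Otimes>\<^sub>M M). V p * u p))"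

text \<open>The step process \<open>\<Sum>k<n. x(kT/n) 1\<^bsub>[kT/n, (k+1)T/n)\<^esub>\<close> as an element of \<open>L\<^sup>2(\<Omega>; \<HH>)\<close>.\<close>

definition step_process ::
    "(real \<Rightarrow> 'a \<Rightarrow> real) \<Rightarrow> (real \<Rightarrow> 'a \<Rightarrow> real) \<Rightarrow> real \<Rightarrow> nat \<Rightarrow> 'a \<times> 'a \<Rightarrow> real" where
  "step_process G x T n = (\<lambda>(\<omega>, \<omega>'). \<Sum>k<n. x (real k * T / real n) \<omega> *
     (G (real (Suc k) * T / real n) \<omega>' - G (real k * T / real n) \<omega>'))"

text \<open>\<open>\<integral>\<^sub>0\<^sup>T x\<^sub>t dG\<^sub>t = \<delta>(x 1\<^bsub>[0,T]\<^esub>) = Y\<close> for a continuous process \<open>x\<close>: as an element of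
  \<open>L\<^sup>2(\<Omega>; \<HH>)\<close>, \<open>x 1\<^bsub>[0,T]\<^esub>\<close> is the limit of its step processes.\<close>

definition skorohod_integral ::
    "'a measure \<Rightarrow> (real \<Rightarrow> 'a \<Rightarrow> real) \<Rightarrow> (real \<Rightarrow> 'a \<Rightarrow> real) \<Rightarrow> real \<Rightarrow> ('a \<Rightarrow> real) \<Rightarrow> bool" where
  "skorohod_integral M G x T Y \<longleftrightarrow>
     (\<exists>u. L2_limit (M \<Otimes>\<^sub>M M) (step_process G x T) u \<and> divergence M G u Y)"

text \<open>For each \<open>T\<close> the integral is determined only up to a null set, which may depend on \<open>T\<close>.
  Almost sure limits as \<open>T \<rightarrow> \<infinity>\<close> refer to a version with continuous paths, which is unique up to
  indistinguishability.\<close>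

definition skorohod_version ::
    "'a measure \<Rightarrow> (real \<Rightarrow> 'a \<Rightarrow> real) \<Rightarrow> (real \<Rightarrow> 'a \<Rightarrow> real) \<Rightarrow> (real \<Rightarrow> 'a \<Rightarrow> real) \<Rightarrow> bool" where
  "skorohod_version M G x I \<longleftrightarrow> (\<forall>T\<ge>0. skorohod_integral M G x T (I T)) \<and>
     (AE \<omega> in M. continuous_on {0..} (\<lambda>T. I T \<omega>))"

section \<open>The Ornstein--Uhlenbeck process and the estimators\<close>

definition ornstein_uhlenbeck ::
    "'a measure \<Rightarrow> (real \<Rightarrow> 'a \<Rightarrow> real) \<Rightarrow> real \<Rightarrow> (real \<Rightarrow> 'a \<Rightarrow> real) \<Rightarrow> bool" where
  "ornstein_uhlenbeck M G \<theta> X \<longleftrightarrow> (\<forall>t\<ge>0. X t \<in> borel_measurable M) \<and>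
     (AE \<omega> in M. continuous_on {0..} (\<lambda>t. X t \<omega>) \<and> X 0 \<omega> = 0 \<and>
        (\<forall>t\<ge>0. X t \<omega> = - \<theta> * (LBINT s:{0..t}. X s \<omega>) + G t \<omega>))"

definition energy :: "(real \<Rightarrow> 'a \<Rightarrow> real) \<Rightarrow> real \<Rightarrow> 'a \<Rightarrow> real" where
  "energy X T \<omega> = (LBINT t:{0..T}. (X t \<omega>)\<^sup>2)"

text \<open>In both definitions below, \<open>I T\<close> is the Skorohod integral \<open>\<integral>\<^sub>0\<^sup>T X\<^sub>t dG\<^sub>t\<close>; the first one is
  \<open>\<integral>\<^sub>0\<^sup>T X\<^sub>t dX\<^sub>t\<close> with \<open>dX\<^sub>t = - \<theta> X\<^sub>t dt + dG\<^sub>t\<close>.\<close>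

definition integral_X_dX ::
    "real \<Rightarrow> (real \<Rightarrow> 'a \<Rightarrow> real) \<Rightarrow> (real \<Rightarrow> 'a \<Rightarrow> real) \<Rightarrow> real \<Rightarrow> 'a \<Rightarrow> real" where
  "integral_X_dX \<theta> X I T \<omega> = - \<theta> * energy X T \<omega> + I T \<omega>"

definition least_squares_estimator ::
    "real \<Rightarrow> (real \<Rightarrow> 'a \<Rightarrow> real) \<Rightarrow> (real \<Rightarrow> 'a \<Rightarrow> real) \<Rightarrow> real \<Rightarrow> 'a \<Rightarrow> real" where
  "least_squares_estimator \<theta> X I T \<omega> = - (integral_X_dX \<theta> X I T \<omega> / energy X T \<omega>)"

definition second_moment_estimator ::
    "real \<Rightarrow> real \<Rightarrow> (real \<Rightarrow> 'a \<Rightarrow> real) \<Rightarrow> real \<Rightarrow> 'a \<Rightarrow> real" where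
  "second_moment_estimator \<beta> C X T \<omega> =
     (1 / (C * Gamma (2 * \<beta> - 1) * T) * energy X T \<omega>) powr (- (1 / (2 * \<beta>)))"

end

theory Submission
  imports Defs "HOL-Real_Asymp.Real_Asymp"
begin

text \<open>With \<open>E\<^sub>T = \<integral>\<^sub>0\<^sup>T X\<^sub>t\<^sup>2 dt\<close>, the Skorohod integral \<open>I\<^sub>T = \<integral>\<^sub>0\<^sup>T X\<^sub>t dG\<^sub>t\<close> is
  \<open>X\<^sub>T\<^sup>2 / 2 + \<theta> E\<^sub>T\<close> minus its expectation: the Riemann sums of the pathwise integral converge to
  \<open>X\<^sub>T\<^sup>2 / 2 + \<theta> E\<^sub>T\<close>, and Gaussian integration by parts shows that centering a sum of products
  \<open>X\<^sub>s (G\<^sub>t - G\<^sub>s)\<close> gives its divergence. Both limits therefore follow from \<open>E\<^sub>T / T \<rightarrow> l\<close> and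
  \<open>X\<^sub>T\<^sup>2 / T \<rightarrow> 0\<close> almost surely, where \<open>l = C \<Gamma>(2\<beta>-1) \<theta>\<^bsup>-2\<beta>\<^esup>\<close>.

  The covariance of \<open>X\<close> is compared with that of the fractional Ornstein--Uhlenbeck process; the
  perturbation \<open>\<Psi>\<close> contributes a product of two functions that tend to \<open>0\<close>. This gives
  \<open>E[X\<^sub>t\<^sup>2] \<rightarrow> l\<close> and \<open>E[X\<^sub>s X\<^sub>t] = O(\<bar>t - s\<bar>\<^bsup>\<beta>-1\<^esup>)\<close>. By Wick's formula \<open>E\<^sub>T\<close> has variance
  \<open>O(T\<^bsup>2\<beta>\<^esup>)\<close>, and Borel--Cantelli along \<open>T = n\<^sup>m\<close> with monotonicity of \<open>E\<^sub>T\<close> gives the first limit. The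
  second one follows from the first and a chaining bound for the oscillation of \<open>G\<close> on \<open>[N, N + 1]\<close>.\<close>

section \<open>Square-integrable functions\<close>

text \<open>The mixed derivative of the covariance is singular on the diagonal and its bound is
  singular on the axes, so it is never integrated. Sign conditions on it become sign conditions on
  rectangle increments, and \<open>ou_op\<close>, a Stieltjes integral against the exponential
  kernel written after integration by parts, turns bounds on increments into bounds on the
  covariance of X.

  The integrand X 1_[0,T] has no formula as an element of L2(\<Omega>; H). It comes from
  completeness: its step processes are Cauchy because the rectangle increments of R have finite
  total variation.

  An arbitrary continuous version of the Skorohod integral has to be covered. It is identified for
  each T by uniqueness of the divergence, which rests on the trigonometric functionals of G being
  total when G generates the sigma-algebra, and then for all T by continuity. Path properties hold
  only almost surely, so the analysis is done for modified processes G', X' and carried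
  back.\<close>

lemma sq_int_mult:
  assumes "square_integrable N f" "square_integrable N g"
  shows "integrable N (\<lambda>x. f x * g x)"
proof (rule Bochner_Integration.integrable_bound)
  show "integrable N (\<lambda>x. (f x)\<^sup>2 + (g x)\<^sup>2)"
    using assms by (auto simp: square_integrable_def)
  show "(\<lambda>x. f x * g x) \<in> borel_measurable N"
    using assms by (auto simp: square_integrable_def)
  show "AE x in N. norm (f x * g x) \<le> norm ((f x)\<^sup>2 + (g x)\<^sup>2)"
  proof (rule AE_I2)
    fix x
    have "0 \<le> (\<bar>f x\<bar> - \<bar>g x\<bar>)\<^sup>2" by simp
    then have "2 * (\<bar>f x\<bar> * \<bar>g x\<bar>) \<le> (f x)\<^sup>2 + (g x)\<^sup>2"
      by (simp add: power2_diff algebra_simps)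
    moreover have "0 \<le> \<bar>f x\<bar> * \<bar>g x\<bar>" by simp
    ultimately have "\<bar>f x\<bar> * \<bar>g x\<bar> \<le> (f x)\<^sup>2 + (g x)\<^sup>2" by linarith
    then show "norm (f x * g x) \<le> norm ((f x)\<^sup>2 + (g x)\<^sup>2)"
      by (simp add: abs_mult)
  qed
qed

lemma sq_int_add:
  assumes "square_integrable N f" "square_integrable N g"
  shows "square_integrable N (\<lambda>x. f x + g x)"
proof -
  have "integrable N (\<lambda>x. (f x)\<^sup>2 + (g x)\<^sup>2 + 2 * (f x * g x))"
    using assms sq_int_mult[OF assms] by (auto simp: square_integrable_def)
  moreover have "(\<lambda>x. (f x)\<^sup>2 + (g x)\<^sup>2 + 2 * (f x * g x)) = (\<lambda>x. (f x + g x)\<^sup>2)"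
    by (auto simp: power2_sum)
  ultimately show ?thesis
    using assms by (auto simp: square_integrable_def)
qed

lemma sq_int_cmult:
  assumes "square_integrable N f"
  shows "square_integrable N (\<lambda>x. c * f x)"
  using assms by (auto simp: square_integrable_def power_mult_distrib)

lemma sq_int_diff:
  assumes "square_integrable N f" "square_integrable N g"
  shows "square_integrable N (\<lambda>x. f x - g x)"
  using sq_int_add[OF assms(1) sq_int_cmult[OF assms(2), of "-1"]] by simp

lemma sq_int_zero: "square_integrable N (\<lambda>x. 0)"
  by (auto simp: square_integrable_def)

lemma sq_int_sum:
  "(\<And>i. i \<in> A \<Longrightarrow> square_integrable N (f i)) \<Longrightarrow> square_integrable N (\<lambda>x. \<Sum>i\<in>A. f i x)"
  by (induction A rule: infinite_finite_induct) (auto intro: sq_int_add sq_int_zero)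

text \<open>The integral of (f - t g)^2 is a nonnegative quadratic in t. Its value at the vertex
  gives the bound; if the leading coefficient vanishes it is affine in t, and then its slope must
  vanish too.\<close>

lemma integral_sq_cauchy_schwarz:
  assumes f: "square_integrable N f" and g: "square_integrable N g"
  shows "(LINT x|N. f x * g x)\<^sup>2 \<le> (LINT x|N. (f x)\<^sup>2) * (LINT x|N. (g x)\<^sup>2)"
proof -
  let ?a = "LINT x|N. (f x)\<^sup>2" and ?b = "LINT x|N. f x * g x" and ?c = "LINT x|N. (g x)\<^sup>2"
  have fi: "integrable N (\<lambda>x. (f x)\<^sup>2)" "integrable N (\<lambda>x. (g x)\<^sup>2)"
    using f g by (auto simp: square_integrable_def)
  note fg = sq_int_mult[OF f g]
  have quad: "0 \<le> ?a - 2 * t * ?b + t\<^sup>2 * ?c" for t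
  proof -
    have "0 \<le> (LINT x|N. (f x - t * g x)\<^sup>2)" by simp
    also have "(\<lambda>x. (f x - t * g x)\<^sup>2) = (\<lambda>x. (f x)\<^sup>2 - 2 * t * (f x * g x) + t\<^sup>2 * (g x)\<^sup>2)"
      by (auto simp: power2_diff power_mult_distrib)
    also have "(LINT x|N. (f x)\<^sup>2 - 2 * t * (f x * g x) + t\<^sup>2 * (g x)\<^sup>2) = ?a - 2 * t * ?b + t\<^sup>2 * ?c"
      using fi fg by simp
    finally show ?thesis .
  qed
  have a0: "0 \<le> ?a" and c0: "0 \<le> ?c" by simp_all
  show ?thesis
  proof (cases "?c = 0")
    case True
    have "?b = 0"
    proof (rule ccontr)
      assume b: "?b \<noteq> 0"
      \<comment> \<open>This choice of t brings the affine function down to -1.\<close>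
      have "0 \<le> ?a - 2 * ((?a + 1) / (2 * ?b)) * ?b"
        using quad[of "(?a + 1) / (2 * ?b)"] True by simp
      also have "\<dots> = -1" using b by (simp add: field_simps)
      finally show False by simp
    qed
    then show ?thesis using a0 c0 by simp
  next
    case False
    then have c: "0 < ?c" using c0 by linarith
    have "0 \<le> ?a - 2 * (?b / ?c) * ?b + (?b / ?c)\<^sup>2 * ?c" by (rule quad)
    also have "\<dots> = ?a - ?b\<^sup>2 / ?c"
      using c by (simp add: field_simps power2_eq_square)
    finally show ?thesis using c by (simp add: field_simps)
  qed
qed

lemma tendsto_zero_of_sq_le:
  fixes f g :: "nat \<Rightarrow> real"
  assumes "\<And>n. (f n)\<^sup>2 \<le> g n" "g \<longlonglongrightarrow> 0"
  shows "f \<longlonglongrightarrow> 0"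
proof -
  have "(\<lambda>n. (f n)\<^sup>2) \<longlonglongrightarrow> 0"
    by (rule tendsto_sandwich[OF _ _ tendsto_const assms(2)]) (auto simp: assms(1))
  then show ?thesis by simp
qed

section \<open>Limits and completeness in L2\<close>

lemma L2_limit_inner:
  assumes L: "L2_limit N f g" and h: "square_integrable N h"
  shows "(\<lambda>n. LINT x|N. f n x * h x) \<longlonglongrightarrow> (LINT x|N. g x * h x)"
proof -
  have f: "square_integrable N (f n)" and g: "square_integrable N g" for n
    using L by (auto simp: L2_limit_def)
  have l: "(\<lambda>n. (LINT x|N. (f n x - g x)\<^sup>2) * (LINT x|N. (h x)\<^sup>2)) \<longlonglongrightarrow> 0"
    using L by (auto simp: L2_limit_def intro!: tendsto_mult_left_zero)
  have "(\<lambda>n. LINT x|N. (f n x - g x) * h x) \<longlonglongrightarrow> 0"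
    by (rule tendsto_zero_of_sq_le[OF _ l]) (rule integral_sq_cauchy_schwarz[OF sq_int_diff[OF f g] h])
  moreover have "(LINT x|N. (f n x - g x) * h x) = (LINT x|N. f n x * h x) - (LINT x|N. g x * h x)" for n
    using sq_int_mult[OF f h] sq_int_mult[OF g h] by (simp add: left_diff_distrib)
  ultimately show ?thesis by (simp add: LIM_zero_iff)
qed

lemma L2_limit_norm:
  assumes L: "L2_limit N f g"
  shows "(\<lambda>n. LINT x|N. (f n x)\<^sup>2) \<longlonglongrightarrow> (LINT x|N. (g x)\<^sup>2)"
proof -
  have f: "square_integrable N (f n)" and g: "square_integrable N g" for n
    using L by (auto simp: L2_limit_def)
  have "(LINT x|N. (f n x)\<^sup>2) = (LINT x|N. (f n x - g x)\<^sup>2) + 2 * (LINT x|N. f n x * g x) - (LINT x|N. (g x)\<^sup>2)" for n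
  proof -
    have *: "(\<lambda>x. (f n x)\<^sup>2) = (\<lambda>x. (f n x - g x)\<^sup>2 + 2 * (f n x * g x) - (g x)\<^sup>2)"
      by (auto simp: power2_diff)
    show ?thesis
      unfolding * using sq_int_diff[OF f[of n] g] g sq_int_mult[OF f[of n] g]
      by (simp add: square_integrable_def)
  qed
  moreover have "(\<lambda>n. (LINT x|N. (f n x - g x)\<^sup>2) + 2 * (LINT x|N. f n x * g x) - (LINT x|N. (g x)\<^sup>2))
     \<longlonglongrightarrow> 0 + 2 * (LINT x|N. g x * g x) - (LINT x|N. (g x)\<^sup>2)"
    using L by (intro tendsto_intros L2_limit_inner g) (auto simp: L2_limit_def)
  ultimately show ?thesis by (simp add: power2_eq_square)
qed

lemma L2_limit_const: "square_integrable N g \<Longrightarrow> L2_limit N (\<lambda>n. g) g"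
  by (simp add: L2_limit_def)

lemma sq_sum_le: "(a + b)\<^sup>2 \<le> 2 * a\<^sup>2 + 2 * b\<^sup>2" for a b :: real
proof -
  have "0 \<le> (a - b)\<^sup>2" by simp
  then show ?thesis by (simp add: power2_diff power2_sum)
qed

lemma integral_sq_sum_le:
  assumes f: "square_integrable N f" and g: "square_integrable N g"
  shows "(LINT x|N. (f x + g x)\<^sup>2) \<le> 2 * (LINT x|N. (f x)\<^sup>2) + 2 * (LINT x|N. (g x)\<^sup>2)"
proof -
  have "(LINT x|N. (f x + g x)\<^sup>2) \<le> (LINT x|N. 2 * (f x)\<^sup>2 + 2 * (g x)\<^sup>2)"
    using sq_int_add[OF f g] f g by (intro integral_mono sq_sum_le) (auto simp: square_integrable_def)
  also have "\<dots> = 2 * (LINT x|N. (f x)\<^sup>2) + 2 * (LINT x|N. (g x)\<^sup>2)"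
    using f g by (simp add: square_integrable_def)
  finally show ?thesis .
qed

lemma L2_limit_add:
  assumes "L2_limit N f g" "L2_limit N f' g'"
  shows "L2_limit N (\<lambda>n x. f n x + f' n x) (\<lambda>x. g x + g' x)"
proof -
  have f: "square_integrable N (f n)" "square_integrable N (f' n)"
    and g: "square_integrable N g" "square_integrable N g'" for n
    using assms by (auto simp: L2_limit_def)
  have "(\<lambda>n. LINT x|N. (f n x + f' n x - (g x + g' x))\<^sup>2) \<longlonglongrightarrow> 0"
  proof (rule tendsto_sandwich[OF _ _ tendsto_const])
    show "(\<lambda>n. 2 * (LINT x|N. (f n x - g x)\<^sup>2) + 2 * (LINT x|N. (f' n x - g' x)\<^sup>2)) \<longlonglongrightarrow> 0"
      using assms by (auto simp: L2_limit_def intro!: tendsto_add_zero tendsto_mult_right_zero)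
    have "(LINT x|N. (f n x + f' n x - (g x + g' x))\<^sup>2) \<le>
       2 * (LINT x|N. (f n x - g x)\<^sup>2) + 2 * (LINT x|N. (f' n x - g' x)\<^sup>2)" for n
      using integral_sq_sum_le[OF sq_int_diff[OF f(1)[of n] g(1)] sq_int_diff[OF f(2)[of n] g(2)]]
      by (simp add: algebra_simps)
    then show "eventually (\<lambda>n. (LINT x|N. (f n x + f' n x - (g x + g' x))\<^sup>2) \<le>
       2 * (LINT x|N. (f n x - g x)\<^sup>2) + 2 * (LINT x|N. (f' n x - g' x)\<^sup>2)) sequentially"
      by simp
  qed simp
  then show ?thesis using f g by (auto simp: L2_limit_def sq_int_add)
qed

lemma L2_limit_cmult:
  assumes "L2_limit N f g"
  shows "L2_limit N (\<lambda>n x. c * f n x) (\<lambda>x. c * g x)"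
proof -
  have "(\<lambda>n. LINT x|N. (c * f n x - c * g x)\<^sup>2) = (\<lambda>n. c\<^sup>2 * (LINT x|N. (f n x - g x)\<^sup>2))"
    by (auto simp flip: right_diff_distrib simp: power_mult_distrib)
  then show ?thesis
    using assms by (auto simp: L2_limit_def sq_int_cmult intro!: tendsto_mult_right_zero)
qed

lemma sq_int_AE_cong:
  assumes "square_integrable N f" "f' \<in> borel_measurable N" "AE x in N. f x = f' x"
  shows "square_integrable N f'"
proof -
  have "integrable N (\<lambda>x. (f x)\<^sup>2) = integrable N (\<lambda>x. (f' x)\<^sup>2)"
    using assms by (intro integrable_cong_AE) (auto simp: square_integrable_def)
  then show ?thesis using assms by (auto simp: square_integrable_def)
qed

lemma L2_limit_AE_cong:
  assumes L: "L2_limit N f g" and f': "\<And>n. f' n \<in> borel_measurable N" and g': "g' \<in> borel_measurable N"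
    and "\<And>n. AE x in N. f n x = f' n x" "AE x in N. g x = g' x"
  shows "L2_limit N f' g'"
proof -
  have f: "f n \<in> borel_measurable N" "g \<in> borel_measurable N" for n
    using L by (auto simp: L2_limit_def square_integrable_def)
  have "(LINT x|N. (f n x - g x)\<^sup>2) = (LINT x|N. (f' n x - g' x)\<^sup>2)" for n
  proof (rule integral_cong_AE)
    show "AE x in N. (f n x - g x)\<^sup>2 = (f' n x - g' x)\<^sup>2"
      using assms(4)[of n] assms(5) by eventually_elim simp
  qed (use f f' g' in measurable)
  then show ?thesis
    using L sq_int_AE_cong[OF _ f' assms(4)] sq_int_AE_cong[OF _ g' assms(5)]
    by (simp add: L2_limit_def)
qed

lemma L2_limit_unique:
  assumes "L2_limit N f g" "L2_limit N f h"
  shows "AE x in N. g x = h x"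
proof -
  have f: "square_integrable N (f n)" and g: "square_integrable N g" and h: "square_integrable N h" for n
    using assms by (auto simp: L2_limit_def)
  have "L2_limit N (\<lambda>n x. f n x + -1 * f n x) (\<lambda>x. g x + -1 * h x)"
    by (intro L2_limit_add L2_limit_cmult assms)
  then have "L2_limit N (\<lambda>n x. 0) (\<lambda>x. g x - h x)" by simp
  from L2_limit_norm[OF this] have "(LINT x|N. (g x - h x)\<^sup>2) = 0"
    by (simp add: LIMSEQ_const_iff)
  moreover have "integrable N (\<lambda>x. (g x - h x)\<^sup>2)"
    using sq_int_diff[OF g h] by (simp add: square_integrable_def)
  ultimately show ?thesis
    by (subst (asm) integral_nonneg_eq_0_iff_AE) auto
qed

text \<open>By monotone convergence the series has a finite integral, so it is finite almost
  everywhere. In this form it replaces Markov's inequality together with Borel-Cantelli in the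
  almost sure limits below.\<close>

lemma AE_summable_of_integrable:
  fixes Z :: "nat \<Rightarrow> 'b \<Rightarrow> real"
  assumes i: "\<And>n. integrable N (Z n)" and nn: "\<And>n x. 0 \<le> Z n x" and s: "summable (\<lambda>n. LINT x|N. Z n x)"
  shows "AE x in N. summable (\<lambda>n. Z n x)"
proof -
  have [measurable]: "Z n \<in> borel_measurable N" for n using i by auto
  have "(\<integral>\<^sup>+x. (\<Sum>n. ennreal (Z n x)) \<partial>N) = (\<Sum>n. \<integral>\<^sup>+x. ennreal (Z n x) \<partial>N)"
    by (rule nn_integral_suminf) simp
  also have "\<dots> = (\<Sum>n. ennreal (LINT x|N. Z n x))"
    by (intro suminf_cong nn_integral_eq_integral i) (simp add: nn)
  also have "\<dots> = ennreal (\<Sum>n. LINT x|N. Z n x)"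
    by (intro suminf_ennreal2 s) (simp add: nn)
  finally have "(\<integral>\<^sup>+x. (\<Sum>n. ennreal (Z n x)) \<partial>N) \<noteq> \<infinity>" by simp
  then have "AE x in N. (\<Sum>n. ennreal (Z n x)) \<noteq> \<infinity>"
    by (intro nn_integral_PInf_AE) simp_all
  then show ?thesis
    by eventually_elim (auto intro!: summable_suminf_not_top nn)
qed

lemma AE_tendsto_zero_of_integrable:
  fixes Z :: "nat \<Rightarrow> 'b \<Rightarrow> real"
  assumes "\<And>n. integrable N (Z n)" and "\<And>n x. 0 \<le> Z n x" and "summable (\<lambda>n. LINT x|N. Z n x)"
  shows "AE x in N. (\<lambda>n. Z n x) \<longlonglongrightarrow> 0"
  using AE_summable_of_integrable[OF assms] by eventually_elim (rule summable_LIMSEQ_zero)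

text \<open>Riesz-Fischer: a rapidly Cauchy subsequence converges almost everywhere, and Fatou's
  lemma carries the Cauchy bound over to its limit. It supplies the limit of the step processes of
  X, for which no formula is at hand.\<close>

lemma L2_complete:
  assumes f: "\<And>n. square_integrable N (f n)"
    and cauchy: "\<And>e. 0 < e \<Longrightarrow> \<exists>K. \<forall>m\<ge>K. \<forall>n\<ge>K. (LINT x|N. (f m x - f n x)\<^sup>2) \<le> e"
  shows "\<exists>g. L2_limit N f g"
proof -
  have [measurable]: "f n \<in> borel_measurable N" for n
    using f by (auto simp: square_integrable_def)
  have fi: "integrable N (\<lambda>x. (f m x - f n x)\<^sup>2)" for m n
    using sq_int_diff[OF f f] by (simp add: square_integrable_def)
  have "\<forall>k. \<exists>K. \<forall>m\<ge>K. \<forall>n\<ge>K. (LINT x|N. (f m x - f n x)\<^sup>2) \<le> (1/16)^k"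
    using cauchy by simp
  then obtain K where K: "\<And>k m n. m \<ge> K k \<Longrightarrow> n \<ge> K k \<Longrightarrow> (LINT x|N. (f m x - f n x)\<^sup>2) \<le> (1/16)^k"
    by metis
  \<comment> \<open>The sum makes \<open>r\<close> monotone and at least \<open>K k\<close>; the
    summand \<open>k\<close> makes it tend to infinity.\<close>
  define r where "r k = (\<Sum>i\<le>k. K i) + k" for k
  have rK: "K k \<le> r k" for k
    using member_le_sum[of k "{..k}" K] by (simp add: r_def)
  have rk: "k \<le> r k" for k by (simp add: r_def)
  have rS: "r k \<le> r (Suc k)" for k by (simp add: r_def)
  \<comment> \<open>The Cauchy rate 16^(-k) leaves 4^(-k) after the weight 4^k, which is summable,
    while Z k x < 1 means that the increment is below 2^(-k).\<close>
  define Z where "Z k x = 4^k * (f (r (Suc k)) x - f (r k) x)\<^sup>2" for k x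
  have Zi: "(LINT x|N. Z k x) \<le> (1/4)^k" for k
  proof -
    have "(LINT x|N. Z k x) = 4^k * (LINT x|N. (f (r (Suc k)) x - f (r k) x)\<^sup>2)"
      by (simp add: Z_def)
    also have "\<dots> \<le> 4^k * (1/16)^k"

      using rK[of k] rS[of k] by (intro mult_left_mono K) auto
    also have "\<dots> = (1/4)^k" by (simp flip: power_mult_distrib)
    finally show ?thesis .
  qed
  have "AE x in N. (\<lambda>k. Z k x) \<longlonglongrightarrow> 0"
  proof (rule AE_tendsto_zero_of_integrable)
    show "integrable N (Z k)" for k unfolding Z_def by (intro integrable_mult_right fi)
    show "0 \<le> Z k x" for k x by (simp add: Z_def)
    show "summable (\<lambda>k. LINT x|N. Z k x)"
      by (rule summable_comparison_test'[OF summable_geometric[of "1/4::real"], of 0])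
        (use Zi in \<open>auto simp: Z_def\<close>)
  qed
  then have conv: "AE x in N. convergent (\<lambda>k. f (r k) x)"
  proof eventually_elim
    case (elim x)
    have "eventually (\<lambda>k. Z k x < 1) sequentially"
      using elim by (rule order_tendstoD) simp
    then obtain k0 where k0: "\<And>k. k \<ge> k0 \<Longrightarrow> Z k x < 1"
      by (auto simp: eventually_sequentially)
    have "summable (\<lambda>k. f (r (Suc k)) x - f (r k) x)"
    proof (rule summable_comparison_test'[OF summable_geometric[of "1/2::real"], of k0])
      fix k assume "k0 \<le> k"
      from k0[OF this] have "(f (r (Suc k)) x - f (r k) x)\<^sup>2 \<le> 1 / 4^k"
        by (simp add: Z_def field_simps)
      also have "\<dots> = ((1/2)^k)\<^sup>2"
          by (simp only: power_mult[symmetric] mult.commute[of k 2]) (simp add: power_mult power_divide)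
      finally show "norm (f (r (Suc k)) x - f (r k) x) \<le> (1/2)^k"
        using abs_le_square_iff[of "f (r (Suc k)) x - f (r k) x" "(1/2)^k"] by simp
    qed simp
    then have "summable (\<lambda>k. f (r (Suc k)) x - f (r k) x)" .
    then have "convergent (\<lambda>n. \<Sum>k<n. f (r (Suc k)) x - f (r k) x)"
      by (simp add: summable_iff_convergent)
    then have "convergent (\<lambda>n. f (r n) x - f (r 0) x)"
      by (simp add: sum_lessThan_telescope[of "\<lambda>k. f (r k) x"])
    then show ?case by (simp add: convergent_diff_const_right_iff)
  qed
  define g where "g x = lim (\<lambda>k. f (r k) x)" for x
  have [measurable]: "g \<in> borel_measurable N"
    unfolding g_def by (rule borel_measurable_lim_metric) simp
  \<comment> \<open>Fatou's lemma along the subsequence \<open>r\<close>: a bound against all late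
    members of the sequence is inherited by the limit. With e = 1 it also yields the square
    integrability of \<open>g\<close>.\<close>
  have main: "integrable N (\<lambda>x. (f n x - g x)\<^sup>2) \<and> (LINT x|N. (f n x - g x)\<^sup>2) \<le> e"
    if e: "0 < e" and n: "\<And>m. m \<ge> L \<Longrightarrow> (LINT x|N. (f n x - f m x)\<^sup>2) \<le> e" for n e L
  proof -
    have "(\<integral>\<^sup>+x. ennreal ((f n x - g x)\<^sup>2) \<partial>N) = (\<integral>\<^sup>+x. liminf (\<lambda>k. ennreal ((f n x - f (r k) x)\<^sup>2)) \<partial>N)"
    proof (rule nn_integral_cong_AE)
      show "AE x in N. ennreal ((f n x - g x)\<^sup>2) = liminf (\<lambda>k. ennreal ((f n x - f (r k) x)\<^sup>2))"
        using conv
      proof eventually_elim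
        case (elim x)
        then have "(\<lambda>k. f (r k) x) \<longlonglongrightarrow> g x" by (simp add: g_def convergent_LIMSEQ_iff)
        then have "(\<lambda>k. ennreal ((f n x - f (r k) x)\<^sup>2)) \<longlonglongrightarrow> ennreal ((f n x - g x)\<^sup>2)"
          by (intro tendsto_intros)
        from lim_imp_Liminf[OF _ this] show ?case by simp
      qed
    qed
    also have "\<dots> \<le> liminf (\<lambda>k. \<integral>\<^sup>+x. ennreal ((f n x - f (r k) x)\<^sup>2) \<partial>N)"
      by (rule nn_integral_liminf) simp
    also have "\<dots> \<le> limsup (\<lambda>k. \<integral>\<^sup>+x. ennreal ((f n x - f (r k) x)\<^sup>2) \<partial>N)"
      by (rule Liminf_le_Limsup) simp
    also have "\<dots> \<le> ennreal e"
    proof (rule Limsup_bounded)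
      show "eventually (\<lambda>k. (\<integral>\<^sup>+x. ennreal ((f n x - f (r k) x)\<^sup>2) \<partial>N) \<le> ennreal e) sequentially"
        using eventually_ge_at_top[of L]
      proof eventually_elim
        case (elim k)
        have "(\<integral>\<^sup>+x. ennreal ((f n x - f (r k) x)\<^sup>2) \<partial>N) = ennreal (LINT x|N. (f n x - f (r k) x)\<^sup>2)"
          by (intro nn_integral_eq_integral fi) simp
        also have "\<dots> \<le> ennreal e"
          using n[of "r k"] rk[of k] elim by (intro ennreal_leI) auto
        finally show ?case .
      qed
    qed
    finally have le: "(\<integral>\<^sup>+x. ennreal ((f n x - g x)\<^sup>2) \<partial>N) \<le> ennreal e" .
    have int: "integrable N (\<lambda>x. (f n x - g x)\<^sup>2)"
      by (rule integrableI_bounded) (use le in \<open>auto simp: order_le_less_trans\<close>)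
    have "ennreal (LINT x|N. (f n x - g x)\<^sup>2) \<le> ennreal e"
      using le by (subst nn_integral_eq_integral[OF int, symmetric]) auto
    then have "(LINT x|N. (f n x - g x)\<^sup>2) \<le> e"
      using e by (simp add: ennreal_le_iff)
    with int show ?thesis by simp
  qed
  have "square_integrable N (\<lambda>x. f (K 0) x - g x)"
    using main[of 1 "K 0" "K 0"] K[of 0 "K 0"] by (simp add: square_integrable_def)
  from sq_int_diff[OF f[of "K 0"] this] have g: "square_integrable N g" by simp
  have "(\<lambda>n. LINT x|N. (f n x - g x)\<^sup>2) \<longlonglongrightarrow> 0"
  proof (rule LIMSEQ_I)
    fix e :: real assume e: "0 < e"
    obtain L where L: "\<And>m n. m \<ge> L \<Longrightarrow> n \<ge> L \<Longrightarrow> (LINT x|N. (f m x - f n x)\<^sup>2) \<le> e / 2"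
      using cauchy[of "e/2"] e by auto
    have "(LINT x|N. (f n x - g x)\<^sup>2) \<le> e / 2" if "n \<ge> L" for n
      using main[of "e/2" L n] e L that by auto
    then have "norm ((LINT x|N. (f n x - g x)\<^sup>2) - 0) < e" if "n \<ge> L" for n
      using that e by (fastforce simp: abs_of_nonneg)
    then show "\<exists>no. \<forall>n\<ge>no. norm ((LINT x|N. (f n x - g x)\<^sup>2) - 0) < e" by blast
  qed
  then show ?thesis using f g by (auto simp: L2_limit_def)
qed

section \<open>Gaussian variables and the Gaussian space\<close>

lemma cos_diff_sq_le: "(cos x - cos y)\<^sup>2 \<le> (x - y)\<^sup>2" for x y :: real
proof -
  have "\<bar>cos x - cos y\<bar> = 2 * (\<bar>sin ((x + y) / 2)\<bar> * \<bar>sin ((y - x) / 2)\<bar>)"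
    by (simp add: cos_diff_cos abs_mult)
  also have "\<dots> \<le> 2 * (1 * \<bar>(y - x) / 2\<bar>)"
    by (intro mult_left_mono mult_mono abs_sin_x_le_abs_x) auto
  finally have "\<bar>cos x - cos y\<bar> \<le> \<bar>x - y\<bar>" by simp
  then show ?thesis by (simp add: abs_le_square_iff)
qed

lemma sin_diff_sq_le: "(sin x - sin y)\<^sup>2 \<le> (x - y)\<^sup>2" for x y :: real
proof -
  have "\<bar>sin x - sin y\<bar> = 2 * (\<bar>sin ((x - y) / 2)\<bar> * \<bar>cos ((x + y) / 2)\<bar>)"
    by (simp add: sin_diff_sin abs_mult)
  also have "\<dots> \<le> 2 * (\<bar>(x - y) / 2\<bar> * 1)"
    by (intro mult_left_mono mult_mono abs_sin_x_le_abs_x) auto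
  finally have "\<bar>sin x - sin y\<bar> \<le> \<bar>x - y\<bar>" by simp
  then show ?thesis by (simp add: abs_le_square_iff)
qed

section \<open>Gaussian variables through their characteristic functions and fourth moments\<close>

context prob_space
begin

lemma integral_sq_le_sq_integral:
  assumes "square_integrable M f"
  shows "(LINT x|M. f x)\<^sup>2 \<le> (LINT x|M. (f x)\<^sup>2)"
  using integral_sq_cauchy_schwarz[OF assms, of "\<lambda>_. 1"] by (simp add: square_integrable_def prob_space)

lemma sq_int_integrable:
  assumes "square_integrable M f"
  shows "integrable M f"
  using sq_int_mult[OF assms, of "\<lambda>_. 1"] by (simp add: square_integrable_def)

lemma sq_int_bounded:
  assumes "f \<in> borel_measurable M" "\<And>x. x \<in> space M \<Longrightarrow> \<bar>f x\<bar> \<le> B"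
  shows "square_integrable M f"
proof -
  have "integrable M (\<lambda>x. (f x)\<^sup>2)"
  proof (rule integrable_const_bound[of _ "B\<^sup>2"])
    show "AE x in M. norm ((f x)\<^sup>2) \<le> B\<^sup>2"
      using order_trans[OF assms(2) abs_ge_self] by (auto intro!: AE_I2 simp: abs_le_square_iff[symmetric])
  qed (use assms(1) in measurable)
  then show ?thesis using assms(1) by (simp add: square_integrable_def)
qed

lemma integrable_bounded:
  fixes f :: "'a \<Rightarrow> real"
  assumes "f \<in> borel_measurable M" "\<And>x. x \<in> space M \<Longrightarrow> \<bar>f x\<bar> \<le> B"
  shows "integrable M f"
  by (rule integrable_const_bound[of _ B]) (use assms in auto)

lemma char_distr_eq:
  assumes [measurable]: "Z \<in> borel_measurable M"
  shows "char (distr M borel Z) t = Complex (LINT \<omega>|M. cos (t * Z \<omega>)) (LINT \<omega>|M. sin (t * Z \<omega>))"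
proof -
  have i: "integrable M (\<lambda>\<omega>. iexp (t * Z \<omega>))"
    by (rule integrable_iexp) auto
  have e: "Re (iexp (t * Z \<omega>)) = cos (t * Z \<omega>)" "Im (iexp (t * Z \<omega>)) = sin (t * Z \<omega>)" for \<omega>
    by (simp_all add: Re_exp Im_exp)
  have "char (distr M borel Z) t = (CLINT \<omega>|M. iexp (t * Z \<omega>))"
    by (simp add: char_def integral_distr)
  also have "\<dots> = Complex (Re (CLINT \<omega>|M. iexp (t * Z \<omega>))) (Im (CLINT \<omega>|M. iexp (t * Z \<omega>)))"
    by (simp add: complex_surj)
  also have "\<dots> = Complex (LINT \<omega>|M. cos (t * Z \<omega>)) (LINT \<omega>|M. sin (t * Z \<omega>))"
    using integral_Re[OF i] integral_Im[OF i] unfolding e by simp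
  finally show ?thesis .
qed

lemma centered_gaussian_std:
  assumes [measurable]: "Z \<in> borel_measurable M" and "0 < \<sigma>"
  shows "distributed M lborel Z (normal_density 0 \<sigma>) \<longleftrightarrow> distr M borel (\<lambda>\<omega>. Z \<omega> / \<sigma>) = std_normal_distribution"
proof -
  have "distributed M lborel Z (normal_density 0 \<sigma>) \<longleftrightarrow> distributed M lborel (\<lambda>\<omega>. Z \<omega> / \<sigma>) std_normal_density"
    using normal_standard_normal_convert[OF assms(2), of Z 0] by simp
  also have "\<dots> \<longleftrightarrow> distr M lborel (\<lambda>\<omega>. Z \<omega> / \<sigma>) = std_normal_distribution"
    by (simp add: distributed_def)
  also have "distr M lborel (\<lambda>\<omega>. Z \<omega> / \<sigma>) = distr M borel (\<lambda>\<omega>. Z \<omega> / \<sigma>)"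
    by (rule distr_cong) auto
  finally show ?thesis .
qed

text \<open>A degenerate variable has no density and is treated separately; all formulas then hold
  with variance 0. Otherwise they are read off from the density and from the standard normal
  characteristic function.\<close>

lemma centered_gaussian_moments:
  assumes "centered_gaussian M Z"
  shows "square_integrable M Z" "integrable M (\<lambda>\<omega>. Z \<omega> ^ 4)"
    "(LINT \<omega>|M. Z \<omega> ^ 4) = 3 * (LINT \<omega>|M. (Z \<omega>)\<^sup>2)\<^sup>2"
    "(LINT \<omega>|M. cos (s * Z \<omega>)) = exp (- (s\<^sup>2 * (LINT \<omega>|M. (Z \<omega>)\<^sup>2) / 2))"
    "(LINT \<omega>|M. sin (s * Z \<omega>)) = 0"
proof -
  have [measurable]: "Z \<in> borel_measurable M" using assms by (simp add: centered_gaussian_def)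
  have "square_integrable M Z \<and> integrable M (\<lambda>\<omega>. Z \<omega> ^ 4) \<and>
    (LINT \<omega>|M. Z \<omega> ^ 4) = 3 * (LINT \<omega>|M. (Z \<omega>)\<^sup>2)\<^sup>2 \<and>
    (LINT \<omega>|M. cos (s * Z \<omega>)) = exp (- (s\<^sup>2 * (LINT \<omega>|M. (Z \<omega>)\<^sup>2) / 2)) \<and>
    (LINT \<omega>|M. sin (s * Z \<omega>)) = 0"
  proof (cases "AE \<omega> in M. Z \<omega> = 0")
    case True
    have "square_integrable M Z"
      by (rule sq_int_AE_cong[OF sq_int_zero]) (use True in auto)
    moreover have "integrable M (\<lambda>\<omega>. Z \<omega> ^ 4) = integrable M (\<lambda>\<omega>. 0::real)"
      using True by (intro integrable_cong_AE) auto
    moreover have "(LINT \<omega>|M. Z \<omega> ^ 4) = (LINT \<omega>|M. 0::real)"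
      using True by (intro integral_cong_AE) auto
    moreover have "(LINT \<omega>|M. (Z \<omega>)\<^sup>2) = (LINT \<omega>|M. 0::real)"
      using True by (intro integral_cong_AE) auto
    moreover have "(LINT \<omega>|M. cos (s * Z \<omega>)) = (LINT \<omega>|M. 1::real)"
      using True by (intro integral_cong_AE) auto
    moreover have "(LINT \<omega>|M. sin (s * Z \<omega>)) = (LINT \<omega>|M. 0::real)"
      using True by (intro integral_cong_AE) auto
    ultimately show ?thesis by (simp add: prob_space)
  next
    case False
    then obtain \<sigma> where \<sigma>: "0 < \<sigma>" and D: "distributed M lborel Z (normal_density 0 \<sigma>)"
      using assms by (auto simp: centered_gaussian_def)
    have i2: "integrable M (\<lambda>\<omega>. (Z \<omega>)\<^sup>2)"
      using distributed_integrable[OF D, of "\<lambda>x. x\<^sup>2"] integrable_normal_moment[OF \<sigma>, of 0 2]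
      by (simp add: normal_density_nonneg)
    have i4: "integrable M (\<lambda>\<omega>. (Z \<omega>)^4)"
      using distributed_integrable[OF D, of "\<lambda>x. x^4"] integrable_normal_moment[OF \<sigma>, of 0 4]
      by (simp add: normal_density_nonneg)
    have e2: "(LINT \<omega>|M. (Z \<omega>)\<^sup>2) = \<sigma>\<^sup>2"
      using distributed_integral[OF D, of "\<lambda>x. x\<^sup>2"] integral_normal_moment_even[OF \<sigma>, of 0 1]
      by (simp add: normal_density_nonneg fact_numeral)
    have e4: "(LINT \<omega>|M. (Z \<omega>)^4) = 3 * \<sigma>^4"
      using distributed_integral[OF D, of "\<lambda>x. x^4"] integral_normal_moment_even[OF \<sigma>, of 0 2]
      by (simp add: normal_density_nonneg fact_numeral field_simps power2_eq_square power4_eq_xxxx)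
    have d: "distr M borel (\<lambda>\<omega>. Z \<omega> / \<sigma>) = std_normal_distribution"
      using D centered_gaussian_std[OF _ \<sigma>] by simp
    have "char std_normal_distribution (s * \<sigma>) = Complex (LINT \<omega>|M. cos (s * Z \<omega>)) (LINT \<omega>|M. sin (s * Z \<omega>))"
      using char_distr_eq[of "\<lambda>\<omega>. Z \<omega> / \<sigma>" "s * \<sigma>"] \<sigma> by (simp add: d)
    then have c: "Complex (LINT \<omega>|M. cos (s * Z \<omega>)) (LINT \<omega>|M. sin (s * Z \<omega>)) = of_real (exp (- ((s * \<sigma>)\<^sup>2) / 2))"
      by (simp add: char_std_normal_distribution)
    have "(LINT \<omega>|M. cos (s * Z \<omega>)) = exp (- ((s * \<sigma>)\<^sup>2) / 2)" "(LINT \<omega>|M. sin (s * Z \<omega>)) = 0"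
      using arg_cong[OF c, of Re] arg_cong[OF c, of Im] by simp_all
    then show ?thesis using i2 i4 e2 e4 by (simp add: square_integrable_def power_mult_distrib)
  qed
  then show "square_integrable M Z" "integrable M (\<lambda>\<omega>. Z \<omega> ^ 4)"
    "(LINT \<omega>|M. Z \<omega> ^ 4) = 3 * (LINT \<omega>|M. (Z \<omega>)\<^sup>2)\<^sup>2"
    "(LINT \<omega>|M. cos (s * Z \<omega>)) = exp (- (s\<^sup>2 * (LINT \<omega>|M. (Z \<omega>)\<^sup>2) / 2))"
    "(LINT \<omega>|M. sin (s * Z \<omega>)) = 0" by auto
qed

text \<open>Zero variance means that the variable is degenerate. Otherwise division by the standard
  deviation produces the standard normal characteristic function, and Levy's uniqueness theorem
  identifies the law.\<close>

lemma centered_gaussian_charI: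
  assumes Z: "square_integrable M Z"
    and c: "\<And>s. (LINT \<omega>|M. cos (s * Z \<omega>)) = exp (- (s\<^sup>2 * (LINT \<omega>|M. (Z \<omega>)\<^sup>2) / 2))"
    and s: "\<And>s. (LINT \<omega>|M. sin (s * Z \<omega>)) = 0"
  shows "centered_gaussian M Z"
proof -
  have [measurable]: "Z \<in> borel_measurable M" using Z by (simp add: square_integrable_def)
  let ?v = "LINT \<omega>|M. (Z \<omega>)\<^sup>2"
  show ?thesis
  proof (cases "?v = 0")
    case True
    then have "AE \<omega> in M. (Z \<omega>)\<^sup>2 = 0"
      using Z by (subst (asm) integral_nonneg_eq_0_iff_AE) (auto simp: square_integrable_def)
    then show ?thesis by (auto simp: centered_gaussian_def)
  next
    case False
    have "0 \<le> ?v" by simp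
    with False have v: "0 < ?v" by linarith
    define \<sigma> where "\<sigma> = sqrt ?v"
    have \<sigma>: "0 < \<sigma>" and \<sigma>2: "\<sigma>\<^sup>2 = ?v" using v by (auto simp: \<sigma>_def)
    have "char (distr M borel (\<lambda>\<omega>. Z \<omega> / \<sigma>)) = char std_normal_distribution"
    proof
      fix t
      have "char (distr M borel (\<lambda>\<omega>. Z \<omega> / \<sigma>)) t =
          Complex (LINT \<omega>|M. cos ((t / \<sigma>) * Z \<omega>)) (LINT \<omega>|M. sin ((t / \<sigma>) * Z \<omega>))"
        by (simp add: char_distr_eq)
      also have "\<dots> = of_real (exp (- t\<^sup>2 / 2))"
        unfolding c s using \<sigma> by (simp add: \<sigma>2[symmetric] power_divide complex_eq_iff)
      finally show "char (distr M borel (\<lambda>\<omega>. Z \<omega> / \<sigma>)) t = char std_normal_distribution t"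
        by (simp add: char_std_normal_distribution)
    qed
    then have "distr M borel (\<lambda>\<omega>. Z \<omega> / \<sigma>) = std_normal_distribution"
      by (intro Levy_uniqueness real_dist_normal_dist)
        (auto simp: real_distribution_def real_distribution_axioms_def intro!: prob_space_distr)
    then show ?thesis
      using \<sigma> centered_gaussian_std[OF _ \<sigma>] by (auto simp: centered_gaussian_def)
  qed
qed

lemma L2_limit_integral_lipschitz:
  fixes h :: "real \<Rightarrow> real"
  assumes L: "L2_limit M f Z" and [measurable]: "h \<in> borel_measurable borel" and b: "\<And>x. \<bar>h x\<bar> \<le> B"
    and lip: "\<And>x y. (h x - h y)\<^sup>2 \<le> K * (x - y)\<^sup>2"
  shows "(\<lambda>n. LINT \<omega>|M. h (f n \<omega>)) \<longlonglongrightarrow> (LINT \<omega>|M. h (Z \<omega>))"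
proof -
  have f: "square_integrable M (f n)" and Z: "square_integrable M Z" for n
    using L by (auto simp: L2_limit_def)
  then have [measurable]: "f n \<in> borel_measurable M" "Z \<in> borel_measurable M" for n
    by (auto simp: square_integrable_def)
  have h: "square_integrable M (\<lambda>\<omega>. h (f n \<omega>))" "square_integrable M (\<lambda>\<omega>. h (Z \<omega>))" for n
    by (rule sq_int_bounded[of _ B]; simp add: b)+
  have "(\<lambda>n. LINT \<omega>|M. h (f n \<omega>) - h (Z \<omega>)) \<longlonglongrightarrow> 0"
  proof (rule tendsto_zero_of_sq_le)
    fix n
    have "(LINT \<omega>|M. h (f n \<omega>) - h (Z \<omega>))\<^sup>2 \<le> (LINT \<omega>|M. (h (f n \<omega>) - h (Z \<omega>))\<^sup>2)"
      by (intro integral_sq_le_sq_integral sq_int_diff h)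
    also have "\<dots> \<le> (LINT \<omega>|M. K * (f n \<omega> - Z \<omega>)\<^sup>2)"
      by (rule integral_mono) (use sq_int_diff[OF h(1)[of n] h(2)] sq_int_diff[OF f[of n] Z] lip
        in \<open>auto simp: square_integrable_def\<close>)
    also have "\<dots> = K * (LINT \<omega>|M. (f n \<omega> - Z \<omega>)\<^sup>2)" by simp
    finally show "(LINT \<omega>|M. h (f n \<omega>) - h (Z \<omega>))\<^sup>2 \<le> K * (LINT \<omega>|M. (f n \<omega> - Z \<omega>)\<^sup>2)" .
    show "(\<lambda>n. K * (LINT \<omega>|M. (f n \<omega> - Z \<omega>)\<^sup>2)) \<longlonglongrightarrow> 0"
      using L by (auto simp: L2_limit_def intro!: tendsto_mult_right_zero)
  qed
  then have "(\<lambda>n. (LINT \<omega>|M. h (f n \<omega>)) - (LINT \<omega>|M. h (Z \<omega>))) \<longlonglongrightarrow> 0"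
    using sq_int_integrable[OF h(1)] sq_int_integrable[OF h(2)] by simp
  then show ?thesis by (simp add: LIM_zero_iff)
qed

text \<open>Cosine and sine are bounded and Lipschitz, so characteristic functions pass to the
  limit, and so do the variances. This makes the whole closed span of the noise Gaussian and not
  only its finite linear combinations.\<close>

lemma centered_gaussian_L2_limit:
  assumes L: "L2_limit M f Z" and g: "\<And>n. centered_gaussian M (f n)"
  shows "centered_gaussian M Z"
proof (rule centered_gaussian_charI)
  show "square_integrable M Z" using L by (simp add: L2_limit_def)
  fix s :: real
  have "(\<lambda>n. LINT \<omega>|M. cos (s * f n \<omega>)) \<longlonglongrightarrow> (LINT \<omega>|M. cos (s * Z \<omega>))"
    by (rule L2_limit_integral_lipschitz[OF L, of "\<lambda>x. cos (s * x)" 1 "s\<^sup>2"])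
      (use cos_diff_sq_le[of "s * _" "s * _"] in \<open>auto simp flip: power_mult_distrib simp: right_diff_distrib\<close>)
  moreover have "(\<lambda>n. exp (- (s\<^sup>2 * (LINT \<omega>|M. (f n \<omega>)\<^sup>2) / 2))) \<longlonglongrightarrow> exp (- (s\<^sup>2 * (LINT \<omega>|M. (Z \<omega>)\<^sup>2) / 2))"
    by (intro tendsto_intros L2_limit_norm L) simp
  ultimately show "(LINT \<omega>|M. cos (s * Z \<omega>)) = exp (- (s\<^sup>2 * (LINT \<omega>|M. (Z \<omega>)\<^sup>2) / 2))"
    unfolding centered_gaussian_moments(4)[OF g] by (rule LIMSEQ_unique)
  have "(\<lambda>n. LINT \<omega>|M. sin (s * f n \<omega>)) \<longlonglongrightarrow> (LINT \<omega>|M. sin (s * Z \<omega>))"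
    by (rule L2_limit_integral_lipschitz[OF L, of "\<lambda>x. sin (s * x)" 1 "s\<^sup>2"])
      (use sin_diff_sq_le[of "s * _" "s * _"] in \<open>auto simp flip: power_mult_distrib simp: right_diff_distrib\<close>)
  then show "(LINT \<omega>|M. sin (s * Z \<omega>)) = 0"
    unfolding centered_gaussian_moments(5)[OF g] by (simp add: LIMSEQ_const_iff)
qed

lemma sq_int_sq_gaussian: "centered_gaussian M Z \<Longrightarrow> square_integrable M (\<lambda>\<omega>. (Z \<omega>)\<^sup>2)"
  using centered_gaussian_moments(2)[of Z]
  by (auto simp: square_integrable_def centered_gaussian_def power_mult[symmetric])

text \<open>Polarisation: (A + B)^4 + (A - B)^4 equals 2 A^4 + 12 A^2 B^2 + 2 B^4, and each of the
  four fourth powers has expectation three times the squared variance. Only one-dimensional laws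
  enter.\<close>

lemma gaussian_wick:
  assumes A: "centered_gaussian M A" and B: "centered_gaussian M B"
    and p: "centered_gaussian M (\<lambda>\<omega>. A \<omega> + B \<omega>)" and m: "centered_gaussian M (\<lambda>\<omega>. A \<omega> - B \<omega>)"
  shows "square_integrable M (\<lambda>\<omega>. A \<omega> * B \<omega>)"
    "(LINT \<omega>|M. (A \<omega>)\<^sup>2 * (B \<omega>)\<^sup>2) =
      (LINT \<omega>|M. (A \<omega>)\<^sup>2) * (LINT \<omega>|M. (B \<omega>)\<^sup>2) + 2 * (LINT \<omega>|M. A \<omega> * B \<omega>)\<^sup>2"
proof -
  let ?a = "LINT \<omega>|M. (A \<omega>)\<^sup>2" and ?b = "LINT \<omega>|M. (B \<omega>)\<^sup>2" and ?c = "LINT \<omega>|M. A \<omega> * B \<omega>"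
  have AB: "integrable M (\<lambda>\<omega>. (A \<omega>)\<^sup>2 * (B \<omega>)\<^sup>2)"
    using sq_int_mult[OF sq_int_sq_gaussian[OF A] sq_int_sq_gaussian[OF B]] by simp
  then show si: "square_integrable M (\<lambda>\<omega>. A \<omega> * B \<omega>)"
    using A B by (auto simp: square_integrable_def centered_gaussian_def power_mult_distrib)
  note mA = centered_gaussian_moments[OF A] and mB = centered_gaussian_moments[OF B]
  have iAB: "integrable M (\<lambda>\<omega>. A \<omega> * B \<omega>)" by (rule sq_int_integrable[OF si])
  have i2: "integrable M (\<lambda>\<omega>. (A \<omega>)\<^sup>2)" "integrable M (\<lambda>\<omega>. (B \<omega>)\<^sup>2)"
    using mA(1) mB(1) by (auto simp: square_integrable_def)
  have "(LINT \<omega>|M. (A \<omega> + B \<omega>)\<^sup>2) = (LINT \<omega>|M. (A \<omega>)\<^sup>2 + (B \<omega>)\<^sup>2 + 2 * (A \<omega> * B \<omega>))"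
    by (simp add: power2_sum mult.assoc)
  then have 1: "(LINT \<omega>|M. (A \<omega> + B \<omega>)\<^sup>2) = ?a + ?b + 2 * ?c"
    using iAB i2 by simp
  have "(LINT \<omega>|M. (A \<omega> - B \<omega>)\<^sup>2) = (LINT \<omega>|M. (A \<omega>)\<^sup>2 + (B \<omega>)\<^sup>2 - 2 * (A \<omega> * B \<omega>))"
    by (simp add: power2_diff mult.assoc)
  then have 2: "(LINT \<omega>|M. (A \<omega> - B \<omega>)\<^sup>2) = ?a + ?b - 2 * ?c"
    using iAB i2 by simp
  have "(LINT \<omega>|M. (A \<omega> + B \<omega>)^4 + (A \<omega> - B \<omega>)^4) =
      (LINT \<omega>|M. 2 * (A \<omega>)^4 + 12 * ((A \<omega>)\<^sup>2 * (B \<omega>)\<^sup>2) + 2 * (B \<omega>)^4)"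
    by (intro Bochner_Integration.integral_cong) (auto simp: power2_eq_square power4_eq_xxxx algebra_simps)
  then have "3 * (?a + ?b + 2 * ?c)\<^sup>2 + 3 * (?a + ?b - 2 * ?c)\<^sup>2 =
     2 * (3 * ?a\<^sup>2) + 12 * (LINT \<omega>|M. (A \<omega>)\<^sup>2 * (B \<omega>)\<^sup>2) + 2 * (3 * ?b\<^sup>2)"
    using centered_gaussian_moments[OF p] centered_gaussian_moments[OF m] mA mB AB
    by (simp add: 1 2)
  then show "(LINT \<omega>|M. (A \<omega>)\<^sup>2 * (B \<omega>)\<^sup>2) = ?a * ?b + 2 * ?c\<^sup>2"
    by (simp add: power2_eq_square algebra_simps)
qed

end

section \<open>The closed linear span of the noise\<close>

definition linear_span :: "(real \<Rightarrow> 'a \<Rightarrow> real) \<Rightarrow> ('a \<Rightarrow> real) set" where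
  "linear_span G = {(\<lambda>\<omega>. \<Sum>t\<in>S. c t * G t \<omega>) | S c. finite S \<and> S \<subseteq> {0..}}"

lemma linear_spanI: "finite S \<Longrightarrow> S \<subseteq> {0..} \<Longrightarrow> (\<lambda>\<omega>. \<Sum>t\<in>S. c t * G t \<omega>) \<in> linear_span G"
  unfolding linear_span_def by blast

lemma noise_space_iff: "Z \<in> noise_space M G \<longleftrightarrow> (\<exists>f. (\<forall>n. f n \<in> linear_span G) \<and> L2_limit M f Z)"
proof
  assume "Z \<in> noise_space M G"
  then obtain S c where "\<And>n. finite (S n)" "\<And>n. S n \<subseteq> {0..}" "L2_limit M (\<lambda>n \<omega>. \<Sum>t\<in>S n. c n t * G t \<omega>) Z"
    unfolding noise_space_def by blast
  then show "\<exists>f. (\<forall>n. f n \<in> linear_span G) \<and> L2_limit M f Z"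
    using linear_spanI[of "S _" "c _" G] by (intro exI[of _ "\<lambda>n \<omega>. \<Sum>t\<in>S n. c n t * G t \<omega>"]) auto
next
  assume "\<exists>f. (\<forall>n. f n \<in> linear_span G) \<and> L2_limit M f Z"
  then obtain f where f: "\<And>n. f n \<in> linear_span G" and L: "L2_limit M f Z" by blast
  have "\<forall>n. \<exists>S c. finite S \<and> S \<subseteq> {0..} \<and> f n = (\<lambda>\<omega>. \<Sum>t\<in>S. c t * G t \<omega>)"
    using f unfolding linear_span_def by blast
  then obtain S c where "\<And>n. finite (S n)" "\<And>n. S n \<subseteq> {0..}" and e: "\<And>n. f n = (\<lambda>\<omega>. \<Sum>t\<in>S n. c n t * G t \<omega>)"
    by metis
  moreover have "f = (\<lambda>n \<omega>. \<Sum>t\<in>S n. c n t * G t \<omega>)" using e by auto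
  ultimately show "Z \<in> noise_space M G"
    using L unfolding noise_space_def by blast
qed

lemma linear_span_add:
  assumes "f \<in> linear_span G" "g \<in> linear_span G"
  shows "(\<lambda>\<omega>. f \<omega> + g \<omega>) \<in> linear_span G"
proof -
  obtain S c where S: "finite S" "S \<subseteq> {0..}" and f: "f = (\<lambda>\<omega>. \<Sum>t\<in>S. c t * G t \<omega>)"
    using assms(1) by (auto simp: linear_span_def)
  obtain T d where T: "finite T" "T \<subseteq> {0..}" and g: "g = (\<lambda>\<omega>. \<Sum>t\<in>T. d t * G t \<omega>)"
    using assms(2) by (auto simp: linear_span_def)
  have 1: "(\<Sum>t\<in>S. c t * G t \<omega>) = (\<Sum>t\<in>S \<union> T. (if t \<in> S then c t else 0) * G t \<omega>)" for \<omega>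
    using S T by (intro sum.mono_neutral_cong_left) auto
  have 2: "(\<Sum>t\<in>T. d t * G t \<omega>) = (\<Sum>t\<in>S \<union> T. (if t \<in> T then d t else 0) * G t \<omega>)" for \<omega>
    using S T by (intro sum.mono_neutral_cong_left) auto
  have "(\<lambda>\<omega>. f \<omega> + g \<omega>) = (\<lambda>\<omega>. \<Sum>t\<in>S \<union> T. ((if t \<in> S then c t else 0) + (if t \<in> T then d t else 0)) * G t \<omega>)"
    by (auto simp: f g 1 2 sum.distrib[symmetric] distrib_right)
  also have "\<dots> \<in> linear_span G" using S T by (intro linear_spanI) auto
  finally show ?thesis .
qed

lemma linear_span_cmult:
  assumes "f \<in> linear_span G"
  shows "(\<lambda>\<omega>. a * f \<omega>) \<in> linear_span G"
proof -
  obtain S c where S: "finite S" "S \<subseteq> {0..}" and f: "f = (\<lambda>\<omega>. \<Sum>t\<in>S. c t * G t \<omega>)"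
    using assms(1) by (auto simp: linear_span_def)
  have "(\<lambda>\<omega>. a * f \<omega>) = (\<lambda>\<omega>. \<Sum>t\<in>S. (a * c t) * G t \<omega>)"
    by (auto simp: f sum_distrib_left mult.assoc)
  also have "\<dots> \<in> linear_span G" using S by (intro linear_spanI) auto
  finally show ?thesis .
qed

lemma linear_span_base: "0 \<le> t \<Longrightarrow> G t \<in> linear_span G"
  using linear_spanI[of "{t}" "\<lambda>_. 1" G] by simp

locale centered_gp = prob_space M for M :: "'a measure" +
  fixes G :: "real \<Rightarrow> 'a \<Rightarrow> real"
  assumes gp: "centered_gaussian_process M G"
begin

abbreviation H where "H \<equiv> noise_space M G"

lemma linear_span_gaussian: "f \<in> linear_span G \<Longrightarrow> centered_gaussian M f"
  using gp by (auto simp: linear_span_def centered_gaussian_process_def)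

lemma linear_span_subset: "f \<in> linear_span G \<Longrightarrow> f \<in> H"
  unfolding noise_space_iff
  using centered_gaussian_moments(1)[OF linear_span_gaussian] by (intro exI[of _ "\<lambda>_. f"]) (auto intro: L2_limit_const)

lemma H_base: "0 \<le> t \<Longrightarrow> G t \<in> H"
  by (intro linear_span_subset linear_span_base)

lemma H_add:
  assumes "f \<in> H" "g \<in> H" shows "(\<lambda>\<omega>. f \<omega> + g \<omega>) \<in> H"
proof -
  obtain f' g' where "\<And>n. f' n \<in> linear_span G" "L2_limit M f' f" "\<And>n. g' n \<in> linear_span G" "L2_limit M g' g"
    using assms unfolding noise_space_iff by blast
  then show ?thesis unfolding noise_space_iff
    by (intro exI[of _ "\<lambda>n \<omega>. f' n \<omega> + g' n \<omega>"]) (auto intro: linear_span_add L2_limit_add)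
qed

lemma H_cmult:
  assumes "f \<in> H" shows "(\<lambda>\<omega>. a * f \<omega>) \<in> H"
proof -
  obtain f' where "\<And>n. f' n \<in> linear_span G" "L2_limit M f' f"
    using assms unfolding noise_space_iff by blast
  then show ?thesis unfolding noise_space_iff
    by (intro exI[of _ "\<lambda>n \<omega>. a * f' n \<omega>"]) (auto intro: linear_span_cmult L2_limit_cmult)
qed

lemma H_diff: "f \<in> H \<Longrightarrow> g \<in> H \<Longrightarrow> (\<lambda>\<omega>. f \<omega> - g \<omega>) \<in> H"
  using H_add[of f "\<lambda>\<omega>. -1 * g \<omega>"] H_cmult[of g "-1"] by simp

lemma H_zero: "(\<lambda>\<omega>. 0) \<in> H"
  using H_cmult[OF H_base[of 0], of 0] by simp

lemma H_sum: "(\<And>i. i \<in> A \<Longrightarrow> f i \<in> H) \<Longrightarrow> (\<lambda>\<omega>. \<Sum>i\<in>A. f i \<omega>) \<in> H"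
  by (induction A rule: infinite_finite_induct) (auto intro: H_zero H_add)

lemma H_gaussian: "f \<in> H \<Longrightarrow> centered_gaussian M f"
  unfolding noise_space_iff using centered_gaussian_L2_limit linear_span_gaussian by blast

lemma H_sq_int: "f \<in> H \<Longrightarrow> square_integrable M f"
  by (intro centered_gaussian_moments(1) H_gaussian)

lemma H_meas: "f \<in> H \<Longrightarrow> f \<in> borel_measurable M"
  using H_sq_int by (auto simp: square_integrable_def)

text \<open>Diagonal argument: the n-th member of the sequence is replaced by a finite combination
  at squared distance below 1 / (n + 1), which does not change the limit.\<close>

lemma H_L2_closed:
  assumes "\<And>n. f n \<in> H" "L2_limit M f Z"
  shows "Z \<in> H"
proof -
  have "\<exists>g. g \<in> linear_span G \<and> (LINT \<omega>|M. (g \<omega> - f n \<omega>)\<^sup>2) < inverse (real (Suc n))" for n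
  proof -
    obtain g where g: "\<And>k. g k \<in> linear_span G" "L2_limit M g (f n)"
      using assms(1)[of n] unfolding noise_space_iff by blast
    then have "(\<lambda>k. LINT \<omega>|M. (g k \<omega> - f n \<omega>)\<^sup>2) \<longlonglongrightarrow> 0" by (simp add: L2_limit_def)
    then have "eventually (\<lambda>k. (LINT \<omega>|M. (g k \<omega> - f n \<omega>)\<^sup>2) < inverse (real (Suc n))) sequentially"
      by (rule order_tendstoD) simp
    then show ?thesis using g by (auto simp: eventually_sequentially)
  qed
  then obtain g where g: "\<And>n. g n \<in> linear_span G"
    and gl: "\<And>n. (LINT \<omega>|M. (g n \<omega> - f n \<omega>)\<^sup>2) < inverse (real (Suc n))" by metis
  have si: "square_integrable M (g n)" "square_integrable M (f n)" for n
    using g assms(1) by (auto intro: H_sq_int linear_span_subset)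
  have "L2_limit M (\<lambda>n \<omega>. g n \<omega> - f n \<omega>) (\<lambda>\<omega>. 0)"
    unfolding L2_limit_def
  proof (intro conjI allI sq_int_diff si sq_int_zero)
    show "(\<lambda>n. LINT x|M. (g n x - f n x - 0)\<^sup>2) \<longlonglongrightarrow> 0"
      by (rule tendsto_sandwich[OF _ _ tendsto_const LIMSEQ_inverse_real_of_nat])
        (use gl in \<open>auto intro!: always_eventually less_imp_le\<close>)
  qed
  from L2_limit_add[OF this assms(2)] have "L2_limit M g Z" by simp
  then show ?thesis using g unfolding noise_space_iff by blast
qed

lemma H_wick:
  assumes "A \<in> H" "B \<in> H"
  shows "square_integrable M (\<lambda>\<omega>. A \<omega> * B \<omega>)"
    "(LINT \<omega>|M. (A \<omega>)\<^sup>2 * (B \<omega>)\<^sup>2) =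
      (LINT \<omega>|M. (A \<omega>)\<^sup>2) * (LINT \<omega>|M. (B \<omega>)\<^sup>2) + 2 * (LINT \<omega>|M. A \<omega> * B \<omega>)\<^sup>2"
  using gaussian_wick[of A B] assms by (auto intro: H_gaussian H_add H_diff)

end

section \<open>Joint laws and characteristic functions\<close>

text \<open>Divided by their common mass, the weights are densities of two probability measures
  under which Z1 and Z2 have the same characteristic function, so Levy's uniqueness theorem
  applies.\<close>

lemma weighted_law_eq_nonneg:
  fixes Z1 :: "'a \<Rightarrow> real" and Z2 :: "'b \<Rightarrow> real"
  assumes [measurable]: "Z1 \<in> borel_measurable N1" "Z2 \<in> borel_measurable N2"
    and i: "integrable N1 W1" "integrable N2 W2"
    and nn: "\<And>x. 0 \<le> W1 x" "\<And>x. 0 \<le> W2 x"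
    and pos: "0 < (LINT x|N1. W1 x)"
    and c: "\<And>t. (LINT x|N1. W1 x * cos (t * Z1 x)) = (LINT x|N2. W2 x * cos (t * Z2 x))"
    and s: "\<And>t. (LINT x|N1. W1 x * sin (t * Z1 x)) = (LINT x|N2. W2 x * sin (t * Z2 x))"
    and S[measurable]: "S \<in> sets borel"
  shows "(LINT x|N1. W1 x * indicator S (Z1 x)) = (LINT x|N2. W2 x * indicator S (Z2 x))"
proof -
  define m where "m = (LINT x|N1. W1 x)"
  \<comment> \<open>The cosine hypothesis at t = 0 says that both weights have the same
    mass.\<close>
  have m: "0 < m" "m = (LINT x|N2. W2 x)" using pos c[of 0] by (simp_all add: m_def)
  have [measurable]: "W1 \<in> borel_measurable N1" "W2 \<in> borel_measurable N2" using i by auto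
  define D1 where "D1 = density N1 (\<lambda>x. ennreal (W1 x / m))"
  define D2 where "D2 = density N2 (\<lambda>x. ennreal (W2 x / m))"
  have "(\<integral>\<^sup>+x. ennreal (W1 x / m) \<partial>N1) = ennreal (LINT x|N1. W1 x / m)"
    using i nn m by (intro nn_integral_eq_integral) auto
  then have p1: "prob_space D1"
    using m by (intro prob_spaceI) (simp add: D1_def emeasure_density m_def cong: nn_integral_cong)
  have "(\<integral>\<^sup>+x. ennreal (W2 x / m) \<partial>N2) = ennreal (LINT x|N2. W2 x / m)"
    using i nn m by (intro nn_integral_eq_integral) auto
  then have p2: "prob_space D2"
    using m by (intro prob_spaceI) (simp add: D2_def emeasure_density cong: nn_integral_cong)
  interpret p1: prob_space D1 by (rule p1)
  interpret p2: prob_space D2 by (rule p2)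
  have [measurable]: "Z1 \<in> borel_measurable D1" "Z2 \<in> borel_measurable D2"
    by (simp_all add: D1_def D2_def)
  have I1: "(LINT x|D1. g (Z1 x)) = (LINT x|N1. W1 x * g (Z1 x)) / m" if [measurable]: "g \<in> borel_measurable borel" for g :: "real \<Rightarrow> real"
    unfolding D1_def using m nn by (subst integral_density) auto
  have I2: "(LINT x|D2. g (Z2 x)) = (LINT x|N2. W2 x * g (Z2 x)) / m" if [measurable]: "g \<in> borel_measurable borel" for g :: "real \<Rightarrow> real"
    unfolding D2_def using m nn by (subst integral_density) auto
  have "char (distr D1 borel Z1) = char (distr D2 borel Z2)"
    using I1[of "\<lambda>z. cos (_ * z)"] I1[of "\<lambda>z. sin (_ * z)"] I2[of "\<lambda>z. cos (_ * z)"] I2[of "\<lambda>z. sin (_ * z)"]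
    by (auto simp: fun_eq_iff p1.char_distr_eq p2.char_distr_eq c s)
  then have eq: "distr D1 borel Z1 = distr D2 borel Z2"
    by (intro Levy_uniqueness)
      (auto simp: real_distribution_def real_distribution_axioms_def intro!: p1.prob_space_distr p2.prob_space_distr)
  have "(LINT x|N1. W1 x * indicator S (Z1 x)) / m = (LINT x|distr D1 borel Z1. indicator S x)"
    using I1[of "indicator S"] by (subst integral_distr) auto
  also have "\<dots> = (LINT x|N2. W2 x * indicator S (Z2 x)) / m"
    unfolding eq using I2[of "indicator S"] by (subst integral_distr) auto
  finally show ?thesis using m by simp
qed

text \<open>A weight bounded by 1 in absolute value becomes positive after adding 2. The equality
  for the constant weight 2, which comes from the unweighted characteristic functions, is subtracted
  afterwards.\<close>

lemma weighted_law_eq: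
  fixes Z1 :: "'a \<Rightarrow> real" and Z2 :: "'b \<Rightarrow> real"
  assumes N: "prob_space N1" "prob_space N2"
    and Z[measurable]: "Z1 \<in> borel_measurable N1" "Z2 \<in> borel_measurable N2"
    and W[measurable]: "W1 \<in> borel_measurable N1" "W2 \<in> borel_measurable N2"
    and b: "\<And>x. \<bar>W1 x\<bar> \<le> 1" "\<And>x. \<bar>W2 x\<bar> \<le> 1"
    and c: "\<And>t. (LINT x|N1. W1 x * cos (t * Z1 x)) = (LINT x|N2. W2 x * cos (t * Z2 x))"
    and s: "\<And>t. (LINT x|N1. W1 x * sin (t * Z1 x)) = (LINT x|N2. W2 x * sin (t * Z2 x))"
    and c0: "\<And>t. (LINT x|N1. cos (t * Z1 x)) = (LINT x|N2. cos (t * Z2 x))"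
    and s0: "\<And>t. (LINT x|N1. sin (t * Z1 x)) = (LINT x|N2. sin (t * Z2 x))"
    and S[measurable]: "S \<in> sets borel"
  shows "(LINT x|N1. W1 x * indicator S (Z1 x)) = (LINT x|N2. W2 x * indicator S (Z2 x))"
proof -
  interpret N1: prob_space N1 by (rule N(1))
  interpret N2: prob_space N2 by (rule N(2))
  have pathwise_integral: "0 \<le> W1 x + 2" "0 \<le> W2 y + 2" for x y
    using b(1)[of x] b(2)[of y] by linarith+
  have i1: "integrable N1 (\<lambda>x. W1 x * g (Z1 x))" "integrable N1 (\<lambda>x. g (Z1 x))"
    if [measurable]: "g \<in> borel_measurable borel" and g: "\<And>x. \<bar>g x\<bar> \<le> 1" for g :: "real \<Rightarrow> real"
    by (rule N1.integrable_bounded[of _ 1]; use g b mult_mono[OF b(1) g] in \<open>simp add: abs_mult\<close>)+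
  have i2: "integrable N2 (\<lambda>x. W2 x * g (Z2 x))" "integrable N2 (\<lambda>x. g (Z2 x))"
    if [measurable]: "g \<in> borel_measurable borel" and g: "\<And>x. \<bar>g x\<bar> \<le> 1" for g :: "real \<Rightarrow> real"
    by (rule N2.integrable_bounded[of _ 1]; use g b mult_mono[OF b(2) g] in \<open>simp add: abs_mult\<close>)+
  have W1i: "integrable N1 W1" and W2i: "integrable N2 W2"
    by (rule N1.integrable_bounded[of _ 1] N2.integrable_bounded[of _ 1]; simp add: b)+
  have "(LINT x|N1. 1) \<le> (LINT x|N1. W1 x + 2)"
  proof (rule integral_mono)
    show "1 \<le> W1 x + 2" for x using b(1)[of x] by linarith
  qed (use W1i in auto)
  then have p1: "0 < (LINT x|N1. W1 x + 2)" by (simp add: N1.prob_space)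
  have A: "(LINT x|N1. (W1 x + 2) * indicator S (Z1 x)) = (LINT x|N2. (W2 x + 2) * indicator S (Z2 x))"
    by (rule weighted_law_eq_nonneg)
      (use W1i W2i pathwise_integral p1 i1[of "\<lambda>x. cos (_ * x)"] i2[of "\<lambda>x. cos (_ * x)"] i1[of "\<lambda>x. sin (_ * x)"] i2[of "\<lambda>x. sin (_ * x)"]
        in \<open>simp_all add: distrib_right c s c0 s0\<close>)
  have B: "(LINT x|N1. 2 * indicator S (Z1 x)) = (LINT x|N2. (2::real) * indicator S (Z2 x))"
    by (rule weighted_law_eq_nonneg) (simp_all add: c0 s0 N1.prob_space)
  have "integrable N1 (\<lambda>x. W1 x * indicator S (Z1 x))" "integrable N1 (\<lambda>x. indicator S (Z1 x) :: real)"
     "integrable N2 (\<lambda>x. W2 x * indicator S (Z2 x))" "integrable N2 (\<lambda>x. indicator S (Z2 x) :: real)"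
    using i1[of "indicator S"] i2[of "indicator S"] by (auto simp: indicator_def)
  then show ?thesis using A B by (simp add: distrib_right)
qed

lemma abs_mult_le_1: "\<bar>a\<bar> \<le> 1 \<Longrightarrow> \<bar>b\<bar> \<le> 1 \<Longrightarrow> \<bar>a * b\<bar> \<le> 1" for a b :: real
  by (simp add: abs_mult mult_le_one)

text \<open>Iterating this step turns the characteristic functions of linear combinations, one coordinate at
  a time, into the joint law; only the one-dimensional uniqueness theorem is used.\<close>

lemma weighted_law_step:
  fixes Z1 :: "'a \<Rightarrow> real" and Z2 :: "'b \<Rightarrow> real"
  assumes N: "prob_space N1" "prob_space N2"
    and Z[measurable]: "Z1 \<in> borel_measurable N1" "Z2 \<in> borel_measurable N2"
    and W[measurable]: "W1 \<in> borel_measurable N1" "W2 \<in> borel_measurable N2"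
       "S1 \<in> borel_measurable N1" "S2 \<in> borel_measurable N2"
    and b: "\<And>x. \<bar>W1 x\<bar> \<le> 1" "\<And>x. \<bar>W2 x\<bar> \<le> 1"
    and IH: "\<And>t. (LINT x|N1. W1 x * cos (t * Z1 x + S1 x)) = (LINT x|N2. W2 x * cos (t * Z2 x + S2 x))"
      "\<And>t. (LINT x|N1. W1 x * sin (t * Z1 x + S1 x)) = (LINT x|N2. W2 x * sin (t * Z2 x + S2 x))"
    and k: "\<And>t. (LINT x|N1. cos (t * Z1 x)) = (LINT x|N2. cos (t * Z2 x))"
      "\<And>t. (LINT x|N1. sin (t * Z1 x)) = (LINT x|N2. sin (t * Z2 x))"
    and B[measurable]: "B \<in> sets borel"
  shows "(LINT x|N1. W1 x * cos (S1 x) * indicator B (Z1 x)) = (LINT x|N2. W2 x * cos (S2 x) * indicator B (Z2 x))" (is ?C)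
    "(LINT x|N1. W1 x * sin (S1 x) * indicator B (Z1 x)) = (LINT x|N2. W2 x * sin (S2 x) * indicator B (Z2 x))" (is ?S)
proof -
  interpret N1: prob_space N1 by (rule N(1))
  interpret N2: prob_space N2 by (rule N(2))
  have i1: "integrable N1 (\<lambda>x. W1 x * cos (t * Z1 x + S1 x))" "integrable N1 (\<lambda>x. W1 x * sin (t * Z1 x + S1 x))" for t
    by (rule N1.integrable_bounded[of _ 1]; auto intro!: abs_mult_le_1 b)+
  have i2: "integrable N2 (\<lambda>x. W2 x * cos (t * Z2 x + S2 x))" "integrable N2 (\<lambda>x. W2 x * sin (t * Z2 x + S2 x))" for t
    by (rule N2.integrable_bounded[of _ 1]; auto intro!: abs_mult_le_1 b)+
  \<comment> \<open>Product-to-sum formulas: the hypothesis at \<open>t\<close> and at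
    \<open>- t\<close> together separates the factor in \<open>S\<close> from the factor in
    \<open>t * Z\<close>.\<close>
  have e: "w * cos s * cos (t * z) = (w * cos (t * z + s) + w * cos ((-t) * z + s)) / 2"
    "w * cos s * sin (t * z) = (w * sin (t * z + s) - w * sin ((-t) * z + s)) / 2"
    "w * sin s * cos (t * z) = (w * sin (t * z + s) + w * sin ((-t) * z + s)) / 2"
    "w * sin s * sin (t * z) = (w * cos ((-t) * z + s) - w * cos (t * z + s)) / 2" for w s t z :: real
    by (simp_all add: cos_add sin_add cos_diff sin_diff algebra_simps)
  have c: "(LINT x|N1. W1 x * cos (S1 x) * cos (t * Z1 x)) = (LINT x|N2. W2 x * cos (S2 x) * cos (t * Z2 x))"
    "(LINT x|N1. W1 x * cos (S1 x) * sin (t * Z1 x)) = (LINT x|N2. W2 x * cos (S2 x) * sin (t * Z2 x))"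
    "(LINT x|N1. W1 x * sin (S1 x) * cos (t * Z1 x)) = (LINT x|N2. W2 x * sin (S2 x) * cos (t * Z2 x))"
    "(LINT x|N1. W1 x * sin (S1 x) * sin (t * Z1 x)) = (LINT x|N2. W2 x * sin (S2 x) * sin (t * Z2 x))" for t
    unfolding e using i1[of t] i2[of t] i1[of "-t"] i2[of "-t"] IH[of t] IH[of "-t"] by simp_all
  show ?C
    by (rule weighted_law_eq[OF N Z _ _ _ _ c(1,2) k])
      (auto intro!: abs_mult_le_1 b)
  show ?S
    by (rule weighted_law_eq[OF N Z _ _ _ _ c(3,4) k])
      (auto intro!: abs_mult_le_1 b)
qed

text \<open>The coordinates in K are tested by indicators and those in J still by cosine and sine;
  each induction step moves one coordinate from J to K. With J empty this is the measure of a
  cylinder set, and cylinder sets determine a finite measure on the product space.\<close>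

lemma joint_law_eq:
  fixes Z1 :: "'i \<Rightarrow> 'a \<Rightarrow> real" and Z2 :: "'i \<Rightarrow> 'b \<Rightarrow> real"
  assumes N: "prob_space N1" "prob_space N2"
    and Z1: "\<And>i. i \<in> I \<Longrightarrow> Z1 i \<in> borel_measurable N1" and Z2: "\<And>i. i \<in> I \<Longrightarrow> Z2 i \<in> borel_measurable N2"
    and c: "\<And>J c. finite J \<Longrightarrow> J \<subseteq> I \<Longrightarrow>
      (LINT x|N1. cos (\<Sum>i\<in>J. c i * Z1 i x)) = (LINT x|N2. cos (\<Sum>i\<in>J. c i * Z2 i x))"
    and s: "\<And>J c. finite J \<Longrightarrow> J \<subseteq> I \<Longrightarrow>
      (LINT x|N1. sin (\<Sum>i\<in>J. c i * Z1 i x)) = (LINT x|N2. sin (\<Sum>i\<in>J. c i * Z2 i x))"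
  shows "distr N1 (Pi\<^sub>M I (\<lambda>_. borel)) (\<lambda>\<omega>. \<lambda>i\<in>I. Z1 i \<omega>) = distr N2 (Pi\<^sub>M I (\<lambda>_. borel)) (\<lambda>\<omega>. \<lambda>i\<in>I. Z2 i \<omega>)"
proof -
  interpret N1: prob_space N1 by (rule N(1))
  interpret N2: prob_space N2 by (rule N(2))
  let ?I = "\<lambda>K (B :: 'i \<Rightarrow> real set) z. (\<Prod>i\<in>K. indicator (B i) (z i :: real)) :: real"
  have main: "(LINT x|N1. ?I K B (\<lambda>i. Z1 i x) * cos (\<Sum>i\<in>J. c i * Z1 i x)) =
          (LINT x|N2. ?I K B (\<lambda>i. Z2 i x) * cos (\<Sum>i\<in>J. c i * Z2 i x)) \<and>
        (LINT x|N1. ?I K B (\<lambda>i. Z1 i x) * sin (\<Sum>i\<in>J. c i * Z1 i x)) =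
          (LINT x|N2. ?I K B (\<lambda>i. Z2 i x) * sin (\<Sum>i\<in>J. c i * Z2 i x))"
    if "finite K" "K \<subseteq> I" "finite J" "J \<subseteq> I" "J \<inter> K = {}" "\<And>i. B i \<in> sets borel" for K J B c
    using that
  proof (induction K arbitrary: J c rule: finite_induct)
    case empty
    then show ?case using c s by simp
  next
    case (insert k K)
    have [measurable]: "B i \<in> sets borel" for i by (rule insert)
    have [measurable]: "Z1 k \<in> borel_measurable N1" "Z2 k \<in> borel_measurable N2"
      using Z1 Z2 insert by auto
    have kJ: "k \<notin> J" "finite J" using insert by auto
    let ?S1 = "\<lambda>x. \<Sum>i\<in>J. c i * Z1 i x" and ?S2 = "\<lambda>x. \<Sum>i\<in>J. c i * Z2 i x"
    let ?I1 = "\<lambda>x. ?I K B (\<lambda>i. Z1 i x)" and ?I2 = "\<lambda>x. ?I K B (\<lambda>i. Z2 i x)"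
    have Ib: "\<bar>?I K B z\<bar> \<le> 1" for z
      by (subst abs_prod) (auto intro!: prod_le_1 simp: indicator_def)
    have ins: "(\<Sum>i\<in>insert k J. (c(k := t)) i * z i) = t * z k + (\<Sum>i\<in>J. c i * z i)" for t and z :: "'i \<Rightarrow> real"
    proof -
      have "(\<Sum>i\<in>J. (c(k := t)) i * z i) = (\<Sum>i\<in>J. c i * z i)"
        using kJ by (intro sum.cong) auto
      then show ?thesis using kJ by simp
    qed
    have IH: "(LINT x|N1. ?I1 x * cos (t * Z1 k x + ?S1 x)) = (LINT x|N2. ?I2 x * cos (t * Z2 k x + ?S2 x))"
      "(LINT x|N1. ?I1 x * sin (t * Z1 k x + ?S1 x)) = (LINT x|N2. ?I2 x * sin (t * Z2 k x + ?S2 x))" for t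
      using insert.IH[of "insert k J" "c(k := t)"] insert.prems insert.hyps unfolding ins by auto
    have k: "(LINT x|N1. cos (t * Z1 k x)) = (LINT x|N2. cos (t * Z2 k x))"
      "(LINT x|N1. sin (t * Z1 k x)) = (LINT x|N2. sin (t * Z2 k x))" for t
      using c[of "{k}" "\<lambda>_. t"] s[of "{k}" "\<lambda>_. t"] insert.prems by auto
    have IB: "?I (insert k K) B z = ?I K B z * indicator (B k) (z k)" for z
      using insert.hyps by (simp add: mult.commute)
    have m: "?I1 \<in> borel_measurable N1" "?I2 \<in> borel_measurable N2" "?S1 \<in> borel_measurable N1" "?S2 \<in> borel_measurable N2"
      using Z1 Z2 insert.prems by (auto intro!: borel_measurable_prod borel_measurable_sum borel_measurable_times
         measurable_compose[OF _ borel_measurable_indicator[of _ borel]])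
    have "(LINT x|N1. ?I1 x * cos (?S1 x) * indicator (B k) (Z1 k x)) = (LINT x|N2. ?I2 x * cos (?S2 x) * indicator (B k) (Z2 k x)) \<and>
      (LINT x|N1. ?I1 x * sin (?S1 x) * indicator (B k) (Z1 k x)) = (LINT x|N2. ?I2 x * sin (?S2 x) * indicator (B k) (Z2 k x))"
      using weighted_law_step[OF N _ _ m Ib Ib IH k, of "B k"] by auto
    then show ?case
      unfolding IB by (simp add: mult.assoc mult.left_commute[of "indicator _ _"] mult.commute[of "indicator _ _"])
  qed
  have prodI: "?I J A z = (if \<forall>i\<in>J. z i \<in> A i then 1 else 0)" if "finite J" for J A z
    using that by (induction J rule: finite_induct) auto
  note m1 = measurable_restrict[of I Z1 N1 "\<lambda>_. borel", OF Z1]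
  note m2 = measurable_restrict[of I Z2 N2 "\<lambda>_. borel", OF Z2]
  show ?thesis
  proof (rule measure_eqI_PiM_infinite)
    show "finite_measure (distr N1 (Pi\<^sub>M I (\<lambda>_. borel)) (\<lambda>\<omega>. \<lambda>i\<in>I. Z1 i \<omega>))"
      by (rule N1.finite_measure_distr[OF m1])
    fix A :: "'i \<Rightarrow> real set" and J
    assume J: "finite J" "J \<subseteq> I" and A: "\<And>i. i \<in> J \<Longrightarrow> A i \<in> sets borel"
    let ?E = "prod_emb I (\<lambda>_. borel) J (Pi\<^sub>E J A)"
    have E: "?E \<in> sets (Pi\<^sub>M I (\<lambda>_. borel))"
      using J A by (intro sets_PiM_I) auto
    have mem: "(\<lambda>i\<in>I. z i) \<in> ?E \<longleftrightarrow> (\<forall>i\<in>J. z i \<in> A i)" for z :: "'i \<Rightarrow> real"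
      using J by (auto simp: prod_emb_def PiE_iff Pi_iff extensional_def restrict_def)
    \<comment> \<open>\<open>main\<close> asks for Borel sets at all indices, so the family is
      filled up with UNIV outside J.\<close>
    define B where "B i = (if i \<in> J then A i else UNIV)" for i
    have ind: "?I J B z = indicator ?E (\<lambda>i\<in>I. z i)" for z
      unfolding prodI[OF J(1)] by (simp add: indicator_def mem B_def)
    have "(LINT x|N1. ?I J B (\<lambda>i. Z1 i x)) = (LINT x|N2. ?I J B (\<lambda>i. Z2 i x))"
      using main[of J "{}" B "\<lambda>_. 0"] J A by (auto simp: B_def)
    then have eq: "(LINT x|N1. indicator ?E (\<lambda>i\<in>I. Z1 i x)) = (LINT x|N2. indicator ?E (\<lambda>i\<in>I. Z2 i x) :: real)"
      by (simp only: ind)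
    have "measure (distr N1 (Pi\<^sub>M I (\<lambda>_. borel)) (\<lambda>\<omega>. \<lambda>i\<in>I. Z1 i \<omega>)) ?E =
       (LINT x|distr N1 (Pi\<^sub>M I (\<lambda>_. borel)) (\<lambda>\<omega>. \<lambda>i\<in>I. Z1 i \<omega>). indicator ?E x)"
      using E by simp
    also have "\<dots> = (LINT x|distr N2 (Pi\<^sub>M I (\<lambda>_. borel)) (\<lambda>\<omega>. \<lambda>i\<in>I. Z2 i \<omega>). indicator ?E x)"
      using eq E integral_distr[OF m1, of "indicator ?E :: _ \<Rightarrow> real"]
        integral_distr[OF m2, of "indicator ?E :: _ \<Rightarrow> real"] by simp
    also have "\<dots> = measure (distr N2 (Pi\<^sub>M I (\<lambda>_. borel)) (\<lambda>\<omega>. \<lambda>i\<in>I. Z2 i \<omega>)) ?E"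
      using E by simp
    finally show "emeasure (distr N1 (Pi\<^sub>M I (\<lambda>_. borel)) (\<lambda>\<omega>. \<lambda>i\<in>I. Z1 i \<omega>)) ?E =
      emeasure (distr N2 (Pi\<^sub>M I (\<lambda>_. borel)) (\<lambda>\<omega>. \<lambda>i\<in>I. Z2 i \<omega>)) ?E"
      using N1.finite_measure_distr[OF m1] N2.finite_measure_distr[OF m2]
      by (simp add: finite_measure.emeasure_eq_measure)
  qed auto
qed

section \<open>Gaussian integration by parts\<close>

lemma normal_density_0: "normal_density 0 \<sigma> x = 1 / sqrt (2 * pi * \<sigma>\<^sup>2) * exp (- (x\<^sup>2 / (2 * \<sigma>\<^sup>2)))"
  by (simp add: normal_density_def)

text \<open>The density n satisfies x n(x) = -\<sigma>^2 n'(x), so the difference of the two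
  integrands is the derivative of -\<sigma>^2 n k. This primitive vanishes at both ends because the
  Gaussian density beats linear growth.\<close>

lemma stein_normal:
  fixes k k' :: "real \<Rightarrow> real"
  assumes \<sigma>: "0 < \<sigma>" and d: "\<And>x. (k has_real_derivative k' x) (at x)" and c: "continuous_on UNIV k'"
    and b: "\<And>x. \<bar>k x\<bar> \<le> a + b * \<bar>x\<bar>" "\<And>x. \<bar>k' x\<bar> \<le> a + b * \<bar>x\<bar>"
  shows "(LINT x|lborel. normal_density 0 \<sigma> x * (k x * x)) = \<sigma>\<^sup>2 * (LINT x|lborel. normal_density 0 \<sigma> x * k' x)"
proof -
  let ?n = "normal_density 0 \<sigma>"
  have kc: "continuous_on UNIV k"
    using d by (meson DERIV_isCont continuous_at_imp_continuous_on)
  have [measurable]: "k \<in> borel_measurable borel" "k' \<in> borel_measurable borel"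
    using kc c by (auto intro: borel_measurable_continuous_onI)
  have n0: "0 \<le> ?n x" for x by (rule normal_density_nonneg)
  have im: "integrable lborel (\<lambda>x. ?n x * x ^ j)" for j
    using integrable_normal_moment[OF \<sigma>, of 0 j] by simp
  have i: "integrable lborel (\<lambda>x. ?n x * (a + b * \<bar>x\<bar>))" "integrable lborel (\<lambda>x. ?n x * ((a + b * \<bar>x\<bar>) * \<bar>x\<bar>))"
  proof -
    have 1: "integrable lborel (\<lambda>x. ?n x * \<bar>x\<bar>)"
      using integrable_abs[OF im[of 1]] n0 by (simp add: abs_mult)
    then show "integrable lborel (\<lambda>x. ?n x * (a + b * \<bar>x\<bar>))"
      using im[of 0] by (simp add: distrib_left mult.left_commute[of _ b])
    have "(\<lambda>x. ?n x * ((a + b * \<bar>x\<bar>) * \<bar>x\<bar>)) = (\<lambda>x. a * (?n x * \<bar>x\<bar>) + b * (?n x * x\<^sup>2))"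
      by (auto simp: algebra_simps power2_eq_square)
    then show "integrable lborel (\<lambda>x. ?n x * ((a + b * \<bar>x\<bar>) * \<bar>x\<bar>))"
      using 1 im[of 2] by simp
  qed
  have i1: "integrable lborel (\<lambda>x. ?n x * (k x * x))"
  proof (rule Bochner_Integration.integrable_bound[OF i(2)])
    show "AE x in lborel. norm (?n x * (k x * x)) \<le> norm (?n x * ((a + b * \<bar>x\<bar>) * \<bar>x\<bar>))"
    proof (rule AE_I2)
      fix x
      have "\<bar>k x * x\<bar> \<le> (a + b * \<bar>x\<bar>) * \<bar>x\<bar>" using b(1)[of x] by (simp add: abs_mult mult_right_mono)
      then show "norm (?n x * (k x * x)) \<le> norm (?n x * ((a + b * \<bar>x\<bar>) * \<bar>x\<bar>))"
        using n0[of x] by (simp only: real_norm_def abs_mult[of "?n x"]) (intro mult_left_mono; linarith)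
    qed
  qed simp
  have i2: "integrable lborel (\<lambda>x. ?n x * k' x)"
  proof (rule Bochner_Integration.integrable_bound[OF i(1)])
    show "AE x in lborel. norm (?n x * k' x) \<le> norm (?n x * (a + b * \<bar>x\<bar>))"
    proof (rule AE_I2)
      fix x show "norm (?n x * k' x) \<le> norm (?n x * (a + b * \<bar>x\<bar>))"
        using b(2)[of x] n0[of x] by (simp only: real_norm_def abs_mult[of "?n x"]) (intro mult_left_mono; linarith)
    qed
  qed simp
  let ?F = "\<lambda>x. - \<sigma>\<^sup>2 * ?n x * k x"
  let ?f = "\<lambda>x. ?n x * (k x * x) - \<sigma>\<^sup>2 * (?n x * k' x)"
  have dF: "(?F has_real_derivative ?f x) (at x)" for x
  proof -
    have "((\<lambda>x. K * exp (- (x\<^sup>2 * q))) has_real_derivative - (x * (2 * q)) * (K * exp (- (x\<^sup>2 * q)))) (at x)" for K q :: real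
      by (auto intro!: derivative_eq_intros)
    from this[of "1 / sqrt (2 * pi * \<sigma>\<^sup>2)" "1 / (2 * \<sigma>\<^sup>2)"]
    have "(?n has_real_derivative - (x / \<sigma>\<^sup>2) * ?n x) (at x)"
      unfolding normal_density_0 by simp
    note * = DERIV_mult[OF DERIV_cmult[OF this, of "- \<sigma>\<^sup>2"] d[of x]]
    have "- \<sigma>\<^sup>2 * (- (x / \<sigma>\<^sup>2) * ?n x) * k x + k' x * (- \<sigma>\<^sup>2 * ?n x) = ?f x"
      using \<sigma> by (simp add: field_simps)
    then show ?thesis by (rule DERIV_cong[OF *])
  qed
  have lim: "((\<lambda>x. ?F x) \<longlongrightarrow> 0) F" if "((\<lambda>x. ?n x * (a + b * \<bar>x\<bar>)) \<longlongrightarrow> 0) F" for F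
  proof (rule tendsto_0_le[OF that, of _ "\<sigma>\<^sup>2"])
    have "norm (?F x) \<le> norm (?n x * (a + b * \<bar>x\<bar>)) * \<sigma>\<^sup>2" for x
    proof -
      have "\<bar>?n x * k x\<bar> \<le> \<bar>?n x * (a + b * \<bar>x\<bar>)\<bar>"
        using b(1)[of x] n0[of x] by (simp only: abs_mult[of "?n x"]) (intro mult_left_mono; linarith)
      then have "\<bar>?n x * k x\<bar> * \<sigma>\<^sup>2 \<le> \<bar>?n x * (a + b * \<bar>x\<bar>)\<bar> * \<sigma>\<^sup>2" by (intro mult_right_mono) auto
      then show ?thesis by (simp add: abs_mult mult_ac)
    qed
    then show "eventually (\<lambda>x. norm (?F x) \<le> norm (?n x * (a + b * \<bar>x\<bar>)) * \<sigma>\<^sup>2) F" by simp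
  qed
  define q where "q = 1 / (2 * \<sigma>\<^sup>2)"
  have q: "0 < q" using \<sigma> by (simp add: q_def)
  have lt: "((\<lambda>x. ?n x * (a + b * \<bar>x\<bar>)) \<longlongrightarrow> 0) at_top"
  proof -
    have "((\<lambda>x. 1 / sqrt (2 * pi * \<sigma>\<^sup>2) * (exp (- (q * x\<^sup>2)) * (a + b * \<bar>x\<bar>))) \<longlongrightarrow> 1 / sqrt (2 * pi * \<sigma>\<^sup>2) * 0) at_top"
      by (intro tendsto_mult tendsto_const) (use q in real_asymp)
    then show ?thesis by (simp add: normal_density_0 q_def mult.assoc)
  qed
  have lb: "((\<lambda>x. ?n x * (a + b * \<bar>x\<bar>)) \<longlongrightarrow> 0) at_bot"
  proof -
    have "((\<lambda>x. 1 / sqrt (2 * pi * \<sigma>\<^sup>2) * (exp (- (q * x\<^sup>2)) * (a + b * \<bar>x\<bar>))) \<longlongrightarrow> 1 / sqrt (2 * pi * \<sigma>\<^sup>2) * 0) at_bot"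
      by (intro tendsto_mult tendsto_const) (use q in real_asymp)
    then show ?thesis by (simp add: normal_density_0 q_def mult.assoc)
  qed
  have nc: "continuous_on UNIV ?n"
    unfolding normal_density_0 by (intro continuous_intros) (use \<sigma> in auto)
  have fc: "continuous_on UNIV ?f"
    by (intro continuous_intros nc kc c)
  have fi: "integrable lborel ?f" using i1 i2 by simp
  have "(LBINT x=-\<infinity>..\<infinity>. ?f x) = 0 - 0"
  proof (rule interval_integral_FTC_integrable[where F = ?F])
    show "(?F has_vector_derivative ?f x) (at x)" for x
      using dF by (simp add: has_real_derivative_iff_has_vector_derivative)
    show "isCont ?f x" for x using fc by (simp add: continuous_on_eq_continuous_at)
    show "set_integrable lborel (einterval (-\<infinity>) \<infinity>) ?f"
      using fi by (simp add: set_integrable_def einterval_def)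
    show "((?F \<circ> real_of_ereal) \<longlongrightarrow> 0) (at_right (- \<infinity>))"
      unfolding ereal_tendsto_simps by (rule lim[OF lb])
    show "((?F \<circ> real_of_ereal) \<longlongrightarrow> 0) (at_left \<infinity>)"
      unfolding ereal_tendsto_simps by (rule lim[OF lt])
  qed simp
  then have "(LINT x|lborel. ?f x) = 0"
    by (simp add: interval_lebesgue_integral_def einterval_def set_lebesgue_integral_def)
  then show ?thesis using i1 i2 by simp
qed

lemma (in prob_space) stein_gaussian:
  fixes k k' :: "real \<Rightarrow> real"
  assumes B: "centered_gaussian M B" and v: "(LINT \<omega>|M. (B \<omega>)\<^sup>2) \<noteq> 0"
    and d: "\<And>x. (k has_real_derivative k' x) (at x)" and c: "continuous_on UNIV k'"
    and b: "\<And>x. \<bar>k x\<bar> \<le> a + b * \<bar>x\<bar>" "\<And>x. \<bar>k' x\<bar> \<le> a + b * \<bar>x\<bar>"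
  shows "(LINT \<omega>|M. k (B \<omega>) * B \<omega>) = (LINT \<omega>|M. (B \<omega>)\<^sup>2) * (LINT \<omega>|M. k' (B \<omega>))"
proof -
  have kc: "continuous_on UNIV k"
    using d by (meson DERIV_isCont continuous_at_imp_continuous_on)
  have [measurable]: "k \<in> borel_measurable borel" "k' \<in> borel_measurable borel"
    using kc c by (auto intro: borel_measurable_continuous_onI)
  have "\<not> (AE \<omega> in M. B \<omega> = 0)"
  proof
    assume "AE \<omega> in M. B \<omega> = 0"
    then have "(LINT \<omega>|M. (B \<omega>)\<^sup>2) = (LINT \<omega>|M. 0)"
      using B by (intro integral_cong_AE) (auto simp: centered_gaussian_def)
    then show False using v by simp
  qed
  then obtain \<sigma> where \<sigma>: "0 < \<sigma>" and D: "distributed M lborel B (normal_density 0 \<sigma>)"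
    using B by (auto simp: centered_gaussian_def)
  have e2: "(LINT \<omega>|M. (B \<omega>)\<^sup>2) = \<sigma>\<^sup>2"
    using distributed_integral[OF D, of "\<lambda>x. x\<^sup>2"] integral_normal_moment_even[OF \<sigma>, of 0 1]
    by (simp add: normal_density_nonneg fact_numeral)
  show ?thesis
    unfolding e2 using stein_normal[OF \<sigma> d c b] distributed_integral[OF D, of "\<lambda>x. k x * x"] distributed_integral[OF D, of k']
    by (simp add: normal_density_nonneg)
qed

section \<open>A chain rule for functions with continuous partial derivatives\<close>

lemma mean_value_between:
  fixes \<phi> :: "real \<Rightarrow> real"
  assumes "\<And>v. (\<phi> has_real_derivative \<phi>' v) (at v)"
  shows "\<exists>\<xi>. \<bar>\<xi> - v\<bar> \<le> \<bar>w - v\<bar> \<and> \<phi> w - \<phi> v = (w - v) * \<phi>' \<xi>"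
proof -
  consider "v < w" | "w < v" | "v = w" by linarith
  then show ?thesis
  proof cases
    case 1
    from MVT2[OF this, of \<phi> \<phi>'] assms obtain z where "v < z" "z < w" "\<phi> w - \<phi> v = (w - v) * \<phi>' z" by blast
    then show ?thesis by (intro exI[of _ z]) auto
  next
    case 2
    from MVT2[OF this, of \<phi> \<phi>'] assms obtain z where "w < z" "z < v" "\<phi> v - \<phi> w = (v - w) * \<phi>' z" by blast
    then show ?thesis by (intro exI[of _ z]) (auto simp: algebra_simps)
  qed auto
qed

text \<open>The increment is split into a move of v at fixed b, handled by the mean value theorem,
  and a move of b at fixed v. Continuity of the derivative in v at one point stands in for
  differentiability of F in both variables jointly.\<close>

lemma has_derivative_along_line:
  fixes F F2 :: "real \<Rightarrow> real \<Rightarrow> real"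
  assumes d1: "((\<lambda>b. F b (c * b0 + x)) has_real_derivative D) (at b0)"
    and d2: "\<And>b v. ((\<lambda>v. F b v) has_real_derivative F2 b v) (at v)"
    and cont: "isCont (\<lambda>(b, v). F2 b v) (b0, c * b0 + x)"
  shows "((\<lambda>b. F b (c * b + x)) has_real_derivative D + c * F2 b0 (c * b0 + x)) (at b0)"
proof -
  let ?v = "c * b0 + x"
  have "\<exists>\<xi>. \<bar>\<xi> - ?v\<bar> \<le> \<bar>(c * b + x) - ?v\<bar> \<and> F b (c * b + x) - F b ?v = ((c * b + x) - ?v) * F2 b \<xi>" for b
    by (rule mean_value_between) (rule d2)
  then obtain \<xi> where \<xi>: "\<And>b. \<bar>\<xi> b - ?v\<bar> \<le> \<bar>(c * b + x) - ?v\<bar>"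
    "\<And>b. F b (c * b + x) - F b ?v = ((c * b + x) - ?v) * F2 b (\<xi> b)" by metis
  have "((\<lambda>b. \<xi> b - ?v) \<longlongrightarrow> 0) (at b0)"
  proof (rule tendsto_0_le[of "\<lambda>b. (c * b + x) - ?v" _ _ 1])
    show "((\<lambda>b. (c * b + x) - ?v) \<longlongrightarrow> 0) (at b0)"
      by (rule tendsto_eq_intros refl | simp)+
    show "eventually (\<lambda>b. norm (\<xi> b - ?v) \<le> norm (c * b + x - ?v) * 1) (at b0)"
      using \<xi>(1) by simp
  qed
  then have "(\<xi> \<longlongrightarrow> ?v) (at b0)" by (simp add: LIM_zero_iff)
  then have "((\<lambda>b. (b, \<xi> b)) \<longlongrightarrow> (b0, ?v)) (at b0)" by (intro tendsto_intros)
  then have l2: "((\<lambda>b. F2 b (\<xi> b)) \<longlongrightarrow> F2 b0 ?v) (at b0)"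
    using isCont_tendsto_compose[OF cont] by fastforce
  have l1: "((\<lambda>b. (F b ?v - F b0 ?v) / (b - b0)) \<longlongrightarrow> D) (at b0)"
    using d1 by (simp add: has_field_derivative_iff)
  have "((\<lambda>b. (F b ?v - F b0 ?v) / (b - b0) + c * F2 b (\<xi> b)) \<longlongrightarrow> D + c * F2 b0 ?v) (at b0)"
    by (intro tendsto_intros l1 l2)
  moreover have "(F b ?v - F b0 ?v) / (b - b0) + c * F2 b (\<xi> b) = (F b (c * b + x) - F b0 ?v) / (b - b0)" if "b \<noteq> b0" for b
  proof -
    have "F b (c * b + x) - F b ?v = (b - b0) * (c * F2 b (\<xi> b))"
      using \<xi>(2)[of b] by (simp add: algebra_simps)
    then show ?thesis using that by (simp add: field_simps)
  qed
  then have "eventually (\<lambda>b. (F b ?v - F b0 ?v) / (b - b0) + c * F2 b (\<xi> b) = (F b (c * b + x) - F b0 ?v) / (b - b0)) (at b0)"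
    by (simp add: eventually_at_filter)
  ultimately have "((\<lambda>b. (F b (c * b + x) - F b0 ?v) / (b - b0)) \<longlongrightarrow> D + c * F2 b0 ?v) (at b0)"
    by (rule Lim_transform_eventually)
  then show ?thesis by (simp add: has_field_derivative_iff)
qed

lemma smooth_bounded_deriv:
  assumes f: "smooth_bounded n f" and i: "i < n"
  shows "((\<lambda>y. f (x(i := y))) has_real_derivative partial i f (x(i := v))) (at v)"
proof -
  have "\<forall>x. (\<lambda>y. foldr partial [] f (x(i := y))) field_differentiable at (x i)"
    using f i unfolding smooth_bounded_def by (metis empty_set empty_subsetI)
  then have "(\<lambda>y. f ((x(i := v))(i := y))) field_differentiable at ((x(i := v)) i)"
    by (metis foldr_Nil id_apply)
  then have "(\<lambda>y. f (x(i := y))) field_differentiable at v" by simp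
  then have "((\<lambda>y. f (x(i := y))) has_real_derivative deriv (\<lambda>y. f (x(i := y))) v) (at v)"
    by (rule field_differentiable_derivI)
  then show ?thesis by (simp add: partial_def)
qed

lemma smooth_bounded_cong:
  assumes f: "smooth_bounded n f" and "\<And>i. i < n \<Longrightarrow> x i = y i"
  shows "f x = f y"
  using assms by (auto simp: smooth_bounded_def)

lemma smooth_bounded_cont:
  assumes f: "smooth_bounded n f"
  shows "continuous_on UNIV f" "bounded (range f)" "i < n \<Longrightarrow> continuous_on UNIV (partial i f)"
    "i < n \<Longrightarrow> bounded (range (partial i f))"
proof -
  have *: "set is \<subseteq> {..<n} \<Longrightarrow> continuous_on UNIV (foldr partial is f) \<and> bounded (range (foldr partial is f))" for "is"
    using f by (simp add: smooth_bounded_def)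
  show "continuous_on UNIV f" "bounded (range f)" using *[of "[]"] by simp_all
  show "i < n \<Longrightarrow> continuous_on UNIV (partial i f)" "i < n \<Longrightarrow> bounded (range (partial i f))"
    using *[of "[i]"] by simp_all
qed

text \<open>Smoothness is given through partial derivatives only, so the coordinates are set in
  motion one after the other. Each induction step is an instance of
  \<open>has_derivative_along_line\<close> whose second variable is the coordinate that starts to
  move.\<close>

lemma smooth_bounded_chain:
  assumes f: "smooth_bounded n f"
  shows "((\<lambda>b. f (\<lambda>i. c i * b + x i)) has_real_derivative (\<Sum>i<n. c i * partial i f (\<lambda>i. c i * b + x i))) (at b)"
proof -
  have "((\<lambda>b. f (\<lambda>i. if i < m then c i * b + x i else x i)) has_real_derivative
     (\<Sum>i<m. c i * partial i f (\<lambda>i. if i < m then c i * b + x i else x i))) (at b)" if "m \<le> n" for m x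
    using that
  proof (induction m arbitrary: x)
    case 0
    then show ?case by simp
  next
    case (Suc m)
    define F where "F b v = f ((\<lambda>i. if i < m then c i * b + x i else x i)(m := v))" for b v
    define F2 where "F2 b v = partial m f ((\<lambda>i. if i < m then c i * b + x i else x i)(m := v))" for b v
    have e: "(\<lambda>i. if i < Suc m then c i * b + x i else x i) = (\<lambda>i. if i < m then c i * b + x i else x i)(m := c m * b + x m)" for b
      by (auto simp: fun_eq_iff less_Suc_eq)
    have e': "(\<lambda>i. if i < m then c i * b' + x i else x i)(m := v) = (\<lambda>i. if i < m then c i * b' + (x(m := v)) i else (x(m := v)) i)" for b' v
      by (auto simp: fun_eq_iff)
    have "((\<lambda>b. F b (c m * b + x m)) has_real_derivative
       (\<Sum>i<m. c i * partial i f (\<lambda>i. if i < Suc m then c i * b + x i else x i)) + c m * F2 b (c m * b + x m)) (at b)"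
    proof (rule has_derivative_along_line)
      show "((\<lambda>v. F b v) has_real_derivative F2 b v) (at v)" for b v
        unfolding F_def F2_def using Suc.prems by (intro smooth_bounded_deriv[OF f]) simp
      show "((\<lambda>b'. F b' (c m * b + x m)) has_real_derivative
         (\<Sum>i<m. c i * partial i f (\<lambda>i. if i < Suc m then c i * b + x i else x i))) (at b)"
        unfolding F_def e unfolding e' using Suc by simp
      have "continuous_on UNIV (\<lambda>p. partial m f (\<lambda>i. if i = m then snd p else if i < m then c i * fst p + x i else x i))"
      proof (rule continuous_on_compose2[OF smooth_bounded_cont(3)[OF f]])
        show "m < n" using Suc.prems by simp
        show "continuous_on UNIV (\<lambda>p. (\<lambda>i. if i = m then snd p else if i < m then c i * fst p + x i else x i))"
        proof (rule continuous_on_coordinatewise_then_product)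
          fix i show "continuous_on UNIV (\<lambda>p. if i = m then snd p else if i < m then c i * fst p + x i else x i)"
            by (cases "i = m"; cases "i < m"; simp; intro continuous_intros)
        qed
      qed simp
      moreover have "(\<lambda>(b, v). F2 b v) = (\<lambda>p. partial m f (\<lambda>i. if i = m then snd p else if i < m then c i * fst p + x i else x i))"
        by (auto simp: F2_def fun_upd_def fun_eq_iff cong: if_cong)
      ultimately show "isCont (\<lambda>(b, v). F2 b v) (b, c m * b + x m)"
        by (simp add: continuous_on_eq_continuous_at)
    qed
    moreover have "F2 b (c m * b + x m) = partial m f (\<lambda>i. if i < Suc m then c i * b + x i else x i)"
      unfolding F2_def e ..
    ultimately show ?case
      unfolding F_def e[symmetric] by simp
  qed
  from this[of n x]
  have "((\<lambda>b. f (\<lambda>i. if i < n then c i * b + x i else x i)) has_real_derivative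
     (\<Sum>i<n. c i * partial i f (\<lambda>i. if i < n then c i * b + x i else x i))) (at b)" by simp
  \<comment> \<open>\<open>f\<close> does not see the coordinates from \<open>n\<close> on, so these
    may move as well.\<close>
  moreover have "f (\<lambda>i. if i < n then c i * b + x i else x i) = f (\<lambda>i. c i * b + x i)" for b
    by (rule smooth_bounded_cong[OF f]) auto
  moreover have "partial j f (\<lambda>i. if i < n then c i * b + x i else x i) = partial j f (\<lambda>i. c i * b + x i)" if "j < n" for j
  proof -
    have "f ((\<lambda>i. if i < n then c i * b + x i else x i)(j := y)) = f ((\<lambda>i. c i * b + x i)(j := y))" for y
      by (rule smooth_bounded_cong[OF f]) auto
    then show ?thesis using that by (simp add: partial_def)
  qed
  ultimately show ?thesis by simp
qed

lemma measurable_continuous_sequence_fun: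
  assumes "continuous_on UNIV (f :: (nat \<Rightarrow> real) \<Rightarrow> real)"
  shows "f \<in> borel_measurable (Pi\<^sub>M UNIV (\<lambda>_. borel))"
proof -
  have "f \<in> borel_measurable borel" using assms by (rule borel_measurable_continuous_onI)
  moreover have "sets (Pi\<^sub>M UNIV (\<lambda>_::nat. borel :: real measure)) = sets borel" by (rule sets_PiM_equal_borel)
  ultimately show ?thesis using measurable_cong_sets by blast
qed

lemma integrable_bounded_mult:
  fixes g h :: "'b \<Rightarrow> real"
  assumes g: "g \<in> borel_measurable N" and K: "\<And>x. \<bar>g x\<bar> \<le> K" and h: "integrable N h"
  shows "integrable N (\<lambda>x. g x * h x)"
proof (rule Bochner_Integration.integrable_bound[of _ "\<lambda>x. K * \<bar>h x\<bar>"])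
  show "integrable N (\<lambda>x. K * \<bar>h x\<bar>)" using h by simp
  show "(\<lambda>x. g x * h x) \<in> borel_measurable N" using g h by simp
  have "\<bar>g x\<bar> * \<bar>h x\<bar> \<le> \<bar>K\<bar> * \<bar>h x\<bar>" for x
    using K[of x] by (intro mult_right_mono) auto
  then show "AE x in N. norm (g x * h x) \<le> norm (K * \<bar>h x\<bar>)" by (simp add: abs_mult)
qed

context prob_space
begin

lemma pair_prob_space_self: "pair_prob_space M M"
  by (simp add: pair_prob_space_def pair_sigma_finite_def prob_space_axioms sigma_finite_measure_axioms)

lemma pair_prod_integral:
  fixes f g :: "'a \<Rightarrow> real"
  assumes f: "integrable M f" and g: "integrable M g"
  shows "integrable (M \<Otimes>\<^sub>M M) (\<lambda>p. f (fst p) * g (snd p))"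
    "(LINT p|(M \<Otimes>\<^sub>M M). f (fst p) * g (snd p)) = (LINT x|M. f x) * (LINT x|M. g x)"
proof -
  interpret P: pair_prob_space M M by (rule pair_prob_space_self)
  have [measurable]: "f \<in> borel_measurable M" "g \<in> borel_measurable M" using f g by auto
  show i: "integrable (M \<Otimes>\<^sub>M M) (\<lambda>p. f (fst p) * g (snd p))"
  proof (rule P.Fubini_integrable)
    have "(\<lambda>x. LINT y|M. norm (f (fst (x, y)) * g (snd (x, y)))) = (\<lambda>x. \<bar>f x\<bar> * (LINT y|M. \<bar>g y\<bar>))"
      by (auto simp: abs_mult)
    then show "integrable M (\<lambda>x. LINT y|M. norm (f (fst (x, y)) * g (snd (x, y))))"
      using f by simp
    show "AE x in M. integrable M (\<lambda>y. f (fst (x, y)) * g (snd (x, y)))"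
      using g by simp
  qed simp
  show "(LINT p|(M \<Otimes>\<^sub>M M). f (fst p) * g (snd p)) = (LINT x|M. f x) * (LINT x|M. g x)"
    using P.integral_fst'[OF i] by simp
qed

lemma pair_prod_sq_int:
  assumes f: "square_integrable M f" and g: "square_integrable M g"
  shows "square_integrable (M \<Otimes>\<^sub>M M) (\<lambda>p. f (fst p) * g (snd p))"
proof -
  have [measurable]: "f \<in> borel_measurable M" "g \<in> borel_measurable M"
    using f g by (auto simp: square_integrable_def)
  show ?thesis
    using pair_prod_integral(1)[of "\<lambda>x. (f x)\<^sup>2" "\<lambda>x. (g x)\<^sup>2"] f g
    by (auto simp: square_integrable_def power_mult_distrib)
qed

end

context centered_gp
begin

lemma H_cos_sin:
  assumes "T \<in> H"
  shows "(LINT \<omega>|M. cos (T \<omega>)) = exp (- ((LINT \<omega>|M. (T \<omega>)\<^sup>2) / 2))" "(LINT \<omega>|M. sin (T \<omega>)) = 0"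
  using centered_gaussian_moments(4,5)[OF H_gaussian[OF assms], of 1] by simp_all

lemma H_mult_integrable: "A \<in> H \<Longrightarrow> B \<in> H \<Longrightarrow> integrable M (\<lambda>\<omega>. A \<omega> * B \<omega>)"
  by (intro sq_int_mult H_sq_int)

text \<open>Orthogonality to \<open>B\<close> gives independence of \<open>B\<close>, which may therefore be evaluated on a second,
  independent copy of the space. With \<open>Z - c B\<close> for \<open>W\<close> this reduces the integration by parts to Stein's
  identity in one variable.\<close>

lemma gaussian_split_law:
  fixes W :: "nat \<Rightarrow> 'a \<Rightarrow> real"
  assumes B: "B \<in> H" and W: "\<And>i. W i \<in> H" and orth: "\<And>i. (LINT \<omega>|M. W i \<omega> * B \<omega>) = 0"
  shows "distr M (Pi\<^sub>M UNIV (\<lambda>_. borel)) (\<lambda>\<omega> i. case i of 0 \<Rightarrow> B \<omega> | Suc j \<Rightarrow> W j \<omega>) =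
    distr (M \<Otimes>\<^sub>M M) (Pi\<^sub>M UNIV (\<lambda>_. borel)) (\<lambda>p i. case i of 0 \<Rightarrow> B (snd p) | Suc j \<Rightarrow> W j (fst p))"
proof -
  interpret P: pair_prob_space M M by (rule pair_prob_space_self)
  have [measurable]: "B \<in> borel_measurable M" "W i \<in> borel_measurable M" for i
    using B W by (auto intro: H_meas)
  have sumJ: "(\<Sum>i\<in>J. c i * (case i of 0 \<Rightarrow> b | Suc j \<Rightarrow> w j)) =
     (if 0 \<in> J then c 0 else 0) * b + (\<Sum>i\<in>J - {0}. c i * w (i - 1))" if "finite J" for J c b and w :: "nat \<Rightarrow> real"
  proof -
    have "(\<Sum>i\<in>J - {0}. c i * (case i of 0 \<Rightarrow> b | Suc j \<Rightarrow> w j)) = (\<Sum>i\<in>J - {0}. c i * w (i - 1))"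
      by (intro sum.cong) (auto split: nat.split)
    then show ?thesis
      using that by (cases "0 \<in> J") (simp_all add: sum.remove)
  qed
  have eq: "(LINT x|M. cos (a * B x + (\<Sum>i\<in>K. c i * W (i - 1) x))) =
        (LINT p|(M \<Otimes>\<^sub>M M). cos (a * B (snd p) + (\<Sum>i\<in>K. c i * W (i - 1) (fst p)))) \<and>
      (LINT x|M. sin (a * B x + (\<Sum>i\<in>K. c i * W (i - 1) x))) =
        (LINT p|(M \<Otimes>\<^sub>M M). sin (a * B (snd p) + (\<Sum>i\<in>K. c i * W (i - 1) (fst p))))"
    if "finite K" for a K c
  proof -
    define T where "T x = (\<Sum>i\<in>K. c i * W (i - 1) x)" for x
    have T: "T \<in> H" unfolding T_def by (intro H_sum H_cmult W)
    have aB: "(\<lambda>x. a * B x) \<in> H" by (intro H_cmult B)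
    have [measurable]: "T \<in> borel_measurable M" using T by (rule H_meas)
    have TB: "(LINT x|M. T x * B x) = 0"
    proof -
      have "(LINT x|M. T x * B x) = (LINT x|M. (\<Sum>i\<in>K. c i * (W (i - 1) x * B x)))"
        by (simp add: T_def sum_distrib_right mult.assoc)
      also have "\<dots> = (\<Sum>i\<in>K. c i * (LINT x|M. W (i - 1) x * B x))"
        using H_mult_integrable[OF W B] by simp
      finally show ?thesis by (simp add: orth)
    qed
    \<comment> \<open>The cross term vanishes by orthogonality. The characteristic function of a
      centered Gaussian depends only on its variance, so additivity of the variances makes the joint
      one factor.\<close>
    have "(LINT x|M. (a * B x + T x)\<^sup>2) = (LINT x|M. (a * B x)\<^sup>2 + (T x)\<^sup>2 + 2 * a * (T x * B x))"
      by (simp add: power2_sum mult_ac)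
    also have "\<dots> = (LINT x|M. (a * B x)\<^sup>2) + (LINT x|M. (T x)\<^sup>2)"
      using H_mult_integrable[OF T B] H_sq_int[OF T] H_sq_int[OF aB] TB by (simp add: square_integrable_def)
    finally have var: "(LINT x|M. (a * B x + T x)\<^sup>2) = (LINT x|M. (a * B x)\<^sup>2) + (LINT x|M. (T x)\<^sup>2)" .
    have ib: "integrable M (\<lambda>x. cos (a * B x))" "integrable M (\<lambda>x. sin (a * B x))"
      "integrable M (\<lambda>x. cos (T x))" "integrable M (\<lambda>x. sin (T x))"
      by (rule integrable_bounded[of _ 1]; simp)+
    have "(LINT p|(M \<Otimes>\<^sub>M M). cos (a * B (snd p) + T (fst p))) =
        (LINT p|(M \<Otimes>\<^sub>M M). cos (T (fst p)) * cos (a * B (snd p)) - sin (T (fst p)) * sin (a * B (snd p)))"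
      by (simp add: cos_add mult.commute)
    also have "\<dots> = (LINT x|M. cos (T x)) * (LINT x|M. cos (a * B x)) - (LINT x|M. sin (T x)) * (LINT x|M. sin (a * B x))"
      using pair_prod_integral[OF ib(3) ib(1)] pair_prod_integral[OF ib(4) ib(2)] by simp
    also have "\<dots> = exp (- ((LINT x|M. (T x)\<^sup>2) / 2)) * exp (- ((LINT x|M. (a * B x)\<^sup>2) / 2))"
      by (simp add: H_cos_sin[OF T] H_cos_sin[OF aB])
    also have "\<dots> = (LINT x|M. cos (a * B x + T x))"
      unfolding H_cos_sin[OF H_add[OF aB T]] var by (simp add: exp_add[symmetric] field_simps)
    finally have c: "(LINT x|M. cos (a * B x + T x)) = (LINT p|(M \<Otimes>\<^sub>M M). cos (a * B (snd p) + T (fst p)))" ..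
    have "(LINT p|(M \<Otimes>\<^sub>M M). sin (a * B (snd p) + T (fst p))) =
        (LINT p|(M \<Otimes>\<^sub>M M). sin (T (fst p)) * cos (a * B (snd p)) + cos (T (fst p)) * sin (a * B (snd p)))"
      by (simp add: sin_add add.commute mult.commute)
    also have "\<dots> = (LINT x|M. sin (T x)) * (LINT x|M. cos (a * B x)) + (LINT x|M. cos (T x)) * (LINT x|M. sin (a * B x))"
      using pair_prod_integral[OF ib(4) ib(1)] pair_prod_integral[OF ib(3) ib(2)] by simp
    also have "\<dots> = (LINT x|M. sin (a * B x + T x))"
      by (simp add: H_cos_sin[OF T] H_cos_sin[OF aB] H_cos_sin[OF H_add[OF aB T]])
    finally show ?thesis using c by (simp add: T_def)
  qed
  have "distr M (Pi\<^sub>M UNIV (\<lambda>_. borel)) (\<lambda>\<omega>. \<lambda>i\<in>UNIV. case i of 0 \<Rightarrow> B \<omega> | Suc j \<Rightarrow> W j \<omega>) =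
    distr (M \<Otimes>\<^sub>M M) (Pi\<^sub>M UNIV (\<lambda>_. borel)) (\<lambda>p. \<lambda>i\<in>UNIV. case i of 0 \<Rightarrow> B (snd p) | Suc j \<Rightarrow> W j (fst p))"
  proof (rule joint_law_eq)
    show "(\<lambda>\<omega>. case i of 0 \<Rightarrow> B \<omega> | Suc j \<Rightarrow> W j \<omega>) \<in> borel_measurable M" for i
      by (cases i) simp_all
    show "(\<lambda>p. case i of 0 \<Rightarrow> B (snd p) | Suc j \<Rightarrow> W j (fst p)) \<in> borel_measurable (M \<Otimes>\<^sub>M M)" for i
      by (cases i) simp_all
    show "prob_space M" "prob_space (M \<Otimes>\<^sub>M M)" by unfold_locales
  qed (use eq in \<open>simp_all add: sumJ\<close>)
  then show ?thesis unfolding restrict_UNIV .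
qed

text \<open>Equality of laws moves the expectation to the product space, and Fubini then freezes the
  variables \<open>W\<close> in the outer integral while \<open>B\<close> alone is integrated in the
  inner one.\<close>

lemma gaussian_split_integral:
  fixes W :: "nat \<Rightarrow> 'a \<Rightarrow> real" and \<Phi> :: "(nat \<Rightarrow> real) \<Rightarrow> real"
  assumes B: "B \<in> H" and W: "\<And>i. W i \<in> H" and orth: "\<And>i. (LINT \<omega>|M. W i \<omega> * B \<omega>) = 0"
    and \<Phi>[measurable]: "\<Phi> \<in> borel_measurable (Pi\<^sub>M UNIV (\<lambda>_. borel))"
    and int: "integrable M (\<lambda>\<omega>. \<Phi> (\<lambda>i. case i of 0 \<Rightarrow> B \<omega> | Suc j \<Rightarrow> W j \<omega>))"
  shows "integrable M (\<lambda>\<omega>. LINT \<omega>'|M. \<Phi> (\<lambda>i. case i of 0 \<Rightarrow> B \<omega>' | Suc j \<Rightarrow> W j \<omega>))"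
    "(LINT \<omega>|M. \<Phi> (\<lambda>i. case i of 0 \<Rightarrow> B \<omega> | Suc j \<Rightarrow> W j \<omega>)) =
      (LINT \<omega>|M. LINT \<omega>'|M. \<Phi> (\<lambda>i. case i of 0 \<Rightarrow> B \<omega>' | Suc j \<Rightarrow> W j \<omega>))"
proof -
  interpret P: pair_prob_space M M by (rule pair_prob_space_self)
  have [measurable]: "B \<in> borel_measurable M" "W i \<in> borel_measurable M" for i
    using B W by (auto intro: H_meas)
  let ?z1 = "\<lambda>\<omega> i. case i of 0 \<Rightarrow> B \<omega> | Suc j \<Rightarrow> W j \<omega>"
  let ?z2 = "\<lambda>p i. case i of 0 \<Rightarrow> B (snd p) | Suc j \<Rightarrow> W j (fst p)"
  have z1: "?z1 \<in> measurable M (Pi\<^sub>M UNIV (\<lambda>_. borel))"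
  proof (rule measurable_abs_UNIV)
    show "(\<lambda>\<omega>. ?z1 \<omega> i) \<in> borel_measurable M" for i by (cases i) simp_all
  qed
  have z2: "?z2 \<in> measurable (M \<Otimes>\<^sub>M M) (Pi\<^sub>M UNIV (\<lambda>_. borel))"
  proof (rule measurable_abs_UNIV)
    show "(\<lambda>\<omega>. ?z2 \<omega> i) \<in> borel_measurable (M \<Otimes>\<^sub>M M)" for i by (cases i) simp_all
  qed
  note law = gaussian_split_law[OF B W orth]
  have i2: "integrable (M \<Otimes>\<^sub>M M) (\<lambda>p. \<Phi> (?z2 p))"
    using int unfolding integrable_distr_eq[OF z1 \<Phi>, symmetric] integrable_distr_eq[OF z2 \<Phi>, symmetric] law .
  have e2: "(LINT \<omega>|M. \<Phi> (?z1 \<omega>)) = (LINT p|(M \<Otimes>\<^sub>M M). \<Phi> (?z2 p))"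
    unfolding integral_distr[OF z1 \<Phi>, symmetric] integral_distr[OF z2 \<Phi>, symmetric] law ..
  show "integrable M (\<lambda>\<omega>. LINT \<omega>'|M. \<Phi> (\<lambda>i. case i of 0 \<Rightarrow> B \<omega>' | Suc j \<Rightarrow> W j \<omega>))"
    using P.integrable_fst'[OF i2] by (simp only: fst_conv snd_conv)
  show "(LINT \<omega>|M. \<Phi> (?z1 \<omega>)) = (LINT \<omega>|M. LINT \<omega>'|M. \<Phi> (\<lambda>i. case i of 0 \<Rightarrow> B \<omega>' | Suc j \<Rightarrow> W j \<omega>))"
    unfolding e2 using P.integral_fst'[OF i2] by (simp only: fst_conv snd_conv)
qed

text \<open>Regression on B: A and every Z i are a multiple of B plus a residual that is orthogonal
  to B, hence independent of it. With the residuals frozen, f and A become functions h(b) and a + d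
  b of one variable. Stein's identity for h(b) (a + d b) yields the sum over the partial derivatives
  and an extra term d v E[h(B)], which the centering by E[A B] = d v cancels.\<close>

lemma gaussian_ibp_aux:
  assumes f: "smooth_bounded n f" and Z: "\<And>i. Z i \<in> H" and A: "A \<in> H" and B: "B \<in> H"
  shows "(LINT \<omega>|M. f (\<lambda>i. Z i \<omega>) * (A \<omega> * B \<omega> - (LINT \<omega>|M. A \<omega> * B \<omega>))) =
    (\<Sum>i<n. (LINT \<omega>|M. partial i f (\<lambda>j. Z j \<omega>) * A \<omega>) * (LINT \<omega>|M. Z i \<omega> * B \<omega>))"
proof -
  define v where "v = (LINT \<omega>|M. (B \<omega>)\<^sup>2)"
  have [measurable]: "B \<in> borel_measurable M" "A \<in> borel_measurable M" "Z i \<in> borel_measurable M" for i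
    using B A Z by (auto intro: H_meas)
  note fm[measurable] = measurable_continuous_sequence_fun[OF smooth_bounded_cont(1)[OF f]]
  have pm: "i < n \<Longrightarrow> partial i f \<in> borel_measurable (Pi\<^sub>M UNIV (\<lambda>_. borel))" for i
    by (rule measurable_continuous_sequence_fun[OF smooth_bounded_cont(3)[OF f]])
  have seq: "(\<lambda>\<omega>. g (\<lambda>i. Y i \<omega>)) \<in> borel_measurable N"
    if "g \<in> borel_measurable (Pi\<^sub>M UNIV (\<lambda>_. borel))" "\<And>i. Y i \<in> borel_measurable N" for g :: "(nat \<Rightarrow> real) \<Rightarrow> real" and Y and N :: "'c measure"
    by (rule measurable_compose[OF measurable_abs_UNIV that(1)]) (rule that(2))
  obtain K where K: "\<And>x. \<bar>f x\<bar> \<le> K"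
    using smooth_bounded_cont(2)[OF f] by (auto simp: bounded_iff)
  have "\<forall>i. \<exists>K. i < n \<longrightarrow> (\<forall>x. \<bar>partial i f x\<bar> \<le> K)"
    using smooth_bounded_cont(4)[OF f] by (fastforce simp: bounded_iff)
  then obtain K' where K': "\<And>i x. i < n \<Longrightarrow> \<bar>partial i f x\<bar> \<le> K' i" by metis
  show ?thesis
  proof (cases "v = 0")
    \<comment> \<open>Regression coefficients would divide by 0 here. Instead B vanishes almost
      surely, and by Cauchy-Schwarz so does every covariance with it.\<close>
    case True
    have CS: "(LINT \<omega>|M. Y \<omega> * B \<omega>) = 0" if "Y \<in> H" for Y
      using integral_sq_cauchy_schwarz[OF H_sq_int[OF that] H_sq_int[OF B]] True by (simp add: v_def)
    have "AE \<omega> in M. B \<omega> = 0"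
      using True H_sq_int[OF B] unfolding v_def by (subst (asm) integral_nonneg_eq_0_iff_AE) (auto simp: square_integrable_def)
    then have "(LINT \<omega>|M. f (\<lambda>i. Z i \<omega>) * (A \<omega> * B \<omega> - (LINT \<omega>|M. A \<omega> * B \<omega>))) = (LINT \<omega>|M. 0)"
      using CS[OF A] by (intro integral_cong_AE) (auto intro!: borel_measurable_times seq[OF fm])
    then show ?thesis using CS[OF Z] by simp
  next
    case False
    define c where "c i = (LINT \<omega>|M. Z i \<omega> * B \<omega>) / v" for i
    define d where "d = (LINT \<omega>|M. A \<omega> * B \<omega>) / v"
    define W where "W i = (case i of 0 \<Rightarrow> (\<lambda>\<omega>. A \<omega> - d * B \<omega>) | Suc j \<Rightarrow> (\<lambda>\<omega>. Z j \<omega> - c j * B \<omega>))" for i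
    have W: "W i \<in> H" for i
      unfolding W_def by (cases i) (auto intro!: H_diff H_cmult A B Z)
    have orth0: "(LINT \<omega>|M. (Y \<omega> - ((LINT \<omega>|M. Y \<omega> * B \<omega>) / v) * B \<omega>) * B \<omega>) = 0" if "Y \<in> H" for Y
    proof -
      have "(LINT \<omega>|M. (Y \<omega> - ((LINT \<omega>|M. Y \<omega> * B \<omega>) / v) * B \<omega>) * B \<omega>) =
          (LINT \<omega>|M. Y \<omega> * B \<omega> - ((LINT \<omega>|M. Y \<omega> * B \<omega>) / v) * (B \<omega>)\<^sup>2)"
        by (simp add: left_diff_distrib power2_eq_square mult.assoc)
      also have "\<dots> = (LINT \<omega>|M. Y \<omega> * B \<omega>) - ((LINT \<omega>|M. Y \<omega> * B \<omega>) / v) * v"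
        using H_mult_integrable[OF that B] H_sq_int[OF B] by (simp add: v_def square_integrable_def)
      finally show ?thesis using False by simp
    qed
    have orth: "(LINT \<omega>|M. W i \<omega> * B \<omega>) = 0" for i
      unfolding W_def c_def d_def using orth0[OF A] orth0[OF Z] by (cases i) simp_all
    let ?z1 = "\<lambda>\<omega> i. case i of 0 \<Rightarrow> B \<omega> | Suc j \<Rightarrow> W j \<omega>"
    \<comment> \<open>Layout of \<open>z\<close>: coordinate 0 carries B, coordinate 1 the residual
      of A, and coordinate i + 2 the residual of Z i.\<close>
    let ?L = "\<lambda>z i. c i * z 0 + z (Suc (Suc i))"
    have Lz: "?L (?z1 \<omega>) = (\<lambda>i. Z i \<omega>)" for \<omega> by (simp add: W_def fun_eq_iff)
    have Az: "?z1 \<omega> 1 + d * ?z1 \<omega> 0 = A \<omega>" for \<omega> by (simp add: W_def)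
    have comp[measurable]: "(\<lambda>z. z i) \<in> borel_measurable (Pi\<^sub>M UNIV (\<lambda>_. borel))" for i :: nat
      by (rule measurable_component_singleton) simp
    define \<Phi> where "\<Phi> z = f (?L z) * ((z 1 + d * z 0) * z 0 - d * v)" for z
    define \<Phi>i where "\<Phi>i i z = partial i f (?L z) * (z 1 + d * z 0)" for i z
    have \<Phi>m: "\<Phi> \<in> borel_measurable (Pi\<^sub>M UNIV (\<lambda>_. borel))"
      unfolding \<Phi>_def by (intro borel_measurable_times seq[OF fm]) measurable
    have \<Phi>im: "i < n \<Longrightarrow> \<Phi>i i \<in> borel_measurable (Pi\<^sub>M UNIV (\<lambda>_. borel))" for i
      unfolding \<Phi>i_def by (intro borel_measurable_times seq[OF pm]) measurable
    have AB: "d * v = (LINT \<omega>|M. A \<omega> * B \<omega>)" using False by (simp add: d_def)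
    have \<Phi>1: "\<Phi> (?z1 \<omega>) = f (\<lambda>i. Z i \<omega>) * (A \<omega> * B \<omega> - (LINT \<omega>|M. A \<omega> * B \<omega>))" for \<omega>
      unfolding \<Phi>_def Lz Az AB by simp
    have \<Phi>i1: "\<Phi>i i (?z1 \<omega>) = partial i f (\<lambda>j. Z j \<omega>) * A \<omega>" for i \<omega>
      unfolding \<Phi>i_def Lz Az by simp
    have int: "integrable M (\<lambda>\<omega>. \<Phi> (?z1 \<omega>))"
      unfolding \<Phi>1 by (rule integrable_bounded_mult[OF seq[OF fm] K]) (use H_mult_integrable[OF A B] in auto)
    have inti: "integrable M (\<lambda>\<omega>. \<Phi>i i (?z1 \<omega>))" if "i < n" for i
      unfolding \<Phi>i1 by (rule integrable_bounded_mult[OF seq[OF pm] K']) (use that sq_int_integrable[OF H_sq_int[OF A]] in auto)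
    have inner: "(LINT \<omega>'|M. \<Phi> (\<lambda>i. case i of 0 \<Rightarrow> B \<omega>' | Suc j \<Rightarrow> W j \<omega>)) =
       (\<Sum>i<n. v * c i * (LINT \<omega>'|M. \<Phi>i i (\<lambda>i. case i of 0 \<Rightarrow> B \<omega>' | Suc j \<Rightarrow> W j \<omega>)))" for \<omega>
    proof -
      define x where "x i = W (Suc i) \<omega>" for i
      define a where "a = W 0 \<omega>"
      define h where "h b = f (\<lambda>i. c i * b + x i)" for b
      define p where "p i b = partial i f (\<lambda>j. c j * b + x j)" for i b
      define h' where "h' b = (\<Sum>i<n. c i * p i b)" for b
      have dh: "(h has_real_derivative h' b) (at b)" for b
        unfolding h_def h'_def p_def by (rule smooth_bounded_chain[OF f])
      have hc: "continuous_on UNIV h"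
        using dh by (meson DERIV_isCont continuous_at_imp_continuous_on)
      have pc: "continuous_on UNIV (p i)" if "i < n" for i
        unfolding p_def
        by (rule continuous_on_compose2[OF smooth_bounded_cont(3)[OF f that]])
          (auto intro!: continuous_on_coordinatewise_then_product continuous_intros)
      have hc': "continuous_on UNIV h'" unfolding h'_def by (intro continuous_intros pc) auto
      have [measurable]: "h \<in> borel_measurable borel" "h' \<in> borel_measurable borel"
        using hc hc' by (auto intro: borel_measurable_continuous_onI)
      have pb[measurable]: "i < n \<Longrightarrow> p i \<in> borel_measurable borel" for i
        using pc by (auto intro: borel_measurable_continuous_onI)
      define K1 where "K1 = (\<Sum>i<n. \<bar>c i\<bar> * K' i)"
      have hK: "\<bar>h b\<bar> \<le> K" for b unfolding h_def by (rule K)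
      have pK: "i < n \<Longrightarrow> \<bar>p i b\<bar> \<le> K' i" for i b unfolding p_def by (rule K')
      have h'K: "\<bar>h' b\<bar> \<le> K1" for b
        unfolding h'_def K1_def
        by (rule order_trans[OF sum_abs]) (auto simp: abs_mult intro!: sum_mono mult_left_mono pK)
      have K0: "0 \<le> K" "0 \<le> K1" using hK[of 0] h'K[of 0] by linarith+
      define k where "k b = h b * (a + d * b)" for b
      define k' where "k' b = h' b * (a + d * b) + h b * d" for b
      have ab: "\<bar>a + d * b\<bar> \<le> \<bar>a\<bar> + \<bar>d\<bar> * \<bar>b\<bar>" for b by (metis abs_mult abs_triangle_ineq)
      have st: "(LINT \<omega>'|M. k (B \<omega>') * B \<omega>') = v * (LINT \<omega>'|M. k' (B \<omega>'))"
        unfolding v_def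
      \<comment> \<open>One pair of constants has to serve both functions: |k b| is at most K (|a| +
        |d| |b|), and |k' b| is at most K1 (|a| + |d| |b|) + K |d|.\<close>
      proof (rule stein_gaussian[where a = "K * \<bar>a\<bar> + K1 * \<bar>a\<bar> + K * \<bar>d\<bar>" and b = "K * \<bar>d\<bar> + K1 * \<bar>d\<bar>"])
        show "centered_gaussian M B" by (rule H_gaussian[OF B])
        show "(LINT \<omega>|M. (B \<omega>)\<^sup>2) \<noteq> 0" using False by (simp add: v_def)
        show "(k has_real_derivative k' b) (at b)" for b
          unfolding k_def k'_def by (auto intro!: derivative_eq_intros dh simp: algebra_simps)
        show "continuous_on UNIV k'" unfolding k'_def by (intro continuous_intros hc hc')
        show "\<bar>k b\<bar> \<le> K * \<bar>a\<bar> + K1 * \<bar>a\<bar> + K * \<bar>d\<bar> + (K * \<bar>d\<bar> + K1 * \<bar>d\<bar>) * \<bar>b\<bar>" for b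
        proof -
          have "\<bar>k b\<bar> \<le> K * (\<bar>a\<bar> + \<bar>d\<bar> * \<bar>b\<bar>)"
            unfolding k_def abs_mult by (intro mult_mono hK ab K0) auto
          moreover have "0 \<le> K1 * \<bar>a\<bar> + K * \<bar>d\<bar> + K1 * \<bar>d\<bar> * \<bar>b\<bar>" using K0 by simp
          ultimately show ?thesis by (simp add: algebra_simps)
        qed
        show "\<bar>k' b\<bar> \<le> K * \<bar>a\<bar> + K1 * \<bar>a\<bar> + K * \<bar>d\<bar> + (K * \<bar>d\<bar> + K1 * \<bar>d\<bar>) * \<bar>b\<bar>" for b
        proof -
          have "\<bar>k' b\<bar> \<le> \<bar>h' b\<bar> * \<bar>a + d * b\<bar> + \<bar>h b\<bar> * \<bar>d\<bar>"
            unfolding k'_def by (metis abs_mult abs_triangle_ineq)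
          also have "\<dots> \<le> K1 * (\<bar>a\<bar> + \<bar>d\<bar> * \<bar>b\<bar>) + K * \<bar>d\<bar>"
            by (intro add_mono mult_mono hK h'K ab K0) auto
          moreover have "0 \<le> K * \<bar>a\<bar> + K * \<bar>d\<bar> * \<bar>b\<bar>" using K0 by simp
          ultimately show ?thesis by (simp add: algebra_simps)
        qed
      qed
      have iB: "integrable M B" by (rule sq_int_integrable[OF H_sq_int[OF B]])
      have iab: "integrable M (\<lambda>\<omega>'. a + d * B \<omega>')" using iB by simp
      have ih: "integrable M (\<lambda>\<omega>'. h (B \<omega>'))" by (rule integrable_bounded[of _ K]) (auto simp: hK)
      have ip: "i < n \<Longrightarrow> integrable M (\<lambda>\<omega>'. p i (B \<omega>') * (a + d * B \<omega>'))" for i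
        by (rule integrable_bounded_mult[OF _ pK iab]) auto
      have ik': "integrable M (\<lambda>\<omega>'. h' (B \<omega>') * (a + d * B \<omega>'))"
        by (rule integrable_bounded_mult[OF _ h'K iab]) auto
      have "integrable M (\<lambda>\<omega>'. (a + d * B \<omega>') * B \<omega>')"
        using iB H_sq_int[OF B] by (simp add: distrib_right square_integrable_def power2_eq_square mult.assoc)
      then have ik: "integrable M (\<lambda>\<omega>'. k (B \<omega>') * B \<omega>')"
        unfolding k_def mult.assoc by (rule integrable_bounded_mult[OF _ hK, rotated]) auto
      have "(LINT \<omega>'|M. \<Phi> (\<lambda>i. case i of 0 \<Rightarrow> B \<omega>' | Suc j \<Rightarrow> W j \<omega>)) =
          (LINT \<omega>'|M. k (B \<omega>') * B \<omega>' - d * v * h (B \<omega>'))"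
        by (simp add: \<Phi>_def k_def h_def x_def a_def algebra_simps)
      also have "\<dots> = v * (LINT \<omega>'|M. k' (B \<omega>')) - d * v * (LINT \<omega>'|M. h (B \<omega>'))"
        using ik ih st by simp
      also have "(LINT \<omega>'|M. k' (B \<omega>')) = (LINT \<omega>'|M. h' (B \<omega>') * (a + d * B \<omega>')) + (LINT \<omega>'|M. h (B \<omega>')) * d"
        unfolding k'_def using ik' ih by simp
      also have "v * ((LINT \<omega>'|M. h' (B \<omega>') * (a + d * B \<omega>')) + (LINT \<omega>'|M. h (B \<omega>')) * d) - d * v * (LINT \<omega>'|M. h (B \<omega>'))
         = v * (LINT \<omega>'|M. h' (B \<omega>') * (a + d * B \<omega>'))" by (simp add: algebra_simps)
      also have "(LINT \<omega>'|M. h' (B \<omega>') * (a + d * B \<omega>')) = (LINT \<omega>'|M. (\<Sum>i<n. c i * (p i (B \<omega>') * (a + d * B \<omega>'))))"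
        by (simp add: h'_def sum_distrib_right mult.assoc)
      also have "\<dots> = (\<Sum>i<n. c i * (LINT \<omega>'|M. p i (B \<omega>') * (a + d * B \<omega>')))"
        using ip by simp
      finally show ?thesis
        by (simp add: \<Phi>i_def p_def x_def a_def sum_distrib_left mult.assoc)
    qed
    have "(LINT \<omega>|M. f (\<lambda>i. Z i \<omega>) * (A \<omega> * B \<omega> - (LINT \<omega>|M. A \<omega> * B \<omega>))) = (LINT \<omega>|M. \<Phi> (?z1 \<omega>))"
      by (simp only: \<Phi>1)
    also have "\<dots> = (LINT \<omega>|M. (\<Sum>i<n. v * c i * (LINT \<omega>'|M. \<Phi>i i (\<lambda>i. case i of 0 \<Rightarrow> B \<omega>' | Suc j \<Rightarrow> W j \<omega>))))"
      unfolding gaussian_split_integral(2)[OF B W orth \<Phi>m int] inner ..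
    also have "\<dots> = (\<Sum>i<n. v * c i * (LINT \<omega>|M. \<Phi>i i (?z1 \<omega>)))"
      using gaussian_split_integral[OF B W orth \<Phi>im inti] by simp
    also have "\<dots> = (\<Sum>i<n. (LINT \<omega>|M. partial i f (\<lambda>j. Z j \<omega>) * A \<omega>) * (LINT \<omega>|M. Z i \<omega> * B \<omega>))"
      unfolding \<Phi>i1 using False by (simp add: c_def mult.commute)
    finally show ?thesis .
  qed
qed

lemma partial_cong_smooth:
  assumes f: "smooth_bounded n f" and "\<And>i. i < n \<Longrightarrow> x i = y i" and "j < n"
  shows "partial j f x = partial j f y"
proof -
  have "f (x(j := v)) = f (y(j := v))" for v
    by (rule smooth_bounded_cong[OF f]) (use assms in auto)
  then show ?thesis using assms by (simp add: partial_def)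
qed

text \<open>The coordinates from n on are irrelevant for f and are filled with the zero variable,
  which belongs to H.\<close>

lemma gaussian_ibp:
  assumes f: "smooth_bounded n f" and Z: "\<And>i. i < n \<Longrightarrow> Z i \<in> H" and A: "A \<in> H" and B: "B \<in> H"
  shows "(LINT \<omega>|M. f (\<lambda>i. Z i \<omega>) * (A \<omega> * B \<omega> - (LINT \<omega>|M. A \<omega> * B \<omega>))) =
    (\<Sum>i<n. (LINT \<omega>|M. partial i f (\<lambda>j. Z j \<omega>) * A \<omega>) * (LINT \<omega>|M. Z i \<omega> * B \<omega>))"
proof -
  define Z' where "Z' i = (if i < n then Z i else (\<lambda>\<omega>. 0))" for i
  have e: "f (\<lambda>i. Z i \<omega>) = f (\<lambda>i. Z' i \<omega>)" "j < n \<Longrightarrow> partial j f (\<lambda>i. Z i \<omega>) = partial j f (\<lambda>i. Z' i \<omega>)" for \<omega> j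
    by (rule smooth_bounded_cong[OF f] partial_cong_smooth[OF f]; simp add: Z'_def)+
  have "(\<Sum>i<n. (LINT \<omega>|M. partial i f (\<lambda>j. Z' j \<omega>) * A \<omega>) * (LINT \<omega>|M. Z' i \<omega> * B \<omega>)) =
      (\<Sum>i<n. (LINT \<omega>|M. partial i f (\<lambda>j. Z j \<omega>) * A \<omega>) * (LINT \<omega>|M. Z i \<omega> * B \<omega>))"
    by (intro sum.cong) (auto simp: e(2) Z'_def)
  moreover have "Z' i \<in> H" for i using Z H_zero by (simp add: Z'_def)
  ultimately show ?thesis using gaussian_ibp_aux[OF f _ A B, of Z'] by (simp add: e(1))
qed

section \<open>The divergence of simple processes\<close>

lemma smooth_functional_measurable:
  assumes f: "smooth_bounded n f" and Z: "\<And>i. i < n \<Longrightarrow> Z i \<in> borel_measurable N"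
  shows "(\<lambda>\<omega>. f (\<lambda>i. Z i \<omega>)) \<in> borel_measurable N"
    "j < n \<Longrightarrow> (\<lambda>\<omega>. partial j f (\<lambda>i. Z i \<omega>)) \<in> borel_measurable N"
proof -
  define Z' where "Z' i = (if i < n then Z i else (\<lambda>\<omega>. 0))" for i
  have e: "f (\<lambda>i. Z i \<omega>) = f (\<lambda>i. Z' i \<omega>)" "j < n \<Longrightarrow> partial j f (\<lambda>i. Z i \<omega>) = partial j f (\<lambda>i. Z' i \<omega>)" for \<omega> j
    by (rule smooth_bounded_cong[OF f] partial_cong_smooth[OF f]; simp add: Z'_def)+
  have Z': "(\<lambda>\<omega>. \<lambda>i. Z' i \<omega>) \<in> measurable N (Pi\<^sub>M UNIV (\<lambda>_. borel))"
    by (rule measurable_abs_UNIV) (use Z in \<open>simp add: Z'_def\<close>)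
  show "(\<lambda>\<omega>. f (\<lambda>i. Z i \<omega>)) \<in> borel_measurable N"
    unfolding e(1) by (rule measurable_compose[OF Z' measurable_continuous_sequence_fun[OF smooth_bounded_cont(1)[OF f]]])
  show "(\<lambda>\<omega>. partial j f (\<lambda>i. Z i \<omega>)) \<in> borel_measurable N" if "j < n"
    unfolding e(2)[OF that] by (rule measurable_compose[OF Z' measurable_continuous_sequence_fun[OF smooth_bounded_cont(3)[OF f that]]])
qed

lemma smooth_bounded_bound:
  assumes f: "smooth_bounded n f"
  shows "\<exists>K. \<forall>x. \<bar>f x\<bar> \<le> K" "j < n \<Longrightarrow> \<exists>K. \<forall>x. \<bar>partial j f x\<bar> \<le> K"
  using smooth_bounded_cont(2,4)[OF f] by (fastforce simp: bounded_iff)+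

lemma smooth_functional_sq_int:
  assumes f: "smooth_bounded n f" and Z: "\<And>i. i < n \<Longrightarrow> Z i \<in> H"
  shows "square_integrable M (smooth_functional f Z)"
    "square_integrable (M \<Otimes>\<^sub>M M) (smooth_deriv n f Z)"
proof -
  have m: "i < n \<Longrightarrow> Z i \<in> borel_measurable M" for i using Z by (auto intro: H_meas)
  obtain K where K: "\<And>x. \<bar>f x\<bar> \<le> K" using smooth_bounded_bound(1)[OF f] by auto
  show "square_integrable M (smooth_functional f Z)"
    unfolding smooth_functional_def by (rule sq_int_bounded[OF smooth_functional_measurable(1)[OF f m] K])
  have p: "square_integrable M (\<lambda>\<omega>. partial i f (\<lambda>j. Z j \<omega>))" if i: "i < n" for i
  proof -
    obtain K where K: "\<And>x. \<bar>partial i f x\<bar> \<le> K" using smooth_bounded_bound(2)[OF f i] by auto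
    show ?thesis by (rule sq_int_bounded[OF smooth_functional_measurable(2)[OF f m i] K])
  qed
  have "square_integrable (M \<Otimes>\<^sub>M M) (\<lambda>p. \<Sum>i<n. partial i f (\<lambda>j. Z j (fst p)) * Z i (snd p))"
    by (intro sq_int_sum pair_prod_sq_int p H_sq_int Z) auto
  then show "square_integrable (M \<Otimes>\<^sub>M M) (smooth_deriv n f Z)"
    by (simp add: smooth_deriv_def case_prod_unfold)
qed

text \<open>An instance of \<delta>(F h) = F \<delta>(h) - <DF, h>, with F = A j and h represented
  by B j. Both lie in the first chaos, so the correction is the constant E[A j B j]. The products of
  two expectations from the integration by parts are read as integrals over the product
  space.\<close>

lemma divergence_simple:
  assumes f: "smooth_bounded n f" and Z: "\<And>i. i < n \<Longrightarrow> Z i \<in> H"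
    and J: "finite J" and A: "\<And>j. j \<in> J \<Longrightarrow> A j \<in> H" and B: "\<And>j. j \<in> J \<Longrightarrow> B j \<in> H"
  shows "(LINT \<omega>|M. smooth_functional f Z \<omega> * (\<Sum>j\<in>J. A j \<omega> * B j \<omega> - (LINT \<omega>|M. A j \<omega> * B j \<omega>))) =
    (LINT p|(M \<Otimes>\<^sub>M M). smooth_deriv n f Z p * (\<Sum>j\<in>J. A j (fst p) * B j (snd p)))"
proof -
  have m: "i < n \<Longrightarrow> Z i \<in> borel_measurable M" for i using Z by (auto intro: H_meas)
  obtain K where K: "\<And>x. \<bar>f x\<bar> \<le> K" using smooth_bounded_bound(1)[OF f] by auto
  have i1: "integrable M (\<lambda>\<omega>. f (\<lambda>i. Z i \<omega>) * (A j \<omega> * B j \<omega> - (LINT \<omega>|M. A j \<omega> * B j \<omega>)))" if "j \<in> J" for j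
    using H_mult_integrable[OF A[OF that] B[OF that]]
    by (intro integrable_bounded_mult[OF smooth_functional_measurable(1)[OF f m] K]) auto
  have i2: "integrable M (\<lambda>\<omega>. partial i f (\<lambda>j. Z j \<omega>) * A j \<omega>)" if i: "i < n" and j: "j \<in> J" for i j
  proof -
    obtain K where K: "\<And>x. \<bar>partial i f x\<bar> \<le> K" using smooth_bounded_bound(2)[OF f i] by auto
    show ?thesis
      using sq_int_integrable[OF H_sq_int[OF A[OF j]]]
      by (intro integrable_bounded_mult[OF smooth_functional_measurable(2)[OF f m i] K]) auto
  qed
  have i3: "integrable (M \<Otimes>\<^sub>M M) (\<lambda>p. (partial i f (\<lambda>j. Z j (fst p)) * A j (fst p)) * (Z i (snd p) * B j (snd p)))"
    if "i < n" "j \<in> J" for i j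
    by (rule pair_prod_integral(1)[OF i2[OF that] H_mult_integrable[OF Z[OF that(1)] B[OF that(2)]]])
  have "(LINT \<omega>|M. smooth_functional f Z \<omega> * (\<Sum>j\<in>J. A j \<omega> * B j \<omega> - (LINT \<omega>|M. A j \<omega> * B j \<omega>))) =
      (\<Sum>j\<in>J. LINT \<omega>|M. f (\<lambda>i. Z i \<omega>) * (A j \<omega> * B j \<omega> - (LINT \<omega>|M. A j \<omega> * B j \<omega>)))"
    unfolding smooth_functional_def sum_distrib_left by (intro Bochner_Integration.integral_sum i1)
  also have "\<dots> = (\<Sum>j\<in>J. \<Sum>i<n. (LINT \<omega>|M. partial i f (\<lambda>j. Z j \<omega>) * A j \<omega>) * (LINT \<omega>|M. Z i \<omega> * B j \<omega>))"
    by (intro sum.cong refl gaussian_ibp f Z A B)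
  also have "\<dots> = (\<Sum>j\<in>J. \<Sum>i<n. LINT p|(M \<Otimes>\<^sub>M M). (partial i f (\<lambda>j. Z j (fst p)) * A j (fst p)) * (Z i (snd p) * B j (snd p)))"
    by (intro sum.cong refl pair_prod_integral(2)[symmetric] i2 H_mult_integrable Z B) auto
  also have "\<dots> = (\<Sum>j\<in>J. LINT p|(M \<Otimes>\<^sub>M M). (\<Sum>i<n. (partial i f (\<lambda>j. Z j (fst p)) * A j (fst p)) * (Z i (snd p) * B j (snd p))))"
    by (intro sum.cong refl Bochner_Integration.integral_sum[symmetric] i3) auto
  also have "\<dots> = (LINT p|(M \<Otimes>\<^sub>M M). (\<Sum>j\<in>J. \<Sum>i<n. (partial i f (\<lambda>j. Z j (fst p)) * A j (fst p)) * (Z i (snd p) * B j (snd p))))"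
    by (intro Bochner_Integration.integral_sum[symmetric] Bochner_Integration.integrable_sum i3) auto
  also have "\<dots> = (LINT p|(M \<Otimes>\<^sub>M M). smooth_deriv n f Z p * (\<Sum>j\<in>J. A j (fst p) * B j (snd p)))"
  proof (rule Bochner_Integration.integral_cong[OF refl])
    fix p
    show "(\<Sum>j\<in>J. \<Sum>i<n. (partial i f (\<lambda>j. Z j (fst p)) * A j (fst p)) * (Z i (snd p) * B j (snd p))) =
      smooth_deriv n f Z p * (\<Sum>j\<in>J. A j (fst p) * B j (snd p))"
      unfolding smooth_deriv_def case_prod_unfold sum_product
      by (subst sum.swap) (simp add: mult_ac)
  qed
  finally show ?thesis .
qed

text \<open>Closedness of the adjoint operator. Two limits are taken one after the other: in the
  integrand with the smooth functional fixed, then along the smooth functionals that define the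
  Malliavin derivative.\<close>

lemma divergence_L2_limit:
  assumes J: "\<And>m. finite (J m)" and A: "\<And>m j. j \<in> J m \<Longrightarrow> A m j \<in> H" and B: "\<And>m j. j \<in> J m \<Longrightarrow> B m j \<in> H"
    and u: "L2_limit (M \<Otimes>\<^sub>M M) (\<lambda>m p. \<Sum>j\<in>J m. A m j (fst p) * B m j (snd p)) u"
    and Y: "L2_limit M (\<lambda>m \<omega>. \<Sum>j\<in>J m. A m j \<omega> * B m j \<omega> - (LINT \<omega>|M. A m j \<omega> * B m j \<omega>)) Y"
  shows "divergence M G u Y"
  unfolding divergence_def
proof (intro conjI allI impI)
  show si: "square_integrable (M \<Otimes>\<^sub>M M) u" "square_integrable M Y"
    using u Y by (auto simp: L2_limit_def)
  fix F V assume "malliavin_deriv M G F V"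
  then obtain n f Z where f: "\<And>k. smooth_bounded (n k) (f k)" and Z: "\<And>k i. i < n k \<Longrightarrow> Z k i \<in> H"
    and F: "L2_limit M (\<lambda>k. smooth_functional (f k) (Z k)) F"
    and V: "L2_limit (M \<Otimes>\<^sub>M M) (\<lambda>k. smooth_deriv (n k) (f k) (Z k)) V"
    unfolding malliavin_deriv_def by blast
  have k: "(LINT \<omega>|M. smooth_functional (f k) (Z k) \<omega> * Y \<omega>) = (LINT p|(M \<Otimes>\<^sub>M M). smooth_deriv (n k) (f k) (Z k) p * u p)" for k
  proof -
    note sk = smooth_functional_sq_int[OF f Z, of k]
    have "(\<lambda>m. LINT \<omega>|M. (\<Sum>j\<in>J m. A m j \<omega> * B m j \<omega> - (LINT \<omega>|M. A m j \<omega> * B m j \<omega>)) * smooth_functional (f k) (Z k) \<omega>)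
      \<longlonglongrightarrow> (LINT \<omega>|M. Y \<omega> * smooth_functional (f k) (Z k) \<omega>)"
      by (rule L2_limit_inner[OF Y sk(1)])
    moreover have "(\<lambda>m. LINT p|(M \<Otimes>\<^sub>M M). (\<Sum>j\<in>J m. A m j (fst p) * B m j (snd p)) * smooth_deriv (n k) (f k) (Z k) p)
      \<longlonglongrightarrow> (LINT p|(M \<Otimes>\<^sub>M M). u p * smooth_deriv (n k) (f k) (Z k) p)"
      by (rule L2_limit_inner[OF u sk(2)])
    moreover have "(LINT \<omega>|M. (\<Sum>j\<in>J m. A m j \<omega> * B m j \<omega> - (LINT \<omega>|M. A m j \<omega> * B m j \<omega>)) * smooth_functional (f k) (Z k) \<omega>) =
        (LINT p|(M \<Otimes>\<^sub>M M). (\<Sum>j\<in>J m. A m j (fst p) * B m j (snd p)) * smooth_deriv (n k) (f k) (Z k) p)" for m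
      using divergence_simple[of "n k" "f k" "Z k" "J m" "A m" "B m"] f Z J A B by (simp add: mult.commute)
    ultimately show ?thesis by (simp add: mult.commute LIMSEQ_unique)
  qed
  show "(LINT \<omega>|M. F \<omega> * Y \<omega>) = (LINT p|(M \<Otimes>\<^sub>M M). V p * u p)"
    using L2_limit_inner[OF F si(2)] L2_limit_inner[OF V si(1)] unfolding k by (rule LIMSEQ_unique)
qed

text \<open>The positive and negative parts of Y have equal mass. If this mass were positive, the
  normalised parts would be two densities under which G has the same characteristic functions and
  hence the same law. Then Y integrates to zero over every event determined by G, in particular over
  {Y > 0} up to a null set, and the mass is zero after all.\<close>

lemma generated_by_zero:
  assumes gen: "generated_by M G" and Yi: "integrable M Y"
    and c: "\<And>J c. finite J \<Longrightarrow> J \<subseteq> {0..} \<Longrightarrow> (LINT \<omega>|M. Y \<omega> * cos (\<Sum>t\<in>J. c t * G t \<omega>)) = 0"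
    and s: "\<And>J c. finite J \<Longrightarrow> J \<subseteq> {0..} \<Longrightarrow> (LINT \<omega>|M. Y \<omega> * sin (\<Sum>t\<in>J. c t * G t \<omega>)) = 0"
  shows "AE \<omega> in M. Y \<omega> = 0"
proof -
  have [measurable]: "Y \<in> borel_measurable M" using Yi by auto
  have Gm: "t \<in> {0..} \<Longrightarrow> G t \<in> borel_measurable M" for t by (intro H_meas H_base) simp
  define Y1 where "Y1 \<omega> = max (Y \<omega>) 0" for \<omega>
  define Y2 where "Y2 \<omega> = max (- Y \<omega>) 0" for \<omega>
  have [measurable]: "Y1 \<in> borel_measurable M" "Y2 \<in> borel_measurable M" unfolding Y1_def Y2_def by auto
  have Y12: "Y \<omega> = Y1 \<omega> - Y2 \<omega>" "0 \<le> Y1 \<omega>" "0 \<le> Y2 \<omega>" for \<omega> by (auto simp: Y1_def Y2_def)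
  have i: "integrable M Y1" "integrable M Y2" unfolding Y1_def Y2_def using Yi by auto
  have mult: "(LINT \<omega>|M. Y \<omega> * g \<omega>) = (LINT \<omega>|M. Y1 \<omega> * g \<omega>) - (LINT \<omega>|M. Y2 \<omega> * g \<omega>)"
    if "g \<in> borel_measurable M" "\<And>x. \<bar>g x\<bar> \<le> 1" for g
  proof -
    have "integrable M (\<lambda>\<omega>. Y1 \<omega> * g \<omega>)" "integrable M (\<lambda>\<omega>. Y2 \<omega> * g \<omega>)"
      using integrable_bounded_mult[OF that i(1)] integrable_bounded_mult[OF that i(2)] by (simp_all add: mult.commute)
    then show ?thesis by (simp add: Y12(1) left_diff_distrib)
  qed
  define p where "p = (LINT \<omega>|M. Y1 \<omega>)"
  have p2: "p = (LINT \<omega>|M. Y2 \<omega>)"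
    using c[of "{}"] mult[of "\<lambda>_. 1"] by (simp add: p_def)
  have "p = 0"
  proof (rule ccontr)
    assume "p \<noteq> 0"
    moreover have "0 \<le> p" unfolding p_def using Y12 by simp
    ultimately have p: "0 < p" by simp
    define N1 where "N1 = density M (\<lambda>\<omega>. ennreal (Y1 \<omega> / p))"
    define N2 where "N2 = density M (\<lambda>\<omega>. ennreal (Y2 \<omega> / p))"
    have "(\<integral>\<^sup>+x. ennreal (Y1 x / p) \<partial>M) = ennreal (LINT x|M. Y1 x / p)"
      using i p Y12 by (intro nn_integral_eq_integral) auto
    then have N1: "prob_space N1"
      using p by (intro prob_spaceI) (simp add: N1_def emeasure_density p_def cong: nn_integral_cong)
    have "(\<integral>\<^sup>+x. ennreal (Y2 x / p) \<partial>M) = ennreal (LINT x|M. Y2 x / p)"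
      using i p Y12 by (intro nn_integral_eq_integral) auto
    then have N2: "prob_space N2"
      using p by (intro prob_spaceI) (simp add: N2_def emeasure_density p2 cong: nn_integral_cong)
    have I1: "(LINT x|N1. g x) = (LINT x|M. Y1 x * g x) / p" if [measurable]: "g \<in> borel_measurable M" for g :: "'a \<Rightarrow> real"
      unfolding N1_def using p Y12 by (subst integral_density) auto
    have I2: "(LINT x|N2. g x) = (LINT x|M. Y2 x * g x) / p" if [measurable]: "g \<in> borel_measurable M" for g :: "'a \<Rightarrow> real"
      unfolding N2_def using p Y12 by (subst integral_density) auto
    have I: "(LINT x|N1. g x) - (LINT x|N2. g x) = (LINT x|M. Y x * g x) / p"
      if "g \<in> borel_measurable M" "\<And>x. \<bar>g x\<bar> \<le> 1" for g
      unfolding I1[OF that(1)] I2[OF that(1)] mult[OF that] by (simp add: diff_divide_distrib)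
    let ?\<Phi> = "\<lambda>\<omega>. \<lambda>t\<in>{0..}. G t \<omega>"
    let ?P = "Pi\<^sub>M {0..} (\<lambda>_. borel) :: (real \<Rightarrow> real) measure"
    have law: "distr N1 ?P ?\<Phi> = distr N2 ?P ?\<Phi>"
    proof (rule joint_law_eq[OF N1 N2])
      show "G t \<in> borel_measurable N1" "G t \<in> borel_measurable N2" if "t \<in> {0..}" for t
        using Gm[OF that] by (simp_all add: N1_def N2_def)
      fix J :: "real set" and a assume J: "finite J" "J \<subseteq> {0..}"
      then have "(\<lambda>\<omega>. \<Sum>t\<in>J. a t * G t \<omega>) \<in> borel_measurable M"
        using Gm by (intro borel_measurable_sum borel_measurable_times) auto
      then have [measurable]: "(\<lambda>\<omega>. cos (\<Sum>t\<in>J. a t * G t \<omega>)) \<in> borel_measurable M"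
        "(\<lambda>\<omega>. sin (\<Sum>t\<in>J. a t * G t \<omega>)) \<in> borel_measurable M"
        by (auto intro: measurable_compose[OF _ borel_measurable_continuous_onI[OF continuous_on_cos[OF continuous_on_id]]]
            measurable_compose[OF _ borel_measurable_continuous_onI[OF continuous_on_sin[OF continuous_on_id]]])
      show "(LINT x|N1. cos (\<Sum>t\<in>J. a t * G t x)) = (LINT x|N2. cos (\<Sum>t\<in>J. a t * G t x))"
        using I[of "\<lambda>\<omega>. cos (\<Sum>t\<in>J. a t * G t \<omega>)"] c[OF J] by simp
      show "(LINT x|N1. sin (\<Sum>t\<in>J. a t * G t x)) = (LINT x|N2. sin (\<Sum>t\<in>J. a t * G t x))"
        using I[of "\<lambda>\<omega>. sin (\<Sum>t\<in>J. a t * G t \<omega>)"] s[OF J] by simp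
    qed
    have \<Phi>M: "?\<Phi> \<in> measurable M ?P" by (rule measurable_restrict) (rule Gm)
    then have \<Phi>: "?\<Phi> \<in> measurable N1 ?P" "?\<Phi> \<in> measurable N2 ?P" by (simp_all add: N1_def N2_def)
    have "{\<omega> \<in> space M. 0 < Y \<omega>} \<in> sets M" by simp
    then obtain B where B: "B \<in> sigma_sets (space M) {G t -` S \<inter> space M | t S. t \<ge> 0 \<and> S \<in> sets borel}"
      and AB: "AE \<omega> in M. \<omega> \<in> {\<omega> \<in> space M. 0 < Y \<omega>} \<longleftrightarrow> \<omega> \<in> B"
      using gen unfolding generated_by_def by blast
    \<comment> \<open>The generating events are preimages of cylinder sets under the map into path
      space; this is where the equality of the two laws can be used.\<close>
    have "sigma_sets (space M) {G t -` S \<inter> space M | t S. t \<ge> 0 \<and> S \<in> sets borel} \<subseteq> sets (vimage_algebra (space M) ?\<Phi> ?P)"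
    proof (rule sets.sigma_sets_subset'[of _ "vimage_algebra (space M) ?\<Phi> ?P", simplified space_vimage_algebra])
      show "{G t -` S \<inter> space M | t S. t \<ge> 0 \<and> S \<in> sets borel} \<subseteq> sets (vimage_algebra (space M) ?\<Phi> ?P)"
      proof safe
        fix t :: real and S :: "real set" assume t: "0 \<le> t" and S: "S \<in> sets borel"
        have "(\<lambda>z. z t) -` S \<inter> space ?P \<in> sets ?P"
          using t S by (intro measurable_sets[OF measurable_component_singleton]) auto
        then have "?\<Phi> -` ((\<lambda>z. z t) -` S \<inter> space ?P) \<inter> space M \<in> sets (vimage_algebra (space M) ?\<Phi> ?P)"
          by (rule in_vimage_algebra)
        moreover have "?\<Phi> -` ((\<lambda>z. z t) -` S \<inter> space ?P) \<inter> space M = G t -` S \<inter> space M"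
          using t by (auto simp: space_PiM)
        ultimately show "G t -` S \<inter> space M \<in> sets (vimage_algebra (space M) ?\<Phi> ?P)" by simp
      qed
      show "space M \<in> sets (vimage_algebra (space M) ?\<Phi> ?P)"
        using sets.top[of "vimage_algebra (space M) ?\<Phi> ?P"] by simp
    qed
    with B have "B \<in> sets (vimage_algebra (space M) ?\<Phi> ?P)" by blast
    moreover have "?\<Phi> \<in> space M \<rightarrow> space ?P" by (auto simp: space_PiM)
    ultimately obtain B' where B': "B' \<in> sets ?P" "B = ?\<Phi> -` B' \<inter> space M"
      by (auto simp: sets_vimage_algebra2)
    have Bm[measurable]: "B \<in> sets M" unfolding B'(2) by (rule measurable_sets[OF \<Phi>M B'(1)])
    have "emeasure N1 B = emeasure (distr N1 ?P ?\<Phi>) B'"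
      using \<Phi> B' by (simp add: emeasure_distr N1_def)
    also have "\<dots> = emeasure N2 B"
      unfolding law using \<Phi> B' by (simp add: emeasure_distr N2_def)
    finally have "measure N1 B = measure N2 B" by (simp add: measure_def)
    then have "(LINT x|N1. indicator B x) = (LINT x|N2. indicator B x :: real)"
      by (simp add: N1_def N2_def)
    then have "(LINT x|M. Y x * indicator B x) = 0"
      using I[of "indicator B"] p by (simp add: indicator_def)
    moreover have "(LINT x|M. Y x * indicator B x) = (LINT x|M. Y1 x)"
      using AB by (intro integral_cong_AE) (auto simp: Y1_def indicator_def)
    ultimately show False using p by (simp add: p_def)
  qed
  then have "(LINT \<omega>|M. Y1 \<omega>) = 0" "(LINT \<omega>|M. Y2 \<omega>) = 0" using p2 by (simp_all add: p_def)
  then have "AE \<omega> in M. Y1 \<omega> = 0" "AE \<omega> in M. Y2 \<omega> = 0"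
    using i Y12(2,3) integral_nonneg_eq_0_iff_AE[of M Y1] integral_nonneg_eq_0_iff_AE[of M Y2] by auto
  then show ?thesis by eventually_elim (simp add: Y12(1))
qed

end

text \<open>A phase shift by pi / 2 differentiates the cosine, so the family K cos(a x + b) is
  stable under partial derivatives. This settles all orders of smoothness at once.\<close>

lemma trig_partial:
  fixes a :: "nat \<Rightarrow> real"
  assumes "i < n"
  shows "partial i (\<lambda>x. K * cos ((\<Sum>j<n. a j * x j) + b)) = (\<lambda>x. (K * a i) * cos ((\<Sum>j<n. a j * x j) + (b + pi / 2)))"
    "((\<lambda>y. K * cos ((\<Sum>j<n. a j * (x(i := y)) j) + b)) has_real_derivative (K * a i) * cos ((\<Sum>j<n. a j * x j) + (b + pi / 2))) (at (x i))"
proof -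
  have s: "(\<Sum>j<n. a j * (x(i := y)) j) = a i * (y - x i) + (\<Sum>j<n. a j * x j)" for x y
  proof -
    have "(\<Sum>j<n. a j * (x(i := y)) j) = (\<Sum>j<n. a j * x j + (if j = i then a i * (y - x i) else 0))"
      by (intro sum.cong) (auto simp: algebra_simps)
    then show ?thesis using assms by (simp add: sum.distrib)
  qed
  show d: "((\<lambda>y. K * cos ((\<Sum>j<n. a j * (x(i := y)) j) + b)) has_real_derivative (K * a i) * cos ((\<Sum>j<n. a j * x j) + (b + pi / 2))) (at (x i))" for x
    unfolding s by (auto intro!: derivative_eq_intros simp: cos_add sin_add algebra_simps)
  show "partial i (\<lambda>x. K * cos ((\<Sum>j<n. a j * x j) + b)) = (\<lambda>x. (K * a i) * cos ((\<Sum>j<n. a j * x j) + (b + pi / 2)))"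
    unfolding partial_def by (rule ext) (rule DERIV_imp_deriv[OF d])
qed

lemma trig_smooth_bounded:
  fixes a :: "nat \<Rightarrow> real"
  shows "smooth_bounded n (\<lambda>x. K * cos ((\<Sum>j<n. a j * x j) + b))"
proof -
  have fold: "\<exists>K' b'. foldr partial is (\<lambda>x. K * cos ((\<Sum>j<n. a j * x j) + b)) = (\<lambda>x. K' * cos ((\<Sum>j<n. a j * x j) + b'))"
    if "set is \<subseteq> {..<n}" for "is"
    using that
  proof (induction "is")
    case Nil
    then show ?case by auto
  next
    case (Cons i "is")
    then obtain K' b' where "foldr partial is (\<lambda>x. K * cos ((\<Sum>j<n. a j * x j) + b)) = (\<lambda>x. K' * cos ((\<Sum>j<n. a j * x j) + b'))" by auto
    with Cons.prems trig_partial(1)[of i n K' a b'] show ?case by auto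
  qed
  show ?thesis
    unfolding smooth_bounded_def
  proof (intro conjI allI impI)
    show "K * cos ((\<Sum>j<n. a j * x j) + b) = K * cos ((\<Sum>j<n. a j * y j) + b)" if "\<forall>i<n. x i = y i" for x y
      using that by simp
    fix "is" :: "nat list" assume "set is \<subseteq> {..<n}"
    from fold[OF this] obtain K' b' where e: "foldr partial is (\<lambda>x. K * cos ((\<Sum>j<n. a j * x j) + b)) = (\<lambda>x. K' * cos ((\<Sum>j<n. a j * x j) + b'))" by auto
    show "continuous_on UNIV (foldr partial is (\<lambda>x. K * cos ((\<Sum>j<n. a j * x j) + b)))"
      unfolding e by (intro continuous_intros continuous_on_product_coordinates)
    have "\<bar>K' * cos x\<bar> \<le> \<bar>K'\<bar>" for x by (simp add: abs_mult mult_left_le)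
    then show "bounded (range (foldr partial is (\<lambda>x. K * cos ((\<Sum>j<n. a j * x j) + b))))"
      unfolding e by (auto simp: bounded_iff)
    show "(\<lambda>y. foldr partial is (\<lambda>x. K * cos ((\<Sum>j<n. a j * x j) + b)) (x(i := y))) field_differentiable at (x i)" if "i < n" for i x
      unfolding e using trig_partial(2)[OF that] field_differentiable_def by blast
  qed
qed

text \<open>Every cosine of a finite linear combination of the noise is a smooth functional, so
  duality makes the difference of the two divergences orthogonal to all of them. The assumption that
  G generates the sigma-algebra enters here.\<close>

lemma (in centered_gp) divergence_unique:
  assumes gen: "generated_by M G" and D: "divergence M G u Y" and D': "divergence M G u' Y'"
    and u: "AE p in M \<Otimes>\<^sub>M M. u p = u' p"
  shows "AE \<omega> in M. Y \<omega> = Y' \<omega>"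
proof -
  have Y: "square_integrable M Y" and Y': "square_integrable M Y'"
    and um: "u \<in> borel_measurable (M \<Otimes>\<^sub>M M)" and um': "u' \<in> borel_measurable (M \<Otimes>\<^sub>M M)"
    using D D' by (auto simp: divergence_def square_integrable_def)
  have key: "(LINT \<omega>|M. (Y \<omega> - Y' \<omega>) * cos ((\<Sum>t\<in>J. c t * G t \<omega>) + b)) = 0"
    if J: "finite J" "J \<subseteq> {0..}" for J c b
  proof -
    obtain h where h: "bij_betw h {0..<card J} J" using ex_bij_betw_nat_finite[OF J(1)] by blast
    define n where "n = card J"
    define f where "f = (\<lambda>x. 1 * cos ((\<Sum>j<n. c (h j) * x j) + b))"
    define Z where "Z i = G (h i)" for i
    have f: "smooth_bounded n f" unfolding f_def by (rule trig_smooth_bounded)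
    have hJ: "i < n \<Longrightarrow> h i \<in> J" for i using h by (auto simp: bij_betw_def n_def)
    have Z: "Z i \<in> H" if "i < n" for i
      unfolding Z_def using hJ[OF that] J(2) by (intro H_base) auto
    have F: "smooth_functional f Z \<omega> = cos ((\<Sum>t\<in>J. c t * G t \<omega>) + b)" for \<omega>
      unfolding smooth_functional_def f_def Z_def
      using sum.reindex_bij_betw[OF h, of "\<lambda>t. c t * G t \<omega>"] by (simp add: n_def lessThan_atLeast0)
    note si = smooth_functional_sq_int[OF f Z]
    have "malliavin_deriv M G (smooth_functional f Z) (smooth_deriv n f Z)"
      unfolding malliavin_deriv_def
      using f Z si by (intro exI[of _ "\<lambda>_. n"] exI[of _ "\<lambda>_. f"] exI[of _ "\<lambda>_. Z"]) (auto intro: L2_limit_const)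
    then have "(LINT \<omega>|M. smooth_functional f Z \<omega> * Y \<omega>) = (LINT p|(M \<Otimes>\<^sub>M M). smooth_deriv n f Z p * u p)"
      "(LINT \<omega>|M. smooth_functional f Z \<omega> * Y' \<omega>) = (LINT p|(M \<Otimes>\<^sub>M M). smooth_deriv n f Z p * u' p)"
      using D D' by (auto simp: divergence_def)
    moreover have "(LINT p|(M \<Otimes>\<^sub>M M). smooth_deriv n f Z p * u p) = (LINT p|(M \<Otimes>\<^sub>M M). smooth_deriv n f Z p * u' p)"
    proof (rule integral_cong_AE)
      have "smooth_deriv n f Z \<in> borel_measurable (M \<Otimes>\<^sub>M M)" using si(2) by (simp add: square_integrable_def)
      then show "(\<lambda>p. smooth_deriv n f Z p * u p) \<in> borel_measurable (M \<Otimes>\<^sub>M M)"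
        "(\<lambda>p. smooth_deriv n f Z p * u' p) \<in> borel_measurable (M \<Otimes>\<^sub>M M)"
        using um um' by (auto intro: borel_measurable_times)
      show "AE p in M \<Otimes>\<^sub>M M. smooth_deriv n f Z p * u p = smooth_deriv n f Z p * u' p"
        using u by eventually_elim simp
    qed
    ultimately have "(LINT \<omega>|M. smooth_functional f Z \<omega> * Y \<omega>) = (LINT \<omega>|M. smooth_functional f Z \<omega> * Y' \<omega>)" by simp
    moreover have "(LINT \<omega>|M. (Y \<omega> - Y' \<omega>) * smooth_functional f Z \<omega>) = (LINT \<omega>|M. smooth_functional f Z \<omega> * Y \<omega>) - (LINT \<omega>|M. smooth_functional f Z \<omega> * Y' \<omega>)"
      using sq_int_mult[OF Y si(1)] sq_int_mult[OF Y' si(1)]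
      by (simp add: left_diff_distrib mult.commute[of "smooth_functional f Z _"])
    ultimately show ?thesis by (simp add: F)
  qed
  have "AE \<omega> in M. Y \<omega> - Y' \<omega> = 0"
  proof (rule generated_by_zero[OF gen])
    show "integrable M (\<lambda>\<omega>. Y \<omega> - Y' \<omega>)" by (intro sq_int_integrable sq_int_diff Y Y')
    fix J :: "real set" and c assume J: "finite J" "J \<subseteq> {0..}"
    show "(LINT \<omega>|M. (Y \<omega> - Y' \<omega>) * cos (\<Sum>t\<in>J. c t * G t \<omega>)) = 0" using key[OF J, of c 0] by simp
    \<comment> \<open>The sine is the cosine with phase -pi / 2.\<close>
    show "(LINT \<omega>|M. (Y \<omega> - Y' \<omega>) * sin (\<Sum>t\<in>J. c t * G t \<omega>)) = 0"
      using key[OF J, of c "- (pi / 2)"] by (simp add: cos_diff)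
  qed
  then show ?thesis by eventually_elim simp
qed

section \<open>The Ornstein--Uhlenbeck kernel\<close>

lemma continuous_on_powr_pos:
  fixes f :: "'a::topological_space \<Rightarrow> real"
  assumes "continuous_on S f" "\<And>x. x \<in> S \<Longrightarrow> 0 \<le> f x" "0 < a"
  shows "continuous_on S (\<lambda>x. f x powr a)"
  by (rule continuous_on_powr'[OF assms(1) continuous_on_const]) (use assms in auto)

text \<open>A number in [0, 1] is at most its power with exponent b; this is applied to the two
  fractions x / z and y / z, which add up to 1.\<close>

lemma powr_subadditive:
  fixes x y b :: real
  assumes x: "0 \<le> x" and y: "0 \<le> y" and b: "0 < b" "b \<le> 1"
  shows "(x + y) powr b \<le> x powr b + y powr b"
proof (cases "x + y = 0")
  case True
  then show ?thesis using x y b by simp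
next
  case False
  define z where "z = x + y"
  have z: "0 < z" using False x y by (simp add: z_def)
  have r: "r \<le> r powr b" if "0 \<le> r" "r \<le> 1" for r :: real
  proof (cases "r = 0")
    case False
    then show ?thesis using powr_mono'[of b 1 r] that b by simp
  qed simp
  have "1 = x / z + y / z" using z by (simp add: z_def add_divide_distrib[symmetric])
  also have "\<dots> \<le> (x / z) powr b + (y / z) powr b"
    using x y z by (intro add_mono r) (auto simp: z_def)
  also have "\<dots> = (x powr b + y powr b) / z powr b"
    using x y z by (simp add: powr_divide add_divide_distrib)
  finally show ?thesis using z by (simp add: z_def field_simps)
qed

lemma powr_diff_le:
  fixes b :: real
  assumes m: "0 < m" "m \<le> u" "u \<le> v" and b: "0 < b" "b \<le> 1"
  shows "v powr b - u powr b \<le> b * m powr (b - 1) * (v - u)"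
proof (cases "u = v")
  case False
  then have uv: "u < v" using m by simp
  have "\<exists>z. z > u \<and> z < v \<and> v powr b - u powr b = (v - u) * (b * z powr (b - 1))"
    using m by (intro MVT2[OF uv]) (auto intro!: has_real_derivative_powr)
  then obtain z where z: "u < z" "z < v" "v powr b - u powr b = (v - u) * (b * z powr (b - 1))" by blast
  have "z powr (b - 1) \<le> m powr (b - 1)" using z m b by (intro powr_mono2') auto
  then show ?thesis using z(3) uv b by (simp add: mult_left_mono mult_ac)
qed simp

text \<open>The Stieltjes integral of exp(-\<theta> (t - s)) dg(s) over [m, t], integrated by parts
  so that it makes sense for every continuous g. For m = 0 and a path g of the noise that starts at
  0 it is the value of X at time t.\<close>

definition ou_op :: "real \<Rightarrow> real \<Rightarrow> real \<Rightarrow> (real \<Rightarrow> real) \<Rightarrow> real" where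
  "ou_op \<theta> m t g = g t - exp (- \<theta> * (t - m)) * g m - \<theta> * integral {m..t} (\<lambda>s. exp (- \<theta> * (t - s)) * g s)"

lemma integral_exp_kernel:
  fixes \<theta> m t :: real
  assumes "0 < \<theta>" "m \<le> t"
  shows "integral {m..t} (\<lambda>s. exp (- \<theta> * (t - s))) = (1 - exp (- \<theta> * (t - m))) / \<theta>"
proof -
  have "((\<lambda>s. exp (- \<theta> * (t - s))) has_integral exp (- \<theta> * (t - t)) / \<theta> - exp (- \<theta> * (t - m)) / \<theta>) {m..t}"
    using assms
    by (intro fundamental_theorem_of_calculus)
      (auto simp: has_real_derivative_iff_has_vector_derivative[symmetric] intro!: derivative_eq_intros)
  then show ?thesis by (simp add: integral_unique diff_divide_distrib)
qed

context
  fixes \<theta> :: real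
  assumes \<theta>: "0 < \<theta>"
begin

lemma ou_kernel_integrable:
  assumes "continuous_on {m..t} g"
  shows "(\<lambda>s. exp (- \<theta> * (t - s)) * g s) integrable_on {m..t}"
  by (intro integrable_continuous_real continuous_intros assms)

lemma ou_op_cmult: "ou_op \<theta> m t (\<lambda>s. c * g s) = c * ou_op \<theta> m t g"
proof -
  have "(\<lambda>s. exp (- \<theta> * (t - s)) * (c * g s)) = (\<lambda>s. c * (exp (- \<theta> * (t - s)) * g s))"
    by (auto simp: mult_ac)
  then show ?thesis unfolding ou_op_def by (simp add: algebra_simps del: mult_minus_left)
qed

lemma ou_op_add:
  assumes "continuous_on {m..t} f" "continuous_on {m..t} g"
  shows "ou_op \<theta> m t (\<lambda>s. f s + g s) = ou_op \<theta> m t f + ou_op \<theta> m t g"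
  using integral_add[OF ou_kernel_integrable[OF assms(1)] ou_kernel_integrable[OF assms(2)]]
  unfolding ou_op_def by (simp add: algebra_simps del: mult_minus_left)

lemma ou_op_diff:
  assumes "continuous_on {m..t} f" "continuous_on {m..t} g"
  shows "ou_op \<theta> m t (\<lambda>s. f s - g s) = ou_op \<theta> m t f - ou_op \<theta> m t g"
  using ou_op_add[OF assms(1), of "\<lambda>s. -1 * g s"] ou_op_cmult[of m t "-1" g] assms
  by (simp add: continuous_on_minus)

lemma ou_op_const:
  assumes "m \<le> t" shows "ou_op \<theta> m t (\<lambda>s. c) = 0"
proof -
  have "integral {m..t} (\<lambda>s. exp (- \<theta> * (t - s)) * c) = (1 - exp (- \<theta> * (t - m))) / \<theta> * c"
    using integral_exp_kernel[OF \<theta> assms] by (simp add: integral_mult_left del: mult_minus_left)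
  then show ?thesis unfolding ou_op_def using \<theta> by (simp add: field_simps)
qed

lemma ou_op_cong: "m \<le> t \<Longrightarrow> (\<And>s. s \<in> {m..t} \<Longrightarrow> f s = g s) \<Longrightarrow> ou_op \<theta> m t f = ou_op \<theta> m t g"
  unfolding ou_op_def by (auto intro!: integral_cong)

text \<open>The kernel factors at \<open>k\<close>, and the boundary terms of the two pieces at
  \<open>k\<close> cancel.\<close>

lemma ou_op_split:
  assumes "m \<le> k" "k \<le> t" "continuous_on {m..t} g"
  shows "ou_op \<theta> m t g = exp (- \<theta> * (t - k)) * ou_op \<theta> m k g + ou_op \<theta> k t g"
proof -
  have "integral {m..t} (\<lambda>s. exp (- \<theta> * (t - s)) * g s) =
      integral {m..k} (\<lambda>s. exp (- \<theta> * (t - s)) * g s) + integral {k..t} (\<lambda>s. exp (- \<theta> * (t - s)) * g s)"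
    by (rule Henstock_Kurzweil_Integration.integral_combine[symmetric, OF assms(1,2) ou_kernel_integrable[OF assms(3)]])
  moreover have "(\<lambda>s. exp (- \<theta> * (t - s)) * g s) = (\<lambda>s. exp (- \<theta> * (t - k)) * (exp (- \<theta> * (k - s)) * g s))"
    by (auto simp: mult_exp_exp algebra_simps simp flip: mult.assoc)
  then have "integral {m..k} (\<lambda>s. exp (- \<theta> * (t - s)) * g s) = exp (- \<theta> * (t - k)) * integral {m..k} (\<lambda>s. exp (- \<theta> * (k - s)) * g s)"
    by (metis integral_mult_right)
  moreover have "exp (- \<theta> * (t - m)) = exp (- \<theta> * (t - k)) * exp (- \<theta> * (k - m))"
    by (simp add: mult_exp_exp algebra_simps)
  moreover have "gt - (Ek * Em) * gm - \<theta> * (Ek * J + I2) = Ek * (gk - Em * gm - \<theta> * J) + (gt - Ek * gk - \<theta> * I2)"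
    for gt Ek Em gm J I2 gk :: real by (simp add: algebra_simps)
  ultimately show ?thesis unfolding ou_op_def by metis
qed

text \<open>The weight exp(-\<theta> (t - m)) at m and the density \<theta> exp(-\<theta> (t - s))
  on [m, t] have total mass 1, so the operator is the end value minus an average of earlier
  values.\<close>

lemma ou_op_nonneg:
  assumes "m \<le> t" and g: "continuous_on {m..t} g" and mono: "\<And>u v. m \<le> u \<Longrightarrow> u \<le> v \<Longrightarrow> v \<le> t \<Longrightarrow> g u \<le> g v"
  shows "0 \<le> ou_op \<theta> m t g"
proof -
  have "integral {m..t} (\<lambda>s. exp (- \<theta> * (t - s)) * g s) \<le> integral {m..t} (\<lambda>s. exp (- \<theta> * (t - s)) * g t)"
    using assms by (intro integral_le ou_kernel_integrable continuous_intros mult_left_mono) auto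
  also have "\<dots> = (1 - exp (- \<theta> * (t - m))) / \<theta> * g t"
    using integral_exp_kernel[OF \<theta> assms(1)] by (simp add: integral_mult_left del: mult_minus_left)
  finally have "\<theta> * integral {m..t} (\<lambda>s. exp (- \<theta> * (t - s)) * g s) \<le> (1 - exp (- \<theta> * (t - m))) * g t"
    using \<theta> by (simp add: field_simps del: mult_minus_left)
  moreover have "exp (- \<theta> * (t - m)) * g m \<le> exp (- \<theta> * (t - m)) * g t"
    using mono[of m t] assms(1) by (intro mult_left_mono) auto
  moreover have "(1 - exp (- \<theta> * (t - m))) * g t = g t - exp (- \<theta> * (t - m)) * g t" by (simp add: left_diff_distrib)
  ultimately show ?thesis unfolding ou_op_def by linarith
qed

lemma continuous_of_dominated_increments:
  fixes f p :: "real \<Rightarrow> real"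
  assumes p: "continuous_on {m..t} p"
    and dom: "\<And>u v. m \<le> u \<Longrightarrow> u \<le> v \<Longrightarrow> v \<le> t \<Longrightarrow> \<bar>f v - f u\<bar> \<le> p v - p u"
  shows "continuous_on {m..t} f"
proof -
  have "\<bar>f v - f u\<bar> \<le> \<bar>p v - p u\<bar>" if "u \<in> {m..t}" "v \<in> {m..t}" for u v
    using dom[of u v] dom[of v u] that by (cases "u \<le> v") auto
  then show ?thesis
    using p unfolding continuous_on_iff dist_real_def by (meson order_le_less_trans)
qed

text \<open>Both p + f and p - f are nondecreasing. Positivity on monotone functions thus takes the
  place of integrating a bound on a derivative.\<close>

lemma ou_op_dominated:
  assumes mt: "m \<le> t" and p: "continuous_on {m..t} p"
    and dom: "\<And>u v. m \<le> u \<Longrightarrow> u \<le> v \<Longrightarrow> v \<le> t \<Longrightarrow> \<bar>f v - f u\<bar> \<le> p v - p u"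
  shows "\<bar>ou_op \<theta> m t f\<bar> \<le> ou_op \<theta> m t p"
proof -
  have f: "continuous_on {m..t} f" by (rule continuous_of_dominated_increments[OF p dom])
  have "0 \<le> ou_op \<theta> m t (\<lambda>s. p s + f s)"
    using dom by (intro ou_op_nonneg mt continuous_intros p f) (fastforce simp: abs_le_iff)
  moreover have "0 \<le> ou_op \<theta> m t (\<lambda>s. p s - f s)"
    using dom by (intro ou_op_nonneg mt continuous_intros p f) (fastforce simp: abs_le_iff)
  ultimately show ?thesis using ou_op_add[OF p f] ou_op_diff[OF p f] by simp
qed

text \<open>The one-variable comparison is applied in v to the increments of W in u, and then in u.
  A product bound on rectangle increments becomes a product bound on the double Stieltjes integral,
  without any density of W.\<close>

lemma ou_op_dominated2:
  assumes as: "a \<le> s" and mt: "m \<le> t" and \<rho>: "continuous_on {a..s} \<rho>" and q: "continuous_on {m..t} q"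
    and W: "\<And>u. u \<in> {a..s} \<Longrightarrow> continuous_on {m..t} (W u)"
    and dom: "\<And>u u' v v'. a \<le> u \<Longrightarrow> u \<le> u' \<Longrightarrow> u' \<le> s \<Longrightarrow> m \<le> v \<Longrightarrow> v \<le> v' \<Longrightarrow> v' \<le> t \<Longrightarrow>
       \<bar>W u' v' - W u' v - W u v' + W u v\<bar> \<le> (\<rho> u' - \<rho> u) * (q v' - q v)"
  shows "\<bar>ou_op \<theta> a s (\<lambda>u. ou_op \<theta> m t (W u))\<bar> \<le> ou_op \<theta> a s \<rho> * ou_op \<theta> m t q"
proof -
  have "\<bar>ou_op \<theta> a s (\<lambda>u. ou_op \<theta> m t (W u))\<bar> \<le> ou_op \<theta> a s (\<lambda>u. ou_op \<theta> m t q * \<rho> u)"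
  proof (rule ou_op_dominated[OF as])
    show "continuous_on {a..s} (\<lambda>u. ou_op \<theta> m t q * \<rho> u)" by (intro continuous_intros \<rho>)
    fix u u' assume u: "a \<le> u" "u \<le> u'" "u' \<le> s"
    have "ou_op \<theta> m t (W u') - ou_op \<theta> m t (W u) = ou_op \<theta> m t (\<lambda>v. W u' v - W u v)"
      using u by (intro ou_op_diff[symmetric] W) auto
    also have "\<bar>\<dots>\<bar> \<le> ou_op \<theta> m t (\<lambda>v. (\<rho> u' - \<rho> u) * q v)"
    proof (rule ou_op_dominated[OF mt])
      show "continuous_on {m..t} (\<lambda>v. (\<rho> u' - \<rho> u) * q v)" by (intro continuous_intros q)
      show "\<bar>(W u' v' - W u v') - (W u' v - W u v)\<bar> \<le> (\<rho> u' - \<rho> u) * q v' - (\<rho> u' - \<rho> u) * q v"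
        if "m \<le> v" "v \<le> v'" "v' \<le> t" for v v'
        using dom[OF u that] by (simp add: algebra_simps)
    qed
    also have "\<dots> = ou_op \<theta> m t q * \<rho> u' - ou_op \<theta> m t q * \<rho> u"
      unfolding ou_op_cmult by (simp add: algebra_simps)
    finally show "\<bar>ou_op \<theta> m t (W u') - ou_op \<theta> m t (W u)\<bar> \<le> ou_op \<theta> m t q * \<rho> u' - ou_op \<theta> m t q * \<rho> u" .
  qed
  then show ?thesis unfolding ou_op_cmult by (simp add: mult.commute)
qed

lemma ou_op_le_end:
  assumes "m \<le> t" "continuous_on {m..t} g" "\<And>s. s \<in> {m..t} \<Longrightarrow> 0 \<le> g s"
  shows "ou_op \<theta> m t g \<le> g t"
proof -
  have "0 \<le> integral {m..t} (\<lambda>s. exp (- \<theta> * (t - s)) * g s)"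
    using assms by (intro integral_nonneg ou_kernel_integrable) auto
  then have "0 \<le> \<theta> * integral {m..t} (\<lambda>s. exp (- \<theta> * (t - s)) * g s)" using \<theta> by simp
  moreover have "0 \<le> exp (- \<theta> * (t - m)) * g m" using assms by simp
  ultimately show ?thesis unfolding ou_op_def by linarith
qed

lemma ou_op_id_le:
  assumes "m \<le> t" shows "ou_op \<theta> m t (\<lambda>s. s) \<le> 1 / \<theta>"
proof -
  have "((\<lambda>s. exp (- \<theta> * (t - s)) * s) has_integral
     exp (- \<theta> * (t - t)) * (t / \<theta> - 1 / \<theta>\<^sup>2) - exp (- \<theta> * (t - m)) * (m / \<theta> - 1 / \<theta>\<^sup>2)) {m..t}"
    using assms \<theta>
    by (intro fundamental_theorem_of_calculus)
      (auto simp: has_real_derivative_iff_has_vector_derivative[symmetric] field_simps power2_eq_square intro!: derivative_eq_intros)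
  then have e: "integral {m..t} (\<lambda>s. exp (- \<theta> * (t - s)) * s) =
     (t / \<theta> - 1 / \<theta>\<^sup>2) - exp (- \<theta> * (t - m)) * (m / \<theta> - 1 / \<theta>\<^sup>2)"
    by (simp add: integral_unique)
  have "ou_op \<theta> m t (\<lambda>s. s) = 1 / \<theta> - exp (- \<theta> * (t - m)) / \<theta>"
    unfolding ou_op_def e using \<theta> by (simp add: field_simps power2_eq_square)
  then show ?thesis using \<theta> by simp
qed

lemma ou_op_continuous_param:
  assumes "m \<le> t" and W: "continuous_on (U \<times> {m..t}) (\<lambda>(u, v). W u v)"
  shows "continuous_on U (\<lambda>u. ou_op \<theta> m t (W u))"
proof -
  have c: "continuous_on U (\<lambda>u. W u v)" if "v \<in> {m..t}" for v
  proof -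
    have "continuous_on U (\<lambda>u. (\<lambda>(u, v). W u v) (u, v))"
      by (rule continuous_on_compose2[OF W]) (use that in \<open>auto intro!: continuous_intros\<close>)
    then show ?thesis by simp
  qed
  have "continuous_on (U \<times> {m..t}) (\<lambda>z. exp (- \<theta> * (t - snd z)) * (\<lambda>(u, v). W u v) z)"
    by (intro continuous_intros W)
  then have "continuous_on (U \<times> cbox m t) (\<lambda>(u, v). exp (- \<theta> * (t - v)) * W u v)"
    by (simp add: case_prod_unfold)
  from integral_continuous_on_param[OF this]
  have "continuous_on U (\<lambda>u. integral {m..t} (\<lambda>v. exp (- \<theta> * (t - v)) * W u v))" by simp
  then show ?thesis
    unfolding ou_op_def using assms(1) by (intro continuous_intros c) auto
qed

end

text \<open>L'Hospital's rule for the integral of exp(r u) f(u) over [0, t] divided by exp(r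
  t).\<close>

lemma exp_average_tendsto:
  fixes f :: "real \<Rightarrow> real"
  assumes r: "0 < r" and fc: "\<And>b. continuous_on {0..b} f" and lim: "(f \<longlongrightarrow> a) at_top"
  shows "((\<lambda>t. integral {0..t} (\<lambda>u. exp (- r * (t - u)) * f u)) \<longlongrightarrow> a / r) at_top"
proof -
  have "((\<lambda>t. integral {0..t} (\<lambda>u. exp (r * u) * f u) / exp (r * t)) \<longlongrightarrow> a / r) at_top"
  proof (rule lhospital_at_top_at_top[where f' = "\<lambda>t. exp (r * t) * f t" and g' = "\<lambda>t. r * exp (r * t)"])
    show "LIM t at_top. exp (r * t) :> at_top" using r by real_asymp
    show "eventually (\<lambda>t. r * exp (r * t) \<noteq> 0) at_top" using r by simp
    show "eventually (\<lambda>t. ((\<lambda>t. exp (r * t)) has_real_derivative r * exp (r * t)) (at t)) at_top"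
      by (auto intro!: derivative_eq_intros always_eventually)
    show "eventually (\<lambda>t. ((\<lambda>t. integral {0..t} (\<lambda>u. exp (r * u) * f u)) has_real_derivative exp (r * t) * f t) (at t)) at_top"
      using eventually_gt_at_top[of 0]
    proof eventually_elim
      case (elim t)
      have "((\<lambda>t. integral {0..t} (\<lambda>u. exp (r * u) * f u)) has_real_derivative exp (r * t) * f t) (at t within {0..t+1})"
        by (rule integral_has_real_derivative) (use elim in \<open>auto intro!: continuous_intros fc\<close>)
      then show ?case using elim by (simp add: at_within_Icc_at)
    qed
    show "((\<lambda>t. exp (r * t) * f t / (r * exp (r * t))) \<longlongrightarrow> a / r) at_top"
      using tendsto_divide[OF lim tendsto_const[of r]] r by simp
  qed
  moreover have "integral {0..t} (\<lambda>u. exp (r * u) * f u) / exp (r * t) = integral {0..t} (\<lambda>u. exp (- r * (t - u)) * f u)" for t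
  proof -
    have "exp (- r * (t - u)) * f u = exp (r * u) * f u * inverse (exp (r * t))" for u
      by (simp add: exp_minus[symmetric] mult_exp_exp algebra_simps)
    then have "integral {0..t} (\<lambda>u. exp (- r * (t - u)) * f u) = integral {0..t} (\<lambda>u. exp (r * u) * f u) * inverse (exp (r * t))"
      by (simp only: integral_mult_left)
    then show ?thesis by (simp add: divide_inverse)
  qed
  ultimately show ?thesis by simp
qed

lemma cesaro_integral_tendsto:
  fixes f :: "real \<Rightarrow> real"
  assumes fc: "\<And>b. continuous_on {0..b} f" and lim: "(f \<longlongrightarrow> a) at_top"
  shows "((\<lambda>t. integral {0..t} f / t) \<longlongrightarrow> a) at_top"
proof (rule lhospital_at_top_at_top[where f' = f and g' = "\<lambda>_. 1"])
  show "eventually (\<lambda>t. ((\<lambda>t. integral {0..t} f) has_real_derivative f t) (at t)) at_top"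
    using eventually_gt_at_top[of 0]
  proof eventually_elim
    case (elim t)
    have "((\<lambda>t. integral {0..t} f) has_real_derivative f t) (at t within {0..t+1})"
      by (rule integral_has_real_derivative) (use elim in \<open>auto intro!: fc\<close>)
    then show ?case using elim by (simp add: at_within_Icc_at)
  qed
qed (use lim in \<open>auto intro: filterlim_ident\<close>)

section \<open>The covariance of the noise\<close>

text \<open>A nonnegative mixed derivative off the diagonal forces nonnegative second differences as long as
  the first derivative is continuous across the diagonal. This replaces integration of the mixed
  derivative over rectangles.\<close>

lemma second_difference_nonneg:
  fixes A A' \<alpha> :: "real \<Rightarrow> real \<Rightarrow> real"
  assumes ab: "a \<le> b" and cd: "c \<le> d"
    and d1: "\<And>t s. t \<in> {a, b} \<Longrightarrow> s \<in> {c..d} \<Longrightarrow> ((\<lambda>s. A t s) has_real_derivative A' t s) (at s)"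
    and cont: "\<And>s. s \<in> {c..d} \<Longrightarrow> continuous_on {a..b} (\<lambda>t. A' t s)"
    and d2: "\<And>t s. t \<in> {a<..<b} \<Longrightarrow> s \<in> {c..d} \<Longrightarrow> t \<noteq> s \<Longrightarrow> ((\<lambda>t. A' t s) has_real_derivative \<alpha> t s) (at t)"
    and nn: "\<And>t s. t \<in> {a<..<b} \<Longrightarrow> s \<in> {c..d} \<Longrightarrow> t \<noteq> s \<Longrightarrow> 0 \<le> \<alpha> t s"
  shows "0 \<le> A b d - A b c - A a d + A a c"
proof -
  have mono: "A' a s \<le> A' b s" if s: "s \<in> {c..d}" for s
  proof -
    \<comment> \<open>Monotonicity on either side of the diagonal. The point \<open>s\<close> may be
      an end point, since only continuity is required there; two such pieces are glued at
      \<open>s\<close> below.\<close>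
    have sub: "A' x s \<le> A' y s" if "a \<le> x" "x \<le> y" "y \<le> b" "s \<le> x \<or> y \<le> s" for x y
    proof (rule DERIV_nonneg_imp_increasing_open[OF \<open>x \<le> y\<close>])
      show "continuous_on {x..y} (\<lambda>t. A' t s)"
        using cont[OF s] by (rule continuous_on_subset) (use that in auto)
      fix t assume "x < t" "t < y"
      then have "t \<in> {a<..<b}" "t \<noteq> s" using that by auto
      then show "\<exists>y. ((\<lambda>t. A' t s) has_real_derivative y) (at t) \<and> 0 \<le> y"
        using d2[OF _ s] nn[OF _ s] by blast
    qed
    show ?thesis
    proof (cases "a < s \<and> s < b")
      case True
      then show ?thesis using sub[of a s] sub[of s b] by linarith
    next
      case False
      then show ?thesis using sub[of a b] ab by auto
    qed
  qed
  have "A b c - A a c \<le> A b d - A a d"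
  proof (rule DERIV_nonneg_imp_nondecreasing[OF cd])
    fix s assume "c \<le> s" "s \<le> d"
    then have s: "s \<in> {c..d}" by simp
    have "((\<lambda>s. A b s - A a s) has_real_derivative A' b s - A' a s) (at s)"
      by (intro derivative_intros d1 s) auto
    then show "\<exists>y. ((\<lambda>s. A b s - A a s) has_real_derivative y) (at s) \<and> 0 \<le> y"
      using mono[OF s] by auto
  qed
  then show ?thesis by simp
qed

text \<open>The limit passage from the open to the closed quadrant: shift all corners by \<open>1 / (n + 1)\<close>.\<close>

lemma second_difference_closure:
  fixes W :: "real \<Rightarrow> real \<Rightarrow> real"
  assumes W: "continuous_on ({0..} \<times> {0..}) (\<lambda>(t, s). W t s)"
    and 0: "0 \<le> a" "0 \<le> b" "0 \<le> c" "0 \<le> d"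
    and pos: "\<And>e. 0 < e \<Longrightarrow> 0 \<le> W (b + e) (d + e) - W (b + e) (c + e) - W (a + e) (d + e) + W (a + e) (c + e)"
  shows "0 \<le> W b d - W b c - W a d + W a c"
proof -
  let ?e = "\<lambda>n. inverse (real (Suc n))"
  have e: "?e \<longlonglongrightarrow> 0" by (rule LIMSEQ_inverse_real_of_nat)
  have l: "(\<lambda>n. W (x + ?e n) (y + ?e n)) \<longlonglongrightarrow> W x y" if "0 \<le> x" "0 \<le> y" for x y
  proof -
    have "(\<lambda>n. (x + ?e n, y + ?e n)) \<longlonglongrightarrow> (x + 0, y + 0)" by (intro tendsto_intros e)
    then have "(\<lambda>n. (\<lambda>(t, s). W t s) (x + ?e n, y + ?e n)) \<longlonglongrightarrow> (\<lambda>(t, s). W t s) (x, y)"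
      using that by (intro continuous_on_tendsto_compose[OF W]) auto
    then show ?thesis by simp
  qed
  have "(\<lambda>n. W (b + ?e n) (d + ?e n) - W (b + ?e n) (c + ?e n) - W (a + ?e n) (d + ?e n) + W (a + ?e n) (c + ?e n))
     \<longlonglongrightarrow> W b d - W b c - W a d + W a c"
    using 0 by (intro tendsto_intros l)
  then show ?thesis by (rule LIMSEQ_le_const) (use pos in auto)
qed

lemma abs_powr_deriv:
  fixes p x :: real
  assumes p: "1 < p"
  shows "((\<lambda>x. \<bar>x\<bar> powr p) has_real_derivative p * (sgn x * \<bar>x\<bar> powr (p - 1))) (at x)"
proof -
  consider "0 < x" | "x < 0" | "x = 0" by linarith
  then show ?thesis
  proof cases
    case 1
    have "((\<lambda>x. x powr p) has_real_derivative p * x powr (p - 1)) (at x)"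
      by (rule has_real_derivative_powr[OF 1])
    moreover have "eventually (\<lambda>y. y powr p = \<bar>y\<bar> powr p) (nhds x)"
      using eventually_nhds_in_open[of "{0<..}" x] 1 by (auto elim!: eventually_mono)
    ultimately show ?thesis using 1 by (subst (asm) DERIV_cong_ev[OF refl _ refl]) auto
  next
    case 2
    have "((\<lambda>x. (- x) powr p) has_real_derivative - (p * (- x) powr (p - 1))) (at x)"
      using DERIV_chain2[OF has_real_derivative_powr[of "- x" p] DERIV_minus[OF DERIV_ident]] 2 by simp
    moreover have "eventually (\<lambda>y. (- y) powr p = \<bar>y\<bar> powr p) (nhds x)"
      using eventually_nhds_in_open[of "{..<0}" x] 2 by (auto elim!: eventually_mono)
    ultimately show ?thesis using 2 by (subst (asm) DERIV_cong_ev[OF refl _ refl]) auto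
  next
    case 3
    have "((\<lambda>h. (\<bar>h\<bar> powr p - \<bar>0\<bar> powr p) / (h - 0)) \<longlongrightarrow> 0) (at (0::real))"
    proof (rule tendsto_0_le[where K = 1])
      show "((\<lambda>h::real. \<bar>h\<bar> powr (p - 1)) \<longlongrightarrow> 0) (at 0)"
        by (rule tendsto_eq_intros refl | use p in auto)+
      have "norm ((\<bar>h\<bar> powr p - \<bar>0\<bar> powr p) / (h - 0)) \<le> norm (\<bar>h\<bar> powr (p - 1)) * 1" if "h \<noteq> 0" for h :: real
        using that p by (simp add: powr_diff)
      then show "eventually (\<lambda>h. norm ((\<bar>h\<bar> powr p - \<bar>0\<bar> powr p) / (h - 0)) \<le> norm (\<bar>h\<bar> powr (p - 1)) * 1) (at (0::real))"
        by (simp add: eventually_at_filter)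
    qed
    then show ?thesis using 3 by (simp add: has_field_derivative_iff)
  qed
qed

lemma sgn_abs_powr:
  fixes x a :: real
  assumes "0 < a"
  shows "sgn x * \<bar>x\<bar> powr a = max x 0 powr a - max (- x) 0 powr a"
  using assms by (cases "0 < x"; cases "x < 0") (auto simp: max_def)

lemma continuous_sgn_abs_powr:
  assumes "0 < (a::real)" "continuous_on S f"
  shows "continuous_on S (\<lambda>x. sgn (f x) * \<bar>f x\<bar> powr a)"
  unfolding sgn_abs_powr[OF assms(1)] by (intro continuous_intros continuous_on_powr_pos assms) auto

lemma sgn_abs_powr_deriv:
  fixes x a :: real
  assumes "x \<noteq> 0"
  shows "((\<lambda>x. sgn x * \<bar>x\<bar> powr a) has_real_derivative a * \<bar>x\<bar> powr (a - 1)) (at x)"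
proof (cases "0 < x")
  case True
  have "((\<lambda>x. x powr a) has_real_derivative a * x powr (a - 1)) (at x)"
    by (rule has_real_derivative_powr[OF True])
  moreover have "eventually (\<lambda>y. y powr a = sgn y * \<bar>y\<bar> powr a) (nhds x)"
    using eventually_nhds_in_open[of "{0<..}" x] True by (auto elim!: eventually_mono)
  ultimately show ?thesis using True by (subst (asm) DERIV_cong_ev[OF refl _ refl]) auto
next
  case False
  then have x: "x < 0" using assms by simp
  have "((\<lambda>x. - ((- x) powr a)) has_real_derivative (a * (- x) powr (a - 1))) (at x)"
    using DERIV_minus[OF DERIV_chain2[OF has_real_derivative_powr[of "- x" a] DERIV_minus[OF DERIV_ident]]] x by simp
  moreover have "eventually (\<lambda>y. - ((- y) powr a) = sgn y * \<bar>y\<bar> powr a) (nhds x)"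
    using eventually_nhds_in_open[of "{..<0}" x] x by (auto elim!: eventually_mono)
  ultimately show ?thesis using x by (subst (asm) DERIV_cong_ev[OF refl _ refl]) auto
qed

lemma exp_powr_integral_reflect:
  fixes \<theta> p :: real
  assumes p: "0 < p"
  shows "integral {0..t} (\<lambda>v. exp (- \<theta> * (t - v)) * (t - v) powr p) = integral {0..t} (\<lambda>x. exp (- \<theta> * x) * x powr p)"
proof -
  have "continuous_on {0..t} (\<lambda>v. exp (- \<theta> * (t - v)) * (t - v) powr p)"
    by (intro continuous_intros continuous_on_powr_pos p) auto
  then have "integral {0..t} (\<lambda>v. exp (- \<theta> * (t - v)) * (t - v) powr p) = (LBINT v:{0..t}. exp (- \<theta> * (t - v)) * (t - v) powr p)"
    by (intro set_borel_integral_eq_integral(2)[symmetric] borel_integrable_atLeastAtMost')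
  also have "\<dots> = (LBINT x:{0..t}. exp (- \<theta> * x) * x powr p)"
    unfolding set_lebesgue_integral_def
    by (subst lborel_integral_real_affine[of "-1" _ t]) (auto intro!: Bochner_Integration.integral_cong simp: indicator_def)
  also have "\<dots> = integral {0..t} (\<lambda>x. exp (- \<theta> * x) * x powr p)"
    by (intro set_borel_integral_eq_integral(2) borel_integrable_atLeastAtMost' continuous_intros continuous_on_powr_pos p) auto
  finally show ?thesis .
qed

text \<open>After reflection the integrand no longer depends on t, so only the upper limit moves;
  scaling by \<theta> turns the integral over the half line into the Gamma integral.\<close>

lemma exp_powr_integral_tendsto:
  fixes \<theta> p :: real
  assumes \<theta>: "0 < \<theta>" and p: "0 < p"
  shows "((\<lambda>t. integral {0..t} (\<lambda>v. exp (- \<theta> * (t - v)) * (t - v) powr p)) \<longlongrightarrow> Gamma (p + 1) / \<theta> powr (p + 1)) at_top"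
proof -
  let ?g0 = "\<lambda>x::real. indicator {0..} x * x powr p / exp x"
  have nn: "(\<integral>\<^sup>+x. ennreal (?g0 x) \<partial>lborel) = ennreal (Gamma (p + 1))"
    using Gamma_conv_nn_integral_real[of "p + 1"] p by simp
  have i0: "integrable lborel ?g0"
    by (rule integrableI_nonneg) (auto simp: nn)
  have e0: "(LINT x|lborel. ?g0 x) = Gamma (p + 1)"
    using p by (subst integral_eq_nn_integral) (auto simp: nn Gamma_real_pos less_imp_le)
  have eq: "?g0 (0 + \<theta> * x) = \<theta> powr p * (indicator {0..} x * (exp (- \<theta> * x) * x powr p))" for x
    using \<theta> by (auto simp: indicator_def powr_mult exp_minus field_simps zero_le_mult_iff)
  have i1: "integrable lborel (\<lambda>x. indicator {0..} x * (exp (- \<theta> * x) * x powr p))"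
    using lborel_integrable_real_affine[OF i0, of \<theta> 0] \<theta> unfolding eq by simp
  have "Gamma (p + 1) = \<theta> * (\<theta> powr p * (LINT x|lborel. indicator {0..} x * (exp (- \<theta> * x) * x powr p)))"
    using lborel_integral_real_affine[of \<theta> ?g0 0] \<theta> unfolding eq e0 by simp
  then have e1: "(LINT x|lborel. indicator {0..} x * (exp (- \<theta> * x) * x powr p)) = Gamma (p + 1) / \<theta> powr (p + 1)"
    using \<theta> by (simp add: powr_add field_simps)
  have "((\<lambda>b. LBINT x:{0..b}. exp (- \<theta> * x) * x powr p) \<longlongrightarrow> (LBINT x:{0..}. exp (- \<theta> * x) * x powr p)) at_top"
    by (rule tendsto_set_lebesgue_integral_at_top) (use i1 in \<open>simp_all add: set_integrable_def\<close>)
  then have lim: "((\<lambda>b. LBINT x:{0..b}. exp (- \<theta> * x) * x powr p) \<longlongrightarrow> Gamma (p + 1) / \<theta> powr (p + 1)) at_top"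
    unfolding set_lebesgue_integral_def[of _ "{0..}"] using e1 by simp
  have "(LBINT x:{0..t}. exp (- \<theta> * x) * x powr p) = integral {0..t} (\<lambda>x. exp (- \<theta> * x) * x powr p)" for t
    by (intro set_borel_integral_eq_integral(2) borel_integrable_atLeastAtMost' continuous_intros continuous_on_powr_pos p) auto
  then show ?thesis using lim unfolding exp_powr_integral_reflect[OF p] by simp
qed

text \<open>Fubini on the triangle \<open>S\<close> above the diagonal; with the symmetry of k it
  identifies the integral over u \<le> v with the one over v \<le> u.\<close>

lemma integral_symmetric_square:
  fixes k :: "real \<Rightarrow> real \<Rightarrow> real"
  assumes t: "0 \<le> t" and k: "continuous_on ({0..t} \<times> {0..t}) (\<lambda>(u, v). k u v)"
    and sym: "\<And>u v. k u v = k v u"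
  shows "integral {0..t} (\<lambda>u. integral {0..t} (k u)) = 2 * integral {0..t} (\<lambda>u. integral {0..u} (k u))"
proof -
  define S where "S = {z. 0 \<le> fst z \<and> fst z \<le> snd z \<and> snd z \<le> (t::real)}"
  have kc: "continuous_on {0..t} (k u)" if "u \<in> {0..t}" for u
  proof -
    have "continuous_on {0..t} (\<lambda>v. (\<lambda>(u, v). k u v) (u, v))"
      by (rule continuous_on_compose2[OF k]) (use that in \<open>auto intro!: continuous_intros\<close>)
    then show ?thesis by simp
  qed
  have sub: "S \<subseteq> {0..t} \<times> {0..t}" by (auto simp: S_def)
  have "closed S"
    unfolding S_def by (intro closed_Collect_conj closed_Collect_le continuous_intros)
  moreover have "bounded S" by (rule bounded_subset[OF _ sub]) (intro bounded_Times bounded_closed_interval)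
  ultimately have S: "compact S" by (simp add: compact_eq_bounded_closed)
  have "integrable lborel (\<lambda>z. indicator S z *\<^sub>R (\<lambda>(u, v). k u v) z)"
    by (rule borel_integrable_compact[OF S continuous_on_subset[OF k sub]])
  then have i: "integrable (lborel \<Otimes>\<^sub>M lborel) (\<lambda>(u, v). indicator S (u, v) * k u v)"
    by (simp add: lborel_prod case_prod_unfold)
  have inner: "(LINT v|lborel. indicator S (u, v) * k u v) = indicator {0..t} u * integral {u..t} (k u)" for u
  proof (cases "u \<in> {0..t}")
    case True
    have "(LINT v|lborel. indicator S (u, v) * k u v) = (LBINT v:{u..t}. k u v)"
      unfolding set_lebesgue_integral_def
      using True by (intro Bochner_Integration.integral_cong) (auto simp: S_def indicator_def)
    also have "\<dots> = integral {u..t} (k u)"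
      using True by (intro set_borel_integral_eq_integral(2) borel_integrable_atLeastAtMost' continuous_on_subset[OF kc[OF True]]) auto
    finally show ?thesis using True by simp
  next
    case False
    then have "(\<lambda>v. indicator S (u, v) * k u v) = (\<lambda>_. 0)" by (auto simp: S_def indicator_def)
    then show ?thesis using False by simp
  qed
  have inner': "(LINT u|lborel. indicator S (u, v) * k u v) = indicator {0..t} v * integral {0..v} (k v)" for v
  proof (cases "v \<in> {0..t}")
    case True
    have "(LINT u|lborel. indicator S (u, v) * k u v) = (LBINT u:{0..v}. k v u)"
      unfolding set_lebesgue_integral_def
      using True by (intro Bochner_Integration.integral_cong) (auto simp: S_def indicator_def sym)
    also have "\<dots> = integral {0..v} (k v)"
      using True by (intro set_borel_integral_eq_integral(2) borel_integrable_atLeastAtMost' continuous_on_subset[OF kc[OF True]]) auto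
    finally show ?thesis using True by simp
  next
    case False
    then have "(\<lambda>u. indicator S (u, v) * k u v) = (\<lambda>_. 0)" by (auto simp: S_def indicator_def)
    then show ?thesis using False by simp
  qed
  have si1: "set_integrable lborel {0..t} (\<lambda>u. integral {u..t} (k u))"
    using lborel_pair.integrable_fst[OF i] unfolding inner by (simp add: set_integrable_def)
  have si2: "set_integrable lborel {0..t} (\<lambda>v. integral {0..v} (k v))"
    using lborel_pair.integrable_snd[OF i] unfolding inner' by (simp add: set_integrable_def)
  have "(LINT v|lborel. LINT u|lborel. indicator S (u, v) * k u v) = (LINT u|lborel. LINT v|lborel. indicator S (u, v) * k u v)"
    by (rule lborel_pair.Fubini_integral[OF i])
  then have "(LBINT v:{0..t}. integral {0..v} (k v)) = (LBINT u:{0..t}. integral {u..t} (k u))"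
    unfolding inner inner' set_lebesgue_integral_def by simp
  then have swap: "integral {0..t} (\<lambda>v. integral {0..v} (k v)) = integral {0..t} (\<lambda>u. integral {u..t} (k u))"
    using set_borel_integral_eq_integral(2)[OF si1] set_borel_integral_eq_integral(2)[OF si2] by simp
  have "integral {0..t} (\<lambda>u. integral {0..t} (k u)) = integral {0..t} (\<lambda>u. integral {0..u} (k u) + integral {u..t} (k u))"
    by (intro integral_cong Henstock_Kurzweil_Integration.integral_combine[symmetric] integrable_continuous_real kc) auto
  also have "\<dots> = integral {0..t} (\<lambda>u. integral {0..u} (k u)) + integral {0..t} (\<lambda>u. integral {u..t} (k u))"
    by (rule integral_add[OF set_borel_integral_eq_integral(1)[OF si2] set_borel_integral_eq_integral(1)[OF si1]])
  finally show ?thesis using swap by simp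
qed

section \<open>Comparison of the covariance with that of fractional Brownian motion\<close>

locale noise_covariance =
  fixes R :: "real \<Rightarrow> real \<Rightarrow> real" and \<beta> C C' \<theta> :: real and \<Psi> :: "real \<Rightarrow> real \<Rightarrow> real"
  assumes noise: "noise_hypothesis R \<beta> C C' \<Psi>"
    and R_sym: "R t s = R s t"
    and R_cont: "continuous_on ({0..} \<times> {0..}) (\<lambda>(t, s). R t s)"
    and \<theta>: "0 < \<theta>"
begin

lemma params: "1/2 < \<beta>" "\<beta> < 1" "0 < \<beta>" "1 < 2 * \<beta>" "0 < C" "0 \<le> C'" "\<And>t. 0 \<le> t \<Longrightarrow> R 0 t = 0"
  "\<And>t. 0 \<le> t \<Longrightarrow> R t 0 = 0"
  using noise R_sym[of _ 0] by (auto simp: noise_hypothesis_def)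

text \<open>Differentiating |t - s|^(2\<beta>) once in each variable produces the factor -2\<beta>
  (2\<beta> - 1), which this normalisation compensates so that the constant of the mixed derivative
  is C.\<close>

definition c0 where "c0 = C / (2 * \<beta> * (2 * \<beta> - 1))"

text \<open>\<open>F\<close> is the covariance of the fractional Brownian motion with mixed derivative \<open>C \<bar>t - s\<bar>\<^bsup>2\<beta>-2\<^esup>\<close>; the mixed
  derivative of \<open>q\<close> is the bound \<open>C' \<bar>t s\<bar>\<^bsup>\<beta>-1\<^esup>\<close> on \<open>\<Psi>\<close>.\<close>

definition F where "F t s = c0 * (t powr (2 * \<beta>) + s powr (2 * \<beta>) - \<bar>t - s\<bar> powr (2 * \<beta>))"

definition q where "q t s = C' / \<beta>\<^sup>2 * (t powr \<beta> * s powr \<beta>)"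

lemma c0_pos: "0 < c0" using params by (simp add: c0_def)

lemma F_cont: "continuous_on ({0..} \<times> {0..}) (\<lambda>(t, s). F t s)"
  unfolding F_def case_prod_unfold using params(3)
  by (intro continuous_on_mult continuous_on_const continuous_on_add continuous_on_diff continuous_on_powr_pos
      continuous_on_rabs continuous_on_fst continuous_on_snd continuous_on_id) auto

lemma q_cont: "continuous_on ({0..} \<times> {0..}) (\<lambda>(t, s). q t s)"
  unfolding q_def case_prod_unfold using params(3)
  by (intro continuous_on_mult continuous_on_const continuous_on_powr_pos
      continuous_on_fst continuous_on_snd continuous_on_id) auto

definition F' where "F' t s = c0 * (2 * \<beta>) * (s powr (2 * \<beta> - 1) + sgn (t - s) * \<bar>t - s\<bar> powr (2 * \<beta> - 1))"

lemma F_deriv: "0 < s \<Longrightarrow> ((\<lambda>s. F t s) has_real_derivative F' t s) (at s)"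
proof -
  assume s: "0 < s"
  have "((\<lambda>s. \<bar>s - t\<bar> powr (2 * \<beta>)) has_real_derivative 2 * \<beta> * (sgn (s - t) * \<bar>s - t\<bar> powr (2 * \<beta> - 1)) * 1) (at s)"
    by (rule DERIV_chain2[OF abs_powr_deriv[OF params(4)]]) (auto intro!: derivative_eq_intros)
  then have "((\<lambda>s. \<bar>t - s\<bar> powr (2 * \<beta>)) has_real_derivative - (2 * \<beta> * (sgn (t - s) * \<bar>t - s\<bar> powr (2 * \<beta> - 1)))) (at s)"
    by (simp add: abs_minus_commute sgn_minus[of "t - s", simplified])
  from DERIV_cmult[OF DERIV_diff[OF DERIV_add[OF DERIV_const has_real_derivative_powr[OF s]] this], of c0 "t powr (2 * \<beta>)" "2 * \<beta>"]
  show ?thesis unfolding F_def F'_def by (simp add: algebra_simps)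
qed

lemma F'_cont: "continuous_on S (\<lambda>t. F' t s)"
  unfolding F'_def
  by (rule continuous_on_mult[OF continuous_on_const continuous_on_add[OF continuous_on_const continuous_sgn_abs_powr]])
    (use params(4) in \<open>auto intro!: continuous_intros\<close>)

lemma F'_deriv: "t \<noteq> s \<Longrightarrow> ((\<lambda>t. F' t s) has_real_derivative C * \<bar>t - s\<bar> powr (2 * \<beta> - 2)) (at t)"
proof -
  assume ts: "t \<noteq> s"
  have "((\<lambda>t. sgn (t - s) * \<bar>t - s\<bar> powr (2 * \<beta> - 1)) has_real_derivative
     ((2 * \<beta> - 1) * \<bar>t - s\<bar> powr (2 * \<beta> - 1 - 1)) * 1) (at t)"
    by (rule DERIV_chain2[OF sgn_abs_powr_deriv]) (use ts in \<open>auto intro!: derivative_eq_intros\<close>)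
  from DERIV_cmult[OF DERIV_add[OF DERIV_const this], of "c0 * (2 * \<beta>)" "s powr (2 * \<beta> - 1)"]
  have "((\<lambda>t. F' t s) has_real_derivative (c0 * (2 * \<beta>)) * ((2 * \<beta> - 1) * \<bar>t - s\<bar> powr (2 * \<beta> - 2))) (at t)"
    unfolding F'_def by simp
  moreover have "(c0 * (2 * \<beta>)) * (2 * \<beta> - 1) = C" using params by (simp add: c0_def)
  ultimately show ?thesis by (simp flip: mult.assoc)
qed

abbreviation second_diff :: "(real \<Rightarrow> real \<Rightarrow> real) \<Rightarrow> real \<Rightarrow> real \<Rightarrow> real \<Rightarrow> real \<Rightarrow> real" where
  "second_diff W a b c d \<equiv> W b d - W b c - W a d + W a c"

text \<open>The mixed derivative is nonnegative off the diagonal, and \<beta> > 1/2 makes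
  \<open>F'\<close> continuous across it, so nothing is concentrated on the diagonal.\<close>

lemma second_diff_F_nonneg:
  assumes "0 \<le> a" "a \<le> b" "0 \<le> c" "c \<le> d"
  shows "0 \<le> second_diff F a b c d"
proof (rule second_difference_closure[OF F_cont])
  fix e :: real assume e: "0 < e"
  show "0 \<le> F (b + e) (d + e) - F (b + e) (c + e) - F (a + e) (d + e) + F (a + e) (c + e)"
    by (rule second_difference_nonneg[where A' = F' and \<alpha> = "\<lambda>t s. C * \<bar>t - s\<bar> powr (2 * \<beta> - 2)"])
      (use assms e params in \<open>auto intro!: F_deriv F'_cont F'_deriv\<close>)
qed (use assms in auto)

text \<open>The two sides of the rectangle stay at distance \<delta>, and the exponent 2\<beta> - 2
  is negative, so the mixed derivative of F is at most the constant k. The comparison function k t s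
  has exactly this mixed derivative.\<close>

lemma second_diff_F_le:
  assumes a: "0 \<le> a" "a \<le> b" "c \<le> d" and \<delta>: "0 < \<delta>" "b + \<delta> \<le> c"
  shows "second_diff F a b c d \<le> C * \<delta> powr (2 * \<beta> - 2) * (b - a) * (d - c)"
proof -
  define k where "k = C * \<delta> powr (2 * \<beta> - 2)"
  define A where "A t s = k * (t * s) - F t s" for t s
  have Ac: "continuous_on ({0..} \<times> {0..}) (\<lambda>(t, s). A t s)"
    unfolding A_def case_prod_unfold
    by (intro continuous_intros F_cont[unfolded case_prod_unfold])
  have "0 \<le> A b d - A b c - A a d + A a c"
  proof (rule second_difference_closure[OF Ac])
    fix e :: real assume e: "0 < e"
    show "0 \<le> A (b + e) (d + e) - A (b + e) (c + e) - A (a + e) (d + e) + A (a + e) (c + e)"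
    proof (rule second_difference_nonneg[where A' = "\<lambda>t s. k * t - F' t s" and \<alpha> = "\<lambda>t s. k - C * \<bar>t - s\<bar> powr (2 * \<beta> - 2)"])
      show "((\<lambda>s. A t s) has_real_derivative k * t - F' t s) (at s)" if "s \<in> {c + e..d + e}" for t s
        unfolding A_def using that a \<delta> e by (auto intro!: derivative_eq_intros F_deriv)
      show "continuous_on {a + e..b + e} (\<lambda>t. k * t - F' t s)" for s
        by (intro continuous_intros F'_cont)
      fix t s assume ts: "t \<in> {a + e<..<b + e}" "s \<in> {c + e..d + e}" "t \<noteq> s"
      show "((\<lambda>t. k * t - F' t s) has_real_derivative k - C * \<bar>t - s\<bar> powr (2 * \<beta> - 2)) (at t)"
        using ts by (auto intro!: derivative_eq_intros F'_deriv)
      have "\<delta> \<le> \<bar>t - s\<bar>" using ts \<delta> by auto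
      then have "\<bar>t - s\<bar> powr (2 * \<beta> - 2) \<le> \<delta> powr (2 * \<beta> - 2)"
        using \<delta> params by (intro powr_mono2') auto
      then show "0 \<le> k - C * \<bar>t - s\<bar> powr (2 * \<beta> - 2)"
        using params by (simp add: k_def)
    qed (use assms in auto)
  qed (use assms in auto)
  then show ?thesis unfolding A_def k_def[symmetric] by (simp add: algebra_simps)
qed

text \<open>The singular term cancels in R - F, and the bound on \<Psi> makes the mixed derivatives
  of q + (R - F) and q - (R - F) nonnegative. The increments of q factor because q is a
  product.\<close>

lemma second_diff_P_le:
  assumes ab: "0 \<le> a" "a \<le> b" "0 \<le> c" "c \<le> d"
  shows "\<bar>second_diff (\<lambda>t s. R t s - F t s) a b c d\<bar> \<le> C' / \<beta>\<^sup>2 * (b powr \<beta> - a powr \<beta>) * (d powr \<beta> - c powr \<beta>)"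
proof -
  from noise obtain R'
    where R1': "\<forall>t>0. \<forall>s>0. ((\<lambda>s. R t s) has_real_derivative R' t s) (at s)"
      and R2': "\<forall>s>0. continuous_on {0<..} (\<lambda>t. R' t s)"
      and R3': "\<forall>t>0. \<forall>s>0. t \<noteq> s \<longrightarrow>
              ((\<lambda>t. R' t s) has_real_derivative C * \<bar>t - s\<bar> powr (2 * \<beta> - 2) + \<Psi> t s) (at t)"
      and \<Psi>': "\<forall>t>0. \<forall>s>0. t \<noteq> s \<longrightarrow> \<bar>\<Psi> t s\<bar> \<le> C' * \<bar>t * s\<bar> powr (\<beta> - 1)"
    unfolding noise_hypothesis_def by (elim conjE exE) (rule that, assumption+)
  note R1 = R1'[rule_format] and R2 = R2'[rule_format] and R3 = R3'[rule_format] and \<Psi> = \<Psi>'[rule_format]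
  have main: "0 \<le> second_diff (\<lambda>t s. q t s + \<sigma> * (R t s - F t s)) a b c d" if \<sigma>: "\<bar>\<sigma>\<bar> = 1" for \<sigma>
  proof (rule second_difference_closure)
    show "continuous_on ({0..} \<times> {0..}) (\<lambda>(t, s). q t s + \<sigma> * (R t s - F t s))"
      unfolding case_prod_unfold
      by (intro continuous_intros F_cont[unfolded case_prod_unfold] q_cont[unfolded case_prod_unfold] R_cont[unfolded case_prod_unfold])
    fix e :: real assume e: "0 < e"
    show "0 \<le> second_diff (\<lambda>t s. q t s + \<sigma> * (R t s - F t s)) (a + e) (b + e) (c + e) (d + e)"
    proof (rule second_difference_nonneg[where A' = "\<lambda>t s. C' / \<beta> * (t powr \<beta> * s powr (\<beta> - 1)) + \<sigma> * (R' t s - F' t s)"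
          and \<alpha> = "\<lambda>t s. C' * (t powr (\<beta> - 1) * s powr (\<beta> - 1)) + \<sigma> * \<Psi> t s"])
      fix t s assume "t \<in> {a + e, b + e}" "s \<in> {c + e..d + e}"
      then have ts: "0 < t" "0 < s" using ab e by auto
      have "((\<lambda>s. C' / \<beta>\<^sup>2 * (t powr \<beta> * s powr \<beta>)) has_real_derivative C' / \<beta>\<^sup>2 * (t powr \<beta> * (\<beta> * s powr (\<beta> - 1)))) (at s)"
        by (intro DERIV_cmult has_real_derivative_powr ts)
      moreover have "C' / \<beta>\<^sup>2 * (t powr \<beta> * (\<beta> * s powr (\<beta> - 1))) = C' / \<beta> * (t powr \<beta> * s powr (\<beta> - 1))"
        using params by (simp add: power2_eq_square)
      ultimately have "((\<lambda>s. q t s) has_real_derivative C' / \<beta> * (t powr \<beta> * s powr (\<beta> - 1))) (at s)"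
        unfolding q_def by simp
      then show "((\<lambda>s. q t s + \<sigma> * (R t s - F t s)) has_real_derivative
         C' / \<beta> * (t powr \<beta> * s powr (\<beta> - 1)) + \<sigma> * (R' t s - F' t s)) (at s)"
        using ts by (intro DERIV_add DERIV_cmult DERIV_diff R1 F_deriv)
    next
      fix s assume "s \<in> {c + e..d + e}"
      then have s: "0 < s" using ab e by auto
      have "continuous_on {a + e..b + e} (\<lambda>t. R' t s)"
        by (rule continuous_on_subset[OF R2[OF s]]) (use ab e in auto)
      then show "continuous_on {a + e..b + e} (\<lambda>t. C' / \<beta> * (t powr \<beta> * s powr (\<beta> - 1)) + \<sigma> * (R' t s - F' t s))"
        using ab e params by (intro continuous_intros continuous_on_powr_pos F'_cont) auto
    next
      fix t s assume "t \<in> {a + e<..<b + e}" "s \<in> {c + e..d + e}" and ne: "t \<noteq> s"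
      then have ts: "0 < t" "0 < s" using ab e by auto
      have "((\<lambda>t. C' / \<beta> * (t powr \<beta> * s powr (\<beta> - 1))) has_real_derivative C' / \<beta> * (\<beta> * t powr (\<beta> - 1) * s powr (\<beta> - 1))) (at t)"
        by (intro DERIV_cmult DERIV_cmult_right has_real_derivative_powr ts)
      moreover have "C' / \<beta> * (\<beta> * t powr (\<beta> - 1) * s powr (\<beta> - 1)) = C' * (t powr (\<beta> - 1) * s powr (\<beta> - 1))"
        using params by simp
      ultimately have 1: "((\<lambda>t. C' / \<beta> * (t powr \<beta> * s powr (\<beta> - 1))) has_real_derivative C' * (t powr (\<beta> - 1) * s powr (\<beta> - 1))) (at t)"
        by simp
      have "((\<lambda>t. R' t s - F' t s) has_real_derivative \<Psi> t s) (at t)"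
        using DERIV_diff[OF R3[OF ts ne] F'_deriv[OF ne]] by simp
      from DERIV_add[OF 1 DERIV_cmult[OF this]]
      show "((\<lambda>t. C' / \<beta> * (t powr \<beta> * s powr (\<beta> - 1)) + \<sigma> * (R' t s - F' t s)) has_real_derivative
         C' * (t powr (\<beta> - 1) * s powr (\<beta> - 1)) + \<sigma> * \<Psi> t s) (at t)" .
      have "\<bar>\<sigma> * \<Psi> t s\<bar> \<le> C' * (t powr (\<beta> - 1) * s powr (\<beta> - 1))"
        using \<Psi>[OF ts ne] ts \<sigma> by (simp add: abs_mult powr_mult)
      then show "0 \<le> C' * (t powr (\<beta> - 1) * s powr (\<beta> - 1)) + \<sigma> * \<Psi> t s" by linarith
    qed (use ab in auto)
  qed (use ab in auto)
  have "second_diff q a b c d = C' / \<beta>\<^sup>2 * (b powr \<beta> - a powr \<beta>) * (d powr \<beta> - c powr \<beta>)"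
  proof -
    have "second_diff (\<lambda>t s. B * (t powr \<beta> * s powr \<beta>)) a b c d = B * (b powr \<beta> - a powr \<beta>) * (d powr \<beta> - c powr \<beta>)" for B
      by (simp add: algebra_simps)
    then show ?thesis unfolding q_def .
  qed
  then show ?thesis using main[of 1] main[of "-1"] by (simp add: abs_le_iff)
qed

lemma powr_mono_nonneg: "0 \<le> a \<Longrightarrow> a \<le> b \<Longrightarrow> a powr \<beta> \<le> b powr \<beta>"
  using params by (intro powr_mono2) auto

lemma second_diff_R_le:
  assumes "0 \<le> a" "a \<le> b" "0 \<le> c" "c \<le> d"
  shows "\<bar>second_diff R a b c d\<bar> \<le> second_diff F a b c d + C' / \<beta>\<^sup>2 * (b powr \<beta> - a powr \<beta>) * (d powr \<beta> - c powr \<beta>)"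
  using second_diff_P_le[OF assms] second_diff_F_nonneg[OF assms] by (simp add: abs_le_iff)

definition K1 where "K1 = 2 * c0 + C' / \<beta>\<^sup>2"

lemma K1_nonneg: "0 \<le> K1" using c0_pos params by (simp add: K1_def)

text \<open>Over a square on the diagonal F contributes 2 c0 (t - s)^(2\<beta>). Subadditivity gives
  t^\<beta> - s^\<beta> \<le> (t - s)^\<beta>, which puts the contribution of \<Psi> under the same
  power; the two constants add up to \<open>K1\<close>.\<close>

lemma R_increment:
  assumes s: "0 \<le> s" "s \<le> t"
  shows "R t t - 2 * R t s + R s s \<le> K1 * (t - s) powr (2 * \<beta>)"
proof -
  have "(t powr \<beta> - s powr \<beta>) * (t powr \<beta> - s powr \<beta>) \<le> (t - s) powr \<beta> * (t - s) powr \<beta>"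
    using powr_subadditive[of s "t - s" \<beta>] powr_mono_nonneg[OF s] s params by (intro mult_mono) auto
  also have "\<dots> = (t - s) powr (2 * \<beta>)" by (simp add: powr_add[symmetric])
  finally have "C' / \<beta>\<^sup>2 * ((t powr \<beta> - s powr \<beta>) * (t powr \<beta> - s powr \<beta>)) \<le> C' / \<beta>\<^sup>2 * (t - s) powr (2 * \<beta>)"
    using params by (intro mult_left_mono) auto
  moreover have "second_diff F s t s t = 2 * c0 * (t - s) powr (2 * \<beta>)"
    using s by (simp add: F_def algebra_simps)
  moreover have "R t t - 2 * R t s + R s s = second_diff R s t s t" using R_sym[of s t] by simp
  moreover have "second_diff R s t s t \<le> second_diff F s t s t + C' / \<beta>\<^sup>2 * ((t powr \<beta> - s powr \<beta>) * (t powr \<beta> - s powr \<beta>))"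
    using abs_le_D1[OF second_diff_R_le[OF s s]] by (simp only: mult.assoc)
  ultimately show ?thesis unfolding K1_def distrib_right by linarith
qed

definition Q where "Q t = F t t + C' / \<beta>\<^sup>2 * (t powr \<beta> * t powr \<beta>)"

text \<open>The majorant of the increments of R is additive over rectangles, so its sum telescopes
  to the value on the square with side [0, x n], whatever the grid. \<open>Q\<close> therefore
  bounds the total variation of the covariance.\<close>

lemma second_diff_R_sum_le:
  assumes x: "\<And>j. 0 \<le> x j" "\<And>j. x j \<le> x (Suc j)" "x 0 = 0"
  shows "(\<Sum>j<n. \<Sum>l<n. \<bar>second_diff R (x j) (x (Suc j)) (x l) (x (Suc l))\<bar>) \<le> Q (x n)"
proof -
  have tele: "(\<Sum>l<n. second_diff W a b (x l) (x (Suc l))) = (W b (x n) - W a (x n)) - (W b 0 - W a 0)" for W a b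
    using sum_lessThan_telescope[of "\<lambda>l. W b (x l) - W a (x l)" n] x(3) by (simp add: algebra_simps)
  have F0: "F 0 t = 0" "F t 0 = 0" if "0 \<le> t" for t using that by (simp_all add: F_def)
  have "(\<Sum>j<n. \<Sum>l<n. \<bar>second_diff R (x j) (x (Suc j)) (x l) (x (Suc l))\<bar>) \<le>
     (\<Sum>j<n. \<Sum>l<n. second_diff F (x j) (x (Suc j)) (x l) (x (Suc l)) +
        C' / \<beta>\<^sup>2 * ((x (Suc j) powr \<beta> - x j powr \<beta>) * (x (Suc l) powr \<beta> - x l powr \<beta>)))"
    using second_diff_R_le x by (intro sum_mono) (simp add: mult.assoc)
  also have "\<dots> = (\<Sum>j<n. \<Sum>l<n. second_diff F (x j) (x (Suc j)) (x l) (x (Suc l))) +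
      C' / \<beta>\<^sup>2 * ((\<Sum>j<n. x (Suc j) powr \<beta> - x j powr \<beta>) * (\<Sum>l<n. x (Suc l) powr \<beta> - x l powr \<beta>))"
    unfolding sum.distrib sum_product by (simp only: sum_distrib_left)
  also have "(\<Sum>j<n. \<Sum>l<n. second_diff F (x j) (x (Suc j)) (x l) (x (Suc l))) = (\<Sum>j<n. F (x (Suc j)) (x n) - F (x j) (x n))"
    unfolding tele by (simp add: F0 x(1))
  also have "(\<Sum>j<n. F (x (Suc j)) (x n) - F (x j) (x n)) +
      C' / \<beta>\<^sup>2 * ((\<Sum>j<n. x (Suc j) powr \<beta> - x j powr \<beta>) * (\<Sum>l<n. x (Suc l) powr \<beta> - x l powr \<beta>)) =
    F (x n) (x n) - F (x 0) (x n) + C' / \<beta>\<^sup>2 * ((x n powr \<beta> - x 0 powr \<beta>) * (x n powr \<beta> - x 0 powr \<beta>))"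
    by (simp only: sum_lessThan_telescope[of "\<lambda>j. F (x j) (x n)"] sum_lessThan_telescope[of "\<lambda>j. x j powr \<beta>"])
  also have "\<dots> = Q (x n)" using x params F0[OF x(1)[of n]] by (simp add: Q_def)
  finally show ?thesis .
qed

end

text \<open>One B each for the end value, the boundary term at m and the integral, whose weight is
  at most 1.\<close>

lemma ou_op_abs_le:
  assumes \<theta>: "0 < \<theta>" and mt: "m \<le> t" and g: "continuous_on {m..t} g" and b: "\<And>s. s \<in> {m..t} \<Longrightarrow> \<bar>g s\<bar> \<le> B"
  shows "\<bar>ou_op \<theta> m t g\<bar> \<le> 3 * B"
proof -
  have B: "0 \<le> B" using b[of m] mt by auto
  have "norm (integral {m..t} (\<lambda>s. exp (- \<theta> * (t - s)) * g s)) \<le> integral {m..t} (\<lambda>s. exp (- \<theta> * (t - s)) * B)"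
    using b by (intro integral_norm_bound_integral ou_kernel_integrable[OF \<theta>] g continuous_intros) (auto simp: abs_mult)
  also have "\<dots> = (1 - exp (- \<theta> * (t - m))) / \<theta> * B"
    using integral_exp_kernel[OF \<theta> mt] by (simp add: integral_mult_left del: mult_minus_left)
  finally have "\<theta> * \<bar>integral {m..t} (\<lambda>s. exp (- \<theta> * (t - s)) * g s)\<bar> \<le> (1 - exp (- \<theta> * (t - m))) * B"
    using \<theta> by (simp add: field_simps del: mult_minus_left)
  also have "\<dots> \<le> 1 * B" using B by (intro mult_right_mono) auto
  finally have 1: "\<bar>\<theta> * integral {m..t} (\<lambda>s. exp (- \<theta> * (t - s)) * g s)\<bar> \<le> B" using \<theta> by (simp add: abs_mult)
  have "exp (- \<theta> * (t - m)) * \<bar>g m\<bar> \<le> 1 * B" using b[of m] \<theta> mt B by (intro mult_mono) auto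
  then have 2: "\<bar>exp (- \<theta> * (t - m)) * g m\<bar> \<le> B" by (simp add: abs_mult)
  show ?thesis unfolding ou_op_def using 1 2 b[of t] mt by (auto simp: abs_le_iff)
qed

section \<open>The covariance of the Ornstein-Uhlenbeck process\<close>

context noise_covariance
begin

abbreviation L :: "real \<Rightarrow> (real \<Rightarrow> real) \<Rightarrow> real" where "L \<equiv> ou_op \<theta> 0"

lemma section_cont:
  fixes W :: "real \<Rightarrow> real \<Rightarrow> real"
  assumes W: "continuous_on ({0..} \<times> {0..}) (\<lambda>(t, s). W t s)" and "0 \<le> m" "0 \<le> u"
  shows "continuous_on {m..t} (W u)"
proof -
  have "continuous_on {m..t} (\<lambda>v. (\<lambda>(t, s). W t s) (u, v))"
    by (rule continuous_on_compose2[OF W]) (use assms in \<open>auto intro!: continuous_intros\<close>)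
  then show ?thesis by simp
qed

lemma L_section_cont:
  fixes W :: "real \<Rightarrow> real \<Rightarrow> real"
  assumes W: "continuous_on ({0..} \<times> {0..}) (\<lambda>(t, s). W t s)" and "0 \<le> m" "m \<le> t"
  shows "continuous_on {0..s} (\<lambda>u. ou_op \<theta> m t (W u))"
  by (intro ou_op_continuous_param[OF \<theta>] assms continuous_on_subset[OF W]) (use assms in auto)

lemma pow_cont: "0 \<le> m \<Longrightarrow> 0 < a \<Longrightarrow> continuous_on {m..t} (\<lambda>u::real. u powr a)"
  by (rule continuous_on_powr_pos[OF continuous_on_id]) auto

text \<open>One factor of the contribution of \<Psi> to the variance; formally \<beta> times the
  integral of exp(-\<theta> (t - u)) u^(\<beta> - 1) over [0, t].\<close>

definition ell where "ell t = L t (\<lambda>u. u powr \<beta>)"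

lemma ell_nonneg: "0 \<le> t \<Longrightarrow> 0 \<le> ell t"
  unfolding ell_def using params by (intro ou_op_nonneg[OF \<theta>] pow_cont powr_mono_nonneg) auto

lemma ell_le: "0 \<le> t \<Longrightarrow> ell t \<le> t powr \<beta>"
  unfolding ell_def using params by (intro ou_op_le_end[OF \<theta>] pow_cont) auto

text \<open>Splitting at t / 2: the older half is damped exponentially, and on the recent half the
  power with exponent \<beta> is Lipschitz with constant \<beta> (t / 2)^(\<beta> - 1), which tends
  to 0.\<close>

lemma ell_split:
  assumes t: "0 < t"
  shows "ell t \<le> exp (- \<theta> * (t / 2)) * (t / 2) powr \<beta> + \<beta> * (t / 2) powr (\<beta> - 1) / \<theta>"
proof -
  have "ell t = exp (- \<theta> * (t - t / 2)) * ell (t / 2) + ou_op \<theta> (t / 2) t (\<lambda>u. u powr \<beta>)"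
    unfolding ell_def by (rule ou_op_split[OF \<theta>]) (use t params in \<open>auto intro!: pow_cont\<close>)
  moreover have "exp (- \<theta> * (t - t / 2)) * ell (t / 2) \<le> exp (- \<theta> * (t / 2)) * (t / 2) powr \<beta>"
    using ell_le[of "t / 2"] t by (simp add: field_simps)
  moreover have "ou_op \<theta> (t / 2) t (\<lambda>u. u powr \<beta>) \<le> ou_op \<theta> (t / 2) t (\<lambda>u. (\<beta> * (t / 2) powr (\<beta> - 1)) * u)"
  proof (rule order_trans[OF abs_ge_self ou_op_dominated[OF \<theta>]])
    show "\<bar>v powr \<beta> - u powr \<beta>\<bar> \<le> (\<beta> * (t / 2) powr (\<beta> - 1)) * v - (\<beta> * (t / 2) powr (\<beta> - 1)) * u"
      if "t / 2 \<le> u" "u \<le> v" "v \<le> t" for u v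
      using powr_diff_le[of "t / 2" u v \<beta>] powr_mono_nonneg[of u v] that t params
      by (simp add: right_diff_distrib)
  qed (use t in \<open>auto intro!: continuous_intros\<close>)
  moreover have "ou_op \<theta> (t / 2) t (\<lambda>u. (\<beta> * (t / 2) powr (\<beta> - 1)) * u) \<le> (\<beta> * (t / 2) powr (\<beta> - 1)) * (1 / \<theta>)"
    unfolding ou_op_cmult[OF \<theta>] using t params by (intro mult_left_mono ou_op_id_le[OF \<theta>]) auto
  moreover have "(\<beta> * (t / 2) powr (\<beta> - 1)) * (1 / \<theta>) = \<beta> * (t / 2) powr (\<beta> - 1) / \<theta>" by simp
  ultimately show ?thesis by linarith
qed

lemma ell_lim: "(ell \<longlongrightarrow> 0) at_top"
proof (rule tendsto_sandwich)
  show "eventually (\<lambda>t. 0 \<le> ell t) at_top"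
    using eventually_ge_at_top[of 0] by eventually_elim (rule ell_nonneg)
  show "eventually (\<lambda>t. ell t \<le> exp (- \<theta> * (t / 2)) * (t / 2) powr \<beta> + \<beta> * (t / 2) powr (\<beta> - 1) / \<theta>) at_top"
    using eventually_gt_at_top[of 0] by eventually_elim (rule ell_split)
  have "((\<lambda>t. exp (- \<theta> * (t / 2)) * (t / 2) powr \<beta>) \<longlongrightarrow> 0) at_top"
    using \<theta> params by real_asymp
  moreover have "((\<lambda>t. (t / 2) powr (\<beta> - 1)) \<longlongrightarrow> 0) at_top"
    using params by real_asymp
  ultimately show "((\<lambda>t. exp (- \<theta> * (t / 2)) * (t / 2) powr \<beta> + \<beta> * (t / 2) powr (\<beta> - 1) / \<theta>) \<longlongrightarrow> 0) at_top"
    using tendsto_add[of "\<lambda>t. exp (- \<theta> * (t / 2)) * (t / 2) powr \<beta>" 0 at_top "\<lambda>t. (\<beta> / \<theta>) * (t / 2) powr (\<beta> - 1)" 0]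
      tendsto_mult_right_zero[of "\<lambda>t. (t / 2) powr (\<beta> - 1)" at_top "\<beta> / \<theta>"] by simp
qed simp

lemma ell_bounded: "\<exists>B\<ge>0. \<forall>t\<ge>0. ell t \<le> B"
proof -
  have "eventually (\<lambda>t. ell t < 1) at_top" using ell_lim by (rule order_tendstoD) simp
  then obtain T where T: "\<And>t. T \<le> t \<Longrightarrow> ell t < 1" by (auto simp: eventually_at_top_linorder)
  have "ell t \<le> 1 + \<bar>T\<bar> powr \<beta>" if "0 \<le> t" for t
  proof (cases "T \<le> t")
    case True
    then show ?thesis using T[OF True] by (smt (verit) powr_ge_zero)
  next
    case False
    then have "t powr \<beta> \<le> \<bar>T\<bar> powr \<beta>" using that by (intro powr_mono_nonneg) auto
    then show ?thesis using ell_le[OF that] by simp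
  qed
  then show ?thesis by (intro exI[of _ "1 + \<bar>T\<bar> powr \<beta>"]) auto
qed

text \<open>Since \<open>X t = L t G\<close> pathwise, this is \<open>E[X s * X t]\<close>.\<close>

definition K where "K s t = L s (\<lambda>u. L t (R u))"

definition F_ou_variance where "F_ou_variance t = L t (\<lambda>u. L t (F u))"

text \<open>The rectangle increments of R - F are dominated by those of a product, so the double
  operator is bounded by a product of two single ones.\<close>

lemma K_F_ou_variance:
  assumes t: "0 \<le> t" shows "\<bar>K t t - F_ou_variance t\<bar> \<le> C' / \<beta>\<^sup>2 * (ell t * ell t)"
proof -
  have "K t t - F_ou_variance t = L t (\<lambda>u. L t (R u) - L t (F u))"
    unfolding K_def F_ou_variance_def using t by (intro ou_op_diff[OF \<theta>, symmetric] L_section_cont R_cont F_cont) auto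
  also have "\<dots> = L t (\<lambda>u. L t (\<lambda>v. R u v - F u v))"
    using t by (intro ou_op_cong[OF \<theta>] ou_op_diff[OF \<theta>, symmetric] section_cont R_cont F_cont) auto
  also have "\<bar>\<dots>\<bar> \<le> L t (\<lambda>u. C' / \<beta>\<^sup>2 * u powr \<beta>) * L t (\<lambda>v. v powr \<beta>)"
  proof (rule ou_op_dominated2[OF \<theta> t t])
    show "continuous_on {0..t} (\<lambda>u. C' / \<beta>\<^sup>2 * u powr \<beta>)" "continuous_on {0..t} (\<lambda>v. v powr \<beta>)"
      by (intro continuous_on_mult continuous_on_const pow_cont params order_refl)+
    show "continuous_on {0..t} (\<lambda>v. R u v - F u v)" if "u \<in> {0..t}" for u
      using that by (intro continuous_on_diff section_cont R_cont F_cont) auto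
    show "\<bar>R u' v' - F u' v' - (R u' v - F u' v) - (R u v' - F u v') + (R u v - F u v)\<bar>
         \<le> (C' / \<beta>\<^sup>2 * u' powr \<beta> - C' / \<beta>\<^sup>2 * u powr \<beta>) * (v' powr \<beta> - v powr \<beta>)"
      if "0 \<le> u" "u \<le> u'" "u' \<le> t" "0 \<le> v" "v \<le> v'" "v' \<le> t" for u u' v v'
      using second_diff_P_le[of u u' v v'] that by (simp add: right_diff_distrib)
  qed
  also have "\<dots> = C' / \<beta>\<^sup>2 * (ell t * ell t)"
    unfolding ou_op_cmult[OF \<theta>] ell_def by simp
  finally show ?thesis .
qed

section \<open>The limiting variance in the fractional case\<close>

definition A where "A t = integral {0..t} (\<lambda>v. exp (- \<theta> * (t - v)) * (t - v) powr (2 * \<beta>))"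

definition Ainf where "Ainf = Gamma (2 * \<beta> + 1) / \<theta> powr (2 * \<beta> + 1)"

lemma A_lim: "(A \<longlongrightarrow> Ainf) at_top"
  unfolding A_def Ainf_def using params by (intro exp_powr_integral_tendsto \<theta>) auto

lemma A_cont: "continuous_on {0..b} A"
proof -
  have "A = (\<lambda>t. integral {0..t} (\<lambda>x. exp (- \<theta> * x) * x powr (2 * \<beta>)))"
    unfolding A_def by (rule ext, rule exp_powr_integral_reflect) (use params in simp)
  moreover have "continuous_on {0..b} (\<lambda>x. exp (- \<theta> * x) * x powr (2 * \<beta>))"
    using params by (intro continuous_on_mult continuous_on_exp continuous_on_const continuous_on_id pow_cont) auto
  ultimately show ?thesis by (auto intro!: indefinite_integral_continuous_1 integrable_continuous_real)
qed

text \<open>\<open>A\<close>, \<open>B\<close> and \<open>D\<close> are the integrals that arise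
  when the double operator is expanded on |u - v|^(2\<beta>): one variable held at t, one variable
  held at 0, and both variables integrated.\<close>

definition B where "B t = integral {0..t} (\<lambda>v. exp (- \<theta> * (t - v)) * v powr (2 * \<beta>))"

definition D where "D t = integral {0..t} (\<lambda>u. integral {0..t} (\<lambda>v. exp (- \<theta> * (t - u)) * (exp (- \<theta> * (t - v)) * \<bar>u - v\<bar> powr (2 * \<beta>))))"

lemma N_cont: "continuous_on S (\<lambda>z. \<bar>fst z - snd z\<bar> powr (2 * \<beta>))"
  using params by (intro continuous_on_powr_pos continuous_on_rabs continuous_on_diff continuous_on_fst continuous_on_snd continuous_on_id) auto

text \<open>By symmetry the square reduces to twice the triangle v \<le> u. There exp(-\<theta> (t -
  u)) exp(-\<theta> (t - v)) equals exp(-2\<theta> (t - u)) exp(-\<theta> (u - v)), and the inner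
  integral is A u.\<close>

lemma D_eq:
  assumes t: "0 \<le> t" shows "D t = 2 * integral {0..t} (\<lambda>u. exp (- (2 * \<theta>) * (t - u)) * A u)"
proof -
  have "D t = 2 * integral {0..t} (\<lambda>u. integral {0..u} (\<lambda>v. exp (- \<theta> * (t - u)) * (exp (- \<theta> * (t - v)) * \<bar>u - v\<bar> powr (2 * \<beta>))))"
    unfolding D_def
  proof (rule integral_symmetric_square[OF t])
    show "continuous_on ({0..t} \<times> {0..t}) (\<lambda>(u, v). exp (- \<theta> * (t - u)) * (exp (- \<theta> * (t - v)) * \<bar>u - v\<bar> powr (2 * \<beta>)))"
      unfolding case_prod_unfold by (intro continuous_on_mult N_cont continuous_on_exp continuous_on_const continuous_on_diff continuous_on_fst continuous_on_snd continuous_on_id)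
  qed (simp add: abs_minus_commute mult_ac)
  also have "integral {0..t} (\<lambda>u. integral {0..u} (\<lambda>v. exp (- \<theta> * (t - u)) * (exp (- \<theta> * (t - v)) * \<bar>u - v\<bar> powr (2 * \<beta>)))) =
     integral {0..t} (\<lambda>u. exp (- (2 * \<theta>) * (t - u)) * A u)"
  proof (rule integral_cong)
    fix u assume "u \<in> {0..t}"
    have "integral {0..u} (\<lambda>v. exp (- \<theta> * (t - u)) * (exp (- \<theta> * (t - v)) * \<bar>u - v\<bar> powr (2 * \<beta>))) =
        integral {0..u} (\<lambda>v. exp (- (2 * \<theta>) * (t - u)) * (exp (- \<theta> * (u - v)) * (u - v) powr (2 * \<beta>)))"
    proof (rule integral_cong)
      fix v assume "v \<in> {0..u}"
      then have "\<bar>u - v\<bar> = u - v" by simp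
      moreover have "exp (- \<theta> * (t - u)) * exp (- \<theta> * (t - v)) = exp (- (2 * \<theta>) * (t - u)) * exp (- \<theta> * (u - v))"
        by (simp only: mult_exp_exp) (simp add: algebra_simps)
      ultimately show "exp (- \<theta> * (t - u)) * (exp (- \<theta> * (t - v)) * \<bar>u - v\<bar> powr (2 * \<beta>)) =
        exp (- (2 * \<theta>) * (t - u)) * (exp (- \<theta> * (u - v)) * (u - v) powr (2 * \<beta>))"
        by (simp only: mult.assoc[symmetric])
    qed
    then show "integral {0..u} (\<lambda>v. exp (- \<theta> * (t - u)) * (exp (- \<theta> * (t - v)) * \<bar>u - v\<bar> powr (2 * \<beta>))) = exp (- (2 * \<theta>) * (t - u)) * A u"
      unfolding A_def by (simp only: integral_mult_right)
  qed
  finally show ?thesis .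
qed

text \<open>The operator annihilates constants, hence those summands of F that depend on one of the
  two variables only. What remains is -c0 times the double operator on |u - v|^(2\<beta>), expanded
  term by term.\<close>

lemma F_ou_variance_eq:
  assumes t: "0 \<le> t"
  shows "F_ou_variance t = c0 * (2 * \<theta> * A t - \<theta>\<^sup>2 * D t + 2 * (exp (- \<theta> * t) * t powr (2 * \<beta>)) - 2 * \<theta> * (exp (- \<theta> * t) * B t))"
proof -
  let ?p = "2 * \<beta>"
  have p: "0 < ?p" using params by simp
  define n where "n u = L t (\<lambda>v. \<bar>u - v\<bar> powr ?p)" for u
  have Nc: "continuous_on {0..t} (\<lambda>v. \<bar>u - v\<bar> powr ?p)" "continuous_on {0..t} (\<lambda>v. \<bar>v - u\<bar> powr ?p)" for u
    by (intro continuous_on_powr_pos continuous_on_rabs continuous_on_diff continuous_on_const continuous_on_id abs_ge_zero p)+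
  have nc: "continuous_on {0..t} n"
    unfolding n_def
    by (rule ou_op_continuous_param[OF \<theta> t]) (use N_cont in \<open>simp add: case_prod_unfold\<close>)
  have LF: "L t (F u) = c0 * (L t (\<lambda>v. v powr ?p)) - c0 * n u" for u
  proof -
    have "F u = (\<lambda>v. c0 * ((u powr ?p + v powr ?p) - \<bar>u - v\<bar> powr ?p))" by (simp add: F_def fun_eq_iff)
    then have "L t (F u) = c0 * (L t (\<lambda>v. u powr ?p + v powr ?p) - n u)"
      using ou_op_cmult[OF \<theta>]
        ou_op_diff[OF \<theta>, of 0 t "\<lambda>v. u powr ?p + v powr ?p" "\<lambda>v. \<bar>u - v\<bar> powr ?p"]
        continuous_on_add[OF continuous_on_const pow_cont[OF order_refl p], of t "u powr ?p"] Nc(1)[of u]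
      by (simp add: n_def)
    also have "L t (\<lambda>v. u powr ?p + v powr ?p) = L t (\<lambda>v. v powr ?p)"
      using ou_op_add[OF \<theta> continuous_on_const pow_cont[OF _ p], of 0 t "u powr ?p"] ou_op_const[OF \<theta> t] by simp
    finally show ?thesis by (simp add: right_diff_distrib)
  qed
  have "F_ou_variance t = - (c0 * L t n)"
    unfolding F_ou_variance_def LF
    using ou_op_diff[OF \<theta> continuous_on_const continuous_on_mult[OF continuous_on_const nc], of "c0 * L t (\<lambda>v. v powr ?p)" c0]
      ou_op_const[OF \<theta> t] ou_op_cmult[OF \<theta>] by simp
  moreover have "L t n = - 2 * \<theta> * A t + \<theta>\<^sup>2 * D t - 2 * (exp (- \<theta> * t) * t powr ?p) + 2 * \<theta> * (exp (- \<theta> * t) * B t)"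
  proof -
    have At: "integral {0..t} (\<lambda>v. exp (- \<theta> * (t - v)) * \<bar>t - v\<bar> powr ?p) = A t"
      "integral {0..t} (\<lambda>v. exp (- \<theta> * (t - v)) * \<bar>v - t\<bar> powr ?p) = A t"
      unfolding A_def by (auto intro!: integral_cong)
    have Bt: "integral {0..t} (\<lambda>v. exp (- \<theta> * (t - v)) * \<bar>0 - v\<bar> powr ?p) = B t"
       "integral {0..t} (\<lambda>v. exp (- \<theta> * (t - v)) * \<bar>v - 0\<bar> powr ?p) = B t"
      unfolding B_def by (auto intro!: integral_cong)
    have n_eq: "n u = \<bar>u - t\<bar> powr ?p - exp (- \<theta> * t) * \<bar>u - 0\<bar> powr ?p
        - \<theta> * integral {0..t} (\<lambda>v. exp (- \<theta> * (t - v)) * \<bar>u - v\<bar> powr ?p)" for u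
      unfolding n_def ou_op_def by simp
    have nt: "n t = - (exp (- \<theta> * t) * t powr ?p) - \<theta> * A t"
      unfolding n_eq At using t by simp
    have n0: "n 0 = t powr ?p - \<theta> * B t"
      unfolding n_eq Bt using t by simp
    have ic: "(\<lambda>u. exp (- \<theta> * (t - u)) * \<bar>u - t\<bar> powr ?p) integrable_on {0..t}"
      "(\<lambda>u. exp (- \<theta> * (t - u)) * \<bar>u - 0\<bar> powr ?p) integrable_on {0..t}"
      by (intro ou_kernel_integrable[OF \<theta>] Nc)+
    have "continuous_on {0..t} (\<lambda>u. integral (cbox 0 t) (\<lambda>v. exp (- \<theta> * (t - v)) * \<bar>u - v\<bar> powr ?p))"
      by (rule integral_continuous_on_param)
        (unfold case_prod_unfold, intro continuous_on_mult N_cont continuous_on_exp continuous_on_const continuous_on_diff continuous_on_fst continuous_on_snd continuous_on_id)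
    then have id: "(\<lambda>u. exp (- \<theta> * (t - u)) * integral {0..t} (\<lambda>v. exp (- \<theta> * (t - v)) * \<bar>u - v\<bar> powr ?p)) integrable_on {0..t}"
      by (intro ou_kernel_integrable[OF \<theta>]) simp
    have Dt: "integral {0..t} (\<lambda>u. exp (- \<theta> * (t - u)) * integral {0..t} (\<lambda>v. exp (- \<theta> * (t - v)) * \<bar>u - v\<bar> powr ?p)) = D t"
      unfolding D_def by (simp add: integral_mult_right)
    have "integral {0..t} (\<lambda>u. exp (- \<theta> * (t - u)) * n u) =
        integral {0..t} (\<lambda>u. exp (- \<theta> * (t - u)) * \<bar>u - t\<bar> powr ?p - exp (- \<theta> * t) * (exp (- \<theta> * (t - u)) * \<bar>u - 0\<bar> powr ?p)
         - \<theta> * (exp (- \<theta> * (t - u)) * integral {0..t} (\<lambda>v. exp (- \<theta> * (t - v)) * \<bar>u - v\<bar> powr ?p)))"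
      unfolding n_eq by (rule integral_cong) (simp add: algebra_simps)
    also have "\<dots> = A t - exp (- \<theta> * t) * B t - \<theta> * D t"
    proof -
      note cm = integrable_on_mult_right
      have "integral {0..t} (\<lambda>u. exp (- \<theta> * (t - u)) * \<bar>u - t\<bar> powr ?p - exp (- \<theta> * t) * (exp (- \<theta> * (t - u)) * \<bar>u - 0\<bar> powr ?p)
         - \<theta> * (exp (- \<theta> * (t - u)) * integral {0..t} (\<lambda>v. exp (- \<theta> * (t - v)) * \<bar>u - v\<bar> powr ?p))) =
         integral {0..t} (\<lambda>u. exp (- \<theta> * (t - u)) * \<bar>u - t\<bar> powr ?p - exp (- \<theta> * t) * (exp (- \<theta> * (t - u)) * \<bar>u - 0\<bar> powr ?p))
         - integral {0..t} (\<lambda>u. \<theta> * (exp (- \<theta> * (t - u)) * integral {0..t} (\<lambda>v. exp (- \<theta> * (t - v)) * \<bar>u - v\<bar> powr ?p)))"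
        by (rule Henstock_Kurzweil_Integration.integral_diff) (intro integrable_diff cm ic id)+
      also have "integral {0..t} (\<lambda>u. exp (- \<theta> * (t - u)) * \<bar>u - t\<bar> powr ?p - exp (- \<theta> * t) * (exp (- \<theta> * (t - u)) * \<bar>u - 0\<bar> powr ?p)) =
         integral {0..t} (\<lambda>u. exp (- \<theta> * (t - u)) * \<bar>u - t\<bar> powr ?p) - integral {0..t} (\<lambda>u. exp (- \<theta> * t) * (exp (- \<theta> * (t - u)) * \<bar>u - 0\<bar> powr ?p))"
        by (rule Henstock_Kurzweil_Integration.integral_diff) (intro cm ic)+
      finally show ?thesis unfolding integral_mult_right At Bt Dt .
    qed
    finally have In: "integral {0..t} (\<lambda>u. exp (- \<theta> * (t - u)) * n u) = A t - exp (- \<theta> * t) * B t - \<theta> * D t" .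
    show ?thesis
      unfolding ou_op_def[of \<theta> 0 t n] In nt n0 by (simp add: algebra_simps power2_eq_square)
  qed
  ultimately show ?thesis by (simp add: algebra_simps)
qed

text \<open>As an exponential average of A with rate 2\<theta>, doubled, D tends to Ainf / \<theta>,
  and the two terms with exp(-\<theta> t) die out. This leaves c0 \<theta> Ainf, where two steps of
  the Gamma recursion cancel the factor 2\<beta> (2\<beta> - 1) in the denominator of c0.\<close>

lemma F_ou_variance_lim: "(F_ou_variance \<longlongrightarrow> C * Gamma (2 * \<beta> - 1) * \<theta> powr (- (2 * \<beta>))) at_top"
proof -
  have B0: "0 \<le> B t" "B t \<le> t powr (2 * \<beta>) / \<theta>" if t: "0 \<le> t" for t
  proof -
    have i: "(\<lambda>v. exp (- \<theta> * (t - v)) * v powr (2 * \<beta>)) integrable_on {0..t}"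
      using params by (intro ou_kernel_integrable[OF \<theta>] pow_cont) auto
    show "0 \<le> B t" unfolding B_def by (rule integral_nonneg[OF i]) auto
    have "B t \<le> integral {0..t} (\<lambda>v. exp (- \<theta> * (t - v)) * t powr (2 * \<beta>))"
      unfolding B_def using params
      by (intro integral_le i ou_kernel_integrable[OF \<theta>] continuous_on_const mult_left_mono powr_mono2) auto
    also have "\<dots> = (1 - exp (- \<theta> * (t - 0))) / \<theta> * t powr (2 * \<beta>)"
      using integral_exp_kernel[OF \<theta> t] by (simp add: integral_mult_left del: mult_minus_left)
    also have "\<dots> \<le> (1 / \<theta>) * t powr (2 * \<beta>)"
      using \<theta> by (intro mult_right_mono divide_right_mono) auto
    finally show "B t \<le> t powr (2 * \<beta>) / \<theta>" by simp
  qed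
  have e0: "((\<lambda>t. exp (- \<theta> * t) * t powr (2 * \<beta>)) \<longlongrightarrow> 0) at_top" using \<theta> params by real_asymp
  have eB: "((\<lambda>t. exp (- \<theta> * t) * B t) \<longlongrightarrow> 0) at_top"
  proof (rule tendsto_sandwich[OF _ _ tendsto_const])
    show "eventually (\<lambda>t. 0 \<le> exp (- \<theta> * t) * B t) at_top"
      using eventually_ge_at_top[of 0] by eventually_elim (simp add: B0)
    show "eventually (\<lambda>t. exp (- \<theta> * t) * B t \<le> (1 / \<theta>) * (exp (- \<theta> * t) * t powr (2 * \<beta>))) at_top"
      using eventually_ge_at_top[of 0]
    proof eventually_elim
      case (elim t)
      have "exp (- \<theta> * t) * B t \<le> exp (- \<theta> * t) * (t powr (2 * \<beta>) / \<theta>)" using B0[OF elim] by (intro mult_left_mono) auto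
      then show ?case by simp
    qed
    show "((\<lambda>t. (1 / \<theta>) * (exp (- \<theta> * t) * t powr (2 * \<beta>))) \<longlongrightarrow> 0) at_top" by (rule tendsto_mult_right_zero[OF e0])
  qed
  have D0: "(D \<longlongrightarrow> 2 * (Ainf / (2 * \<theta>))) at_top"
  proof (rule Lim_transform_eventually)
    show "((\<lambda>t. 2 * integral {0..t} (\<lambda>u. exp (- (2 * \<theta>) * (t - u)) * A u)) \<longlongrightarrow> 2 * (Ainf / (2 * \<theta>))) at_top"
      using \<theta> by (intro tendsto_intros exp_average_tendsto A_cont A_lim) auto
    show "eventually (\<lambda>t. 2 * integral {0..t} (\<lambda>u. exp (- (2 * \<theta>) * (t - u)) * A u) = D t) at_top"
      using eventually_ge_at_top[of 0] by eventually_elim (simp add: D_eq)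
  qed
  have "((\<lambda>t. c0 * (2 * \<theta> * A t - \<theta>\<^sup>2 * D t + 2 * (exp (- \<theta> * t) * t powr (2 * \<beta>)) - 2 * \<theta> * (exp (- \<theta> * t) * B t)))
     \<longlongrightarrow> c0 * (2 * \<theta> * Ainf - \<theta>\<^sup>2 * (2 * (Ainf / (2 * \<theta>))) + 2 * 0 - 2 * \<theta> * 0)) at_top"
    by (intro tendsto_add tendsto_diff tendsto_mult tendsto_const A_lim D0 e0 eB)
  also have "c0 * (2 * \<theta> * Ainf - \<theta>\<^sup>2 * (2 * (Ainf / (2 * \<theta>))) + 2 * 0 - 2 * \<theta> * 0) = c0 * (\<theta> * Ainf)"
    using \<theta> by (simp add: power2_eq_square)
  also have "\<dots> = C * Gamma (2 * \<beta> - 1) * \<theta> powr (- (2 * \<beta>))"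
  proof -
    have np: "x \<notin> \<int>\<^sub>\<le>\<^sub>0" if "0 < x" for x :: real using nonpos_Ints_nonpos[of x] that by auto
    have "Gamma (2 * \<beta> + 1) = 2 * \<beta> * Gamma (2 * \<beta>)" using params by (intro Gamma_plus1 np) simp
    moreover have "Gamma (2 * \<beta> - 1 + 1) = (2 * \<beta> - 1) * Gamma (2 * \<beta> - 1)" using params by (intro Gamma_plus1 np) simp
    ultimately have "c0 * Gamma (2 * \<beta> + 1) = C * Gamma (2 * \<beta> - 1)"
      using params by (simp add: c0_def)
    moreover have "\<theta> / \<theta> powr (2 * \<beta> + 1) = \<theta> powr (- (2 * \<beta>))" using \<theta> by (simp add: powr_add powr_minus field_simps)
    moreover have "c0 * (\<theta> * Ainf) = (c0 * Gamma (2 * \<beta> + 1)) * (\<theta> / \<theta> powr (2 * \<beta> + 1))" by (simp add: Ainf_def)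
    ultimately show ?thesis by simp
  qed
  finally have "((\<lambda>t. c0 * (2 * \<theta> * A t - \<theta>\<^sup>2 * D t + 2 * (exp (- \<theta> * t) * t powr (2 * \<beta>)) - 2 * \<theta> * (exp (- \<theta> * t) * B t)))
     \<longlongrightarrow> C * Gamma (2 * \<beta> - 1) * \<theta> powr (- (2 * \<beta>))) at_top" .
  then show ?thesis
    by (rule Lim_transform_eventually)
      (use eventually_ge_at_top[of 0] in eventually_elim, simp add: F_ou_variance_eq)
qed

lemma K_lim: "((\<lambda>t. K t t) \<longlongrightarrow> C * Gamma (2 * \<beta> - 1) * \<theta> powr (- (2 * \<beta>))) at_top"
proof -
  have "((\<lambda>t. K t t - F_ou_variance t) \<longlongrightarrow> 0) at_top"
  proof (rule tendsto_0_le[where K = 1])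
    have "((\<lambda>t. C' / \<beta>\<^sup>2 * (ell t * ell t)) \<longlongrightarrow> C' / \<beta>\<^sup>2 * (0 * 0)) at_top"
      by (intro tendsto_mult tendsto_const ell_lim)
    then show "((\<lambda>t. C' / \<beta>\<^sup>2 * (ell t * ell t)) \<longlongrightarrow> 0) at_top" by simp
    show "eventually (\<lambda>t. norm (K t t - F_ou_variance t) \<le> norm (C' / \<beta>\<^sup>2 * (ell t * ell t)) * 1) at_top"
      using eventually_ge_at_top[of 0]
    proof eventually_elim
      case (elim t)
      show ?case using K_F_ou_variance[OF elim] abs_ge_self[of "C' / \<beta>\<^sup>2 * (ell t * ell t)"] by (simp only: real_norm_def mult_1_right)
    qed
  qed
  from tendsto_add[OF this F_ou_variance_lim] show ?thesis by simp
qed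

section \<open>Boundedness and decay of the covariance\<close>

lemma K_compact_bound:
  assumes T: "0 \<le> T" shows "\<exists>B. \<forall>s\<in>{0..T}. \<forall>t\<in>{0..T}. \<bar>K s t\<bar> \<le> B"
proof -
  have "compact ((\<lambda>(t, s). R t s) ` ({0..T} \<times> {0..T}))"
    by (intro compact_continuous_image compact_Times compact_Icc continuous_on_subset[OF R_cont]) auto
  then have "bounded ((\<lambda>(t, s). R t s) ` ({0..T} \<times> {0..T}))" by (rule compact_imp_bounded)
  then obtain b where b: "\<And>u v. u \<in> {0..T} \<Longrightarrow> v \<in> {0..T} \<Longrightarrow> \<bar>R u v\<bar> \<le> b"
    by (force simp: bounded_iff)
  have "\<bar>K s t\<bar> \<le> 3 * (3 * b)" if "s \<in> {0..T}" "t \<in> {0..T}" for s t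
    unfolding K_def using that b
    by (intro ou_op_abs_le[OF \<theta>] L_section_cont section_cont R_cont) auto
  then show ?thesis by blast
qed

text \<open>For u \<le> s and v \<ge> m the times differ by at least \<delta> = m - s, which bounds
  the mixed derivative of F by C \<delta>^(2\<beta> - 2); and v \<ge> \<delta> makes the power with
  exponent \<beta> Lipschitz in v with constant \<beta> \<delta>^(\<beta> - 1). Together these give
  a majorant of the form \<rho>(u) v, to which the product comparison applies.\<close>

lemma K_sep: "\<exists>c\<ge>0. \<forall>s m t. 0 \<le> s \<longrightarrow> s < m \<longrightarrow> m \<le> t \<longrightarrow>
    \<bar>L s (\<lambda>u. ou_op \<theta> m t (R u))\<bar> \<le> c * ((m - s) powr (2 * \<beta> - 2) + (m - s) powr (\<beta> - 1))"
proof -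
  obtain b where b: "0 \<le> b" "\<And>t. 0 \<le> t \<Longrightarrow> ell t \<le> b" using ell_bounded by auto
  define c where "c = (C / \<theta> + C' / \<beta> * b) * (1 / \<theta>)"
  have c: "0 \<le> c" using params \<theta> b by (simp add: c_def)
  have "\<bar>L s (\<lambda>u. ou_op \<theta> m t (R u))\<bar> \<le> c * ((m - s) powr (2 * \<beta> - 2) + (m - s) powr (\<beta> - 1))"
    if s: "0 \<le> s" "s < m" "m \<le> t" for s m t
  proof -
    define \<delta> where "\<delta> = m - s"
    have \<delta>: "0 < \<delta>" "s + \<delta> \<le> m" "\<delta> \<le> m" using s by (auto simp: \<delta>_def)
    define \<rho> where "\<rho> u = C * \<delta> powr (2 * \<beta> - 2) * u + C' / \<beta> * \<delta> powr (\<beta> - 1) * u powr \<beta>" for u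
    have \<rho>c: "continuous_on {0..s} (\<lambda>u. C * \<delta> powr (2 * \<beta> - 2) * u)" "continuous_on {0..s} (\<lambda>u. C' / \<beta> * \<delta> powr (\<beta> - 1) * u powr \<beta>)"
      by (intro continuous_on_mult continuous_on_const continuous_on_id pow_cont params order_refl)+
    have "\<bar>L s (\<lambda>u. ou_op \<theta> m t (R u))\<bar> \<le> L s \<rho> * ou_op \<theta> m t (\<lambda>v. v)"
    proof (rule ou_op_dominated2[OF \<theta> s(1) s(3)])
      show "continuous_on {0..s} \<rho>" unfolding \<rho>_def by (intro continuous_on_add \<rho>c)
      show "continuous_on {m..t} (\<lambda>v. v)" by (rule continuous_on_id)
      show "continuous_on {m..t} (R u)" if "u \<in> {0..s}" for u
        using that s by (intro section_cont R_cont) auto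
      fix u u' v v' assume u: "0 \<le> u" "u \<le> u'" "u' \<le> s" and v: "m \<le> v" "v \<le> v'" "v' \<le> t"
      have 1: "second_diff F u u' v v' \<le> C * \<delta> powr (2 * \<beta> - 2) * (u' - u) * (v' - v)"
        using u v \<delta> by (intro second_diff_F_le) auto
      have "v' powr \<beta> - v powr \<beta> \<le> \<beta> * \<delta> powr (\<beta> - 1) * (v' - v)"
        using v \<delta> params by (intro powr_diff_le) auto
      then have "C' / \<beta>\<^sup>2 * (u' powr \<beta> - u powr \<beta>) * (v' powr \<beta> - v powr \<beta>) \<le>
          C' / \<beta>\<^sup>2 * (u' powr \<beta> - u powr \<beta>) * (\<beta> * \<delta> powr (\<beta> - 1) * (v' - v))"
        using params powr_mono_nonneg[OF u(1,2)] by (intro mult_left_mono) auto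
      also have "\<dots> = C' / \<beta> * \<delta> powr (\<beta> - 1) * (u' powr \<beta> - u powr \<beta>) * (v' - v)"
        using params by (simp add: power2_eq_square field_simps)
      finally have 2: "C' / \<beta>\<^sup>2 * (u' powr \<beta> - u powr \<beta>) * (v' powr \<beta> - v powr \<beta>) \<le>
         C' / \<beta> * \<delta> powr (\<beta> - 1) * (u' powr \<beta> - u powr \<beta>) * (v' - v)" .
      have "\<bar>second_diff R u u' v v'\<bar> \<le> second_diff F u u' v v' + C' / \<beta>\<^sup>2 * (u' powr \<beta> - u powr \<beta>) * (v' powr \<beta> - v powr \<beta>)"
        using u v s by (intro second_diff_R_le) auto
      also have "\<dots> \<le> C * \<delta> powr (2 * \<beta> - 2) * (u' - u) * (v' - v) + C' / \<beta> * \<delta> powr (\<beta> - 1) * (u' powr \<beta> - u powr \<beta>) * (v' - v)"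
        using 1 2 by linarith
      also have "\<dots> = (\<rho> u' - \<rho> u) * (v' - v)"
      proof -
        have "k1 * (u' - u) * (v' - v) + k2 * (U' - U) * (v' - v) = (k1 * u' + k2 * U' - (k1 * u + k2 * U)) * (v' - v)" for k1 k2 U U' :: real
          by (simp add: algebra_simps)
        then show ?thesis unfolding \<rho>_def .
      qed
      finally show "\<bar>R u' v' - R u' v - R u v' + R u v\<bar> \<le> (\<rho> u' - \<rho> u) * (v' - v)" .
    qed
    also have "L s \<rho> = C * \<delta> powr (2 * \<beta> - 2) * L s (\<lambda>u. u) + C' / \<beta> * \<delta> powr (\<beta> - 1) * ell s"
      unfolding \<rho>_def ou_op_add[OF \<theta> \<rho>c] ou_op_cmult[OF \<theta>] ell_def ..
    also have "(C * \<delta> powr (2 * \<beta> - 2) * L s (\<lambda>u. u) + C' / \<beta> * \<delta> powr (\<beta> - 1) * ell s) * ou_op \<theta> m t (\<lambda>v. v) \<le>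
       (C * \<delta> powr (2 * \<beta> - 2) * (1 / \<theta>) + C' / \<beta> * \<delta> powr (\<beta> - 1) * b) * (1 / \<theta>)"
    proof (rule mult_mono)
      show "C * \<delta> powr (2 * \<beta> - 2) * L s (\<lambda>u. u) + C' / \<beta> * \<delta> powr (\<beta> - 1) * ell s \<le>
        C * \<delta> powr (2 * \<beta> - 2) * (1 / \<theta>) + C' / \<beta> * \<delta> powr (\<beta> - 1) * b"
        using params s b by (intro add_mono mult_left_mono ou_op_id_le[OF \<theta>]) auto
      show "ou_op \<theta> m t (\<lambda>v. v) \<le> 1 / \<theta>" using s by (intro ou_op_id_le[OF \<theta>]) auto
      show "0 \<le> ou_op \<theta> m t (\<lambda>v. v)" using s by (intro ou_op_nonneg[OF \<theta>] continuous_on_id) auto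
      show "0 \<le> C * \<delta> powr (2 * \<beta> - 2) * (1 / \<theta>) + C' / \<beta> * \<delta> powr (\<beta> - 1) * b" using params \<theta> b by simp
    qed
    also have "\<dots> \<le> c * (\<delta> powr (2 * \<beta> - 2) + \<delta> powr (\<beta> - 1))"
    proof -
      have "0 \<le> C / \<theta> * \<delta> powr (\<beta> - 1) + C' / \<beta> * b * \<delta> powr (2 * \<beta> - 2)" using params \<theta> b by simp
      then have "C * \<delta> powr (2 * \<beta> - 2) * (1 / \<theta>) + C' / \<beta> * \<delta> powr (\<beta> - 1) * b \<le>
         (C / \<theta> + C' / \<beta> * b) * (\<delta> powr (2 * \<beta> - 2) + \<delta> powr (\<beta> - 1))" by (simp add: algebra_simps)
      from mult_right_mono[OF this, of "1 / \<theta>"] show ?thesis using \<theta> by (simp add: c_def mult_ac)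
    qed
    finally show ?thesis by (simp add: \<delta>_def)
  qed
  with c show ?thesis by blast
qed

lemma K_split:
  assumes "0 \<le> s" "0 \<le> m" "m \<le> t"
  shows "K s t = exp (- \<theta> * (t - m)) * K s m + L s (\<lambda>u. ou_op \<theta> m t (R u))"
proof -
  have "K s t = L s (\<lambda>u. exp (- \<theta> * (t - m)) * L m (R u) + ou_op \<theta> m t (R u))"
    unfolding K_def using assms by (intro ou_op_cong[OF \<theta>] ou_op_split[OF \<theta>] section_cont R_cont) auto
  also have "\<dots> = L s (\<lambda>u. exp (- \<theta> * (t - m)) * L m (R u)) + L s (\<lambda>u. ou_op \<theta> m t (R u))"
    using assms by (intro ou_op_add[OF \<theta>] continuous_on_mult continuous_on_const L_section_cont R_cont) auto
  finally show ?thesis unfolding ou_op_cmult[OF \<theta>] K_def .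
qed

text \<open>The kernel is split at the midpoint of \<open>s\<close> and \<open>t\<close>: the part before it carries the exponential
  factor, and on the part after it the noise is separated from \<open>[0, s]\<close> by \<open>(t - s) / 2\<close>.\<close>

lemma K_decay:
  assumes \<kappa>: "\<And>s t. 0 \<le> s \<Longrightarrow> 0 \<le> t \<Longrightarrow> \<bar>K s t\<bar> \<le> \<kappa>"
  shows "\<exists>c\<ge>0. \<forall>s t. 0 \<le> s \<longrightarrow> s < t \<longrightarrow> \<bar>K s t\<bar> \<le> c * (t - s) powr (\<beta> - 1)"
proof -
  obtain c where c: "0 \<le> c" "\<And>s m t. 0 \<le> s \<Longrightarrow> s < m \<Longrightarrow> m \<le> t \<Longrightarrow>
    \<bar>L s (\<lambda>u. ou_op \<theta> m t (R u))\<bar> \<le> c * ((m - s) powr (2 * \<beta> - 2) + (m - s) powr (\<beta> - 1))"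
    using K_sep by blast
  have \<kappa>0: "0 \<le> \<kappa>" using \<kappa>[of 0 0] by simp
  define k where "k = \<kappa> * (2 / \<theta>) + c * ((1/2) powr (2 * \<beta> - 2) + (1/2) powr (\<beta> - 1)) + \<kappa>"
  have k: "0 \<le> k" "\<kappa> \<le> k" using \<kappa>0 c \<theta> by (auto simp: k_def)
  have "\<bar>K s t\<bar> \<le> k * (t - s) powr (\<beta> - 1)" if s: "0 \<le> s" "s < t" for s t
  proof -
    define h where "h = t - s"
    have h: "0 < h" using s by (simp add: h_def)
    show ?thesis
    proof (cases "h \<le> 1")
      case True
      \<comment> \<open>At distance at most 1 the power is at least 1, so the uniform bound \<kappa>
        suffices.\<close>
      have "h powr 0 \<le> h powr (\<beta> - 1)" using h True params by (intro powr_mono') auto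
      then have "\<kappa> * 1 \<le> k * h powr (\<beta> - 1)" using k \<kappa>0 h by (intro mult_mono) auto
      then show ?thesis using \<kappa>[of s t] s by (simp add: h_def)
    next
      case False
      define m where "m = s + h / 2"
      have m: "0 \<le> m" "s < m" "m \<le> t" "t - m = h / 2" "m - s = h / 2" using s h by (auto simp: m_def h_def field_simps)
      have "\<bar>K s t\<bar> \<le> \<bar>exp (- \<theta> * (t - m)) * K s m\<bar> + \<bar>L s (\<lambda>u. ou_op \<theta> m t (R u))\<bar>"
        unfolding K_split[OF s(1) m(1,3)] by (rule abs_triangle_ineq)
      also have "\<bar>exp (- \<theta> * (t - m)) * K s m\<bar> \<le> \<kappa> * (2 / \<theta>) * h powr (\<beta> - 1)"
      proof -
        \<comment> \<open>The crude bound x \<le> exp x already gives decay of order 1 / h, which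
          for h > 1 is better than the rate h^(\<beta> - 1).\<close>
        have "\<theta> * (h / 2) \<le> exp (\<theta> * (h / 2))" using exp_ge_add_one_self[of "\<theta> * (h / 2)"] by linarith
        then have "exp (- \<theta> * (h / 2)) \<le> 2 / (\<theta> * h)"
          using \<theta> h by (simp add: exp_minus field_simps)
        also have "\<dots> \<le> (2 / \<theta>) * h powr (\<beta> - 1)"
        proof -
          have "h powr (- 1) \<le> h powr (\<beta> - 1)" using False params by (intro powr_mono) auto
          then have "1 / h \<le> h powr (\<beta> - 1)" using h by (simp add: powr_minus_divide)
          then have "(2 / \<theta>) * (1 / h) \<le> (2 / \<theta>) * h powr (\<beta> - 1)" using \<theta> by (intro mult_left_mono) auto
          then show ?thesis by simp
        qed
        finally have "exp (- \<theta> * (h / 2)) * \<bar>K s m\<bar> \<le> ((2 / \<theta>) * h powr (\<beta> - 1)) * \<kappa>"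
          using \<kappa>[OF s(1) m(1)] \<theta> by (intro mult_mono) auto
        then show ?thesis by (simp add: m abs_mult mult_ac)
      qed
      also have "\<bar>L s (\<lambda>u. ou_op \<theta> m t (R u))\<bar> \<le> c * ((h / 2) powr (2 * \<beta> - 2) + (h / 2) powr (\<beta> - 1))"
        using c(2)[OF s(1) m(2,3)] by (simp add: m)
      also have "\<dots> \<le> c * ((1/2) powr (2 * \<beta> - 2) + (1/2) powr (\<beta> - 1)) * h powr (\<beta> - 1)"
      proof -
        \<comment> \<open>For h > 1 the fractional term decays faster than the one from \<Psi>, so
          the latter fixes the rate.\<close>
        have "h powr (2 * \<beta> - 2) \<le> h powr (\<beta> - 1)" using False params by (intro powr_mono) auto
        then have "(1/2) powr (2 * \<beta> - 2) * h powr (2 * \<beta> - 2) \<le> (1/2) powr (2 * \<beta> - 2) * h powr (\<beta> - 1)" by (intro mult_left_mono) auto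
        moreover have "(h / 2) powr a = (1/2) powr a * h powr a" for a
          using h powr_mult[of "1/2" h a] by simp
        ultimately have "(h / 2) powr (2 * \<beta> - 2) + (h / 2) powr (\<beta> - 1) \<le> ((1/2) powr (2 * \<beta> - 2) + (1/2) powr (\<beta> - 1)) * h powr (\<beta> - 1)"
          by (simp add: distrib_right)
        from mult_left_mono[OF this c(1)] show ?thesis by (simp add: mult.assoc)
      qed
      finally have "\<bar>K s t\<bar> \<le> (k - \<kappa>) * h powr (\<beta> - 1)" by (simp add: k_def distrib_right)
      also have "\<dots> \<le> k * h powr (\<beta> - 1)" using \<kappa>0 by (intro mult_right_mono) auto
      finally show ?thesis by (simp add: h_def)
    qed
  qed
  with k(1) show ?thesis by blast
qed

end

section \<open>Integrals of continuous processes\<close>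

lemma sum_sq_le_card: "(\<Sum>k<n. f k)\<^sup>2 \<le> real n * (\<Sum>k<n. (f k)\<^sup>2)" for f :: "nat \<Rightarrow> real"
  using Cauchy_Schwarz_ineq_sum[of "\<lambda>_. 1" f "{..<n}"] by simp

context prob_space
begin

text \<open>Continuity is asked for every \<omega> of the space, so that joint measurability and
  pathwise integrals involve no exceptional set.\<close>

definition cont_process :: "(real \<Rightarrow> 'a \<Rightarrow> real) \<Rightarrow> bool" where
  "cont_process Y \<longleftrightarrow> (\<forall>t\<ge>0. Y t \<in> borel_measurable M) \<and> (\<forall>\<omega>\<in>space M. continuous_on {0..} (\<lambda>t. Y t \<omega>))"

lemma cont_process_meas: "cont_process Y \<Longrightarrow> 0 \<le> t \<Longrightarrow> Y t \<in> borel_measurable M"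
  by (simp add: cont_process_def)

lemma cont_process_path:
  assumes "cont_process Y" "\<omega> \<in> space M" "0 \<le> a" shows "continuous_on {a..b} (\<lambda>t. Y t \<omega>)"
  by (rule continuous_on_subset[of "{0..}"]) (use assms in \<open>auto simp: cont_process_def\<close>)

lemma cont_process_diff: "cont_process Y \<Longrightarrow> cont_process Z \<Longrightarrow> cont_process (\<lambda>t \<omega>. Y t \<omega> - Z t \<omega>)"
  by (auto simp: cont_process_def intro!: continuous_intros borel_measurable_diff)

lemma cont_process_mult: "cont_process Y \<Longrightarrow> cont_process Z \<Longrightarrow> cont_process (\<lambda>t \<omega>. Y t \<omega> * Z t \<omega>)"
  by (auto simp: cont_process_def intro!: continuous_intros borel_measurable_times)

lemma cont_process_const: "Z \<in> borel_measurable M \<Longrightarrow> cont_process (\<lambda>t. Z)"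
  by (auto simp: cont_process_def)

lemma cont_process_det: "continuous_on {0..} w \<Longrightarrow> cont_process (\<lambda>t \<omega>. w t)"
  by (auto simp: cont_process_def)

text \<open>By continuity of the paths Y is the limit of its values at times rounded down to
  multiples of 1 / (n + 1); such a rounded time takes countably many values, so each approximation
  is measurable. The maximum with 0 keeps the rounded times in the domain.\<close>

lemma cont_process_jointly:
  assumes Y: "cont_process Y" and a: "0 \<le> a"
  shows "(\<lambda>p. indicator {a..b} (fst p) * Y (fst p) (snd p)) \<in> borel_measurable (lborel \<Otimes>\<^sub>M M)"
proof -
  have "(\<lambda>p. Y (max 0 (fst p)) (snd p)) \<in> borel_measurable (lborel \<Otimes>\<^sub>M M)"
  proof (rule borel_measurable_LIMSEQ_real)
    fix n :: nat
    have [measurable]: "i \<ge> 0 \<Longrightarrow> Y i \<in> borel_measurable M" for i by (rule cont_process_meas[OF Y])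
    have m: "(\<lambda>p. Y (max 0 (real_of_int i / real (Suc n))) (snd p)) \<in> borel_measurable (lborel \<Otimes>\<^sub>M M)" for i :: int
      by (rule measurable_compose[OF measurable_snd]) simp
    have f: "(\<lambda>p. \<lfloor>fst p * real (Suc n) :: real\<rfloor>) \<in> measurable ((lborel :: real measure) \<Otimes>\<^sub>M M) (count_space UNIV)" by measurable
    show "(\<lambda>p. Y (max 0 (real_of_int \<lfloor>fst p * real (Suc n)\<rfloor> / real (Suc n))) (snd p)) \<in> borel_measurable (lborel \<Otimes>\<^sub>M M)"
      by (rule measurable_compose_countable[OF m f])
  next
    fix p :: "real \<times> 'a" assume "p \<in> space (lborel \<Otimes>\<^sub>M M)"
    then have \<omega>: "snd p \<in> space M" by (auto simp: space_pair_measure)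
    have "(\<lambda>n. real_of_int \<lfloor>fst p * real (Suc n)\<rfloor> / real (Suc n)) \<longlonglongrightarrow> fst p"
    proof (rule tendsto_sandwich)
      show "eventually (\<lambda>n. fst p - inverse (real (Suc n)) \<le> real_of_int \<lfloor>fst p * real (Suc n)\<rfloor> / real (Suc n)) sequentially"
      proof (intro always_eventually allI)
        fix n :: nat
        have "fst p * real (Suc n) - 1 \<le> real_of_int \<lfloor>fst p * real (Suc n)\<rfloor>" by linarith
        from divide_right_mono[OF this, of "real (Suc n)"]
        show "fst p - inverse (real (Suc n)) \<le> real_of_int \<lfloor>fst p * real (Suc n)\<rfloor> / real (Suc n)"
          by (simp add: diff_divide_distrib inverse_eq_divide)
      qed
      show "eventually (\<lambda>n. real_of_int \<lfloor>fst p * real (Suc n)\<rfloor> / real (Suc n) \<le> fst p) sequentially"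
        by (intro always_eventually allI) (simp add: divide_le_eq del: of_nat_Suc)
      show "(\<lambda>n. fst p - inverse (real (Suc n))) \<longlonglongrightarrow> fst p"
        using tendsto_diff[OF tendsto_const[of "fst p"] LIMSEQ_inverse_real_of_nat] by simp
    qed simp
    then have "(\<lambda>n. max 0 (real_of_int \<lfloor>fst p * real (Suc n)\<rfloor> / real (Suc n))) \<longlonglongrightarrow> max 0 (fst p)"
      by (intro tendsto_intros)
    then show "(\<lambda>n. Y (max 0 (real_of_int \<lfloor>fst p * real (Suc n)\<rfloor> / real (Suc n))) (snd p)) \<longlonglongrightarrow> Y (max 0 (fst p)) (snd p)"
      using Y \<omega> unfolding cont_process_def
      by (intro continuous_on_tendsto_compose[of "{0..}" "\<lambda>t. Y t (snd p)"]) auto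
  qed
  then have "(\<lambda>p. indicator {a..b} (fst p) * Y (max 0 (fst p)) (snd p)) \<in> borel_measurable (lborel \<Otimes>\<^sub>M M)"
    by measurable
  moreover have "(\<lambda>p. indicator {a..b} (fst p) * Y (max 0 (fst p)) (snd p)) = (\<lambda>p. indicator {a..b} (fst p) * Y (fst p) (snd p))"
    using a by (auto simp: indicator_def max_def)
  ultimately show ?thesis by simp
qed

lemma cont_process_integral_eq:
  assumes "cont_process Y" "\<omega> \<in> space M" "0 \<le> a"
  shows "integral {a..b} (\<lambda>t. Y t \<omega>) = (LINT t|lborel. indicator {a..b} t * Y t \<omega>)"
  using set_borel_integral_eq_integral(2)[OF borel_integrable_atLeastAtMost'[OF cont_process_path[OF assms, of b]]]
  by (simp add: set_lebesgue_integral_def)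

lemma cont_process_integral_measurable:
  assumes "cont_process Y" "0 \<le> a"
  shows "(\<lambda>\<omega>. integral {a..b} (\<lambda>t. Y t \<omega>)) \<in> borel_measurable M"
proof -
  have "(\<lambda>(\<omega>, t). indicator {a..b} t * Y t \<omega>) \<in> borel_measurable (M \<Otimes>\<^sub>M lborel)"
    using measurable_compose[OF measurable_pair_swap' cont_process_jointly[OF assms, of b]]
    by (simp add: case_prod_unfold)
  then have "(\<lambda>\<omega>. LINT t|lborel. indicator {a..b} t * Y t \<omega>) \<in> borel_measurable M"
    by (rule lborel.borel_measurable_lebesgue_integral)
  then show ?thesis
    by (rule measurable_cong[THEN iffD1, rotated]) (simp add: cont_process_integral_eq[OF assms(1) _ assms(2)])
qed

text \<open>Cauchy-Schwarz in time, then Tonelli. The computation is done with nonnegative extended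
  integrals, so that square integrability comes out as a conclusion.\<close>

lemma cont_process_integral_sq:
  assumes Y: "cont_process Y" and a: "0 \<le> a" "a \<le> b"
    and si: "\<And>s. s \<in> {a..b} \<Longrightarrow> square_integrable M (Y s)"
    and e: "\<And>s. s \<in> {a..b} \<Longrightarrow> (LINT \<omega>|M. (Y s \<omega>)\<^sup>2) \<le> e"
  shows "square_integrable M (\<lambda>\<omega>. integral {a..b} (\<lambda>t. Y t \<omega>))"
    "(LINT \<omega>|M. (integral {a..b} (\<lambda>t. Y t \<omega>))\<^sup>2) \<le> (b - a)\<^sup>2 * e"
proof -
  interpret P: pair_sigma_finite lborel M by unfold_locales
  have e0: "0 \<le> e" using e[of a] a by (intro order_trans[OF _ e[of a]]) auto
  note jm = cont_process_jointly[OF Y a(1), of b]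
  define f where "f = (\<lambda>p. ennreal \<bar>indicator {a..b} (fst p) * Y (fst p) (snd p)\<bar>)"
  have fm[measurable]: "f \<in> borel_measurable (lborel \<Otimes>\<^sub>M M)"
    unfolding f_def using jm by measurable
  note im = cont_process_integral_measurable[OF Y a(1), of b]
  have pt: "ennreal ((integral {a..b} (\<lambda>t. Y t \<omega>))\<^sup>2) \<le> ennreal (b - a) * (\<integral>\<^sup>+t. (f (t, \<omega>))\<^sup>2 \<partial>lborel)" if \<omega>: "\<omega> \<in> space M" for \<omega>
  proof -
    have i: "integrable lborel (\<lambda>t. indicator {a..b} t * Y t \<omega>)"
      using borel_integrable_atLeastAtMost'[OF cont_process_path[OF Y \<omega> a(1), of b]] by (simp add: set_integrable_def)
    have m1: "(\<lambda>t. f (t, \<omega>)) \<in> borel_measurable lborel"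
      unfolding f_def using i by auto
    have "ennreal \<bar>integral {a..b} (\<lambda>t. Y t \<omega>)\<bar> \<le> (\<integral>\<^sup>+t. f (t, \<omega>) * indicator {a..b} t \<partial>lborel)"
    proof -
      have "ennreal (norm (LINT t|lborel. indicator {a..b} t * Y t \<omega>)) \<le> (\<integral>\<^sup>+t. ennreal (norm (indicator {a..b} t * Y t \<omega>)) \<partial>lborel)"
        by (rule integral_norm_bound_ennreal[OF i])
      also have "\<dots> = (\<integral>\<^sup>+t. f (t, \<omega>) * indicator {a..b} t \<partial>lborel)"
        by (intro nn_integral_cong) (auto simp: f_def indicator_def)
      finally show ?thesis unfolding cont_process_integral_eq[OF Y \<omega> a(1)] by simp
    qed
    then have "(ennreal \<bar>integral {a..b} (\<lambda>t. Y t \<omega>)\<bar>)\<^sup>2 \<le> (\<integral>\<^sup>+t. f (t, \<omega>) * indicator {a..b} t \<partial>lborel)\<^sup>2"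
      by (rule power_mono) simp
    also have "\<dots> \<le> (\<integral>\<^sup>+t. (f (t, \<omega>))\<^sup>2 \<partial>lborel) * (\<integral>\<^sup>+t. (indicator {a..b} t)\<^sup>2 \<partial>lborel)"
      by (rule Cauchy_Schwarz_nn_integral[OF m1]) simp
    also have "(\<integral>\<^sup>+t. (indicator {a..b} t :: ennreal)\<^sup>2 \<partial>lborel) = (\<integral>\<^sup>+t. indicator {a..b} t \<partial>lborel)"
      by (intro nn_integral_cong) (auto simp: indicator_def)
    also have "\<dots> = ennreal (b - a)" using a by simp
    finally show ?thesis by (simp add: ennreal_power mult.commute)
  qed
  have inner: "(\<integral>\<^sup>+\<omega>. (f (t, \<omega>))\<^sup>2 \<partial>M) \<le> ennreal e * indicator {a..b} t" for t
  proof (cases "t \<in> {a..b}")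
    case True
    have "(\<integral>\<^sup>+\<omega>. (f (t, \<omega>))\<^sup>2 \<partial>M) = (\<integral>\<^sup>+\<omega>. ennreal ((Y t \<omega>)\<^sup>2) \<partial>M)"
      using True by (intro nn_integral_cong) (simp add: f_def ennreal_power)
    also have "\<dots> = ennreal (LINT \<omega>|M. (Y t \<omega>)\<^sup>2)"
      using si[OF True] by (intro nn_integral_eq_integral) (auto simp: square_integrable_def)
    also have "\<dots> \<le> ennreal e" using e[OF True] by (rule ennreal_leI)
    finally show ?thesis using True by simp
  next
    case False
    then show ?thesis by (simp add: f_def)
  qed
  have "(\<integral>\<^sup>+\<omega>. ennreal ((integral {a..b} (\<lambda>t. Y t \<omega>))\<^sup>2) \<partial>M) \<le> (\<integral>\<^sup>+\<omega>. ennreal (b - a) * (\<integral>\<^sup>+t. (f (t, \<omega>))\<^sup>2 \<partial>lborel) \<partial>M)"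
    by (rule nn_integral_mono) (rule pt)
  also have "\<dots> = ennreal (b - a) * (\<integral>\<^sup>+\<omega>. (\<integral>\<^sup>+t. (f (t, \<omega>))\<^sup>2 \<partial>lborel) \<partial>M)"
    by (rule nn_integral_cmult) measurable
  also have "(\<integral>\<^sup>+\<omega>. (\<integral>\<^sup>+t. (f (t, \<omega>))\<^sup>2 \<partial>lborel) \<partial>M) = (\<integral>\<^sup>+t. (\<integral>\<^sup>+\<omega>. (f (t, \<omega>))\<^sup>2 \<partial>M) \<partial>lborel)"
    by (rule P.Fubini'[symmetric, of "\<lambda>t \<omega>. (f (t, \<omega>))\<^sup>2", symmetric]) measurable
  also have "ennreal (b - a) * \<dots> \<le> ennreal (b - a) * (\<integral>\<^sup>+t. ennreal e * indicator {a..b} t \<partial>lborel)"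
    by (intro mult_left_mono nn_integral_mono inner) simp
  also have "(\<integral>\<^sup>+t. ennreal e * indicator {a..b} t \<partial>lborel) = ennreal e * ennreal (b - a)"
    using a by (simp add: nn_integral_cmult)
  also have "ennreal (b - a) * (ennreal e * ennreal (b - a)) = ennreal ((b - a)\<^sup>2 * e)"
    using a e0 by (simp add: ennreal_mult'[symmetric] power2_eq_square mult_ac)
  finally have le: "(\<integral>\<^sup>+\<omega>. ennreal ((integral {a..b} (\<lambda>t. Y t \<omega>))\<^sup>2) \<partial>M) \<le> ennreal ((b - a)\<^sup>2 * e)" .
  have int: "integrable M (\<lambda>\<omega>. (integral {a..b} (\<lambda>t. Y t \<omega>))\<^sup>2)"
    by (rule integrableI_bounded) (use im le in \<open>auto simp: order_le_less_trans\<close>)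
  show "square_integrable M (\<lambda>\<omega>. integral {a..b} (\<lambda>t. Y t \<omega>))"
    using im int by (simp add: square_integrable_def)
  have "ennreal (LINT \<omega>|M. (integral {a..b} (\<lambda>t. Y t \<omega>))\<^sup>2) \<le> ennreal ((b - a)\<^sup>2 * e)"
    using le by (subst nn_integral_eq_integral[OF int, symmetric]) auto
  then show "(LINT \<omega>|M. (integral {a..b} (\<lambda>t. Y t \<omega>))\<^sup>2) \<le> (b - a)\<^sup>2 * e"
    using e0 by (simp add: ennreal_le_iff)
qed

text \<open>Fubini, justified by |Y s Z| \<le> (Y s)^2 + Z^2, whose expectation is bounded uniformly
  in s. Covariances of time integrals are computed in this way below.\<close>

lemma cont_process_integral_inner:
  assumes Y: "cont_process Y" and a: "0 \<le> a" "a \<le> b"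
    and si: "\<And>s. s \<in> {a..b} \<Longrightarrow> square_integrable M (Y s)"
    and e: "\<And>s. s \<in> {a..b} \<Longrightarrow> (LINT \<omega>|M. (Y s \<omega>)\<^sup>2) \<le> e" and Z: "square_integrable M Z"
  shows "(\<lambda>s. LINT \<omega>|M. Y s \<omega> * Z \<omega>) integrable_on {a..b}"
    "(LINT \<omega>|M. integral {a..b} (\<lambda>t. Y t \<omega>) * Z \<omega>) = integral {a..b} (\<lambda>s. LINT \<omega>|M. Y s \<omega> * Z \<omega>)"
proof -
  interpret P: pair_sigma_finite lborel M by unfold_locales
  have [measurable]: "Z \<in> borel_measurable M" using Z by (simp add: square_integrable_def)
  define f where "f = (\<lambda>p. (indicator {a..b} (fst p) * Y (fst p) (snd p)) * Z (snd p))"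
  have fm[measurable]: "f \<in> borel_measurable (lborel \<Otimes>\<^sub>M M)"
    unfolding f_def using cont_process_jointly[OF Y a(1), of b] by measurable
  define z where "z = (LINT \<omega>|M. (Z \<omega>)\<^sup>2)"
  have Zi: "integrable M (\<lambda>\<omega>. (Z \<omega>)\<^sup>2)" using Z by (simp add: square_integrable_def)
  have inner: "integrable M (\<lambda>\<omega>. f (t, \<omega>))" "(LINT \<omega>|M. \<bar>f (t, \<omega>)\<bar>) \<le> indicator {a..b} t * (e + z)" for t
  proof -
    show i: "integrable M (\<lambda>\<omega>. f (t, \<omega>))"
      using sq_int_mult[OF si Z, of t] by (cases "t \<in> {a..b}") (auto simp: f_def)
    show "(LINT \<omega>|M. \<bar>f (t, \<omega>)\<bar>) \<le> indicator {a..b} t * (e + z)"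
    proof (cases "t \<in> {a..b}")
      case True
      have Yi: "integrable M (\<lambda>\<omega>. (Y t \<omega>)\<^sup>2)" using si[OF True] by (simp add: square_integrable_def)
      have "(LINT \<omega>|M. \<bar>f (t, \<omega>)\<bar>) \<le> (LINT \<omega>|M. (Y t \<omega>)\<^sup>2 + (Z \<omega>)\<^sup>2)"
      proof (rule integral_mono)
        fix \<omega>
        have "0 \<le> (\<bar>Y t \<omega>\<bar> - \<bar>Z \<omega>\<bar>)\<^sup>2" by simp
        then have "2 * (\<bar>Y t \<omega>\<bar> * \<bar>Z \<omega>\<bar>) \<le> (Y t \<omega>)\<^sup>2 + (Z \<omega>)\<^sup>2" by (simp add: power2_diff algebra_simps)
        moreover have "0 \<le> \<bar>Y t \<omega>\<bar> * \<bar>Z \<omega>\<bar>" by simp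
        ultimately have "\<bar>Y t \<omega>\<bar> * \<bar>Z \<omega>\<bar> \<le> (Y t \<omega>)\<^sup>2 + (Z \<omega>)\<^sup>2" by linarith
        then show "\<bar>f (t, \<omega>)\<bar> \<le> (Y t \<omega>)\<^sup>2 + (Z \<omega>)\<^sup>2" using True by (simp add: f_def abs_mult)
      qed (use i Yi Zi in auto)
      also have "\<dots> \<le> e + z" using Yi Zi e[OF True] by (simp add: z_def)
      finally show ?thesis using True by simp
    qed (simp add: f_def)
  qed
  have int: "integrable (lborel \<Otimes>\<^sub>M M) f"
  proof (rule P.Fubini_integrable[OF fm])
    show "integrable lborel (\<lambda>t. LINT \<omega>|M. norm (f (t, \<omega>)))"
    proof (rule Bochner_Integration.integrable_bound[of _ "\<lambda>t. indicator {a..b} t * (e + z)"])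
      show "AE t in lborel. norm (LINT \<omega>|M. norm (f (t, \<omega>))) \<le> norm (indicator {a..b} t * (e + z))"
        using inner(2) by (auto intro!: AE_I2 intro: order_trans[OF _ abs_ge_self] simp: abs_of_nonneg)
    next
      show "integrable lborel (\<lambda>t. indicator {a..b} t * (e + z))"
        using a by (intro integrable_mult_left integrable_real_indicator) auto
    qed measurable
    show "AE t in lborel. integrable M (\<lambda>\<omega>. f (t, \<omega>))" using inner by simp
  qed
  then have int': "integrable (lborel \<Otimes>\<^sub>M M) (case_prod (\<lambda>t \<omega>. f (t, \<omega>)))" by simp
  have ft: "(LINT \<omega>|M. f (t, \<omega>)) = indicator {a..b} t * (LINT \<omega>|M. Y t \<omega> * Z \<omega>)" for t
    by (simp add: f_def mult.assoc)
  have s: "set_integrable lborel {a..b} (\<lambda>t. LINT \<omega>|M. Y t \<omega> * Z \<omega>)"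
    using P.integrable_fst'[OF int] unfolding ft by (simp add: set_integrable_def)
  then show "(\<lambda>s. LINT \<omega>|M. Y s \<omega> * Z \<omega>) integrable_on {a..b}"
    by (rule set_borel_integral_eq_integral(1))
  have "(LINT \<omega>|M. integral {a..b} (\<lambda>t. Y t \<omega>) * Z \<omega>) = (LINT \<omega>|M. LINT t|lborel. f (t, \<omega>))"
    by (intro Bochner_Integration.integral_cong) (simp_all add: cont_process_integral_eq[OF Y _ a(1)] f_def)
  also have "\<dots> = (LINT t|lborel. LINT \<omega>|M. f (t, \<omega>))"
    by (rule P.Fubini_integral[OF int'])
  also have "\<dots> = (LBINT t:{a..b}. LINT \<omega>|M. Y t \<omega> * Z \<omega>)"
    unfolding ft set_lebesgue_integral_def by simp
  also have "\<dots> = integral {a..b} (\<lambda>s. LINT \<omega>|M. Y s \<omega> * Z \<omega>)"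
    by (rule set_borel_integral_eq_integral(2)[OF s])
  finally show "(LINT \<omega>|M. integral {a..b} (\<lambda>t. Y t \<omega>) * Z \<omega>) = integral {a..b} (\<lambda>s. LINT \<omega>|M. Y s \<omega> * Z \<omega>)" .
qed

end

lemma integral_grid:
  fixes g :: "real \<Rightarrow> real"
  assumes T: "0 \<le> T" and g: "continuous_on {0..T} g" and n: "0 < n"
  shows "integral {0..T} g = (\<Sum>k<n. integral {real k * T / real n..real (Suc k) * T / real n} g)"
proof -
  have "integral {0..real m * T / real n} g = (\<Sum>k<m. integral {real k * T / real n..real (Suc k) * T / real n} g)" if "m \<le> n" for m
    using that
  proof (induction m)
    case 0
    then show ?case by simp
  next
    case (Suc m)
    have le: "0 \<le> real m * T / real n" "real m * T / real n \<le> real (Suc m) * T / real n" "real (Suc m) * T / real n \<le> T"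
    proof -
      show "0 \<le> real m * T / real n" "real m * T / real n \<le> real (Suc m) * T / real n"
        using T by (auto intro!: divide_right_mono mult_right_mono)
      have "real (Suc m) * T \<le> real n * T" using Suc.prems T by (intro mult_right_mono) auto
      then show "real (Suc m) * T / real n \<le> T" using n by (simp add: field_simps del: of_nat_Suc)
    qed
    have "integral {0..real m * T / real n} g + integral {real m * T / real n..real (Suc m) * T / real n} g = integral {0..real (Suc m) * T / real n} g"
      by (intro Henstock_Kurzweil_Integration.integral_combine le integrable_continuous_real continuous_on_subset[OF g]) (use le in auto)
    then show ?case using Suc by simp
  qed
  from this[of n] show ?thesis using n by simp
qed

text \<open>The error on a cell is the integral of Y s minus its value at the left end point, with
  second moment at most (T / n)^2 e; adding n such errors by Cauchy-Schwarz costs a factor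
  n^2.\<close>

lemma (in prob_space) riemann_L2_bound:
  assumes Y: "cont_process Y" and T: "0 \<le> T" and n: "0 < n"
    and si: "\<And>s. s \<in> {0..T} \<Longrightarrow> square_integrable M (Y s)"
    and e: "\<And>s r. s \<in> {0..T} \<Longrightarrow> r \<in> {0..T} \<Longrightarrow> r \<le> s \<Longrightarrow> s - r \<le> T / real n \<Longrightarrow> (LINT \<omega>|M. (Y s \<omega> - Y r \<omega>)\<^sup>2) \<le> e"
  shows "(LINT \<omega>|M. (integral {0..T} (\<lambda>s. Y s \<omega>) - (\<Sum>k<n. T / real n * Y (real k * T / real n) \<omega>))\<^sup>2) \<le> T\<^sup>2 * e"
proof -
  let ?t = "\<lambda>k. real k * T / real n"
  have le: "0 \<le> ?t k" "?t k \<le> ?t (Suc k)" "?t (Suc k) \<le> T" "?t (Suc k) - ?t k = T / real n" if "k < n" for k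
  proof -
    show "0 \<le> ?t k" "?t k \<le> ?t (Suc k)" using T by (auto intro!: divide_right_mono mult_right_mono)
    have "real (Suc k) * T \<le> real n * T" using that T by (intro mult_right_mono) auto
    then show "?t (Suc k) \<le> T" using n by (simp add: field_simps del: of_nat_Suc)
    show "?t (Suc k) - ?t k = T / real n" by (simp add: add_divide_distrib distrib_right)
  qed
  define J where "J k \<omega> = integral {?t k..?t (Suc k)} (\<lambda>s. Y s \<omega> - Y (?t k) \<omega>)" for k \<omega>
  have Yk: "cont_process (\<lambda>s \<omega>. Y s \<omega> - Y (?t k) \<omega>)" if "k < n" for k
    by (intro cont_process_diff Y cont_process_const cont_process_meas[OF Y] le that)
  have eq: "integral {0..T} (\<lambda>s. Y s \<omega>) - (\<Sum>k<n. T / real n * Y (?t k) \<omega>) = (\<Sum>k<n. J k \<omega>)" if \<omega>: "\<omega> \<in> space M" for \<omega>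
  proof -
    have "J k \<omega> = integral {?t k..?t (Suc k)} (\<lambda>s. Y s \<omega>) - T / real n * Y (?t k) \<omega>" if "k < n" for k
    proof -
      have "J k \<omega> = integral {?t k..?t (Suc k)} (\<lambda>s. Y s \<omega>) - integral {?t k..?t (Suc k)} (\<lambda>s. Y (?t k) \<omega>)"
        unfolding J_def
        by (intro Henstock_Kurzweil_Integration.integral_diff integrable_continuous_real continuous_on_const cont_process_path[OF Y \<omega>] le that)
      then show ?thesis using le[OF that] by simp
    qed
    then show ?thesis
      unfolding integral_grid[OF T cont_process_path[OF Y \<omega> order_refl] n] by (simp add: sum_subtractf)
  qed
  have Jsi: "square_integrable M (J k)" and Je: "(LINT \<omega>|M. (J k \<omega>)\<^sup>2) \<le> (T / real n)\<^sup>2 * e" if k: "k < n" for k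
  proof -
    have s: "square_integrable M (\<lambda>\<omega>. Y s \<omega> - Y (?t k) \<omega>)" if "s \<in> {?t k..?t (Suc k)}" for s
      using that le[OF k] by (intro sq_int_diff si) auto
    have d: "(LINT \<omega>|M. (Y s \<omega> - Y (?t k) \<omega>)\<^sup>2) \<le> e" if "s \<in> {?t k..?t (Suc k)}" for s
      using that le[OF k] by (intro e) auto
    show "square_integrable M (J k)" "(LINT \<omega>|M. (J k \<omega>)\<^sup>2) \<le> (T / real n)\<^sup>2 * e"
      using cont_process_integral_sq[OF Yk[OF k] le(1,2)[OF k] s d] le(4)[OF k] unfolding J_def by simp_all
  qed
  have "(LINT \<omega>|M. (integral {0..T} (\<lambda>s. Y s \<omega>) - (\<Sum>k<n. T / real n * Y (?t k) \<omega>))\<^sup>2) = (LINT \<omega>|M. (\<Sum>k<n. J k \<omega>)\<^sup>2)"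
    by (intro Bochner_Integration.integral_cong refl) (simp only: eq)
  also have "\<dots> \<le> (LINT \<omega>|M. real n * (\<Sum>k<n. (J k \<omega>)\<^sup>2))"
    using sq_int_sum[of "{..<n}" M J] Jsi
    by (intro integral_mono sum_sq_le_card) (auto simp: square_integrable_def)
  also have "\<dots> = real n * (\<Sum>k<n. LINT \<omega>|M. (J k \<omega>)\<^sup>2)"
    using Jsi by (simp add: square_integrable_def)
  also have "\<dots> \<le> real n * (\<Sum>k<n. (T / real n)\<^sup>2 * e)"
    by (intro mult_left_mono sum_mono Je) auto
  also have "\<dots> = T\<^sup>2 * e" using n by (simp add: power2_eq_square)
  finally show ?thesis .
qed

section \<open>The Ornstein--Uhlenbeck process\<close>

lemma continuous_on_halfline:
  fixes f :: "real \<Rightarrow> real"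
  assumes "\<And>b. continuous_on {0..b} f"
  shows "continuous_on {0..} f"
  unfolding continuous_on_eq_continuous_within
proof
  fix x :: real assume x: "x \<in> {0..}"
  have "at x within {0..} = at x within {0..x + 1}"
    by (rule at_within_nhd[of x "{..<x + 1}"]) (use x in auto)
  moreover have "continuous (at x within {0..x + 1}) f"
    using assms[of "x + 1"] x by (simp add: continuous_on_eq_continuous_within)
  ultimately show "continuous (at x within {0..}) f" by simp
qed

lemma continuous_on_of_sq_holder:
  fixes f :: "real \<Rightarrow> real"
  assumes p: "0 < p" and f: "\<And>s t. s \<in> S \<Longrightarrow> t \<in> S \<Longrightarrow> s \<le> t \<Longrightarrow> (f t - f s)\<^sup>2 \<le> c * (t - s) powr p"
  shows "continuous_on S f"
  unfolding continuous_on_def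
proof
  fix x assume x: "x \<in> S"
  have f': "(f t - f x)\<^sup>2 \<le> c * \<bar>t - x\<bar> powr p" if "t \<in> S" for t
    using f[of t x] f[of x t] x that by (cases "t \<le> x") (auto simp: power2_commute)
  have "((\<lambda>t. (f t - f x)\<^sup>2) \<longlongrightarrow> 0) (at x within S)"
  proof (rule tendsto_sandwich[OF _ _ tendsto_const])
    show "eventually (\<lambda>t. (f t - f x)\<^sup>2 \<le> c * \<bar>t - x\<bar> powr p) (at x within S)"
      using f' by (simp add: eventually_at_filter)
    have "((\<lambda>t. c * \<bar>t - x\<bar> powr p) \<longlongrightarrow> c * \<bar>x - x\<bar> powr p) (at x within S)"
      using p by (intro tendsto_mult tendsto_const tendsto_powr' tendsto_rabs tendsto_diff tendsto_ident_at) auto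
    then show "((\<lambda>t. c * \<bar>t - x\<bar> powr p) \<longlongrightarrow> 0) (at x within S)" using p by simp
  qed simp
  then have "((\<lambda>t. f t - f x) \<longlongrightarrow> 0) (at x within S)" by simp
  then show "(f \<longlongrightarrow> f x) (at x within S)" by (simp add: LIM_zero_iff)
qed

text \<open>Variation of constants: exp(-\<theta> (t - s)) times the integral of x over [0, s] has
  the derivative exp(-\<theta> (t - s)) g(s) in s, so the weighted integral of g over [0, t] equals
  the integral of x.\<close>

lemma linear_ode_solution:
  fixes x g :: "real \<Rightarrow> real"
  assumes x: "continuous_on {0..} x" and eq: "\<And>t. 0 \<le> t \<Longrightarrow> x t = g t - \<theta> * integral {0..t} x" and t: "0 \<le> t"
  shows "x t = g t - \<theta> * integral {0..t} (\<lambda>s. exp (- \<theta> * (t - s)) * g s)"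
proof -
  have xc: "continuous_on {0..t} x" by (rule continuous_on_subset[OF x]) auto
  have "((\<lambda>s. exp (- \<theta> * (t - s)) * g s) has_integral
     exp (- \<theta> * (t - t)) * integral {0..t} x - exp (- \<theta> * (t - 0)) * integral {0..0} x) {0..t}"
  proof (rule fundamental_theorem_of_calculus[OF t])
    fix s assume s: "s \<in> {0..t}"
    have "((\<lambda>s. integral {0..s} x) has_real_derivative x s) (at s within {0..t})"
      by (rule integral_has_real_derivative[OF xc s])
    then have "((\<lambda>s. exp (- \<theta> * (t - s)) * integral {0..s} x) has_real_derivative
       exp (- \<theta> * (t - s)) * (\<theta> * integral {0..s} x + x s)) (at s within {0..t})"
      by (auto intro!: derivative_eq_intros simp: algebra_simps)
    moreover have "\<theta> * integral {0..s} x + x s = g s" using eq[of s] s by simp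
    ultimately show "((\<lambda>s. exp (- \<theta> * (t - s)) * integral {0..s} x) has_vector_derivative exp (- \<theta> * (t - s)) * g s) (at s within {0..t})"
      by (simp add: has_real_derivative_iff_has_vector_derivative)
  qed
  then have "integral {0..t} (\<lambda>s. exp (- \<theta> * (t - s)) * g s) = integral {0..t} x"
    by (simp add: integral_unique)
  then show ?thesis using eq[OF t] by simp
qed

text \<open>The squared norm of a simple element of L2(\<Omega>; H): products in \<omega> give
  covariances of the coefficients, products in \<omega>' give inner products in H.\<close>

lemma (in prob_space) tensor_norm:
  fixes n :: nat
  assumes a: "\<And>j. j < n \<Longrightarrow> square_integrable M (a j)" and b: "\<And>j. j < n \<Longrightarrow> square_integrable M (b j)"
  shows "(LINT p|(M \<Otimes>\<^sub>M M). (\<Sum>j<n. a j (fst p) * b j (snd p))\<^sup>2) =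
    (\<Sum>j<n. \<Sum>l<n. (LINT \<omega>|M. a j \<omega> * a l \<omega>) * (LINT \<omega>|M. b j \<omega> * b l \<omega>))"
proof -
  have i: "integrable (M \<Otimes>\<^sub>M M) (\<lambda>p. (a j (fst p) * a l (fst p)) * (b j (snd p) * b l (snd p)))" if "j < n" "l < n" for j l
    using that by (intro pair_prod_integral(1) sq_int_mult a b)
  have "(LINT p|(M \<Otimes>\<^sub>M M). (\<Sum>j<n. a j (fst p) * b j (snd p))\<^sup>2) =
     (LINT p|(M \<Otimes>\<^sub>M M). (\<Sum>j<n. \<Sum>l<n. (a j (fst p) * a l (fst p)) * (b j (snd p) * b l (snd p))))"
    by (simp add: power2_eq_square sum_product mult_ac)
  also have "\<dots> = (\<Sum>j<n. LINT p|(M \<Otimes>\<^sub>M M). (\<Sum>l<n. (a j (fst p) * a l (fst p)) * (b j (snd p) * b l (snd p))))"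
    by (intro Bochner_Integration.integral_sum Bochner_Integration.integrable_sum i) auto
  also have "\<dots> = (\<Sum>j<n. \<Sum>l<n. LINT p|(M \<Otimes>\<^sub>M M). (a j (fst p) * a l (fst p)) * (b j (snd p) * b l (snd p)))"
    by (intro sum.cong refl Bochner_Integration.integral_sum i) auto
  also have "\<dots> = (\<Sum>j<n. \<Sum>l<n. (LINT \<omega>|M. a j \<omega> * a l \<omega>) * (LINT \<omega>|M. b j \<omega> * b l \<omega>))"
    by (intro sum.cong refl pair_prod_integral(2) sq_int_mult a b) auto
  finally show ?thesis .
qed

text \<open>Two step processes over different grids can be subtracted only over a common refinement;
  \<open>j div m\<close> is the coarse cell that contains the fine cell j.\<close>

lemma sum_refine:
  fixes a g :: "nat \<Rightarrow> real"
  assumes m: "0 < m"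
  shows "(\<Sum>k<n. a k * (g (Suc k * m) - g (k * m))) = (\<Sum>j<n * m. a (j div m) * (g (Suc j) - g j))"
proof -
  have "(\<Sum>j<n * m. a (j div m) * (g (Suc j) - g j)) = (\<Sum>k<n. \<Sum>j = k * m..<k * m + m. a (j div m) * (g (Suc j) - g j))"
    by (rule sum.nat_group[symmetric])
  also have "\<dots> = (\<Sum>k<n. a k * (g (Suc k * m) - g (k * m)))"
  proof (rule sum.cong[OF refl])
    fix k
    have "(\<Sum>j = k * m..<k * m + m. a (j div m) * (g (Suc j) - g j)) = (\<Sum>j = k * m..<k * m + m. a k * (g (Suc j) - g j))"
    proof (rule sum.cong[OF refl])
      fix j assume "j \<in> {k * m..<k * m + m}"
      then have "j div m = k" by (intro div_nat_eqI) (auto simp: mult.commute)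
      then show "a (j div m) * (g (Suc j) - g j) = a k * (g (Suc j) - g j)" by simp
    qed
    also have "\<dots> = a k * (g (k * m + m) - g (k * m))"
      by (simp add: sum_distrib_left[symmetric] sum_Suc_diff')
    finally show "(\<Sum>j = k * m..<k * m + m. a (j div m) * (g (Suc j) - g j)) = a k * (g (Suc k * m) - g (k * m))"
      by (simp add: add.commute)
  qed
  finally show ?thesis ..
qed

lemma (in prob_space) abs_inner_le:
  assumes f: "square_integrable M f" and g: "square_integrable M g"
    and "(LINT \<omega>|M. (f \<omega>)\<^sup>2) \<le> e" "(LINT \<omega>|M. (g \<omega>)\<^sup>2) \<le> e"
  shows "\<bar>LINT \<omega>|M. f \<omega> * g \<omega>\<bar> \<le> e"
proof -
  have e: "0 \<le> e" by (rule order_trans[OF _ assms(3)]) simp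
  have "(LINT \<omega>|M. f \<omega> * g \<omega>)\<^sup>2 \<le> (LINT \<omega>|M. (f \<omega>)\<^sup>2) * (LINT \<omega>|M. (g \<omega>)\<^sup>2)"
    by (rule integral_sq_cauchy_schwarz[OF f g])
  also have "\<dots> \<le> e * e" using assms(3,4) e by (intro mult_mono) auto
  finally have "(LINT \<omega>|M. f \<omega> * g \<omega>)\<^sup>2 \<le> e\<^sup>2" by (simp add: power2_eq_square)
  then have "\<bar>LINT \<omega>|M. f \<omega> * g \<omega>\<bar> \<le> \<bar>e\<bar>" by (simp only: abs_le_square_iff)
  then show ?thesis using e by simp
qed

text \<open>Here every path, and not just almost every one, is continuous, starts at 0 and solves
  the equation. The general situation is reduced to this one by a change on a null set.\<close>

locale regular_noise = centered_gp M G + noise_covariance "covariance M G" \<beta> C C' \<theta> \<Psi>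
  for M :: "'a measure" and G :: "real \<Rightarrow> 'a \<Rightarrow> real" and \<beta> C C' \<theta> :: real and \<Psi> :: "real \<Rightarrow> real \<Rightarrow> real" +
  fixes X :: "real \<Rightarrow> 'a \<Rightarrow> real"
  assumes G_path: "\<omega> \<in> space M \<Longrightarrow> continuous_on {0..} (\<lambda>t. G t \<omega>)"
    and G0: "\<omega> \<in> space M \<Longrightarrow> G 0 \<omega> = 0"
    and X_meas: "0 \<le> t \<Longrightarrow> X t \<in> borel_measurable M"
    and X_path: "\<omega> \<in> space M \<Longrightarrow> continuous_on {0..} (\<lambda>t. X t \<omega>)"
    and X_eq: "\<omega> \<in> space M \<Longrightarrow> 0 \<le> t \<Longrightarrow> X t \<omega> = G t \<omega> - \<theta> * integral {0..t} (\<lambda>s. X s \<omega>)"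
begin

abbreviation R where "R \<equiv> covariance M G"

lemma G_cont_process: "cont_process G"
  by (auto simp: cont_process_def G_path intro: H_meas H_base)

lemma X_cont_process: "cont_process X"
  by (auto simp: cont_process_def X_path intro: X_meas)

lemma X0: "\<omega> \<in> space M \<Longrightarrow> X 0 \<omega> = 0"
  using X_eq[of \<omega> 0] G0 by simp

lemma X_ou: "\<omega> \<in> space M \<Longrightarrow> 0 \<le> t \<Longrightarrow> X t \<omega> = G t \<omega> - \<theta> * integral {0..t} (\<lambda>s. exp (- \<theta> * (t - s)) * G s \<omega>)"
  by (rule linear_ode_solution[OF X_path X_eq])

lemma inner_G: "(LINT \<omega>|M. G t \<omega> * G s \<omega>) = R t s" by (simp add: covariance_def)

lemma second_diff_inner:
  assumes "0 \<le> a" "0 \<le> b" "0 \<le> c" "0 \<le> d"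
  shows "(LINT \<omega>|M. (G b \<omega> - G a \<omega>) * (G d \<omega> - G c \<omega>)) = second_diff R a b c d"
proof -
  have "(LINT \<omega>|M. (G b \<omega> - G a \<omega>) * (G d \<omega> - G c \<omega>)) =
    (LINT \<omega>|M. G b \<omega> * G d \<omega> - G b \<omega> * G c \<omega> - G a \<omega> * G d \<omega> + G a \<omega> * G c \<omega>)"
    by (simp add: algebra_simps)
  also have "\<dots> = second_diff R a b c d"
    using H_mult_integrable[OF H_base H_base] assms by (simp add: inner_G)
  finally show ?thesis .
qed

lemma G_increment:
  assumes "0 \<le> s" "s \<le> t"
  shows "(LINT \<omega>|M. (G t \<omega> - G s \<omega>)\<^sup>2) \<le> K1 * (t - s) powr (2 * \<beta>)"
  using second_diff_inner[of s t s t] R_increment[OF assms] R_sym[of s t] assms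
  by (simp add: power2_eq_square)

lemma G_var: "0 \<le> t \<Longrightarrow> (LINT \<omega>|M. (G t \<omega>)\<^sup>2) \<le> K1 * t powr (2 * \<beta>)"
proof -
  assume t: "0 \<le> t"
  have "(LINT \<omega>|M. (G t \<omega>)\<^sup>2) = (LINT \<omega>|M. (G t \<omega> - G 0 \<omega>)\<^sup>2)"
    by (intro Bochner_Integration.integral_cong) (auto simp: G0)
  then show ?thesis using G_increment[of 0 t] t by simp
qed

text \<open>The explicit solution is X t = G t minus \<theta> times the integral of
  \<open>Y t s\<close> over s in [0, t].\<close>

definition Y where "Y t s \<omega> = exp (- \<theta> * (t - s)) * G s \<omega>"

lemma Y_cont_process: "cont_process (Y t)"
  unfolding Y_def by (intro cont_process_mult cont_process_det G_cont_process continuous_intros)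

lemma Y_H: "0 \<le> s \<Longrightarrow> Y t s \<in> H"
  unfolding Y_def by (intro H_cmult H_base)

lemma Y_var:
  assumes "0 \<le> s" "s \<le> t" shows "(LINT \<omega>|M. (Y t s \<omega>)\<^sup>2) \<le> K1 * t powr (2 * \<beta>)"
proof -
  have "(LINT \<omega>|M. (Y t s \<omega>)\<^sup>2) = (exp (- \<theta> * (t - s)))\<^sup>2 * (LINT \<omega>|M. (G s \<omega>)\<^sup>2)"
    by (simp add: Y_def power_mult_distrib)
  also have "\<dots> \<le> 1 * (K1 * s powr (2 * \<beta>))"
    using assms \<theta> G_var[of s] by (intro mult_mono) (auto simp: power_le_one)
  also have "\<dots> \<le> K1 * t powr (2 * \<beta>)"
    using assms params K1_nonneg by (auto intro!: mult_left_mono powr_mono2)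
  finally show ?thesis .
qed

text \<open>The increment splits into one of G with a weight at most 1 and one of the kernel, which
  is Lipschitz with constant \<theta>.\<close>

lemma Y_increment:
  assumes "0 \<le> r" "r \<le> s" "s \<le> t"
  shows "(LINT \<omega>|M. (Y t s \<omega> - Y t r \<omega>)\<^sup>2) \<le> 2 * (K1 * (s - r) powr (2 * \<beta>)) + 2 * ((\<theta> * (s - r))\<^sup>2 * (K1 * t powr (2 * \<beta>)))"
proof -
  define w where "w s = exp (- \<theta> * (t - s))" for s
  have w: "0 \<le> w s" "w s \<le> 1" using assms \<theta> by (auto simp: w_def)
  have "w r = w s * exp (- \<theta> * (s - r))" by (simp only: w_def mult_exp_exp) (simp add: algebra_simps)
  moreover have "1 - \<theta> * (s - r) \<le> exp (- \<theta> * (s - r))" using exp_ge_add_one_self[of "- \<theta> * (s - r)"] by simp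
  then have "w s * (1 - \<theta> * (s - r)) \<le> w s * exp (- \<theta> * (s - r))" using w by (intro mult_left_mono)
  ultimately have "w s - w r \<le> w s * (\<theta> * (s - r))" by (simp add: algebra_simps)
  also have "\<dots> \<le> 1 * (\<theta> * (s - r))" using w assms \<theta> by (intro mult_right_mono) auto
  finally have 1: "w s - w r \<le> \<theta> * (s - r)" by simp
  have 2: "0 \<le> w s - w r" using assms \<theta> by (simp add: w_def)
  have h: "(\<lambda>\<omega>. w s * (G s \<omega> - G r \<omega>)) \<in> H" "(\<lambda>\<omega>. (w s - w r) * G r \<omega>) \<in> H"
    using assms by (auto intro!: H_cmult H_diff H_base)
  have "(LINT \<omega>|M. (Y t s \<omega> - Y t r \<omega>)\<^sup>2) = (LINT \<omega>|M. (w s * (G s \<omega> - G r \<omega>) + (w s - w r) * G r \<omega>)\<^sup>2)"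
    by (simp add: Y_def w_def algebra_simps)
  also have "\<dots> \<le> 2 * (LINT \<omega>|M. (w s * (G s \<omega> - G r \<omega>))\<^sup>2) + 2 * (LINT \<omega>|M. ((w s - w r) * G r \<omega>)\<^sup>2)"
    by (intro integral_sq_sum_le H_sq_int h)
  also have "(LINT \<omega>|M. (w s * (G s \<omega> - G r \<omega>))\<^sup>2) \<le> K1 * (s - r) powr (2 * \<beta>)"
  proof -
    have "(LINT \<omega>|M. (w s * (G s \<omega> - G r \<omega>))\<^sup>2) = (w s)\<^sup>2 * (LINT \<omega>|M. (G s \<omega> - G r \<omega>)\<^sup>2)" by (simp add: power_mult_distrib)
    also have "\<dots> \<le> 1 * (K1 * (s - r) powr (2 * \<beta>))"
      using w assms G_increment[of r s] by (intro mult_mono) (auto simp: power_le_one)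
    finally show ?thesis by simp
  qed
  also have "(LINT \<omega>|M. ((w s - w r) * G r \<omega>)\<^sup>2) \<le> (\<theta> * (s - r))\<^sup>2 * (K1 * t powr (2 * \<beta>))"
  proof -
    have "(LINT \<omega>|M. ((w s - w r) * G r \<omega>)\<^sup>2) = (w s - w r)\<^sup>2 * (LINT \<omega>|M. (G r \<omega>)\<^sup>2)" by (simp add: power_mult_distrib)
    also have "\<dots> \<le> (\<theta> * (s - r))\<^sup>2 * (K1 * r powr (2 * \<beta>))"
      using 1 2 assms G_var[of r] by (intro mult_mono power_mono) auto
    also have "\<dots> \<le> (\<theta> * (s - r))\<^sup>2 * (K1 * t powr (2 * \<beta>))"
      using assms params K1_nonneg by (intro mult_left_mono powr_mono2) auto
    finally show ?thesis .
  qed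
  finally show ?thesis by simp
qed

text \<open>The Riemann sums are finite combinations of the noise and converge in L2, and H is
  closed.\<close>

lemma Y_integral_H:
  assumes t: "0 \<le> t" shows "(\<lambda>\<omega>. integral {0..t} (\<lambda>s. Y t s \<omega>)) \<in> H"
proof (rule H_L2_closed)
  let ?S = "\<lambda>n \<omega>. \<Sum>k<Suc n. t / real (Suc n) * Y t (real k * t / real (Suc n)) \<omega>"
  show S: "?S n \<in> H" for n using t by (intro H_sum H_cmult Y_H) auto
  have si: "square_integrable M (\<lambda>\<omega>. integral {0..t} (\<lambda>s. Y t s \<omega>))"
    by (rule cont_process_integral_sq(1)[OF Y_cont_process order_refl t H_sq_int[OF Y_H] Y_var]) auto
  define b where "b n = 2 * (K1 * (t / real (Suc n)) powr (2 * \<beta>)) + 2 * ((\<theta> * (t / real (Suc n)))\<^sup>2 * (K1 * t powr (2 * \<beta>)))" for n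
  have bound: "(LINT \<omega>|M. (?S n \<omega> - integral {0..t} (\<lambda>s. Y t s \<omega>))\<^sup>2) \<le> t\<^sup>2 * b n" for n
  proof -
    have "(LINT \<omega>|M. (integral {0..t} (\<lambda>s. Y t s \<omega>) - ?S n \<omega>)\<^sup>2) \<le> t\<^sup>2 * b n"
    proof (rule riemann_L2_bound[OF Y_cont_process t])
      show "square_integrable M (Y t s)" if "s \<in> {0..t}" for s using that by (intro H_sq_int Y_H) auto
      fix s r assume s: "s \<in> {0..t}" "r \<in> {0..t}" "r \<le> s" "s - r \<le> t / real (Suc n)"
      have "(LINT \<omega>|M. (Y t s \<omega> - Y t r \<omega>)\<^sup>2) \<le> 2 * (K1 * (s - r) powr (2 * \<beta>)) + 2 * ((\<theta> * (s - r))\<^sup>2 * (K1 * t powr (2 * \<beta>)))"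
        using s by (intro Y_increment) auto
      also have "\<dots> \<le> b n"
        unfolding b_def using s \<theta> params K1_nonneg
        by (intro add_mono mult_left_mono mult_right_mono powr_mono2 power_mono) auto
      finally show "(LINT \<omega>|M. (Y t s \<omega> - Y t r \<omega>)\<^sup>2) \<le> b n" .
    qed simp
    then show ?thesis by (simp add: power2_commute)
  qed
  have d: "(\<lambda>n. t / real (Suc n)) \<longlonglongrightarrow> 0"
    using tendsto_mult_right_zero[OF LIMSEQ_inverse_real_of_nat, of t] by (simp add: divide_inverse)
  have "(\<lambda>n. t\<^sup>2 * b n) \<longlonglongrightarrow> t\<^sup>2 * (2 * (K1 * 0 powr (2 * \<beta>)) + 2 * ((\<theta> * 0)\<^sup>2 * (K1 * t powr (2 * \<beta>))))"
    unfolding b_def using params t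
    by (intro tendsto_mult tendsto_add tendsto_const tendsto_power tendsto_powr' d) auto
  then have bl: "(\<lambda>n. t\<^sup>2 * b n) \<longlonglongrightarrow> 0" using params by simp
  have "(\<lambda>n. LINT \<omega>|M. (?S n \<omega> - integral {0..t} (\<lambda>s. Y t s \<omega>))\<^sup>2) \<longlonglongrightarrow> 0"
    by (rule tendsto_sandwich[OF _ _ tendsto_const bl]) (use bound in \<open>auto intro!: always_eventually\<close>)
  then show "L2_limit M ?S (\<lambda>\<omega>. integral {0..t} (\<lambda>s. Y t s \<omega>))"
    using si H_sq_int[OF S] by (simp add: L2_limit_def)
qed

lemma X_H:
  assumes t: "0 \<le> t" shows "X t \<in> H"
proof -
  have h: "(\<lambda>\<omega>. G t \<omega> - \<theta> * integral {0..t} (\<lambda>s. Y t s \<omega>)) \<in> H"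
    by (intro H_diff H_cmult Y_integral_H H_base t)
  have L: "L2_limit M (\<lambda>n \<omega>. G t \<omega> - \<theta> * integral {0..t} (\<lambda>s. Y t s \<omega>)) (\<lambda>\<omega>. G t \<omega> - \<theta> * integral {0..t} (\<lambda>s. Y t s \<omega>))"
    by (rule L2_limit_const[OF H_sq_int[OF h]])
  have "L2_limit M (\<lambda>n \<omega>. G t \<omega> - \<theta> * integral {0..t} (\<lambda>s. Y t s \<omega>)) (X t)"
    by (rule L2_limit_AE_cong[OF L H_meas[OF h] X_meas[OF t]]) (auto simp: X_ou[OF _ t] Y_def)
  then show ?thesis by (rule H_L2_closed[OF h])
qed

text \<open>Fubini applied to the explicit solution; the boundary term of the operator at 0 vanishes
  because G starts at 0. Used in both arguments it gives the covariance of X as a double operator on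
  R.\<close>

lemma X_inner:
  assumes s: "0 \<le> s" and Z: "square_integrable M Z"
  shows "(LINT \<omega>|M. X s \<omega> * Z \<omega>) = L s (\<lambda>u. LINT \<omega>|M. G u \<omega> * Z \<omega>)"
proof -
  note i = cont_process_integral_inner[OF Y_cont_process order_refl s H_sq_int[OF Y_H] Y_var Z, of s]
  have si: "square_integrable M (\<lambda>\<omega>. integral {0..s} (\<lambda>r. Y s r \<omega>))" by (rule H_sq_int[OF Y_integral_H[OF s]])
  have G0': "(LINT \<omega>|M. G 0 \<omega> * Z \<omega>) = 0"
  proof -
    have "(LINT \<omega>|M. G 0 \<omega> * Z \<omega>) = (LINT \<omega>|M. 0)" by (intro Bochner_Integration.integral_cong) (auto simp: G0)
    then show ?thesis by simp
  qed
  have "(LINT \<omega>|M. X s \<omega> * Z \<omega>) = (LINT \<omega>|M. G s \<omega> * Z \<omega> - \<theta> * (integral {0..s} (\<lambda>r. Y s r \<omega>) * Z \<omega>))"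
    by (intro Bochner_Integration.integral_cong) (auto simp: X_ou[OF _ s] Y_def algebra_simps)
  also have "\<dots> = (LINT \<omega>|M. G s \<omega> * Z \<omega>) - \<theta> * (LINT \<omega>|M. integral {0..s} (\<lambda>r. Y s r \<omega>) * Z \<omega>)"
    using sq_int_mult[OF H_sq_int[OF H_base[OF s]] Z] sq_int_mult[OF si Z] by simp
  also have "(LINT \<omega>|M. integral {0..s} (\<lambda>r. Y s r \<omega>) * Z \<omega>) = integral {0..s} (\<lambda>r. LINT \<omega>|M. Y s r \<omega> * Z \<omega>)"
    by (rule i(2)) auto
  also have "\<dots> = integral {0..s} (\<lambda>r. exp (- \<theta> * (s - r)) * (LINT \<omega>|M. G r \<omega> * Z \<omega>))"
    by (simp add: Y_def mult.assoc)
  finally show ?thesis unfolding ou_op_def G0' by simp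
qed

lemma K_eq:
  assumes "0 \<le> s" "0 \<le> t"
  shows "(LINT \<omega>|M. X s \<omega> * X t \<omega>) = K s t"
proof -
  have "(LINT \<omega>|M. G u \<omega> * X t \<omega>) = L t (R u)" if u: "0 \<le> u" for u
  proof -
    have "(LINT \<omega>|M. G u \<omega> * X t \<omega>) = L t (\<lambda>v. LINT \<omega>|M. G v \<omega> * G u \<omega>)"
      using X_inner[OF assms(2) H_sq_int[OF H_base[OF u]]] by (simp add: mult.commute)
    then show ?thesis by (simp add: inner_G R_sym[of _ u])
  qed
  then show ?thesis
    unfolding X_inner[OF assms(1) H_sq_int[OF X_H[OF assms(2)]]] K_def
    using assms by (intro ou_op_cong[OF \<theta>]) auto
qed

lemma K_var: "0 \<le> t \<Longrightarrow> (LINT \<omega>|M. (X t \<omega>)\<^sup>2) = K t t"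
  using K_eq[of t t] by (simp add: power2_eq_square)

lemma K_nonneg: "0 \<le> t \<Longrightarrow> 0 \<le> K t t"
  by (simp add: K_var[symmetric])

lemma K_diag_bounded: "\<exists>k. \<forall>t\<ge>0. K t t \<le> k"
proof -
  define l where "l = C * Gamma (2 * \<beta> - 1) * \<theta> powr (- (2 * \<beta>))"
  have "eventually (\<lambda>t. K t t < l + 1) at_top"
    using K_lim unfolding l_def by (rule order_tendstoD) simp
  then obtain T where T: "\<And>t. T \<le> t \<Longrightarrow> K t t < l + 1" by (auto simp: eventually_at_top_linorder)
  obtain b where "\<forall>s\<in>{0..max 0 T}. \<forall>t\<in>{0..max 0 T}. \<bar>K s t\<bar> \<le> b" using K_compact_bound[of "max 0 T"] by auto
  then have b: "\<And>t. t \<in> {0..max 0 T} \<Longrightarrow> \<bar>K t t\<bar> \<le> b" by blast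
  have "K t t \<le> max b (l + 1)" if "0 \<le> t" for t
    using T[of t] b[of t] that by (cases "T \<le> t") auto
  then show ?thesis by blast
qed

definition variance_bound where "variance_bound = (SOME k. \<forall>t\<ge>0. K t t \<le> k)"

lemma variance_bound: "0 \<le> t \<Longrightarrow> K t t \<le> variance_bound"
  using someI_ex[OF K_diag_bounded] unfolding variance_bound_def by blast

lemma variance_bound_nonneg: "0 \<le> variance_bound"
  using variance_bound[of 0] K_nonneg[of 0] by simp

lemma K_abs_le: "0 \<le> s \<Longrightarrow> 0 \<le> t \<Longrightarrow> \<bar>K s t\<bar> \<le> variance_bound"
  using abs_inner_le[OF H_sq_int[OF X_H] H_sq_int[OF X_H], of s t variance_bound] variance_bound[of s] variance_bound[of t]
  by (simp add: K_var K_eq)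

lemma X_increment_eq:
  assumes \<omega>: "\<omega> \<in> space M" and s: "0 \<le> s" "s \<le> t"
  shows "X t \<omega> - X s \<omega> = (G t \<omega> - G s \<omega>) - \<theta> * integral {s..t} (\<lambda>r. X r \<omega>)"
proof -
  have "integral {0..s} (\<lambda>r. X r \<omega>) + integral {s..t} (\<lambda>r. X r \<omega>) = integral {0..t} (\<lambda>r. X r \<omega>)"
    by (intro Henstock_Kurzweil_Integration.integral_combine s integrable_continuous_real cont_process_path[OF X_cont_process \<omega>]) auto
  then have "\<theta> * integral {0..t} (\<lambda>r. X r \<omega>) = \<theta> * integral {0..s} (\<lambda>r. X r \<omega>) + \<theta> * integral {s..t} (\<lambda>r. X r \<omega>)"
    by (simp add: distrib_left[symmetric])
  then show ?thesis using X_eq[OF \<omega>, of t] X_eq[OF \<omega>, of s] s by simp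
qed

definition K2 where "K2 T = 2 * K1 + 2 * (\<theta>\<^sup>2 * (T powr (2 - 2 * \<beta>) * variance_bound))"

lemma K2_nonneg: "0 \<le> K2 T" using K1_nonneg variance_bound_nonneg by (simp add: K2_def)

lemma X_increment:
  assumes s: "0 \<le> s" "s \<le> t" "t \<le> T"
  shows "(LINT \<omega>|M. (X t \<omega> - X s \<omega>)\<^sup>2) \<le> K2 T * (t - s) powr (2 * \<beta>)"
proof -
  have X: "square_integrable M (X r)" "(LINT \<omega>|M. (X r \<omega>)\<^sup>2) \<le> variance_bound" if "r \<in> {s..t}" for r
    using that s variance_bound[of r] by (auto intro!: H_sq_int X_H simp: K_var)
  note ci = cont_process_integral_sq[OF X_cont_process s(1,2) X]
  have "(LINT \<omega>|M. (X t \<omega> - X s \<omega>)\<^sup>2) = (LINT \<omega>|M. ((G t \<omega> - G s \<omega>) + (- \<theta>) * integral {s..t} (\<lambda>r. X r \<omega>))\<^sup>2)"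
    by (intro Bochner_Integration.integral_cong) (auto simp: X_increment_eq[OF _ s(1,2)])
  also have "\<dots> \<le> 2 * (LINT \<omega>|M. (G t \<omega> - G s \<omega>)\<^sup>2) + 2 * (LINT \<omega>|M. ((- \<theta>) * integral {s..t} (\<lambda>r. X r \<omega>))\<^sup>2)"
    using s by (intro integral_sq_sum_le sq_int_cmult ci(1) H_sq_int H_diff H_base) auto
  finally have 0: "(LINT \<omega>|M. (X t \<omega> - X s \<omega>)\<^sup>2) \<le> 2 * (LINT \<omega>|M. (G t \<omega> - G s \<omega>)\<^sup>2) + 2 * (LINT \<omega>|M. ((- \<theta>) * integral {s..t} (\<lambda>r. X r \<omega>))\<^sup>2)" .
  have 1: "(LINT \<omega>|M. (G t \<omega> - G s \<omega>)\<^sup>2) \<le> K1 * (t - s) powr (2 * \<beta>)" using s by (intro G_increment) auto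
  have "(LINT \<omega>|M. (integral {s..t} (\<lambda>r. X r \<omega>))\<^sup>2) \<le> (t - s)\<^sup>2 * variance_bound" by (rule ci(2))
  \<comment> \<open>On [0, T] the exponent 2 of the drift is traded for the exponent 2\<beta> of the
    noise; the factor \<open>T powr (2 - 2 * \<beta>)\<close> in \<open>K2\<close> pays for
    this.\<close>
  also have "(t - s)\<^sup>2 * variance_bound \<le> (t - s) powr (2 * \<beta>) * (T powr (2 - 2 * \<beta>) * variance_bound)"
  proof (cases "s = t")
    case False
    then have "(t - s)\<^sup>2 = (t - s) powr (2 * \<beta>) * (t - s) powr (2 - 2 * \<beta>)" using s by (simp add: powr_add[symmetric] powr_numeral)
    also have "\<dots> \<le> (t - s) powr (2 * \<beta>) * T powr (2 - 2 * \<beta>)" using s params by (intro mult_left_mono powr_mono2) auto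
    finally show ?thesis using variance_bound_nonneg by (simp add: mult_right_mono flip: mult.assoc)
  qed simp
  finally have "\<theta>\<^sup>2 * (LINT \<omega>|M. (integral {s..t} (\<lambda>r. X r \<omega>))\<^sup>2) \<le> \<theta>\<^sup>2 * ((t - s) powr (2 * \<beta>) * (T powr (2 - 2 * \<beta>) * variance_bound))"
    by (rule mult_left_mono) simp
  then have 2: "(LINT \<omega>|M. ((- \<theta>) * integral {s..t} (\<lambda>r. X r \<omega>))\<^sup>2) \<le> \<theta>\<^sup>2 * ((t - s) powr (2 * \<beta>) * (T powr (2 - 2 * \<beta>) * variance_bound))"
    by (simp add: power_mult_distrib)
  have "K2 T * (t - s) powr (2 * \<beta>) = 2 * (K1 * (t - s) powr (2 * \<beta>)) + 2 * (\<theta>\<^sup>2 * ((t - s) powr (2 * \<beta>) * (T powr (2 - 2 * \<beta>) * variance_bound)))"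
    by (simp add: K2_def algebra_simps)
  then show ?thesis using 0 1 2 by linarith
qed

text \<open>The difference of squares factors, and Cauchy-Schwarz leaves the increment of X times a
  bounded factor. Continuity is needed for the averages of the variance and for the paths of the
  Skorohod integral.\<close>

lemma K_diag_cont: "continuous_on {0..b} (\<lambda>t. K t t)"
proof (rule continuous_on_of_sq_holder)
  show "0 < 2 * \<beta>" using params by simp
  fix s t assume s: "s \<in> {0..b}" "t \<in> {0..b}" "s \<le> t"
  have st: "0 \<le> s" "0 \<le> t" using s by auto
  have p: "(\<lambda>\<omega>. X t \<omega> + X s \<omega>) \<in> H" "(\<lambda>\<omega>. X t \<omega> - X s \<omega>) \<in> H" using st by (auto intro!: H_add H_diff X_H)
  have "(LINT \<omega>|M. (X t \<omega> - X s \<omega>) * (X t \<omega> + X s \<omega>)) = (LINT \<omega>|M. X t \<omega> * X t \<omega> - X s \<omega> * X s \<omega>)"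
    by (simp add: algebra_simps)
  then have "K t t - K s s = (LINT \<omega>|M. (X t \<omega> - X s \<omega>) * (X t \<omega> + X s \<omega>))"
    using H_mult_integrable[OF X_H[OF st(2)] X_H[OF st(2)]] H_mult_integrable[OF X_H[OF st(1)] X_H[OF st(1)]]
    by (simp add: K_eq[symmetric] st)
  then have "(K t t - K s s)\<^sup>2 \<le> (LINT \<omega>|M. (X t \<omega> - X s \<omega>)\<^sup>2) * (LINT \<omega>|M. (X t \<omega> + X s \<omega>)\<^sup>2)"
    using integral_sq_cauchy_schwarz[OF H_sq_int[OF p(2)] H_sq_int[OF p(1)]] by simp
  also have "\<dots> \<le> (K2 b * (t - s) powr (2 * \<beta>)) * (2 * variance_bound + 2 * variance_bound)"
  proof (rule mult_mono)
    show "(LINT \<omega>|M. (X t \<omega> - X s \<omega>)\<^sup>2) \<le> K2 b * (t - s) powr (2 * \<beta>)" using s by (intro X_increment) auto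
    show "(LINT \<omega>|M. (X t \<omega> + X s \<omega>)\<^sup>2) \<le> 2 * variance_bound + 2 * variance_bound"
      using integral_sq_sum_le[OF H_sq_int[OF X_H[OF st(2)]] H_sq_int[OF X_H[OF st(1)]]] variance_bound[OF st(1)] variance_bound[OF st(2)]
      by (simp add: K_var st)
  qed (use K2_nonneg in auto)
  finally show "(K t t - K s s)\<^sup>2 \<le> (K2 b * (4 * variance_bound)) * (t - s) powr (2 * \<beta>)" by (simp add: mult_ac)
qed

end

section \<open>The Skorohod integral of the Ornstein--Uhlenbeck process\<close>

text \<open>Subtracting its mean from a variable does not increase its second moment.\<close>

lemma (in prob_space) L2_limit_centered:
  assumes L: "L2_limit M f g"
  shows "L2_limit M (\<lambda>n \<omega>. f n \<omega> - (LINT \<omega>|M. f n \<omega>)) (\<lambda>\<omega>. g \<omega> - (LINT \<omega>|M. g \<omega>))"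
proof -
  have f: "square_integrable M (f n)" and g: "square_integrable M g" for n
    using L by (auto simp: L2_limit_def)
  have c: "square_integrable M (\<lambda>\<omega>. c)" for c by (simp add: square_integrable_def)
  have "(LINT \<omega>|M. (f n \<omega> - (LINT \<omega>|M. f n \<omega>) - (g \<omega> - (LINT \<omega>|M. g \<omega>)))\<^sup>2) \<le> (LINT \<omega>|M. (f n \<omega> - g \<omega>)\<^sup>2)" for n
  proof -
    define h where "h \<omega> = f n \<omega> - g \<omega>" for \<omega>
    have h: "square_integrable M h" unfolding h_def by (intro sq_int_diff f g)
    define m where "m = (LINT \<omega>|M. h \<omega>)"
    have m: "m = (LINT \<omega>|M. f n \<omega>) - (LINT \<omega>|M. g \<omega>)"
      unfolding m_def h_def using sq_int_integrable[OF f] sq_int_integrable[OF g] by simp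
    have "(LINT \<omega>|M. (f n \<omega> - (LINT \<omega>|M. f n \<omega>) - (g \<omega> - (LINT \<omega>|M. g \<omega>)))\<^sup>2) = (LINT \<omega>|M. (h \<omega>)\<^sup>2 - 2 * m * h \<omega> + m\<^sup>2)"
    proof (intro Bochner_Integration.integral_cong refl)
      fix \<omega>
      have "f n \<omega> - (LINT \<omega>|M. f n \<omega>) - (g \<omega> - (LINT \<omega>|M. g \<omega>)) = h \<omega> - m" unfolding h_def m by linarith
      then show "(f n \<omega> - (LINT \<omega>|M. f n \<omega>) - (g \<omega> - (LINT \<omega>|M. g \<omega>)))\<^sup>2 = (h \<omega>)\<^sup>2 - 2 * m * h \<omega> + m\<^sup>2"
        by (simp only: power2_diff) (simp add: mult_ac)
    qed
    also have "\<dots> = (LINT \<omega>|M. (h \<omega>)\<^sup>2) - m\<^sup>2"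
      using h sq_int_integrable[OF h] by (simp add: square_integrable_def m_def[symmetric] prob_space power2_eq_square)
    finally show ?thesis by (simp add: h_def)
  qed
  note le = this
  have lim: "(\<lambda>n. LINT \<omega>|M. (f n \<omega> - g \<omega>)\<^sup>2) \<longlonglongrightarrow> 0" using L by (simp add: L2_limit_def)
  have "(\<lambda>n. LINT \<omega>|M. (f n \<omega> - (LINT \<omega>|M. f n \<omega>) - (g \<omega> - (LINT \<omega>|M. g \<omega>)))\<^sup>2) \<longlonglongrightarrow> 0"
    by (rule tendsto_sandwich[OF _ _ tendsto_const lim]) (use le in simp_all)
  then show ?thesis unfolding L2_limit_def by (auto intro!: sq_int_diff f g c)
qed

context regular_noise
begin

lemma step_process_eq: "step_process G X T n p = (\<Sum>k<n. X (real k * T / real n) (fst p) *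
   (G (real (Suc k) * T / real n) (snd p) - G (real k * T / real n) (snd p)))"
  by (simp add: step_process_def case_prod_unfold)

lemma step_process_sq_int:
  assumes T: "0 \<le> T" shows "square_integrable (M \<Otimes>\<^sub>M M) (step_process G X T n)"
proof -
  have "square_integrable (M \<Otimes>\<^sub>M M) (\<lambda>p. \<Sum>k<n. X (real k * T / real n) (fst p) *
     (\<lambda>\<omega>. G (real (Suc k) * T / real n) \<omega> - G (real k * T / real n) \<omega>) (snd p))"
    using T by (intro sq_int_sum pair_prod_sq_int H_sq_int X_H H_diff H_base) auto
  then show ?thesis by (simp add: step_process_eq[abs_def])
qed

lemma step_process_refine:
  assumes n: "0 < n" and m: "0 < m"
  shows "step_process G X T n p = (\<Sum>j<n * m. X (real (j div m) * T / real n) (fst p) *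
    (G (real (Suc j) * T / real (n * m)) (snd p) - G (real j * T / real (n * m)) (snd p)))"
proof -
  have e: "real (k * m) * T / real (n * m) = real k * T / real n" for k using m by simp
  show ?thesis
    unfolding step_process_eq
    using sum_refine[OF m, of "\<lambda>k. X (real k * T / real n) (fst p)" "\<lambda>j. G (real j * T / real (n * m)) (snd p)" n]
    unfolding e .
qed

lemma grid_bounds:
  fixes n m j :: nat
  assumes T: "0 \<le> T" and n: "0 < n" and m: "0 < m" and j: "j < n * m"
  shows "0 \<le> real (j div m) * T / real n" "real (j div m) * T / real n \<le> real j * T / real (n * m)"
    "real j * T / real (n * m) \<le> real (j div m) * T / real n + T / real n" "real j * T / real (n * m) \<le> T"
proof -
  show "0 \<le> real (j div m) * T / real n" using T by simp
  have "real j = real (j div m * m + j mod m)" by simp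
  then have jm: "real j = real (j div m) * real m + real (j mod m)" by (simp only: of_nat_add of_nat_mult)
  have "real (j mod m) \<le> real m" using m by (simp add: less_imp_le)
  then have 1: "real (j div m) \<le> real j / real m" and 2: "real j / real m \<le> real (j div m) + 1"
    using m jm by (simp_all add: le_divide_eq divide_le_eq distrib_right)
  have e: "real j * T / real (n * m) = (real j / real m) * (T / real n)" by simp
  have Tn: "0 \<le> T / real n" using T by simp
  show "real (j div m) * T / real n \<le> real j * T / real (n * m)"
    unfolding e using mult_right_mono[OF 1 Tn] by simp
  show "real j * T / real (n * m) \<le> real (j div m) * T / real n + T / real n"
    unfolding e using mult_right_mono[OF 2 Tn] by (simp add: distrib_right add_divide_distrib)
  have "real j \<le> real (n * m)" using j by linarith
  then have "real j * T \<le> real (n * m) * T" using T by (rule mult_right_mono)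
  then show "real j * T / real (n * m) \<le> T" using n m by (simp add: field_simps)
qed

text \<open>Over the common refinement the difference is a sum of tensors of d j and g j, and its
  squared norm is the double sum of E[d j d l] E[g j g l]. The first factor is uniformly small by
  mean square continuity of X; the second is a rectangle increment of R, and these are absolutely
  summable with bound Q T.\<close>

lemma step_process_cauchy:
  assumes T: "0 \<le> T" and N: "0 < N" and n: "N \<le> n" and m: "N \<le> m"
  shows "(LINT p|(M \<Otimes>\<^sub>M M). (step_process G X T n p - step_process G X T m p)\<^sup>2) \<le> K2 T * (T / real N) powr (2 * \<beta>) * Q T"
proof -
  have nm: "0 < n" "0 < m" using N n m by auto
  define x where "x j = real j * T / real (n * m)" for j
  define d where "d j \<omega> = X (real (j div m) * T / real n) \<omega> - X (real (j div n) * T / real m) \<omega>" for j \<omega>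
  define g where "g j \<omega> = G (x (Suc j)) \<omega> - G (x j) \<omega>" for j \<omega>
  define e where "e = K2 T * (T / real N) powr (2 * \<beta>)"
  have e0: "0 \<le> e" using K2_nonneg by (simp add: e_def)
  have x0: "0 \<le> x j" "x j \<le> x (Suc j)" "x 0 = 0" for j
    using T by (auto simp: x_def intro!: divide_right_mono mult_right_mono)
  have xT: "x (n * m) = T" using nm by (simp add: x_def)
  have eq: "step_process G X T n p - step_process G X T m p = (\<Sum>j<n * m. d j (fst p) * g j (snd p))" for p
    unfolding step_process_refine[OF nm] step_process_refine[OF nm(2,1)] d_def g_def x_def
    by (simp add: mult.commute[of m n] sum_subtractf[symmetric] left_diff_distrib del: of_nat_Suc)
  \<comment> \<open>Both coarse grid points lie below the same fine grid point by at most one coarse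
    cell, hence within T / N of each other.\<close>
  have bnd: "\<exists>s t. 0 \<le> s \<and> s \<le> t \<and> t \<le> T \<and> t - s \<le> T / real N \<and> (LINT \<omega>|M. (d j \<omega>)\<^sup>2) = (LINT \<omega>|M. (X t \<omega> - X s \<omega>)\<^sup>2)" if j: "j < n * m" for j
  proof -
    let ?a = "real (j div m) * T / real n" and ?b = "real (j div n) * T / real m"
    note 1 = grid_bounds[OF T nm j]
    have j': "j < m * n" using j by (simp add: mult.commute)
    note 2 = grid_bounds[OF T nm(2,1) j', unfolded mult.commute[of m n]]
    have N': "T / real n \<le> T / real N" "T / real m \<le> T / real N" using T N n m by (auto intro!: divide_left_mono)
    show ?thesis
    proof (cases "?b \<le> ?a")
      case True
      then show ?thesis using 1 2 N' by (intro exI[of _ ?b] exI[of _ ?a]) (auto simp: d_def)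
    next
      case False
      have "(LINT \<omega>|M. (d j \<omega>)\<^sup>2) = (LINT \<omega>|M. (X ?b \<omega> - X ?a \<omega>)\<^sup>2)" by (simp add: d_def power2_commute)
      then show ?thesis using False 1 2 N' by (intro exI[of _ ?a] exI[of _ ?b]) auto
    qed
  qed
  have de: "(LINT \<omega>|M. (d j \<omega>)\<^sup>2) \<le> e" if j: "j < n * m" for j
  proof -
    obtain s t where st: "0 \<le> s" "s \<le> t" "t \<le> T" "t - s \<le> T / real N" and de: "(LINT \<omega>|M. (d j \<omega>)\<^sup>2) = (LINT \<omega>|M. (X t \<omega> - X s \<omega>)\<^sup>2)"
      using bnd[OF j] by blast
    have "(LINT \<omega>|M. (d j \<omega>)\<^sup>2) \<le> K2 T * (t - s) powr (2 * \<beta>)" unfolding de by (rule X_increment[OF st(1-3)])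
    also have "\<dots> \<le> e" unfolding e_def using st K2_nonneg params by (intro mult_left_mono powr_mono2) auto
    finally show ?thesis .
  qed
  have dsi: "square_integrable M (d j)" for j
    unfolding d_def using T by (intro H_sq_int H_diff X_H) auto
  have gsi: "square_integrable M (g j)" for j
    unfolding g_def using x0 by (intro H_sq_int H_diff H_base)
  have "(LINT p|(M \<Otimes>\<^sub>M M). (step_process G X T n p - step_process G X T m p)\<^sup>2) =
    (\<Sum>j<n * m. \<Sum>l<n * m. (LINT \<omega>|M. d j \<omega> * d l \<omega>) * (LINT \<omega>|M. g j \<omega> * g l \<omega>))"
    unfolding eq by (rule tensor_norm[OF dsi gsi])
  also have "\<dots> \<le> (\<Sum>j<n * m. \<Sum>l<n * m. e * \<bar>second_diff R (x j) (x (Suc j)) (x l) (x (Suc l))\<bar>)"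
  proof (intro sum_mono)
    fix j l assume jl: "j \<in> {..<n * m}" "l \<in> {..<n * m}"
    have "(LINT \<omega>|M. g j \<omega> * g l \<omega>) = second_diff R (x j) (x (Suc j)) (x l) (x (Suc l))"
      unfolding g_def using x0 by (intro second_diff_inner)
    moreover have "\<bar>LINT \<omega>|M. d j \<omega> * d l \<omega>\<bar> \<le> e" using jl by (intro abs_inner_le dsi de) auto
    moreover have "a * b \<le> e * \<bar>b\<bar>" if "\<bar>a\<bar> \<le> e" for a b :: real
      using mult_right_mono[OF that, of "\<bar>b\<bar>"] abs_ge_self[of "a * b"] by (simp add: abs_mult)
    ultimately show "(LINT \<omega>|M. d j \<omega> * d l \<omega>) * (LINT \<omega>|M. g j \<omega> * g l \<omega>) \<le> e * \<bar>second_diff R (x j) (x (Suc j)) (x l) (x (Suc l))\<bar>"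
      by simp
  qed
  also have "\<dots> = e * (\<Sum>j<n * m. \<Sum>l<n * m. \<bar>second_diff R (x j) (x (Suc j)) (x l) (x (Suc l))\<bar>)"
    by (simp add: sum_distrib_left)
  also have "\<dots> \<le> e * Q (x (n * m))"
    using e0 x0 by (intro mult_left_mono second_diff_R_sum_le) auto
  finally show ?thesis by (simp add: xT e_def)
qed

lemma step_process_converges:
  assumes T: "0 \<le> T" shows "\<exists>u. L2_limit (M \<Otimes>\<^sub>M M) (step_process G X T) u"
proof (rule L2_complete[OF step_process_sq_int[OF T]])
  fix e :: real assume e: "0 < e"
  have "(\<lambda>N. T / real N) \<longlonglongrightarrow> 0"
    using tendsto_mult_right_zero[OF lim_inverse_n, of T] by (simp add: divide_inverse)
  then have "(\<lambda>N. K2 T * (T / real N) powr (2 * \<beta>) * Q T) \<longlonglongrightarrow> K2 T * 0 powr (2 * \<beta>) * Q T"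
    using params T by (intro tendsto_intros tendsto_powr') (auto intro!: always_eventually)
  then have "(\<lambda>N. K2 T * (T / real N) powr (2 * \<beta>) * Q T) \<longlonglongrightarrow> 0" using params by simp
  then have "eventually (\<lambda>N. K2 T * (T / real N) powr (2 * \<beta>) * Q T < e) sequentially"
    using e by (rule order_tendstoD)
  then obtain N0 where N0: "\<And>N. N0 \<le> N \<Longrightarrow> K2 T * (T / real N) powr (2 * \<beta>) * Q T < e"
    by (auto simp: eventually_sequentially)
  show "\<exists>K. \<forall>m\<ge>K. \<forall>n\<ge>K. (LINT p|(M \<Otimes>\<^sub>M M). (step_process G X T m p - step_process G X T n p)\<^sup>2) \<le> e"
  proof (intro exI allI impI)
    fix n m assume "Suc N0 \<le> m" "Suc N0 \<le> n"
    from step_process_cauchy[OF T _ this] N0[of "Suc N0"]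
    show "(LINT p|(M \<Otimes>\<^sub>M M). (step_process G X T m p - step_process G X T n p)\<^sup>2) \<le> e" by simp
  qed
qed

section \<open>Riemann sums of the pathwise integral and their limit\<close>

definition W where "W T n \<omega> = (\<Sum>k<n. X (real k * T / real n) \<omega> * (G (real (Suc k) * T / real n) \<omega> - G (real k * T / real n) \<omega>))"

definition path_energy where "path_energy T \<omega> = integral {0..T} (\<lambda>s. (X s \<omega>)\<^sup>2)"

text \<open>By the chain rule, \<open>\<integral>\<^sub>0\<^sup>T X dG = X\<^sub>T\<^sup>2 / 2 + \<theta> \<integral>\<^sub>0\<^sup>T X\<^sup>2 dt\<close> as a pathwise integral, because \<open>G\<close> is of
  zero quadratic variation. The divergence subtracts from each product in the Riemann sum \<open>W\<close> its
  expectation, so the Skorohod integral is this variable minus its mean.\<close>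

definition pathwise_integral where "pathwise_integral T \<omega> = (X T \<omega>)\<^sup>2 / 2 + \<theta> * path_energy T \<omega>"

lemma X_sq_cont_process: "cont_process (\<lambda>s \<omega>. (X s \<omega>)\<^sup>2)"
  unfolding power2_eq_square by (intro cont_process_mult X_cont_process)

lemma X2_sq_int: "0 \<le> t \<Longrightarrow> square_integrable M (\<lambda>\<omega>. (X t \<omega>)\<^sup>2)"
  by (intro sq_int_sq_gaussian H_gaussian X_H)

lemma X4: "0 \<le> t \<Longrightarrow> (LINT \<omega>|M. ((X t \<omega>)\<^sup>2)\<^sup>2) = 3 * (K t t)\<^sup>2"
  using centered_gaussian_moments(3)[OF H_gaussian[OF X_H[of t]]] by (simp add: K_var power_mult[symmetric])

lemma X4_le: "0 \<le> t \<Longrightarrow> (LINT \<omega>|M. ((X t \<omega>)\<^sup>2)\<^sup>2) \<le> 3 * variance_bound\<^sup>2"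
  unfolding X4 using variance_bound[of t] K_nonneg[of t] by (intro mult_left_mono power_mono) auto

lemma path_energy_sq_int: "0 \<le> T \<Longrightarrow> square_integrable M (path_energy T)"
  unfolding path_energy_def by (rule cont_process_integral_sq(1)[OF X_sq_cont_process order_refl _ X2_sq_int X4_le]) auto

lemma path_energy_inner:
  assumes T: "0 \<le> T" and Z: "square_integrable M Z"
  shows "(\<lambda>s. LINT \<omega>|M. (X s \<omega>)\<^sup>2 * Z \<omega>) integrable_on {0..T}"
    "(LINT \<omega>|M. path_energy T \<omega> * Z \<omega>) = integral {0..T} (\<lambda>s. LINT \<omega>|M. (X s \<omega>)\<^sup>2 * Z \<omega>)"
  unfolding path_energy_def by (rule cont_process_integral_inner[OF X_sq_cont_process order_refl T X2_sq_int X4_le Z]; simp)+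

lemma path_energy_mean: "0 \<le> T \<Longrightarrow> (LINT \<omega>|M. path_energy T \<omega>) = integral {0..T} (\<lambda>s. K s s)"
proof -
  assume T: "0 \<le> T"
  have "square_integrable M (\<lambda>_. 1)" by (simp add: square_integrable_def)
  from path_energy_inner(2)[OF T this] have "(LINT \<omega>|M. path_energy T \<omega>) = integral {0..T} (\<lambda>s. LINT \<omega>|M. (X s \<omega>)\<^sup>2)" by simp
  also have "\<dots> = integral {0..T} (\<lambda>s. K s s)" by (rule integral_cong) (simp add: K_var)
  finally show ?thesis .
qed

lemma pathwise_integral_sq_int: "0 \<le> T \<Longrightarrow> square_integrable M (pathwise_integral T)"
  using sq_int_add[OF sq_int_cmult[OF X2_sq_int, of T "1/2"] sq_int_cmult[OF path_energy_sq_int, of T \<theta>]]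
  by (simp add: pathwise_integral_def[abs_def])

lemma W_sq_int: "0 \<le> T \<Longrightarrow> square_integrable M (W T n)"
  unfolding W_def by (intro sq_int_sum H_wick(1) X_H H_diff H_base) auto

text \<open>On one cell a (b - a) = (b^2 - a^2) / 2 - (b - a)^2 / 2, and the increment of G is that
  of X plus \<theta> times the integral of X. The errors are half the quadratic variation of X and
  the effect of freezing X at the left end point in the drift.\<close>

lemma W_diff:
  assumes T: "0 \<le> T" and n: "0 < n" and \<omega>: "\<omega> \<in> space M"
  shows "W T n \<omega> - pathwise_integral T \<omega> =
    - (\<Sum>k<n. (X (real (Suc k) * T / real n) \<omega> - X (real k * T / real n) \<omega>)\<^sup>2) / 2 +
    \<theta> * (\<Sum>k<n. integral {real k * T / real n..real (Suc k) * T / real n} (\<lambda>s. (X (real k * T / real n) \<omega> - X s \<omega>) * X s \<omega>))"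
proof -
  let ?t = "\<lambda>k. real k * T / real n"
  have le: "0 \<le> ?t k" "?t k \<le> ?t (Suc k)" for k using T by (auto intro!: divide_right_mono mult_right_mono)
  have "X (?t k) \<omega> * (G (?t (Suc k)) \<omega> - G (?t k) \<omega>) =
     ((X (?t (Suc k)) \<omega>)\<^sup>2 / 2 - (X (?t k) \<omega>)\<^sup>2 / 2) - (X (?t (Suc k)) \<omega> - X (?t k) \<omega>)\<^sup>2 / 2
     + \<theta> * integral {?t k..?t (Suc k)} (\<lambda>s. (X (?t k) \<omega> - X s \<omega>) * X s \<omega>) + \<theta> * integral {?t k..?t (Suc k)} (\<lambda>s. (X s \<omega>)\<^sup>2)" for k
  proof -
    have Xc: "continuous_on {?t k..?t (Suc k)} (\<lambda>s. X s \<omega>)" by (rule cont_process_path[OF X_cont_process \<omega> le(1)])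
    have "integral {?t k..?t (Suc k)} (\<lambda>s. (X (?t k) \<omega> - X s \<omega>) * X s \<omega>) =
       integral {?t k..?t (Suc k)} (\<lambda>s. X (?t k) \<omega> * X s \<omega> - (X s \<omega>)\<^sup>2)"
      by (simp add: left_diff_distrib power2_eq_square)
    also have "\<dots> = X (?t k) \<omega> * integral {?t k..?t (Suc k)} (\<lambda>s. X s \<omega>) - integral {?t k..?t (Suc k)} (\<lambda>s. (X s \<omega>)\<^sup>2)"
    proof -
      have "(\<lambda>s. X (?t k) \<omega> * X s \<omega>) integrable_on {?t k..?t (Suc k)}" "(\<lambda>s. (X s \<omega>)\<^sup>2) integrable_on {?t k..?t (Suc k)}"
        by (intro integrable_continuous_real continuous_on_mult continuous_on_const continuous_on_power Xc)+
      from Henstock_Kurzweil_Integration.integral_diff[OF this] show ?thesis unfolding integral_mult_right .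
    qed
    finally have i: "integral {?t k..?t (Suc k)} (\<lambda>s. (X (?t k) \<omega> - X s \<omega>) * X s \<omega>) =
      X (?t k) \<omega> * integral {?t k..?t (Suc k)} (\<lambda>s. X s \<omega>) - integral {?t k..?t (Suc k)} (\<lambda>s. (X s \<omega>)\<^sup>2)" .
    have g: "G (?t (Suc k)) \<omega> - G (?t k) \<omega> = X (?t (Suc k)) \<omega> - X (?t k) \<omega> + \<theta> * integral {?t k..?t (Suc k)} (\<lambda>s. X s \<omega>)"
      using X_increment_eq[OF \<omega> le] by simp
    have "a * (b - a + \<theta> * c) = (b\<^sup>2 / 2 - a\<^sup>2 / 2) - (b - a)\<^sup>2 / 2 + \<theta> * (a * c - d) + \<theta> * d" for a b c d :: real
      by (simp add: power2_eq_square field_simps)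
    then show ?thesis unfolding i g .
  qed
  then have "W T n \<omega> = (\<Sum>k<n. (X (?t (Suc k)) \<omega>)\<^sup>2 / 2 - (X (?t k) \<omega>)\<^sup>2 / 2) - (\<Sum>k<n. (X (?t (Suc k)) \<omega> - X (?t k) \<omega>)\<^sup>2 / 2)
     + (\<Sum>k<n. \<theta> * integral {?t k..?t (Suc k)} (\<lambda>s. (X (?t k) \<omega> - X s \<omega>) * X s \<omega>)) + (\<Sum>k<n. \<theta> * integral {?t k..?t (Suc k)} (\<lambda>s. (X s \<omega>)\<^sup>2))"
    unfolding W_def by (simp only: sum.distrib sum_subtractf)
  also have "(\<Sum>k<n. (X (?t (Suc k)) \<omega>)\<^sup>2 / 2 - (X (?t k) \<omega>)\<^sup>2 / 2) = (X T \<omega>)\<^sup>2 / 2"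
    using sum_lessThan_telescope[of "\<lambda>k. (X (?t k) \<omega>)\<^sup>2 / 2" n] n X0[OF \<omega>] by simp
  also have "(\<Sum>k<n. \<theta> * integral {?t k..?t (Suc k)} (\<lambda>s. (X s \<omega>)\<^sup>2)) = \<theta> * path_energy T \<omega>"
    unfolding path_energy_def integral_grid[OF T cont_process_path[OF X_sq_cont_process \<omega> order_refl] n] by (simp add: sum_distrib_left)
  finally show ?thesis by (simp add: pathwise_integral_def sum_distrib_left sum_divide_distrib)
qed

text \<open>Let \<epsilon>, of order n^(-2\<beta>), bound the variance of one increment. By Gaussian
  fourth moments the quadratic variation has L2 norm of order n \<epsilon>; by Wick's formula the
  drift error has L2 norm of the order of the square root of \<epsilon>.\<close>

lemma W_L2_bound:
  assumes T: "0 \<le> T" and n: "0 < n"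
  shows "(LINT \<omega>|M. (W T n \<omega> - pathwise_integral T \<omega>)\<^sup>2) \<le>
    3 / 2 * (real n * (K2 T * (T / real n) powr (2 * \<beta>)))\<^sup>2 + 2 * \<theta>\<^sup>2 * (T\<^sup>2 * (3 * (K2 T * (T / real n) powr (2 * \<beta>) * variance_bound)))"
proof -
  let ?t = "\<lambda>k. real k * T / real n"
  define \<epsilon> where "\<epsilon> = K2 T * (T / real n) powr (2 * \<beta>)"
  have \<epsilon>0: "0 \<le> \<epsilon>" using K2_nonneg by (simp add: \<epsilon>_def)
  have le: "0 \<le> ?t k" "?t k \<le> ?t (Suc k)" for k using T by (auto intro!: divide_right_mono mult_right_mono)
  have dT: "?t (Suc k) - ?t k = T / real n" for k by (simp add: add_divide_distrib distrib_right)
  have leT: "?t (Suc k) \<le> T" if "k < n" for k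
  proof -
    have "real (Suc k) * T \<le> real n * T" using that T by (intro mult_right_mono) auto
    then show ?thesis using n by (simp add: field_simps del: of_nat_Suc)
  qed
  define d where "d k \<omega> = X (?t (Suc k)) \<omega> - X (?t k) \<omega>" for k \<omega>
  define J where "J k \<omega> = integral {?t k..?t (Suc k)} (\<lambda>s. (X (?t k) \<omega> - X s \<omega>) * X s \<omega>)" for k \<omega>
  have dH: "d k \<in> H" for k unfolding d_def using le T by (intro H_diff X_H) (auto intro: order_trans)
  have d2: "(LINT \<omega>|M. (d k \<omega>)\<^sup>2) \<le> \<epsilon>" if "k < n" for k
    using X_increment[OF le(1) le(2) leT[OF that]] unfolding d_def dT \<epsilon>_def .
  have d2si: "square_integrable M (\<lambda>\<omega>. (d k \<omega>)\<^sup>2)" for k by (intro sq_int_sq_gaussian H_gaussian dH)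
  have d4: "(LINT \<omega>|M. ((d k \<omega>)\<^sup>2)\<^sup>2) \<le> 3 * \<epsilon>\<^sup>2" if "k < n" for k
  proof -
    have "(LINT \<omega>|M. ((d k \<omega>)\<^sup>2)\<^sup>2) = 3 * (LINT \<omega>|M. (d k \<omega>)\<^sup>2)\<^sup>2"
      using centered_gaussian_moments(3)[OF H_gaussian[OF dH]] by (simp add: power_mult[symmetric])
    also have "\<dots> \<le> 3 * \<epsilon>\<^sup>2" using d2[OF that] by (intro mult_left_mono power_mono) auto
    finally show ?thesis .
  qed
  have sumsq: "(LINT \<omega>|M. (\<Sum>k<n. f k \<omega>)\<^sup>2) \<le> (real n)\<^sup>2 * e"
    if f: "\<And>k. k < n \<Longrightarrow> square_integrable M (f k)" and e: "\<And>k. k < n \<Longrightarrow> (LINT \<omega>|M. (f k \<omega>)\<^sup>2) \<le> e" for f :: "nat \<Rightarrow> 'a \<Rightarrow> real" and e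
  proof -
    have "(LINT \<omega>|M. (\<Sum>k<n. f k \<omega>)\<^sup>2) \<le> (LINT \<omega>|M. real n * (\<Sum>k<n. (f k \<omega>)\<^sup>2))"
      using sq_int_sum[of "{..<n}" M f] f by (intro integral_mono sum_sq_le_card) (auto simp: square_integrable_def)
    also have "\<dots> = real n * (\<Sum>k<n. LINT \<omega>|M. (f k \<omega>)\<^sup>2)" using f by (simp add: square_integrable_def)
    also have "\<dots> \<le> real n * (\<Sum>k<n. e)" using e by (intro mult_left_mono sum_mono) auto
    finally show ?thesis by (simp add: power2_eq_square)
  qed
  have Jk: "square_integrable M (J k)" "(LINT \<omega>|M. (J k \<omega>)\<^sup>2) \<le> (T / real n)\<^sup>2 * (3 * (\<epsilon> * variance_bound))" if k: "k < n" for k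
  proof -
    have cp: "cont_process (\<lambda>s \<omega>. (X (?t k) \<omega> - X s \<omega>) * X s \<omega>)"
      by (intro cont_process_mult cont_process_diff cont_process_const X_cont_process X_meas le)
    have si: "square_integrable M (\<lambda>\<omega>. (X (?t k) \<omega> - X s \<omega>) * X s \<omega>)"
      and bd: "(LINT \<omega>|M. ((X (?t k) \<omega> - X s \<omega>) * X s \<omega>)\<^sup>2) \<le> 3 * (\<epsilon> * variance_bound)" if s: "s \<in> {?t k..?t (Suc k)}" for s
    proof -
      have s0: "0 \<le> s" using s le[of k] by auto
      have h: "(\<lambda>\<omega>. X (?t k) \<omega> - X s \<omega>) \<in> H" by (intro H_diff X_H le s0)
      show "square_integrable M (\<lambda>\<omega>. (X (?t k) \<omega> - X s \<omega>) * X s \<omega>)" by (rule H_wick(1)[OF h X_H[OF s0]])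
      have a: "(LINT \<omega>|M. (X (?t k) \<omega> - X s \<omega>)\<^sup>2) \<le> \<epsilon>"
      proof -
        have "(LINT \<omega>|M. (X (?t k) \<omega> - X s \<omega>)\<^sup>2) = (LINT \<omega>|M. (X s \<omega> - X (?t k) \<omega>)\<^sup>2)" by (simp add: power2_commute)
        also have "\<dots> \<le> K2 T * (s - ?t k) powr (2 * \<beta>)" using s leT[OF k] by (intro X_increment le) auto
        also have "\<dots> \<le> \<epsilon>" unfolding \<epsilon>_def using s dT[of k] K2_nonneg params by (intro mult_left_mono powr_mono2) auto
        finally show ?thesis .
      qed
      have b: "(LINT \<omega>|M. (X s \<omega>)\<^sup>2) \<le> variance_bound" using variance_bound[OF s0] K_var[OF s0] by simp
      have "(LINT \<omega>|M. ((X (?t k) \<omega> - X s \<omega>) * X s \<omega>)\<^sup>2) =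
         (LINT \<omega>|M. (X (?t k) \<omega> - X s \<omega>)\<^sup>2) * (LINT \<omega>|M. (X s \<omega>)\<^sup>2) + 2 * (LINT \<omega>|M. (X (?t k) \<omega> - X s \<omega>) * X s \<omega>)\<^sup>2"
        using H_wick(2)[OF h X_H[OF s0]] by (simp add: power_mult_distrib)
      \<comment> \<open>Cauchy-Schwarz bounds the squared covariance in Wick's formula by the
        product of the variances, which makes 1 + 2 = 3 of them.\<close>
      also have "\<dots> \<le> 3 * ((LINT \<omega>|M. (X (?t k) \<omega> - X s \<omega>)\<^sup>2) * (LINT \<omega>|M. (X s \<omega>)\<^sup>2))"
        using integral_sq_cauchy_schwarz[OF H_sq_int[OF h] H_sq_int[OF X_H[OF s0]]] by linarith
      also have "\<dots> \<le> 3 * (\<epsilon> * variance_bound)" using a b \<epsilon>0 by (intro mult_left_mono mult_mono) auto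
      finally show "(LINT \<omega>|M. ((X (?t k) \<omega> - X s \<omega>) * X s \<omega>)\<^sup>2) \<le> 3 * (\<epsilon> * variance_bound)" .
    qed
    show "square_integrable M (J k)" "(LINT \<omega>|M. (J k \<omega>)\<^sup>2) \<le> (T / real n)\<^sup>2 * (3 * (\<epsilon> * variance_bound))"
      using cont_process_integral_sq[OF cp le si bd, of k] unfolding J_def dT by auto
  qed
  have S1: "square_integrable M (\<lambda>\<omega>. (-1/2) * (\<Sum>k<n. (d k \<omega>)\<^sup>2))" by (intro sq_int_cmult sq_int_sum d2si)
  have S2: "square_integrable M (\<lambda>\<omega>. \<theta> * (\<Sum>k<n. J k \<omega>))" by (intro sq_int_cmult sq_int_sum Jk) auto
  have "(LINT \<omega>|M. (W T n \<omega> - pathwise_integral T \<omega>)\<^sup>2) = (LINT \<omega>|M. ((-1/2) * (\<Sum>k<n. (d k \<omega>)\<^sup>2) + \<theta> * (\<Sum>k<n. J k \<omega>))\<^sup>2)"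
    by (intro Bochner_Integration.integral_cong) (auto simp: W_diff[OF T n] d_def J_def)
  also have "\<dots> \<le> 2 * (LINT \<omega>|M. ((-1/2) * (\<Sum>k<n. (d k \<omega>)\<^sup>2))\<^sup>2) + 2 * (LINT \<omega>|M. (\<theta> * (\<Sum>k<n. J k \<omega>))\<^sup>2)"
    by (rule integral_sq_sum_le[OF S1 S2])
  also have "\<dots> = 1 / 2 * (LINT \<omega>|M. (\<Sum>k<n. (d k \<omega>)\<^sup>2)\<^sup>2) + 2 * \<theta>\<^sup>2 * (LINT \<omega>|M. (\<Sum>k<n. J k \<omega>)\<^sup>2)"
  proof -
    have "(- 1 / 2)\<^sup>2 = (1 / 4 :: real)" by (simp add: power2_eq_square)
    then show ?thesis unfolding power_mult_distrib integral_mult_right_zero by simp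
  qed
  also have "\<dots> \<le> 1 / 2 * ((real n)\<^sup>2 * (3 * \<epsilon>\<^sup>2)) + 2 * \<theta>\<^sup>2 * ((real n)\<^sup>2 * ((T / real n)\<^sup>2 * (3 * (\<epsilon> * variance_bound))))"
    by (intro add_mono mult_left_mono sumsq d2si d4 Jk) auto
  also have "\<dots> = 3 / 2 * (real n * \<epsilon>)\<^sup>2 + 2 * \<theta>\<^sup>2 * (T\<^sup>2 * (3 * (\<epsilon> * variance_bound)))"
    using n by (simp add: power_mult_distrib power_divide)
  finally show ?thesis by (simp add: \<epsilon>_def)
qed

lemma W_L2_limit:
  assumes T: "0 \<le> T" shows "L2_limit M (W T) (pathwise_integral T)"
proof -
  have d: "(\<lambda>n. T / real n) \<longlonglongrightarrow> 0"
    using tendsto_mult_right_zero[OF lim_inverse_n, of T] by (simp add: divide_inverse)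
  have p1: "(\<lambda>n. (T / real n) powr (2 * \<beta>)) \<longlonglongrightarrow> 0"
  proof -
    have "(\<lambda>n. (T / real n) powr (2 * \<beta>)) \<longlonglongrightarrow> 0 powr (2 * \<beta>)"
      using params T by (intro tendsto_powr' d tendsto_const) (auto intro!: always_eventually)
    then show ?thesis using params by simp
  qed
  \<comment> \<open>Zero quadratic variation: n (T / n)^(2\<beta>) equals T (T / n)^(2\<beta> - 1),
    whose exponent is positive.\<close>
  have p2: "(\<lambda>n. real n * (T / real n) powr (2 * \<beta>)) \<longlonglongrightarrow> 0"
  proof (rule Lim_transform_eventually)
    have "(\<lambda>n. (T / real n) powr (2 * \<beta> - 1)) \<longlonglongrightarrow> 0 powr (2 * \<beta> - 1)"
      using params T by (intro tendsto_powr' d tendsto_const) (auto intro!: always_eventually)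
    then show "(\<lambda>n. T * (T / real n) powr (2 * \<beta> - 1)) \<longlonglongrightarrow> 0"
      using params by (intro tendsto_mult_right_zero) simp
    show "eventually (\<lambda>n. T * (T / real n) powr (2 * \<beta> - 1) = real n * (T / real n) powr (2 * \<beta>)) sequentially"
      using eventually_gt_at_top[of 0]
    proof eventually_elim
      case (elim n)
      show ?case
      proof (cases "T = 0")
        case False
        then have "(T / real n) powr (2 * \<beta> - 1) = (T / real n) powr (2 * \<beta>) / (T / real n)"
          using T elim by (simp add: powr_diff)
        then show ?thesis using False elim by simp
      qed simp
    qed
  qed
  have b: "(\<lambda>n. 3 / 2 * (real n * (K2 T * (T / real n) powr (2 * \<beta>)))\<^sup>2 + 2 * \<theta>\<^sup>2 * (T\<^sup>2 * (3 * (K2 T * (T / real n) powr (2 * \<beta>) * variance_bound)))) \<longlonglongrightarrow> 0"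
  proof -
    have "(\<lambda>n. 3 / 2 * (K2 T * (real n * (T / real n) powr (2 * \<beta>)))\<^sup>2 + 2 * \<theta>\<^sup>2 * (T\<^sup>2 * (3 * (K2 T * (T / real n) powr (2 * \<beta>) * variance_bound))))
       \<longlonglongrightarrow> 3 / 2 * (K2 T * 0)\<^sup>2 + 2 * \<theta>\<^sup>2 * (T\<^sup>2 * (3 * (K2 T * 0 * variance_bound)))"
      by (intro tendsto_add tendsto_mult tendsto_const tendsto_power p1 p2)
    then show ?thesis by (simp add: mult.left_commute[of _ "K2 T"])
  qed
  have "(\<lambda>n. LINT \<omega>|M. (W T n \<omega> - pathwise_integral T \<omega>)\<^sup>2) \<longlonglongrightarrow> 0"
  proof (rule tendsto_sandwich[OF _ _ tendsto_const b])
    show "eventually (\<lambda>n. (LINT \<omega>|M. (W T n \<omega> - pathwise_integral T \<omega>)\<^sup>2) \<le>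
      3 / 2 * (real n * (K2 T * (T / real n) powr (2 * \<beta>)))\<^sup>2 + 2 * \<theta>\<^sup>2 * (T\<^sup>2 * (3 * (K2 T * (T / real n) powr (2 * \<beta>) * variance_bound)))) sequentially"
      using eventually_gt_at_top[of 0] by eventually_elim (rule W_L2_bound[OF T])
  qed simp
  then show ?thesis using W_sq_int[OF T] pathwise_integral_sq_int[OF T] by (simp add: L2_limit_def)
qed

definition ou_skorohod where "ou_skorohod T \<omega> = pathwise_integral T \<omega> - (K T T / 2 + \<theta> * integral {0..T} (\<lambda>s. K s s))"

lemma pathwise_integral_mean: "0 \<le> T \<Longrightarrow> (LINT \<omega>|M. pathwise_integral T \<omega>) = K T T / 2 + \<theta> * integral {0..T} (\<lambda>s. K s s)"
  using sq_int_integrable[OF X2_sq_int, of T] sq_int_integrable[OF path_energy_sq_int, of T]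
  by (simp add: pathwise_integral_def[abs_def] K_var path_energy_mean)

lemma ou_skorohod_skorohod:
  assumes T: "0 \<le> T" shows "skorohod_integral M G X T (ou_skorohod T)"
proof -
  obtain u where u: "L2_limit (M \<Otimes>\<^sub>M M) (step_process G X T) u" using step_process_converges[OF T] by blast
  have "divergence M G u (ou_skorohod T)"
  proof (rule divergence_L2_limit[where J = "\<lambda>n. {..<n}" and A = "\<lambda>n k. X (real k * T / real n)"
        and B = "\<lambda>n k \<omega>. G (real (Suc k) * T / real n) \<omega> - G (real k * T / real n) \<omega>"])
    show "X (real k * T / real n) \<in> H" for n k using T by (intro X_H) auto
    show "(\<lambda>\<omega>. G (real (Suc k) * T / real n) \<omega> - G (real k * T / real n) \<omega>) \<in> H" for n k
      using T by (intro H_diff H_base) auto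
    show "L2_limit (M \<Otimes>\<^sub>M M) (\<lambda>n p. \<Sum>k<n. X (real k * T / real n) (fst p) *
        (G (real (Suc k) * T / real n) (snd p) - G (real k * T / real n) (snd p))) u"
      using u by (simp add: step_process_eq[abs_def])
    have i: "integrable M (\<lambda>\<omega>. X (real k * T / real n) \<omega> * (G (real (Suc k) * T / real n) \<omega> - G (real k * T / real n) \<omega>))" for k n
      using T by (intro H_mult_integrable X_H H_diff H_base) auto
    \<comment> \<open>Centering \<open>W\<close> as a whole amounts to centering each product, which
      is the form in which the divergence of a step process is known.\<close>
    have "W T n \<omega> - (LINT \<omega>|M. W T n \<omega>) = (\<Sum>k<n. X (real k * T / real n) \<omega> * (G (real (Suc k) * T / real n) \<omega> - G (real k * T / real n) \<omega>)
       - (LINT \<omega>|M. X (real k * T / real n) \<omega> * (G (real (Suc k) * T / real n) \<omega> - G (real k * T / real n) \<omega>)))" for n \<omega>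
      unfolding W_def Bochner_Integration.integral_sum[OF i] by (simp only: sum_subtractf)
    with L2_limit_centered[OF W_L2_limit[OF T]] show "L2_limit M (\<lambda>n \<omega>. \<Sum>k<n. X (real k * T / real n) \<omega> * (G (real (Suc k) * T / real n) \<omega> - G (real k * T / real n) \<omega>)
       - (LINT \<omega>|M. X (real k * T / real n) \<omega> * (G (real (Suc k) * T / real n) \<omega> - G (real k * T / real n) \<omega>))) (ou_skorohod T)"
      by (simp add: ou_skorohod_def[abs_def] pathwise_integral_mean[OF T])
  qed simp
  then show ?thesis using u unfolding skorohod_integral_def by blast
qed

lemma ou_skorohod_path: "\<omega> \<in> space M \<Longrightarrow> continuous_on {0..} (\<lambda>T. ou_skorohod T \<omega>)"
proof -
  assume \<omega>: "\<omega> \<in> space M"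
  have "continuous_on {0..b} (\<lambda>T. ou_skorohod T \<omega>)" for b
    unfolding ou_skorohod_def pathwise_integral_def path_energy_def
    by (intro continuous_on_diff continuous_on_add continuous_on_divide continuous_on_power continuous_on_mult continuous_on_const
        indefinite_integral_continuous_1 integrable_continuous_real cont_process_path[OF X_cont_process \<omega>] cont_process_path[OF X_sq_cont_process \<omega>] K_diag_cont) auto
  then show ?thesis by (rule continuous_on_halfline)
qed

end

section \<open>Long-time behaviour\<close>

text \<open>For (k + 1)^m \<le> T \<le> (k + 2)^m monotonicity encloses f T / T between neighbouring
  members of the sequence, up to the ratio of consecutive m-th powers, which tends to 1.\<close>

lemma tendsto_of_power_subsequence:
  fixes f :: "real \<Rightarrow> real" and m :: nat
  assumes m: "0 < m" and mono: "\<And>s t. 0 \<le> s \<Longrightarrow> s \<le> t \<Longrightarrow> f s \<le> f t" and nn: "\<And>t. 0 \<le> t \<Longrightarrow> 0 \<le> f t"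
    and lim: "(\<lambda>n. f (real (Suc n) ^ m) / real (Suc n) ^ m) \<longlonglongrightarrow> l"
  shows "((\<lambda>T. f T / T) \<longlongrightarrow> l) at_top"
proof -
  \<comment> \<open>\<open>Suc (k T)\<close> is the integer part of the m-th root of T; for T \<ge>
    1 it is at least 1, so the subtraction does not truncate.\<close>
  define k where "k T = nat \<lfloor>root m T\<rfloor> - 1" for T
  have k: "real (Suc (k T)) ^ m \<le> T" "T \<le> real (Suc (Suc (k T))) ^ m" if T: "1 \<le> T" for T
  proof -
    have y: "1 \<le> root m T" using T m by simp
    have yT: "root m T ^ m = T" using T m by simp
    have fl: "1 \<le> \<lfloor>root m T\<rfloor>" using y by simp
    then have 1: "real (Suc (k T)) = real_of_int \<lfloor>root m T\<rfloor>" unfolding k_def by simp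
    have 2: "real (Suc (Suc (k T))) = real_of_int \<lfloor>root m T\<rfloor> + 1" using 1 by simp
    have "real (Suc (k T)) ^ m \<le> root m T ^ m" unfolding 1 using fl by (intro power_mono) auto
    then show "real (Suc (k T)) ^ m \<le> T" by (simp only: yT)
    have "root m T ^ m \<le> real (Suc (Suc (k T))) ^ m"
      unfolding 2 using y real_of_int_floor_add_one_gt[of "root m T"] by (intro power_mono) linarith+
    then show "T \<le> real (Suc (Suc (k T))) ^ m" by (simp only: yT)
  qed
  have kl: "filterlim k sequentially at_top"
    unfolding filterlim_at_top
  proof
    fix Z
    show "eventually (\<lambda>T. Z \<le> k T) at_top"
      using eventually_ge_at_top[of "real (Suc Z) ^ m"]
    proof eventually_elim
      case (elim T)
      have "real (Suc Z) = root m (real (Suc Z) ^ m)" using m by (simp add: real_root_power_cancel)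
      also have "\<dots> \<le> root m T" using elim m by simp
      finally have "int (Suc Z) \<le> \<lfloor>root m T\<rfloor>" by (simp add: le_floor_iff)
      then show ?case unfolding k_def by linarith
    qed
  qed
  have r1: "(\<lambda>n. (real (Suc n) / real (Suc (Suc n))) ^ m) \<longlonglongrightarrow> 1 ^ m"
    by (intro tendsto_power) real_asymp
  have r2: "(\<lambda>n. (real (Suc (Suc n)) / real (Suc n)) ^ m) \<longlonglongrightarrow> 1 ^ m"
    by (intro tendsto_power) real_asymp
  have lo: "(\<lambda>n. f (real (Suc n) ^ m) / real (Suc n) ^ m * (real (Suc n) / real (Suc (Suc n))) ^ m) \<longlonglongrightarrow> l"
    using tendsto_mult[OF lim r1] by simp
  have hi: "(\<lambda>n. f (real (Suc (Suc n)) ^ m) / real (Suc (Suc n)) ^ m * (real (Suc (Suc n)) / real (Suc n)) ^ m) \<longlonglongrightarrow> l"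
    using tendsto_mult[OF LIMSEQ_Suc[OF lim] r2] by simp
  show ?thesis
  proof (rule tendsto_sandwich)
    show "((\<lambda>T. f (real (Suc (k T)) ^ m) / real (Suc (k T)) ^ m * (real (Suc (k T)) / real (Suc (Suc (k T)))) ^ m) \<longlongrightarrow> l) at_top"
      by (rule filterlim_compose[OF lo kl])
    show "((\<lambda>T. f (real (Suc (Suc (k T))) ^ m) / real (Suc (Suc (k T))) ^ m * (real (Suc (Suc (k T))) / real (Suc (k T))) ^ m) \<longlongrightarrow> l) at_top"
      by (rule filterlim_compose[OF hi kl])
    show "eventually (\<lambda>T. f (real (Suc (k T)) ^ m) / real (Suc (k T)) ^ m * (real (Suc (k T)) / real (Suc (Suc (k T)))) ^ m \<le> f T / T) at_top"
      using eventually_ge_at_top[of 1]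
    proof eventually_elim
      case (elim T)
      have "f (real (Suc (k T)) ^ m) / real (Suc (k T)) ^ m * (real (Suc (k T)) / real (Suc (Suc (k T)))) ^ m =
        f (real (Suc (k T)) ^ m) / real (Suc (Suc (k T))) ^ m" by (simp add: power_divide del: of_nat_Suc)
      also have "\<dots> \<le> f T / T" using k[OF elim] elim by (intro frac_le nn mono) (auto intro: order_trans)
      finally show ?case .
    qed
    show "eventually (\<lambda>T. f T / T \<le> f (real (Suc (Suc (k T))) ^ m) / real (Suc (Suc (k T))) ^ m * (real (Suc (Suc (k T))) / real (Suc (k T))) ^ m) at_top"
      using eventually_ge_at_top[of 1]
    proof eventually_elim
      case (elim T)
      have "f T / T \<le> f (real (Suc (Suc (k T))) ^ m) / real (Suc (k T)) ^ m"
        using k[OF elim] elim by (intro frac_le nn mono) (auto intro: order_trans)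
      also have "\<dots> = f (real (Suc (Suc (k T))) ^ m) / real (Suc (Suc (k T))) ^ m * (real (Suc (Suc (k T))) / real (Suc (k T))) ^ m"
        by (simp add: power_divide del: of_nat_Suc)
      finally show ?case .
    qed
  qed
qed

text \<open>The point t is approached from the left by its dyadic truncations \<open>s j\<close>.
  From level j to level j + 1 they either stay or move by one cell of level j + 1, so the
  displacement is bounded by a geometric series, and continuity carries the bound to t.\<close>

lemma dyadic_chain:
  fixes g :: "real \<Rightarrow> real"
  assumes g: "continuous_on {a..a + 1} g" and r: "0 \<le> r" "r < 1"
    and inc: "\<And>j k. k < 2 ^ j \<Longrightarrow> \<bar>g (a + real (Suc k) / 2 ^ j) - g (a + real k / 2 ^ j)\<bar> \<le> b * r ^ j"
    and t: "t \<in> {a..a + 1}"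
  shows "\<bar>g t - g a\<bar> \<le> b / (1 - r)"
proof -
  have "\<bar>g (a + 1) - g a\<bar> \<le> b" using inc[of 0 0] by simp
  then have b: "0 \<le> b" "\<bar>g (a + 1) - g a\<bar> \<le> b" by auto
  have bb: "b \<le> b / (1 - r)" using b r by (simp add: le_divide_eq mult_left_le)
  show ?thesis
  proof (cases "t = a + 1")
    \<comment> \<open>The right end point is reached by the single increment of level 0; the
      truncations below need t < a + 1 to have \<open>k j < 2 ^ j\<close>.\<close>
    case True
    then show ?thesis using b bb by simp
  next
    case False
    define x where "x = t - a"
    have x: "0 \<le> x" "x < 1" using t False by (auto simp: x_def)
    define k where "k j = nat \<lfloor>x * 2 ^ j\<rfloor>" for j
    have kx: "real (k j) \<le> x * 2 ^ j" "x * 2 ^ j < real (k j) + 1" for j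
      using x by (auto simp: k_def)
    define s where "s j = a + real (k j) / 2 ^ j" for j
    have kb: "k j < 2 ^ j" for j
    proof -
      have "x * 2 ^ j < 1 * 2 ^ j" using x by (intro mult_strict_right_mono) auto
      then have "real (k j) < 2 ^ j" using kx(1)[of j] by linarith
      then show ?thesis by (metis of_nat_less_iff of_nat_numeral of_nat_power)
    qed
    have step: "\<bar>g (s (Suc j)) - g (s j)\<bar> \<le> b * r ^ Suc j" for j
    proof -
      have 1: "real (k (Suc j)) < 2 * real (k j) + 2" and 2: "2 * real (k j) < real (k (Suc j)) + 1"
        using kx[of j] kx[of "Suc j"] by auto
      have "k (Suc j) = 2 * k j \<or> k (Suc j) = Suc (2 * k j)"
        using 1 2 by linarith
      then show ?thesis
      proof
        assume "k (Suc j) = 2 * k j"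
        then have "s (Suc j) = s j" by (simp add: s_def)
        then show ?thesis using b r by simp
      next
        assume e: "k (Suc j) = Suc (2 * k j)"
        then have "s (Suc j) = a + real (Suc (2 * k j)) / 2 ^ Suc j" "s j = a + real (2 * k j) / 2 ^ Suc j"
          by (simp_all add: s_def)
        moreover have "2 * k j < 2 ^ Suc j" using kb[of j] by simp
        ultimately show ?thesis using inc[of "2 * k j" "Suc j"] by simp
      qed
    qed
    have s0: "s 0 = a" using kb[of 0] by (simp add: s_def)
    have part: "\<bar>g (s j) - g a\<bar> \<le> (\<Sum>i<j. b * r ^ Suc i)" for j
    proof (induction j)
      case 0
      then show ?case by (simp add: s0)
    next
      case (Suc j)
      have "\<bar>g (s (Suc j)) - g a\<bar> \<le> \<bar>g (s (Suc j)) - g (s j)\<bar> + \<bar>g (s j) - g a\<bar>" by linarith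
      then show ?case using Suc step[of j] by simp
    qed
    have sumle: "(\<Sum>i<j. b * r ^ Suc i) \<le> b / (1 - r)" for j
    proof -
      have "(\<Sum>i<j. b * r ^ Suc i) = b * r * (\<Sum>i<j. r ^ i)" by (simp add: sum_distrib_left mult.assoc)
      also have "(\<Sum>i<j. r ^ i) = (1 - r ^ j) / (1 - r)" using r by (simp add: sum_gp_strict)
      also have "b * r * ((1 - r ^ j) / (1 - r)) \<le> (b * 1) * (1 / (1 - r))"
        using b r by (intro mult_mono divide_right_mono) (auto simp: power_le_one)
      finally show ?thesis by simp
    qed
    have "s \<longlonglongrightarrow> t"
    proof (rule tendsto_sandwich)
      show "eventually (\<lambda>j. t - (1/2) ^ j \<le> s j) sequentially"
      proof (intro always_eventually allI)
        fix j
        have "x \<le> (real (k j) + 1) / 2 ^ j" using kx(2)[of j] by (subst pos_le_divide_eq) auto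
        then have "x - 1 / 2 ^ j \<le> real (k j) / 2 ^ j" by (simp add: add_divide_distrib)
        then show "t - (1/2) ^ j \<le> s j" by (simp add: s_def x_def power_divide)
      qed
      show "eventually (\<lambda>j. s j \<le> t) sequentially"
      proof (intro always_eventually allI)
        fix j
        have "real (k j) / 2 ^ j \<le> x" using kx(1)[of j] by (simp add: field_simps)
        then show "s j \<le> t" by (simp add: s_def x_def)
      qed
      show "(\<lambda>j. t - (1/2) ^ j) \<longlonglongrightarrow> t" using tendsto_diff[OF tendsto_const[of t] LIMSEQ_power_zero[of "1/2::real"]] by simp
    qed simp
    moreover have "s j \<in> {a..a + 1}" for j using kb[of j]
    proof -
      have "real (k j) \<le> 2 ^ j" using kb[of j] by (metis less_imp_le of_nat_le_iff of_nat_numeral of_nat_power)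
      then show ?thesis by (simp add: s_def)
    qed
    ultimately have "(\<lambda>j. g (s j)) \<longlonglongrightarrow> g t"
      using t by (intro continuous_on_tendsto_compose[OF g]) auto
    then have "(\<lambda>j. \<bar>g (s j) - g a\<bar>) \<longlonglongrightarrow> \<bar>g t - g a\<bar>" by (intro tendsto_intros)
    then show ?thesis
      by (rule LIMSEQ_le_const2) (use part sumle order_trans in blast)
  qed
qed

text \<open>Explicit primitives on both sides of s. The bound does not depend on s, so a further
  integration over s only costs a factor T.\<close>

lemma integral_shifted_powr_le:
  fixes a s T :: real
  assumes a: "0 < a" and s: "0 \<le> s" "s \<le> T"
  shows "(\<lambda>r. (1 + \<bar>r - s\<bar>) powr (a - 1)) integrable_on {0..T}"
    "integral {0..T} (\<lambda>r. (1 + \<bar>r - s\<bar>) powr (a - 1)) \<le> 2 * ((1 + T) powr a / a)"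
proof -
  have c: "continuous_on S (\<lambda>r. (1 + \<bar>r - s\<bar>) powr (a - 1))" for S
  proof -
    have "1 + \<bar>r - s\<bar> \<noteq> 0" for r using abs_ge_zero[of "r - s"] by linarith
    then show ?thesis by (intro continuous_intros) auto
  qed
  then show i: "(\<lambda>r. (1 + \<bar>r - s\<bar>) powr (a - 1)) integrable_on {0..T}"
    by (rule integrable_continuous_real)
  have "((\<lambda>r. (1 + \<bar>r - s\<bar>) powr (a - 1)) has_integral - ((1 + (s - s)) powr a / a) - - ((1 + (s - 0)) powr a / a)) {0..s}"
  proof (rule fundamental_theorem_of_calculus[OF s(1)])
    fix r assume r: "r \<in> {0..s}"
    have "((\<lambda>r. (1 + (s - r)) powr a) has_real_derivative a * (1 + (s - r)) powr (a - 1) * - 1) (at r within {0..s})"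
      using r by (intro DERIV_chain2[OF has_real_derivative_powr]) (auto intro!: derivative_eq_intros)
    from DERIV_minus[OF DERIV_cdivide[OF this, of a]]
    have "((\<lambda>r. - ((1 + (s - r)) powr a / a)) has_real_derivative (1 + (s - r)) powr (a - 1)) (at r within {0..s})"
      using a by simp
    moreover have "\<bar>r - s\<bar> = s - r" using r by simp
    ultimately show "((\<lambda>r. - ((1 + (s - r)) powr a / a)) has_vector_derivative (1 + \<bar>r - s\<bar>) powr (a - 1)) (at r within {0..s})"
      by (simp add: has_real_derivative_iff_has_vector_derivative)
  qed
  then have 1: "integral {0..s} (\<lambda>r. (1 + \<bar>r - s\<bar>) powr (a - 1)) = ((1 + s) powr a - 1) / a"
    by (simp add: integral_unique diff_divide_distrib)
  have "((\<lambda>r. (1 + \<bar>r - s\<bar>) powr (a - 1)) has_integral ((1 + (T - s)) powr a / a) - ((1 + (s - s)) powr a / a)) {s..T}"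
  proof (rule fundamental_theorem_of_calculus[OF s(2)])
    fix r assume r: "r \<in> {s..T}"
    have "((\<lambda>r. (1 + (r - s)) powr a) has_real_derivative a * (1 + (r - s)) powr (a - 1) * 1) (at r within {s..T})"
      using r by (intro DERIV_chain2[OF has_real_derivative_powr]) (auto intro!: derivative_eq_intros)
    from DERIV_cdivide[OF this, of a]
    have "((\<lambda>r. ((1 + (r - s)) powr a / a)) has_real_derivative (1 + (r - s)) powr (a - 1)) (at r within {s..T})"
      using a by simp
    moreover have "\<bar>r - s\<bar> = r - s" using r by simp
    ultimately show "((\<lambda>r. ((1 + (r - s)) powr a / a)) has_vector_derivative (1 + \<bar>r - s\<bar>) powr (a - 1)) (at r within {s..T})"
      by (simp add: has_real_derivative_iff_has_vector_derivative)
  qed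
  then have 2: "integral {s..T} (\<lambda>r. (1 + \<bar>r - s\<bar>) powr (a - 1)) = ((1 + (T - s)) powr a - 1) / a"
    by (simp add: integral_unique diff_divide_distrib)
  have "integral {0..T} (\<lambda>r. (1 + \<bar>r - s\<bar>) powr (a - 1)) = ((1 + s) powr a - 1) / a + ((1 + (T - s)) powr a - 1) / a"
    using Henstock_Kurzweil_Integration.integral_combine[OF s i] 1 2 by simp
  also have "\<dots> \<le> (1 + T) powr a / a + (1 + T) powr a / a"
  proof (intro add_mono divide_right_mono)
    have "(1 + s) powr a \<le> (1 + T) powr a" using s a by (intro powr_mono2) auto
    then show "(1 + s) powr a - 1 \<le> (1 + T) powr a" by linarith
    have "(1 + (T - s)) powr a \<le> (1 + T) powr a" using s a by (intro powr_mono2) auto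
    then show "(1 + (T - s)) powr a - 1 \<le> (1 + T) powr a" by linarith
  qed (use a in auto)
  finally show "integral {0..T} (\<lambda>r. (1 + \<bar>r - s\<bar>) powr (a - 1)) \<le> 2 * ((1 + T) powr a / a)" by simp
qed

section \<open>The law of large numbers for the energy\<close>

context regular_noise
begin

text \<open>Joins the uniform bound near the diagonal to the decay away from it. With h = |t - s|,
  the number (1 + h) / 2 is at most 1 or at most h, so its power with the negative exponent \<beta>
  - 1 dominates in both cases; writing it as a power of 1 + h costs the factor
  \<open>2 powr (1 - \<beta>)\<close>. The shifted form is not singular at t = s.\<close>

lemma K_sq_decay: "\<exists>c\<ge>0. \<forall>s t. 0 \<le> s \<longrightarrow> 0 \<le> t \<longrightarrow> 2 * (K s t)\<^sup>2 \<le> c * (1 + \<bar>t - s\<bar>) powr (2 * \<beta> - 2)"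
proof -
  obtain c where c: "0 \<le> c" "\<And>s t. 0 \<le> s \<Longrightarrow> s < t \<Longrightarrow> \<bar>K s t\<bar> \<le> c * (t - s) powr (\<beta> - 1)"
    using K_decay[OF K_abs_le] by blast
  have sym: "K s t = K t s" if "0 \<le> s" "0 \<le> t" for s t
    using that by (simp add: K_eq[symmetric] mult.commute)
  define k where "k = (variance_bound + c) * 2 powr (1 - \<beta>)"
  have k: "\<bar>K s t\<bar> \<le> k * (1 + h) powr (\<beta> - 1)" if s: "0 \<le> s" "0 \<le> t" and h: "h = \<bar>t - s\<bar>" for s t h
  proof -
    have h0: "0 \<le> h" using h by simp
    have e: "k * (1 + h) powr (\<beta> - 1) = (variance_bound + c) * ((1 + h) / 2) powr (\<beta> - 1)"
    proof -
      have "((1 + h) / 2) powr (\<beta> - 1) = (1 + h) powr (\<beta> - 1) / 2 powr (\<beta> - 1)" using h0 by (simp add: powr_divide)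
      also have "\<dots> = (1 + h) powr (\<beta> - 1) * 2 powr (1 - \<beta>)" using powr_minus_divide[of 2 "\<beta> - 1"] by simp
      finally show ?thesis by (simp add: k_def)
    qed
    show ?thesis
    proof (cases "h \<le> 1")
      case True
      have "1 powr (\<beta> - 1) \<le> ((1 + h) / 2) powr (\<beta> - 1)" using True h0 params by (intro powr_mono2') auto
      then have "(variance_bound + 0) * 1 \<le> (variance_bound + c) * ((1 + h) / 2) powr (\<beta> - 1)" using c variance_bound_nonneg by (intro mult_mono) auto
      then show ?thesis unfolding e using K_abs_le[OF s] by simp
    next
      case False
      have "h powr (\<beta> - 1) \<le> ((1 + h) / 2) powr (\<beta> - 1)" using False h0 params by (intro powr_mono2') auto
      then have le: "c * h powr (\<beta> - 1) \<le> (variance_bound + c) * ((1 + h) / 2) powr (\<beta> - 1)" using c variance_bound_nonneg by (intro mult_mono) auto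
      have "\<bar>K s t\<bar> \<le> c * h powr (\<beta> - 1)"
      proof (cases "s < t")
        case True
        then show ?thesis using c(2)[of s t] s h by simp
      next
        case False
        then have "t < s" using h \<open>\<not> h \<le> 1\<close> by auto
        then show ?thesis using c(2)[of t s] s h sym[OF s] by simp
      qed
      then show ?thesis unfolding e using le by linarith
    qed
  qed
  have "2 * (K s t)\<^sup>2 \<le> (2 * k\<^sup>2) * (1 + \<bar>t - s\<bar>) powr (2 * \<beta> - 2)" if s: "0 \<le> s" "0 \<le> t" for s t
  proof -
    have "\<bar>K s t\<bar>\<^sup>2 \<le> (k * (1 + \<bar>t - s\<bar>) powr (\<beta> - 1))\<^sup>2" using k[OF s refl] by (intro power_mono) auto
    also have "\<dots> = k\<^sup>2 * (1 + \<bar>t - s\<bar>) powr (2 * \<beta> - 2)"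
      by (simp add: power_mult_distrib power2_eq_square powr_add[symmetric])
    finally show ?thesis by simp
  qed
  then show ?thesis by (intro exI[of _ "2 * k\<^sup>2"]) auto
qed

definition X_sq_centered where "X_sq_centered s \<omega> = (X s \<omega>)\<^sup>2 - K s s"

lemma X_sq_centered_cont_process: "cont_process X_sq_centered"
  unfolding X_sq_centered_def by (intro cont_process_diff X_sq_cont_process cont_process_det continuous_on_halfline K_diag_cont)

lemma X_sq_centered_sq_int: "0 \<le> s \<Longrightarrow> square_integrable M (X_sq_centered s)"
  using sq_int_diff[OF X2_sq_int, of s "\<lambda>_. K s s"] by (simp add: X_sq_centered_def[abs_def] square_integrable_def)

lemma X_sq_centered_inner:
  assumes s: "0 \<le> s" and t: "0 \<le> t"
  shows "(LINT \<omega>|M. X_sq_centered s \<omega> * X_sq_centered t \<omega>) = 2 * (K s t)\<^sup>2"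
proof -
  have i: "integrable M (\<lambda>\<omega>. (X s \<omega>)\<^sup>2 * (X t \<omega>)\<^sup>2)" "integrable M (\<lambda>\<omega>. (X s \<omega>)\<^sup>2)" "integrable M (\<lambda>\<omega>. (X t \<omega>)\<^sup>2)"
    using sq_int_mult[OF X2_sq_int[OF s] X2_sq_int[OF t]] sq_int_integrable[OF X2_sq_int[OF s]] sq_int_integrable[OF X2_sq_int[OF t]] by auto
  have "(LINT \<omega>|M. X_sq_centered s \<omega> * X_sq_centered t \<omega>) =
    (LINT \<omega>|M. (X s \<omega>)\<^sup>2 * (X t \<omega>)\<^sup>2 - K t t * (X s \<omega>)\<^sup>2 - K s s * (X t \<omega>)\<^sup>2 + K s s * K t t)"
    by (simp add: X_sq_centered_def algebra_simps)
  also have "\<dots> = (LINT \<omega>|M. (X s \<omega>)\<^sup>2 * (X t \<omega>)\<^sup>2) - K t t * K s s - K s s * K t t + K s s * K t t"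
    using i s t by (simp add: K_var prob_space)
  also have "\<dots> = 2 * (K s t)\<^sup>2"
    using H_wick(2)[OF X_H[OF s] X_H[OF t]] s t by (simp add: K_var K_eq)
  finally show ?thesis .
qed

lemma X_sq_centered_var: "0 \<le> s \<Longrightarrow> (LINT \<omega>|M. (X_sq_centered s \<omega>)\<^sup>2) \<le> 2 * variance_bound\<^sup>2"
  using X_sq_centered_inner[of s s] K_nonneg[of s] variance_bound[of s] power_mono[of "K s s" variance_bound 2] by (simp add: power2_eq_square)

lemma path_energy_centered: "\<omega> \<in> space M \<Longrightarrow> 0 \<le> T \<Longrightarrow> path_energy T \<omega> - integral {0..T} (\<lambda>s. K s s) = integral {0..T} (\<lambda>s. X_sq_centered s \<omega>)"
  unfolding path_energy_def X_sq_centered_def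
  by (intro Henstock_Kurzweil_Integration.integral_diff[symmetric] integrable_continuous_real cont_process_path[OF X_sq_cont_process] K_diag_cont) auto

text \<open>The variance is the double integral of the covariances 2 (K s r)^2. The inner integral
  is of order (1 + T)^(2\<beta> - 1) uniformly in s, and the outer one adds a factor T; since
  \<beta> < 1 the result is of smaller order than T^2.\<close>

lemma path_energy_variance: "\<exists>c\<ge>0. \<forall>T\<ge>0. (LINT \<omega>|M. (path_energy T \<omega> - integral {0..T} (\<lambda>s. K s s))\<^sup>2) \<le> c * (1 + T) powr (2 * \<beta>)"
proof -
  obtain c where c: "0 \<le> c" "\<And>s t. 0 \<le> s \<Longrightarrow> 0 \<le> t \<Longrightarrow> 2 * (K s t)\<^sup>2 \<le> c * (1 + \<bar>t - s\<bar>) powr (2 * \<beta> - 2)"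
    using K_sq_decay by blast
  define a where "a = 2 * \<beta> - 1"
  have a: "0 < a" "2 * \<beta> - 2 = a - 1" using params by (auto simp: a_def)
  define c' where "c' = c * (2 / a)"
  have "(LINT \<omega>|M. (path_energy T \<omega> - integral {0..T} (\<lambda>s. K s s))\<^sup>2) \<le> c' * (1 + T) powr (2 * \<beta>)" if T: "0 \<le> T" for T
  proof -
    define Z where "Z \<omega> = integral {0..T} (\<lambda>s. X_sq_centered s \<omega>)" for \<omega>
    have Zsi: "square_integrable M Z"
      unfolding Z_def by (rule cont_process_integral_sq(1)[OF X_sq_centered_cont_process order_refl T X_sq_centered_sq_int X_sq_centered_var]) auto
    note inner = cont_process_integral_inner[OF X_sq_centered_cont_process order_refl T X_sq_centered_sq_int X_sq_centered_var, folded Z_def]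
    have "(LINT \<omega>|M. (path_energy T \<omega> - integral {0..T} (\<lambda>s. K s s))\<^sup>2) = (LINT \<omega>|M. Z \<omega> * Z \<omega>)"
      by (intro Bochner_Integration.integral_cong) (auto simp: path_energy_centered[OF _ T] Z_def power2_eq_square)
    also have "\<dots> = integral {0..T} (\<lambda>s. LINT \<omega>|M. X_sq_centered s \<omega> * Z \<omega>)" by (rule inner(2)) (use Zsi in auto)
    also have "\<dots> \<le> integral {0..T} (\<lambda>s. c' * (1 + T) powr a)"
    proof (rule integral_le)
      show "(\<lambda>s. LINT \<omega>|M. X_sq_centered s \<omega> * Z \<omega>) integrable_on {0..T}" by (rule inner(1)) (use Zsi in auto)
      fix s assume s: "s \<in> {0..T}"
      have "(LINT \<omega>|M. X_sq_centered s \<omega> * Z \<omega>) = (LINT \<omega>|M. Z \<omega> * X_sq_centered s \<omega>)" by (simp add: mult.commute)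
      also have "\<dots> = integral {0..T} (\<lambda>r. LINT \<omega>|M. X_sq_centered r \<omega> * X_sq_centered s \<omega>)" by (rule inner(2)) (use s X_sq_centered_sq_int in auto)
      also have "\<dots> \<le> integral {0..T} (\<lambda>r. c * (1 + \<bar>r - s\<bar>) powr (a - 1))"
      proof (rule integral_le)
        show "(\<lambda>r. LINT \<omega>|M. X_sq_centered r \<omega> * X_sq_centered s \<omega>) integrable_on {0..T}" by (rule inner(1)) (use s X_sq_centered_sq_int in auto)
        show "(\<lambda>r. c * (1 + \<bar>r - s\<bar>) powr (a - 1)) integrable_on {0..T}"
          using s by (intro integrable_on_mult_right integral_shifted_powr_le(1) a) auto
        show "(LINT \<omega>|M. X_sq_centered r \<omega> * X_sq_centered s \<omega>) \<le> c * (1 + \<bar>r - s\<bar>) powr (a - 1)" if "r \<in> {0..T}" for r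
          using c(2)[of r s] that s by (simp add: X_sq_centered_inner a(2) abs_minus_commute)
      qed
      also have "\<dots> = c * integral {0..T} (\<lambda>r. (1 + \<bar>r - s\<bar>) powr (a - 1))" by (rule integral_mult_right)
      also have "\<dots> \<le> c * (2 * ((1 + T) powr a / a))" using s c(1) a by (intro mult_left_mono integral_shifted_powr_le(2)) auto
      finally show "(LINT \<omega>|M. X_sq_centered s \<omega> * Z \<omega>) \<le> c' * (1 + T) powr a" by (simp add: c'_def)
    qed auto
    also have "\<dots> = c' * (T * (1 + T) powr a)" using T by simp
    also have "\<dots> \<le> c' * (1 + T) powr (2 * \<beta>)"
    proof (rule mult_left_mono)
      have "T * (1 + T) powr a \<le> (1 + T) * (1 + T) powr a" by (intro mult_right_mono) auto
      also have "\<dots> = (1 + T) powr (2 * \<beta>)" using T by (simp add: a_def powr_diff)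
      finally show "T * (1 + T) powr a \<le> (1 + T) powr (2 * \<beta>)" .
    qed (use c a in \<open>auto simp: c'_def\<close>)
    finally show ?thesis .
  qed
  moreover have "0 \<le> c'" using c a by (simp add: c'_def)
  ultimately show ?thesis by blast
qed

definition lim_var where "lim_var = C * Gamma (2 * \<beta> - 1) * \<theta> powr (- (2 * \<beta>))"

lemma mean_path_energy_lim: "((\<lambda>T. integral {0..T} (\<lambda>s. K s s) / T) \<longlongrightarrow> lim_var) at_top"
  unfolding lim_var_def by (rule cesaro_integral_tendsto[OF K_diag_cont K_lim])

lemma path_energy_mono: "\<omega> \<in> space M \<Longrightarrow> 0 \<le> s \<Longrightarrow> s \<le> t \<Longrightarrow> path_energy s \<omega> \<le> path_energy t \<omega>"
  unfolding path_energy_def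
  by (intro integral_subset_le integrable_continuous_real cont_process_path[OF X_sq_cont_process]) auto

lemma path_energy_nonneg: "\<omega> \<in> space M \<Longrightarrow> 0 \<le> path_energy t \<omega>"
  unfolding path_energy_def by (intro integral_nonneg integrable_continuous_real cont_process_path[OF X_sq_cont_process]) auto

text \<open>The variance of \<open>path_energy T / T\<close> is of order \<open>T powr (2 * \<beta> - 2)\<close>, hence summable along \<open>T = n ^ m\<close>
  when \<open>m * (1 - \<beta>) \<ge> 1\<close>; monotonicity in \<open>T\<close> fills the gaps.\<close>

lemma path_energy_LLN: "AE \<omega> in M. ((\<lambda>T. path_energy T \<omega> / T) \<longlongrightarrow> lim_var) at_top"
proof -
  obtain c where c: "0 \<le> c" "\<And>T. 0 \<le> T \<Longrightarrow> (LINT \<omega>|M. (path_energy T \<omega> - integral {0..T} (\<lambda>s. K s s))\<^sup>2) \<le> c * (1 + T) powr (2 * \<beta>)"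
    using path_energy_variance by blast
  define m where "m = nat \<lceil>1 / (1 - \<beta>)\<rceil>"
  have "1 / (1 - \<beta>) \<le> real m" unfolding m_def using params by (intro real_nat_ceiling_ge)
  then have m1: "1 \<le> real m * (1 - \<beta>)" using params by (simp add: divide_le_eq)
  have m0: "0 < m" using m1 params by (cases m) auto
  define T where "T n = real (Suc n) ^ m" for n
  have T1: "1 \<le> T n" for n unfolding T_def by (rule one_le_power) simp
  have T0: "0 \<le> T n" "0 < T n" for n using T1[of n] by auto
  define Z where "Z n \<omega> = ((path_energy (T n) \<omega> - integral {0..T n} (\<lambda>s. K s s)) / T n)\<^sup>2" for n \<omega>
  have dsi: "square_integrable M (\<lambda>\<omega>. path_energy (T n) \<omega> - integral {0..T n} (\<lambda>s. K s s))" for n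
    using sq_int_diff[OF path_energy_sq_int[OF T0(1)[of n]], of "\<lambda>_. integral {0..T n} (\<lambda>s. K s s)"] by (simp add: square_integrable_def)
  have Ze: "(LINT \<omega>|M. Z n \<omega>) \<le> 4 * c * (1 / real (Suc n) ^ 2)" for n
  proof -
    have "(LINT \<omega>|M. Z n \<omega>) = (LINT \<omega>|M. (path_energy (T n) \<omega> - integral {0..T n} (\<lambda>s. K s s))\<^sup>2) / (T n)\<^sup>2"
      by (simp add: Z_def power_divide)
    also have "\<dots> \<le> c * (1 + T n) powr (2 * \<beta>) / (T n)\<^sup>2" using c(2)[OF T0(1)] by (intro divide_right_mono) auto
    also have "\<dots> \<le> c * (4 * T n powr (2 * \<beta>)) / (T n)\<^sup>2"
    proof (intro divide_right_mono mult_left_mono c(1))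
      have "(1 + T n) powr (2 * \<beta>) \<le> (2 * T n) powr (2 * \<beta>)" using T1[of n] params by (intro powr_mono2) auto
      also have "\<dots> = 2 powr (2 * \<beta>) * T n powr (2 * \<beta>)" using T0 by (simp add: powr_mult)
      also have "\<dots> \<le> 2 powr 2 * T n powr (2 * \<beta>)" using params by (intro mult_right_mono powr_mono) auto
      finally show "(1 + T n) powr (2 * \<beta>) \<le> 4 * T n powr (2 * \<beta>)" by (simp add: powr_numeral)
    qed simp
    also have "\<dots> = 4 * c * T n powr (2 * \<beta> - 2)" using T0(2)[of n] by (simp add: powr_diff powr_numeral)
    also have "\<dots> \<le> 4 * c * (1 / real (Suc n) ^ 2)"
    proof (rule mult_left_mono)
      have "T n powr (2 * \<beta> - 2) = real (Suc n) powr (real m * (2 * \<beta> - 2))"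
        unfolding T_def by (simp add: powr_realpow[symmetric] powr_powr del: of_nat_Suc)
      also have "\<dots> \<le> real (Suc n) powr (- 2)" using m1 by (intro powr_mono) (auto simp: algebra_simps)
      also have "\<dots> = 1 / real (Suc n) ^ 2" by (simp add: powr_minus_divide powr_numeral del: of_nat_Suc)
      finally show "T n powr (2 * \<beta> - 2) \<le> 1 / real (Suc n) ^ 2" .
    qed (use c in auto)
    finally show ?thesis .
  qed
  have "AE \<omega> in M. (\<lambda>n. Z n \<omega>) \<longlonglongrightarrow> 0"
  proof (rule AE_tendsto_zero_of_integrable)
    show "integrable M (Z n)" for n using dsi[of n] by (simp add: Z_def[abs_def] power_divide square_integrable_def)
    show "0 \<le> Z n \<omega>" for n \<omega> by (simp add: Z_def)
    have "summable (\<lambda>n. inverse (real n ^ 2))" by (rule inverse_power_summable) simp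
    then have "summable (\<lambda>n. inverse (real (Suc n) ^ 2))"
      unfolding summable_Suc_iff[of "\<lambda>n. inverse (real n ^ 2)"] .
    then have "summable (\<lambda>n. 4 * c * (1 / real (Suc n) ^ 2))"
      by (intro summable_mult) (simp only: inverse_eq_divide)
    then show "summable (\<lambda>n. LINT \<omega>|M. Z n \<omega>)"
      by (rule summable_comparison_test'[where N = 0]) (use Ze in \<open>auto simp: Z_def\<close>)
  qed
  then show ?thesis
  proof (rule AE_mp[OF _ AE_I2[OF impI]])
    fix \<omega> assume \<omega>: "\<omega> \<in> space M" and Z0: "(\<lambda>n. Z n \<omega>) \<longlonglongrightarrow> 0"
    from Z0 have "(\<lambda>n. (path_energy (T n) \<omega> - integral {0..T n} (\<lambda>s. K s s)) / T n) \<longlonglongrightarrow> 0" unfolding Z_def by simp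
    moreover have "filterlim T at_top sequentially"
      unfolding T_def
      by (intro filterlim_pow_at_top m0 filterlim_compose[OF filterlim_real_sequentially filterlim_Suc])
    then have "(\<lambda>n. integral {0..T n} (\<lambda>s. K s s) / T n) \<longlonglongrightarrow> lim_var"
      by (rule filterlim_compose[OF mean_path_energy_lim])
    ultimately have "(\<lambda>n. (path_energy (T n) \<omega> - integral {0..T n} (\<lambda>s. K s s)) / T n + integral {0..T n} (\<lambda>s. K s s) / T n) \<longlonglongrightarrow> 0 + lim_var"
      by (rule tendsto_add)
    then have "(\<lambda>n. path_energy (T n) \<omega> / T n) \<longlonglongrightarrow> lim_var" by (simp add: diff_divide_distrib)
    then show "((\<lambda>T. path_energy T \<omega> / T) \<longlongrightarrow> lim_var) at_top"
      unfolding T_def by (intro tendsto_of_power_subsequence[OF m0]) (auto intro: path_energy_mono[OF \<omega>] path_energy_nonneg[OF \<omega>])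
  qed
qed

end

text \<open>The sum over j dominates each of its terms, and its expectation is at most w N / (1 -
  q), which is summable in N. Hence one null sequence serves all levels j.\<close>

lemma (in prob_space) AE_bounded_by_null_sequence:
  fixes Z :: "nat \<Rightarrow> nat \<Rightarrow> 'a \<Rightarrow> real"
  assumes Z: "\<And>N j. integrable M (Z N j)" "\<And>N j \<omega>. 0 \<le> Z N j \<omega>"
    and b: "\<And>N j. (LINT \<omega>|M. Z N j \<omega>) \<le> w N * q ^ j" and q: "0 \<le> q" "q < 1" and w: "summable w"
  shows "AE \<omega> in M. \<exists>U. U \<longlonglongrightarrow> 0 \<and> (\<forall>N j. Z N j \<omega> \<le> U N)"
proof -
  have s: "summable (\<lambda>j. LINT \<omega>|M. Z N j \<omega>)" for N
    by (rule summable_comparison_test'[OF summable_mult[OF summable_geometric[of q]], where N = 0 and c1 = "w N"])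
      (use q b Z(2) in auto)
  have S: "AE \<omega> in M. summable (\<lambda>j. Z N j \<omega>)" for N
    by (rule AE_summable_of_integrable[OF Z s])
  have i: "integrable M (\<lambda>\<omega>. \<Sum>j. Z N j \<omega>)" for N
    by (rule integrable_suminf) (use S s Z in auto)
  have e: "(LINT \<omega>|M. (\<Sum>j. Z N j \<omega>)) = (\<Sum>j. LINT \<omega>|M. Z N j \<omega>)" for N
    by (rule integral_suminf) (use S s Z in auto)
  have nn: "AE \<omega> in M. \<bar>\<Sum>j. Z N j \<omega>\<bar> = (\<Sum>j. Z N j \<omega>)" for N
    using S[of N] by eventually_elim (simp add: suminf_nonneg Z(2))
  \<comment> \<open>Where the series diverges its sum is unspecified and possibly negative; the
    absolute value makes the sequence nonnegative everywhere.\<close>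
  have "AE \<omega> in M. (\<lambda>N. \<bar>\<Sum>j. Z N j \<omega>\<bar>) \<longlonglongrightarrow> 0"
  proof (rule AE_tendsto_zero_of_integrable)
    show "summable (\<lambda>N. LINT \<omega>|M. \<bar>\<Sum>j. Z N j \<omega>\<bar>)"
    proof (rule summable_comparison_test'[OF summable_mult2[OF w, of "1 / (1 - q)"], where N = 0])
      fix N
      have "(LINT \<omega>|M. \<bar>\<Sum>j. Z N j \<omega>\<bar>) = (LINT \<omega>|M. (\<Sum>j. Z N j \<omega>))"
        by (rule integral_cong_AE) (use i nn borel_measurable_integrable in auto)
      also have "\<dots> \<le> (\<Sum>j. w N * q ^ j)" unfolding e
        by (intro suminf_le b s summable_mult summable_geometric) (use q in auto)
      also have "\<dots> = w N * (1 / (1 - q))" using q by (simp add: suminf_mult suminf_geometric summable_geometric)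
      finally show "norm (LINT \<omega>|M. \<bar>\<Sum>j. Z N j \<omega>\<bar>) \<le> w N * (1 / (1 - q))" by simp
    qed
  qed (use i in auto)
  moreover have "AE \<omega> in M. \<forall>N. summable (\<lambda>j. Z N j \<omega>)" using S by (simp add: AE_all_countable)
  ultimately show ?thesis
  proof eventually_elim
    case (elim \<omega>)
    have "Z N j \<omega> \<le> (\<Sum>j. Z N j \<omega>)" for N j
      using sum_le_suminf[of "\<lambda>j. Z N j \<omega>" "{j}"] elim(2) Z(2) by auto
    then have "Z N j \<omega> \<le> \<bar>\<Sum>j. Z N j \<omega>\<bar>" for N j by (rule order_trans) simp
    then show ?case using elim(1) by blast
  qed
qed

text \<open>The variance of |f| over an interval of length 1 is nonnegative.\<close>

lemma integral_abs_sq_le: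
  fixes f :: "real \<Rightarrow> real"
  assumes f: "continuous_on {a..a + 1} f"
  shows "(integral {a..a + 1} (\<lambda>s. \<bar>f s\<bar>))\<^sup>2 \<le> integral {a..a + 1} (\<lambda>s. (f s)\<^sup>2)"
proof -
  define c where "c = integral {a..a + 1} (\<lambda>s. \<bar>f s\<bar>)"
  have i: "(\<lambda>s. (f s)\<^sup>2) integrable_on {a..a + 1}" "(\<lambda>s. 2 * c * \<bar>f s\<bar>) integrable_on {a..a + 1}"
    "(\<lambda>s. (f s)\<^sup>2 - 2 * c * \<bar>f s\<bar>) integrable_on {a..a + 1}"
    using f by (auto intro!: integrable_continuous_real continuous_intros)
  have "0 \<le> integral {a..a + 1} (\<lambda>s. (\<bar>f s\<bar> - c)\<^sup>2)"
    by (rule Henstock_Kurzweil_Integration.integral_nonneg) (use f in \<open>auto intro!: integrable_continuous_real continuous_intros\<close>)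
  also have "\<dots> = integral {a..a + 1} (\<lambda>s. (f s)\<^sup>2 - 2 * c * \<bar>f s\<bar> + c\<^sup>2)"
    by (simp add: power2_diff algebra_simps)
  also have "\<dots> = integral {a..a + 1} (\<lambda>s. (f s)\<^sup>2) - 2 * c * c + c\<^sup>2"
    using i by (subst Henstock_Kurzweil_Integration.integral_add)
      (auto simp: Henstock_Kurzweil_Integration.integral_diff integral_mult_right c_def)
  finally show ?thesis by (simp add: c_def[symmetric] power2_eq_square)
qed

section \<open>Oscillation of the noise and growth of X\<close>

context regular_noise
begin

text \<open>The fourth moment is three times the squared variance, and for distances at most 1 the
  power 2\<beta> > 1 may be lowered to 1.\<close>

lemma G_increment_fourth:
  assumes "0 \<le> s" "s \<le> t" "t - s \<le> 1"
  shows "integrable M (\<lambda>\<omega>. (G t \<omega> - G s \<omega>) ^ 4)" "(LINT \<omega>|M. (G t \<omega> - G s \<omega>) ^ 4) \<le> 3 * K1\<^sup>2 * (t - s)\<^sup>2"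
proof -
  have g: "centered_gaussian M (\<lambda>\<omega>. G t \<omega> - G s \<omega>)" using assms by (intro H_gaussian H_diff H_base) auto
  show "integrable M (\<lambda>\<omega>. (G t \<omega> - G s \<omega>) ^ 4)" by (rule centered_gaussian_moments(2)[OF g])
  have "(t - s) powr (2 * \<beta>) \<le> (t - s) powr 1" using assms params by (intro powr_mono') auto
  then have "K1 * (t - s) powr (2 * \<beta>) \<le> K1 * (t - s)" using assms K1_nonneg by (intro mult_left_mono) auto
  then have "(LINT \<omega>|M. (G t \<omega> - G s \<omega>)\<^sup>2) \<le> K1 * (t - s)" using G_increment[OF assms(1,2)] by linarith
  then have "(LINT \<omega>|M. (G t \<omega> - G s \<omega>)\<^sup>2)\<^sup>2 \<le> (K1 * (t - s))\<^sup>2" by (intro power_mono) auto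
  then show "(LINT \<omega>|M. (G t \<omega> - G s \<omega>) ^ 4) \<le> 3 * K1\<^sup>2 * (t - s)\<^sup>2"
    using centered_gaussian_moments(3)[OF g] by (simp add: power_mult_distrib)
qed

text \<open>Chaining over dyadic grids with fourth moments: level \<open>j\<close> contributes at most \<open>3 K1\<^sup>2 2\<^bsup>-j\<^esup>\<close>, which
  leaves room for the weight \<open>p ^ j\<close> with \<open>p = (10/9) ^ 4 < 2\<close>; dividing by \<open>p ^ j\<close> bounds the increments
  of level \<open>j\<close> by a multiple of \<open>(9/10) ^ j\<close>.\<close>

lemma G_oscillation:
  "AE \<omega> in M. \<exists>B. (\<lambda>N. (B N)\<^sup>2 / real (Suc N)) \<longlonglongrightarrow> 0 \<and> (\<forall>N. \<forall>t\<in>{real N..real N + 1}. \<bar>G t \<omega> - G (real N) \<omega>\<bar> \<le> B N)"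
proof -
  define p where "p = (10/9::real) ^ 4"
  \<comment> \<open>Summable in N, while its inverse (N + 1)^2 is still a harmless growth: it leads
    to (B N)^4 = U N (N + 1)^2 with U a null sequence, hence to (B N)^2 = o(N).\<close>
  define w where "w N = 1 / real (Suc N) ^ 2" for N
  define d where "d N j k \<omega> = G (real N + real (Suc k) / 2 ^ j) \<omega> - G (real N + real k / 2 ^ j) \<omega>" for N j k :: nat and \<omega>
  define Z where "Z N j \<omega> = w N * (p ^ j * (\<Sum>k<2 ^ j. d N j k \<omega> ^ 4))" for N j \<omega>
  have p: "0 < p" "p / 2 < 1" by (auto simp: p_def power_divide)
  have w: "0 < w N" for N by (simp add: w_def)
  have len: "(real N + real (Suc k) / 2 ^ j) - (real N + real k / 2 ^ j) = 1 / 2 ^ j" for N k j :: nat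
    by (simp add: diff_divide_distrib[symmetric])
  have ord: "0 \<le> real N + real k / 2 ^ j" "real N + real k / 2 ^ j \<le> real N + real (Suc k) / 2 ^ j" "1 / 2 ^ j \<le> (1::real)" for N k j :: nat
    by (auto intro!: divide_right_mono)
  have di: "integrable M (\<lambda>\<omega>. d N j k \<omega> ^ 4)" for N j k
    unfolding d_def by (rule G_increment_fourth(1)) (use ord len in auto)
  have de: "(LINT \<omega>|M. d N j k \<omega> ^ 4) \<le> 3 * K1\<^sup>2 * (1 / 2 ^ j)\<^sup>2" for N j k
    unfolding d_def using G_increment_fourth(2)[OF ord(1,2)[of N k j]] ord(3)[of j] by (simp only: len)
  have "summable (\<lambda>n. inverse (real n ^ 2))" by (rule inverse_power_summable) simp
  then have "summable (\<lambda>n. inverse (real (Suc n) ^ 2))" unfolding summable_Suc_iff[of "\<lambda>n. inverse (real n ^ 2)"] .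
  then have ws: "summable w" unfolding w_def by (simp only: inverse_eq_divide)
  have "AE \<omega> in M. \<exists>U. U \<longlonglongrightarrow> 0 \<and> (\<forall>N j. Z N j \<omega> \<le> U N)"
  proof (rule AE_bounded_by_null_sequence)
    show "integrable M (Z N j)" for N j
      unfolding Z_def by (intro integrable_mult_right Bochner_Integration.integrable_sum di)
    show "0 \<le> Z N j \<omega>" for N j \<omega>
      unfolding Z_def using w p by (intro mult_nonneg_nonneg sum_nonneg) (auto intro: less_imp_le)
    show "(LINT \<omega>|M. Z N j \<omega>) \<le> (w N * (3 * K1\<^sup>2)) * (p / 2) ^ j" for N j
    proof -
      have "(LINT \<omega>|M. Z N j \<omega>) = w N * (p ^ j * (\<Sum>k<2 ^ j. (LINT \<omega>|M. d N j k \<omega> ^ 4)))"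
        unfolding Z_def using di by simp
      also have "\<dots> \<le> w N * (p ^ j * (\<Sum>k<2 ^ j::nat. 3 * K1\<^sup>2 * (1 / 2 ^ j)\<^sup>2))"
        using w[of N] p by (intro mult_left_mono sum_mono de) auto
      also have "\<dots> = (w N * (3 * K1\<^sup>2)) * (p / 2) ^ j"
        by (simp add: power_divide power2_eq_square)
      finally show ?thesis .
    qed
    show "summable (\<lambda>N. w N * (3 * K1\<^sup>2))" by (intro summable_mult2 ws)
  qed (use p in auto)
  then show ?thesis
  proof (rule AE_mp[OF _ AE_I2[OF impI]])
    fix \<omega> assume \<omega>: "\<omega> \<in> space M" and "\<exists>U. U \<longlonglongrightarrow> 0 \<and> (\<forall>N j. Z N j \<omega> \<le> U N)"
    then obtain U where U: "U \<longlonglongrightarrow> 0" "\<And>N j. Z N j \<omega> \<le> U N" by blast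
    have U0: "0 \<le> U N" for N using U(2)[of N 0] w[of N] by (simp add: Z_def) (meson order_trans zero_le_mult_iff less_imp_le zero_le_even_power even_numeral)
    define B where "B N = sqrt (sqrt (U N) * real (Suc N))" for N
    have B0: "0 \<le> B N" for N by (simp add: B_def U0)
    have B2: "(B N)\<^sup>2 = sqrt (U N) * real (Suc N)" for N unfolding B_def by (intro real_sqrt_pow2 mult_nonneg_nonneg) (auto simp: U0)
    have B4: "B N ^ 4 = U N * real (Suc N) ^ 2" for N
    proof -
      have "B N ^ 4 = ((B N)\<^sup>2)\<^sup>2" by simp
      then show ?thesis unfolding B2 power_mult_distrib using U0 by simp
    qed
    have inc: "\<bar>d N j k \<omega>\<bar> \<le> B N * (9/10) ^ j" if k: "k < 2 ^ j" for N j k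
    \<comment> \<open>Fourth powers (\<open>Suc 3\<close>) are compared; \<open>p\<close> is chosen
      so that the fourth power of (9/10)^j is 1 / p^j.\<close>
    proof (rule power_le_imp_le_base[of _ 3])
      have "((9/10::real) ^ j) ^ 4 = ((9/10) ^ 4) ^ j" by (simp only: power_mult[symmetric] mult.commute)
      also have "(9/10::real) ^ 4 = 1 / p" by (simp add: p_def power_divide)
      finally have r4: "((9/10::real) ^ j) ^ 4 = 1 / p ^ j" by (simp add: power_one_over)
      have "d N j k \<omega> ^ 4 \<le> (\<Sum>k<2 ^ j. d N j k \<omega> ^ 4)"
        using k by (intro member_le_sum) auto
      then have "w N * (p ^ j * d N j k \<omega> ^ 4) \<le> Z N j \<omega>"
        unfolding Z_def using w[of N] p by (intro mult_left_mono) auto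
      then have "w N * (p ^ j * d N j k \<omega> ^ 4) \<le> U N" using U(2)[of N j] by linarith
      then have "d N j k \<omega> ^ 4 \<le> U N * real (Suc N) ^ 2 / p ^ j"
        using p by (simp add: w_def field_simps del: of_nat_Suc)
      also have "\<dots> = (B N * (9/10) ^ j) ^ 4"
        by (simp only: power_mult_distrib B4 r4) (simp del: of_nat_Suc)
      finally show "\<bar>d N j k \<omega>\<bar> ^ Suc 3 \<le> (B N * (9/10) ^ j) ^ Suc 3" by simp
      show "0 \<le> B N * (9/10) ^ j" using B0 by simp
    qed
    have "\<bar>G t \<omega> - G (real N) \<omega>\<bar> \<le> B N / (1 - 9/10)" if t: "t \<in> {real N..real N + 1}" for N t
      by (rule dyadic_chain[OF cont_process_path[OF G_cont_process \<omega>] _ _ _ t]) (use inc in \<open>auto simp: d_def\<close>)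
    moreover have "(\<lambda>N. (B N / (1 - 9/10))\<^sup>2 / real (Suc N)) = (\<lambda>N. 100 * sqrt (U N))"
      by (rule ext) (simp add: power_divide B2 del: of_nat_Suc)
    moreover have "(\<lambda>N. 100 * sqrt (U N)) \<longlonglongrightarrow> 100 * sqrt 0" by (intro tendsto_intros U(1))
    ultimately show "\<exists>B. (\<lambda>N. (B N)\<^sup>2 / real (Suc N)) \<longlonglongrightarrow> 0 \<and> (\<forall>N. \<forall>t\<in>{real N..real N + 1}. \<bar>G t \<omega> - G (real N) \<omega>\<bar> \<le> B N)"
      by (intro exI[of _ "\<lambda>N. B N / (1 - 9/10)"]) auto
  qed
qed

text \<open>X t is compared with X s for every s in the unit interval, and the comparison is
  integrated over s. The difference is at most the oscillation 2 b of G plus \<theta> times the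
  integral J of |X|, and J^2 is at most the energy of the interval.\<close>

lemma X_sq_le:
  assumes \<omega>: "\<omega> \<in> space M" and a: "0 \<le> a" and B: "\<And>t. t \<in> {a..a + 1} \<Longrightarrow> \<bar>G t \<omega> - G a \<omega>\<bar> \<le> b" and t: "t \<in> {a..a + 1}"
  shows "(X t \<omega>)\<^sup>2 \<le> (2 + 4 * \<theta>\<^sup>2) * (path_energy (a + 1) \<omega> - path_energy a \<omega>) + 16 * b\<^sup>2"
proof -
  define d where "d = integral {a..a + 1} (\<lambda>s. (X s \<omega>)\<^sup>2)"
  define J where "J = integral {a..a + 1} (\<lambda>s. \<bar>X s \<omega>\<bar>)"
  have c: "continuous_on {u..v} (\<lambda>s. X s \<omega>)" if "0 \<le> u" for u v by (rule cont_process_path[OF X_cont_process \<omega> that])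
  have ci: "(\<lambda>s. (X s \<omega>)\<^sup>2) integrable_on {u..v}" "(\<lambda>s. \<bar>X s \<omega>\<bar>) integrable_on {u..v}" if "0 \<le> u" for u v
    using c[OF that] by (auto intro!: integrable_continuous_real continuous_intros)
  have "path_energy a \<omega> + d = path_energy (a + 1) \<omega>" unfolding path_energy_def d_def
    by (intro Henstock_Kurzweil_Integration.integral_combine ci a) auto
  then have d: "path_energy (a + 1) \<omega> - path_energy a \<omega> = d" by simp
  have J2: "J\<^sup>2 \<le> d" unfolding J_def d_def by (rule integral_abs_sq_le[OF c[OF a]])
  have diff: "\<bar>X v \<omega> - X u \<omega>\<bar> \<le> 2 * b + \<theta> * J" if u: "a \<le> u" "u \<le> v" "v \<le> a + 1" for u v
  proof -
    have 1: "\<bar>G v \<omega> - G u \<omega>\<bar> \<le> 2 * b" using B[of u] B[of v] u by auto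
    have "\<bar>integral {u..v} (\<lambda>r. X r \<omega>)\<bar> \<le> integral {u..v} (\<lambda>r. \<bar>X r \<omega>\<bar>)"
    proof -
      have "(\<lambda>r. X r \<omega>) integrable_on {u..v}" using u a by (intro integrable_continuous_real c) auto
      from integral_norm_bound_integral[OF this ci(2)] show ?thesis using u a by simp
    qed
    also have "\<dots> \<le> J" unfolding J_def
      by (rule integral_subset_le) (use u a ci in auto)
    finally have "\<theta> * \<bar>integral {u..v} (\<lambda>r. X r \<omega>)\<bar> \<le> \<theta> * J" using \<theta> by (intro mult_left_mono) auto
    then have "\<bar>\<theta> * integral {u..v} (\<lambda>r. X r \<omega>)\<bar> \<le> \<theta> * J" using \<theta> by (simp add: abs_mult)
    then show ?thesis using 1 X_increment_eq[OF \<omega>, of u v] u a by linarith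
  qed
  have pw: "(X t \<omega>)\<^sup>2 - 16 * b\<^sup>2 - 4 * \<theta>\<^sup>2 * d \<le> 2 * (X s \<omega>)\<^sup>2" if s: "s \<in> {a..a + 1}" for s
  proof -
    have "\<bar>X t \<omega> - X s \<omega>\<bar> \<le> 2 * b + \<theta> * J"
      using diff[of s t] diff[of t s] s t by (cases "s \<le> t") auto
    then have "(X t \<omega> - X s \<omega>)\<^sup>2 \<le> (2 * b + \<theta> * J)\<^sup>2" using power_mono[of "\<bar>X t \<omega> - X s \<omega>\<bar>" _ 2] by simp
    also have "\<dots> \<le> 2 * (2 * b)\<^sup>2 + 2 * (\<theta> * J)\<^sup>2"
      using zero_le_power2[of "2 * b - \<theta> * J"] unfolding power2_sum power2_diff by linarith
    also have "\<dots> \<le> 8 * b\<^sup>2 + 2 * (\<theta>\<^sup>2 * d)"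
      using mult_left_mono[OF J2, of "\<theta>\<^sup>2"] by (simp add: power_mult_distrib)
    finally have "(X t \<omega> - X s \<omega>)\<^sup>2 \<le> 8 * b\<^sup>2 + 2 * (\<theta>\<^sup>2 * d)" .
    moreover have "(X t \<omega>)\<^sup>2 \<le> 2 * (X t \<omega> - X s \<omega>)\<^sup>2 + 2 * (X s \<omega>)\<^sup>2"
      using zero_le_power2[of "X t \<omega> - 2 * X s \<omega>"] by (simp add: power2_eq_square algebra_simps)
    ultimately show ?thesis by (simp add: mult.assoc)
  qed
  have "integral {a..a + 1} (\<lambda>s. (X t \<omega>)\<^sup>2 - 16 * b\<^sup>2 - 4 * \<theta>\<^sup>2 * d) \<le> integral {a..a + 1} (\<lambda>s. 2 * (X s \<omega>)\<^sup>2)"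
    by (rule integral_le) (use pw ci[OF a] in \<open>auto intro: integrable_on_mult_right\<close>)
  then have "(X t \<omega>)\<^sup>2 - 16 * b\<^sup>2 - 4 * \<theta>\<^sup>2 * d \<le> 2 * d" by (simp add: integral_mult_right d_def)
  then show ?thesis unfolding d by (simp add: algebra_simps)
qed

text \<open>The energy of [N, N + 1] is o(N), because the energies up to N and up to N + 1, divided
  by N + 1, have the same limit; the oscillation of G on this interval contributes o(N) as
  well.\<close>

lemma X_sq_over_time: "AE \<omega> in M. ((\<lambda>T. (X T \<omega>)\<^sup>2 / T) \<longlongrightarrow> 0) at_top"
  using path_energy_LLN G_oscillation
proof (rule AE_mp[OF AE_conjI AE_I2[OF impI]])
  fix \<omega> assume \<omega>: "\<omega> \<in> space M" and "((\<lambda>T. path_energy T \<omega> / T) \<longlongrightarrow> lim_var) at_top \<and>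
    (\<exists>B. (\<lambda>N. (B N)\<^sup>2 / real (Suc N)) \<longlonglongrightarrow> 0 \<and> (\<forall>N. \<forall>t\<in>{real N..real N + 1}. \<bar>G t \<omega> - G (real N) \<omega>\<bar> \<le> B N))"
  then obtain B where l: "((\<lambda>T. path_energy T \<omega> / T) \<longlongrightarrow> lim_var) at_top" and B: "(\<lambda>N. (B N)\<^sup>2 / real (Suc N)) \<longlonglongrightarrow> 0"
    "\<And>N t. t \<in> {real N..real N + 1} \<Longrightarrow> \<bar>G t \<omega> - G (real N) \<omega>\<bar> \<le> B N" by blast
  define d where "d N = path_energy (real N + 1) \<omega> - path_energy (real N) \<omega>" for N
  define e where "e N = (2 + 4 * \<theta>\<^sup>2) * (d N / real (Suc N)) + 16 * ((B N)\<^sup>2 / real (Suc N))" for N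
  have 1: "(\<lambda>N. path_energy (real N) \<omega> / real N) \<longlonglongrightarrow> lim_var"
    by (rule filterlim_compose[OF l filterlim_real_sequentially])
  have 2: "(\<lambda>N. path_energy (real N + 1) \<omega> / real (Suc N)) \<longlonglongrightarrow> lim_var" using LIMSEQ_Suc[OF 1] by (simp add: add.commute)
  have "(\<lambda>N. real N / real (Suc N)) \<longlonglongrightarrow> 1" by real_asymp
  from tendsto_mult[OF 1 this] have "(\<lambda>N. path_energy (real N) \<omega> / real N * (real N / real (Suc N))) \<longlonglongrightarrow> lim_var" by simp
  moreover have "eventually (\<lambda>N. path_energy (real N) \<omega> / real N * (real N / real (Suc N)) = path_energy (real N) \<omega> / real (Suc N)) sequentially"
    using eventually_gt_at_top[of 0] by eventually_elim simp
  ultimately have 3: "(\<lambda>N. path_energy (real N) \<omega> / real (Suc N)) \<longlonglongrightarrow> lim_var" by (rule Lim_transform_eventually)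
  have "(\<lambda>N. d N / real (Suc N)) \<longlonglongrightarrow> 0" using tendsto_diff[OF 2 3] by (simp add: d_def diff_divide_distrib)
  from tendsto_add[OF tendsto_mult[OF tendsto_const this] tendsto_mult[OF tendsto_const B(1)], of "2 + 4 * \<theta>\<^sup>2" 16]
  have e: "e \<longlonglongrightarrow> 0" unfolding e_def by simp
  have "filterlim (\<lambda>T::real. nat \<lfloor>T\<rfloor>) sequentially at_top"
    by (rule filterlim_compose[OF filterlim_nat_sequentially filterlim_floor_sequentially])
  from filterlim_compose[OF e this] have "((\<lambda>T::real. e (nat \<lfloor>T\<rfloor>)) \<longlongrightarrow> 0) at_top" .
  from tendsto_mult[OF tendsto_const this, of 2]
  have lim: "((\<lambda>T::real. 2 * e (nat \<lfloor>T\<rfloor>)) \<longlongrightarrow> 0) at_top" by simp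
  show "((\<lambda>T. (X T \<omega>)\<^sup>2 / T) \<longlongrightarrow> 0) at_top"
  proof (rule tendsto_sandwich[OF _ _ tendsto_const lim])
    show "eventually (\<lambda>T. 0 \<le> (X T \<omega>)\<^sup>2 / T) at_top"
      using eventually_gt_at_top[of 0] by eventually_elim simp
    show "eventually (\<lambda>T. (X T \<omega>)\<^sup>2 / T \<le> 2 * e (nat \<lfloor>T\<rfloor>)) at_top"
      using eventually_ge_at_top[of 1]
    proof eventually_elim
      case (elim T)
      define N where "N = nat \<lfloor>T\<rfloor>"
      have "real N = of_int \<lfloor>T\<rfloor>" using elim by (simp add: N_def)
      then have N: "real N \<le> T" "T \<le> real N + 1" by linarith+
      have "(X T \<omega>)\<^sup>2 \<le> (2 + 4 * \<theta>\<^sup>2) * d N + 16 * (B N)\<^sup>2"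
        unfolding d_def by (rule X_sq_le[OF \<omega> _ B(2)]) (use N in auto)
      also have "\<dots> = real (Suc N) * e N" by (simp add: e_def distrib_left mult.left_commute del: of_nat_Suc)
      finally have le: "(X T \<omega>)\<^sup>2 \<le> real (Suc N) * e N" .
      \<comment> \<open>The sign is needed to enlarge the factor N + 1 to 2 T in front of
        \<open>e N\<close>.\<close>
      then have "0 \<le> e N" by (meson order_trans zero_le_power2 zero_le_mult_iff of_nat_0_less_iff zero_less_Suc not_less)
      then have "real (Suc N) * e N \<le> (2 * T) * e N" using N elim by (intro mult_right_mono) auto
      with le have "(X T \<omega>)\<^sup>2 \<le> (2 * T) * e N" by linarith
      then have "(X T \<omega>)\<^sup>2 \<le> 2 * e N * T" by (simp add: mult_ac)
      then show ?case using elim by (subst pos_divide_le_eq) (auto simp: N_def)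
    qed
  qed
qed

text \<open>The energy and its mean, divided by T, have the same limit, so the two terms with
  \<theta> cancel; the remaining terms (X T)^2 and K T T are o(T).\<close>

lemma ou_skorohod_over_time: "AE \<omega> in M. ((\<lambda>T. ou_skorohod T \<omega> / T) \<longlongrightarrow> 0) at_top"
  using path_energy_LLN X_sq_over_time
proof eventually_elim
  case (elim \<omega>)
  have k: "((\<lambda>T. K T T / T) \<longlongrightarrow> 0) at_top"
  proof (rule tendsto_sandwich[OF _ _ tendsto_const])
    show "eventually (\<lambda>T. 0 \<le> K T T / T) at_top"
      using eventually_gt_at_top[of 0] by eventually_elim (simp add: K_nonneg)
    show "eventually (\<lambda>T. K T T / T \<le> variance_bound / T) at_top"
      using eventually_gt_at_top[of 0] by eventually_elim (simp add: variance_bound divide_right_mono)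
    show "((\<lambda>T. variance_bound / T) \<longlongrightarrow> 0) at_top"
      by (rule tendsto_divide_0[OF tendsto_const filterlim_at_top_imp_at_infinity[OF filterlim_ident]])
  qed
  have "((\<lambda>T. (X T \<omega>)\<^sup>2 / T / 2 + \<theta> * (path_energy T \<omega> / T) - (K T T / T / 2 + \<theta> * (integral {0..T} (\<lambda>s. K s s) / T))) \<longlongrightarrow>
    0 / 2 + \<theta> * lim_var - (0 / 2 + \<theta> * lim_var)) at_top"
    by (intro tendsto_intros elim k mean_path_energy_lim) auto
  moreover have "ou_skorohod T \<omega> / T = (X T \<omega>)\<^sup>2 / T / 2 + \<theta> * (path_energy T \<omega> / T) - (K T T / T / 2 + \<theta> * (integral {0..T} (\<lambda>s. K s s) / T))" for T
    by (simp add: ou_skorohod_def pathwise_integral_def diff_divide_distrib add_divide_distrib)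
  ultimately show ?case by simp
qed

lemma lim_var_pos: "0 < lim_var"
  using params \<theta> Gamma_real_pos[of "2 * \<beta> - 1"] by (simp add: lim_var_def)

end

section \<open>Passage to regular versions\<close>

text \<open>A process and its modification are compared at nonnegative times only. Derivatives at
  positive times depend on nearby positive times alone, so the hypothesis carries over.\<close>

lemma noise_hypothesis_cong:
  assumes "\<And>t s. 0 \<le> t \<Longrightarrow> 0 \<le> s \<Longrightarrow> R t s = S t s" and R: "noise_hypothesis R \<beta> C C' \<Psi>"
  shows "noise_hypothesis S \<beta> C C' \<Psi>"
proof -
  from R obtain R' where p: "1/2 < \<beta>" "\<beta> < 1" "0 < C" "0 \<le> C'"
    and d: "\<forall>t>0. \<forall>s>0. ((\<lambda>s. R t s) has_real_derivative R' t s) (at s)"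
    and m: "\<forall>s>0. continuous_on {0<..} (\<lambda>t. R' t s)"
      "\<forall>t>0. \<forall>s>0. t \<noteq> s \<longrightarrow> ((\<lambda>t. R' t s) has_real_derivative C * \<bar>t - s\<bar> powr (2 * \<beta> - 2) + \<Psi> t s) (at t)"
    and r: "\<forall>t>0. \<forall>s>0. t \<noteq> s \<longrightarrow> \<bar>\<Psi> t s\<bar> \<le> C' * \<bar>t * s\<bar> powr (\<beta> - 1)" "\<forall>t\<ge>0. R 0 t = 0"
    unfolding noise_hypothesis_def by (elim conjE exE) rule
  have d': "\<forall>t>0. \<forall>s>0. ((\<lambda>s. S t s) has_real_derivative R' t s) (at s)"
  proof (intro allI impI)
    fix t s :: real assume t: "0 < t" "0 < s"
    show "((\<lambda>s. S t s) has_real_derivative R' t s) (at s)"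
      by (rule has_field_derivative_transform_within_open[of "R t" _ _ "{0<..}"]) (use t d in \<open>simp_all add: assms(1)\<close>)
  qed
  have "\<forall>t\<ge>0. S 0 t = 0" using r(2) by (simp add: assms(1)[symmetric])
  with p m d' r(1) show ?thesis unfolding noise_hypothesis_def by (intro conjI exI[of _ R'])
qed

lemma AE_conull_set:
  assumes "AE x in N. P x"
  obtains S where "S \<in> sets N" "AE x in N. x \<in> S" "\<And>x. x \<in> S \<Longrightarrow> x \<in> space N \<and> P x"
proof -
  from AE_E[OF assms] obtain B where B: "{x \<in> space N. \<not> P x} \<subseteq> B" "emeasure N B = 0" "B \<in> sets N" by blast
  show ?thesis
  proof (rule that[of "space N - B"])
    show "AE x in N. x \<in> space N - B"
      by (rule AE_I[of _ _ B]) (use B in auto)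
  qed (use B in auto)
qed

context prob_space
begin

lemma noise_space_mono_AE:
  assumes G: "\<And>t. 0 \<le> t \<Longrightarrow> G' t \<in> borel_measurable M" "\<And>t. 0 \<le> t \<Longrightarrow> AE \<omega> in M. G t \<omega> = G' t \<omega>"
  shows "noise_space M G \<subseteq> noise_space M G'"
proof
  fix Z assume "Z \<in> noise_space M G"
  then obtain S c where S: "\<And>n. finite (S n)" "\<And>n. S n \<subseteq> {0..}" "L2_limit M (\<lambda>n \<omega>. \<Sum>t\<in>S n. c n t * G t \<omega>) Z"
    by (auto simp: noise_space_def)
  have Sp: "0 \<le> t" if "t \<in> S n" for t n using S(2)[of n] that by auto
  have "L2_limit M (\<lambda>n \<omega>. \<Sum>t\<in>S n. c n t * G' t \<omega>) Z"
  proof (rule L2_limit_AE_cong[OF S(3)])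
    show "(\<lambda>\<omega>. \<Sum>t\<in>S n. c n t * G' t \<omega>) \<in> borel_measurable M" for n
      using G(1) Sp by (intro borel_measurable_sum borel_measurable_times) auto
    show "Z \<in> borel_measurable M" using S(3) by (simp add: L2_limit_def square_integrable_def)
    show "AE \<omega> in M. (\<Sum>t\<in>S n. c n t * G t \<omega>) = (\<Sum>t\<in>S n. c n t * G' t \<omega>)" for n
    proof -
      have "AE \<omega> in M. \<forall>t\<in>S n. G t \<omega> = G' t \<omega>" using G(2) Sp S(1) by (intro AE_finite_allI) auto
      then show ?thesis by eventually_elim simp
    qed
  qed simp
  then show "Z \<in> noise_space M G'" using S(1,2) by (auto simp: noise_space_def)
qed

text \<open>Both noises span the same space in L2 and therefore have the same Malliavin derivative
  and divergence; the step processes agree on the square of S, which has full measure in the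
  product.\<close>

lemma skorohod_integral_AE_cong:
  assumes S: "S \<in> sets M" "AE \<omega> in M. \<omega> \<in> S"
    and eq: "\<And>t \<omega>. 0 \<le> t \<Longrightarrow> \<omega> \<in> S \<Longrightarrow> G t \<omega> = G' t \<omega> \<and> X t \<omega> = X' t \<omega>"
    and m: "\<And>t. 0 \<le> t \<Longrightarrow> G t \<in> borel_measurable M" "\<And>t. 0 \<le> t \<Longrightarrow> G' t \<in> borel_measurable M"
      "\<And>t. 0 \<le> t \<Longrightarrow> X' t \<in> borel_measurable M"
    and T: "0 \<le> T" and sk: "skorohod_integral M G X T Z"
  shows "skorohod_integral M G' X' T Z"
proof -
  interpret P: pair_prob_space M M ..
  have Geq: "AE \<omega> in M. G t \<omega> = G' t \<omega>" if "0 \<le> t" for t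
    using S(2) by eventually_elim (use eq that in auto)
  have H: "noise_space M G = noise_space M G'"
  proof
    show "noise_space M G \<subseteq> noise_space M G'" by (rule noise_space_mono_AE[OF m(2) Geq])
    show "noise_space M G' \<subseteq> noise_space M G"
      by (rule noise_space_mono_AE[OF m(1)]) (use Geq in \<open>auto simp: eq_commute\<close>)
  qed
  from sk obtain u where u: "L2_limit (M \<Otimes>\<^sub>M M) (step_process G X T) u" "divergence M G u Z"
    by (auto simp: skorohod_integral_def)
  have "AE p in M \<Otimes>\<^sub>M M. p \<in> S \<times> S"
  proof (rule P.AE_pair_measure)
    have "{x \<in> space (M \<Otimes>\<^sub>M M). x \<in> S \<times> S} = (S \<times> S) \<inter> space (M \<Otimes>\<^sub>M M)" by auto
    then show "{x \<in> space (M \<Otimes>\<^sub>M M). x \<in> S \<times> S} \<in> sets (M \<Otimes>\<^sub>M M)" using S(1) by simp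
    show "AE x in M. AE y in M. (x, y) \<in> S \<times> S"
      using S(2) by eventually_elim (use S(2) in auto)
  qed
  then have AE: "AE p in M \<Otimes>\<^sub>M M. step_process G X T n p = step_process G' X' T n p" for n
  proof eventually_elim
    case (elim p)
    then show ?case using T by (auto simp: step_process_def eq intro!: sum.cong)
  qed
  have "L2_limit (M \<Otimes>\<^sub>M M) (step_process G' X' T) u"
  proof (rule L2_limit_AE_cong[OF u(1)])
    show "u \<in> borel_measurable (M \<Otimes>\<^sub>M M)" using u(1) by (simp add: L2_limit_def square_integrable_def)
    show "step_process G' X' T n \<in> borel_measurable (M \<Otimes>\<^sub>M M)" for n
      unfolding step_process_def case_prod_unfold
      by (intro borel_measurable_sum borel_measurable_times borel_measurable_diff
          measurable_compose[OF measurable_fst m(3)] measurable_compose[OF measurable_snd m(2)]) (use T in auto)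
  qed (use AE in auto)
  moreover have "divergence M G' u Z" using u(2) by (simp add: divergence_def malliavin_deriv_def H)
  ultimately show ?thesis by (auto simp: skorohod_integral_def)
qed

end

text \<open>Both processes are set to 0 outside an event of full measure on which all path
  properties hold; the zero path has these properties too. That G starts at 0 almost surely comes
  from R(0, 0) = 0.\<close>

lemma ornstein_uhlenbeck_regular_version:
  assumes \<theta>: "0 < \<theta>" and G: "gaussian_noise M G \<beta> C C' \<Psi>" and X: "ornstein_uhlenbeck M G \<theta> X"
  obtains S G' X' where "S \<in> sets M" "AE \<omega> in M. \<omega> \<in> S" "S \<subseteq> space M"
    "\<And>t \<omega>. \<omega> \<in> S \<Longrightarrow> G t \<omega> = G' t \<omega> \<and> X t \<omega> = X' t \<omega>"
    "regular_noise M G' \<beta> C C' \<theta> \<Psi> X'"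
proof -
  interpret centered_gp M G
    using G by (auto simp: gaussian_noise_def centered_gp_def centered_gp_axioms_def)
  have noise: "noise_hypothesis (covariance M G) \<beta> C C' \<Psi>"
    and Rc: "continuous_on ({0..} \<times> {0..}) (\<lambda>(t, s). covariance M G t s)"
    using G by (auto simp: gaussian_noise_def)
  have "(LINT \<omega>|M. (G 0 \<omega>)\<^sup>2) = 0"
    using noise by (simp add: noise_hypothesis_def covariance_def power2_eq_square)
  moreover have "integrable M (\<lambda>\<omega>. (G 0 \<omega>)\<^sup>2)" using H_sq_int[OF H_base[of 0]] by (simp add: square_integrable_def)
  ultimately have "AE \<omega> in M. (G 0 \<omega>)\<^sup>2 = 0" by (subst (asm) integral_nonneg_eq_0_iff_AE) auto
  then have G0: "AE \<omega> in M. G 0 \<omega> = 0" by simp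
  define good where "good \<omega> \<longleftrightarrow> continuous_on {0..} (\<lambda>t. G t \<omega>) \<and> G 0 \<omega> = 0 \<and> continuous_on {0..} (\<lambda>t. X t \<omega>) \<and>
    (\<forall>t\<ge>0. X t \<omega> = - \<theta> * (LBINT s:{0..t}. X s \<omega>) + G t \<omega>)" for \<omega>
  have "AE \<omega> in M. continuous_on {0..} (\<lambda>t. G t \<omega>)" using G by (simp add: gaussian_noise_def)
  moreover have "AE \<omega> in M. continuous_on {0..} (\<lambda>t. X t \<omega>) \<and> X 0 \<omega> = 0 \<and>
        (\<forall>t\<ge>0. X t \<omega> = - \<theta> * (LBINT s:{0..t}. X s \<omega>) + G t \<omega>)" using X by (simp add: ornstein_uhlenbeck_def)
  ultimately have "AE \<omega> in M. good \<omega>" using G0 by eventually_elim (simp add: good_def)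
  then obtain S where S: "S \<in> sets M" "AE \<omega> in M. \<omega> \<in> S" "\<And>\<omega>. \<omega> \<in> S \<Longrightarrow> \<omega> \<in> space M \<and> good \<omega>"
    by (rule AE_conull_set) blast
  define G' where "G' t \<omega> = (if \<omega> \<in> S then G t \<omega> else 0)" for t \<omega>
  define X' where "X' t \<omega> = (if \<omega> \<in> S then X t \<omega> else 0)" for t \<omega>
  have eq: "G t \<omega> = G' t \<omega> \<and> X t \<omega> = X' t \<omega>" if "\<omega> \<in> S" for t \<omega>
    using that by (simp add: G'_def X'_def)
  have [measurable]: "S \<in> sets M" by (rule S(1))
  have Gm [measurable]: "G t \<in> borel_measurable M" if "0 \<le> t" for t using that by (intro H_meas H_base)
  have G'm: "G' t \<in> borel_measurable M" if "0 \<le> t" for t using Gm[OF that] unfolding G'_def by measurable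
  have Xm: "X t \<in> borel_measurable M" if "0 \<le> t" for t using X that by (simp add: ornstein_uhlenbeck_def)
  have X'm: "X' t \<in> borel_measurable M" if "0 \<le> t" for t using Xm[OF that] unfolding X'_def by measurable
  have cov: "covariance M G t s = covariance M G' t s" if "0 \<le> t" "0 \<le> s" for t s
    unfolding covariance_def
  proof (rule integral_cong_AE)
    show "AE \<omega> in M. G t \<omega> * G s \<omega> = G' t \<omega> * G' s \<omega>" using S(2) by eventually_elim (simp add: eq)
  qed (use that Gm G'm in auto)
  have "regular_noise M G' \<beta> C C' \<theta> \<Psi> X'"
  proof (intro regular_noise.intro centered_gp.intro centered_gp_axioms.intro noise_covariance.intro regular_noise_axioms.intro)
    show "prob_space M" by (rule prob_space_axioms)
    show "centered_gaussian_process M G'"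
      unfolding centered_gaussian_process_def
    proof (intro allI impI, elim conjE)
      fix J :: "real set" and c assume J: "finite J" "J \<subseteq> {0..}"
      have h: "(\<lambda>\<omega>. \<Sum>t\<in>J. c t * G t \<omega>) \<in> H" by (intro linear_span_subset linear_spanI J)
      have "L2_limit M (\<lambda>n \<omega>. \<Sum>t\<in>J. c t * G t \<omega>) (\<lambda>\<omega>. \<Sum>t\<in>J. c t * G' t \<omega>)"
      proof (rule L2_limit_AE_cong[OF L2_limit_const[OF H_sq_int[OF h]]])
        show "(\<lambda>\<omega>. \<Sum>t\<in>J. c t * G' t \<omega>) \<in> borel_measurable M"
          using J by (intro borel_measurable_sum borel_measurable_times G'm) auto
        show "AE \<omega> in M. (\<Sum>t\<in>J. c t * G t \<omega>) = (\<Sum>t\<in>J. c t * G' t \<omega>)" using S(2) by eventually_elim (simp add: eq)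
      qed (use h H_meas in auto)
      from H_L2_closed[OF _ this] h show "centered_gaussian M (\<lambda>\<omega>. \<Sum>t\<in>J. c t * G' t \<omega>)"
        by (intro H_gaussian) blast
    qed
    show "noise_hypothesis (covariance M G') \<beta> C C' \<Psi>" by (rule noise_hypothesis_cong[OF cov noise])
    show "covariance M G' t s = covariance M G' s t" for t s by (simp add: covariance_def mult.commute)
    show "continuous_on ({0..} \<times> {0..}) (\<lambda>(t, s). covariance M G' t s)"
      by (rule continuous_on_cong[THEN iffD1, OF refl _ Rc]) (use cov in auto)
    show "0 < \<theta>" by (rule \<theta>)
    show "continuous_on {0..} (\<lambda>t. G' t \<omega>)" "G' 0 \<omega> = 0" "continuous_on {0..} (\<lambda>t. X' t \<omega>)" for \<omega>
      using S(3)[of \<omega>] by (cases "\<omega> \<in> S"; simp add: G'_def X'_def good_def)+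
    show "X' t \<in> borel_measurable M" if "0 \<le> t" for t by (rule X'm[OF that])
    show "X' t \<omega> = G' t \<omega> - \<theta> * integral {0..t} (\<lambda>s. X' s \<omega>)" if t: "0 \<le> t" for t \<omega>
    proof (cases "\<omega> \<in> S")
      case True
      then have g: "good \<omega>" using S(3) by blast
      have "continuous_on {0..t} (\<lambda>s. X s \<omega>)"
        by (rule continuous_on_subset[of "{0..}"]) (use g in \<open>auto simp: good_def\<close>)
      then have "(LBINT s:{0..t}. X s \<omega>) = integral {0..t} (\<lambda>s. X s \<omega>)"
        by (intro set_borel_integral_eq_integral(2) borel_integrable_atLeastAtMost')
      then show ?thesis using g t True by (simp add: good_def G'_def X'_def)
    qed (simp add: G'_def X'_def)
  qed
  with S eq show ?thesis using that[of S G' X'] by blast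
qed

text \<open>An almost sure statement can be collected over countably many times only. The fractions
  approach t from above, which keeps them nonnegative.\<close>

lemma continuous_eq_of_fractions:
  fixes f g :: "real \<Rightarrow> real"
  assumes f: "continuous_on {0..} f" and g: "continuous_on {0..} g"
    and eq: "\<And>m n. f (real m / real (Suc n)) = g (real m / real (Suc n))" and t: "0 \<le> t"
  shows "f t = g t"
proof -
  define s where "s n = real (nat \<lceil>t * real (Suc n)\<rceil>) / real (Suc n)" for n
  have s: "t \<le> s n" "s n \<le> t + 1 / real (Suc n)" for n
  proof -
    have "0 \<le> t * real (Suc n)" using t by simp
    then have "t * real (Suc n) \<le> real (nat \<lceil>t * real (Suc n)\<rceil>)" "real (nat \<lceil>t * real (Suc n)\<rceil>) \<le> t * real (Suc n) + 1"
      by linarith+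
    then show "t \<le> s n" "s n \<le> t + 1 / real (Suc n)" unfolding s_def
      by (simp_all add: pos_le_divide_eq pos_divide_le_eq distrib_right del: of_nat_Suc)
  qed
  have "(\<lambda>n. t + 1 / real (Suc n)) \<longlonglongrightarrow> t + 0" by (intro tendsto_intros LIMSEQ_Suc[OF lim_1_over_n])
  then have "s \<longlonglongrightarrow> t" using s by (intro tendsto_sandwich[OF _ _ tendsto_const, of t s sequentially "\<lambda>n. t + 1 / real (Suc n)"]) auto
  moreover have "s n \<in> {0..}" for n using s(1)[of n] t by simp
  ultimately have "(\<lambda>n. f (s n)) \<longlonglongrightarrow> f t" "(\<lambda>n. g (s n)) \<longlonglongrightarrow> g t"
    using t by (auto intro!: continuous_on_tendsto_compose[OF f] continuous_on_tendsto_compose[OF g])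
  moreover have "(\<lambda>n. f (s n)) = (\<lambda>n. g (s n))" by (rule ext) (simp only: s_def eq)
  ultimately show ?thesis using LIMSEQ_unique by metis
qed

text \<open>The existence of a continuous version is part of the claim, so that the assertion about
  all such versions is not vacuous.\<close>

theorem theorem1p2:
  fixes M :: "'a measure" and G X :: "real \<Rightarrow> 'a \<Rightarrow> real"
    and \<theta> \<beta> C C' :: real and \<Psi> :: "real \<Rightarrow> real \<Rightarrow> real"
  assumes "0 < \<theta>"
    and "gaussian_noise M G \<beta> C C' \<Psi>"
    and "ornstein_uhlenbeck M G \<theta> X"
  shows "(\<exists>I. skorohod_version M G X I) \<and>
    (\<forall>I. skorohod_version M G X I \<longrightarrow>
      (AE \<omega> in M. ((\<lambda>T. least_squares_estimator \<theta> X I T \<omega>) \<longlongrightarrow> \<theta>) at_top)) \<and>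
    (AE \<omega> in M. ((\<lambda>T. second_moment_estimator \<beta> C X T \<omega>) \<longlongrightarrow> \<theta>) at_top)"
proof -
  obtain S G' X' where S: "S \<in> sets M" "AE \<omega> in M. \<omega> \<in> S" "S \<subseteq> space M"
    and eq: "\<And>t \<omega>. \<omega> \<in> S \<Longrightarrow> G t \<omega> = G' t \<omega> \<and> X t \<omega> = X' t \<omega>"
    and reg: "regular_noise M G' \<beta> C C' \<theta> \<Psi> X'"
    by (rule ornstein_uhlenbeck_regular_version[OF assms]) (rule that)
  interpret N: centered_gp M G
    using assms(2) by (auto simp: gaussian_noise_def centered_gp_def centered_gp_axioms_def)
  interpret V: regular_noise M G' \<beta> C C' \<theta> \<Psi> X' by (rule reg)
  \<comment> \<open>Uniqueness of the divergence is applied to the original noise, for which this is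
    an assumption; the asymptotics are taken from the modified one.\<close>
  have gen: "generated_by M G" using assms(2) by (simp add: gaussian_noise_def)
  have Gm: "G t \<in> borel_measurable M" if "0 \<le> t" for t using that by (intro N.H_meas N.H_base)
  have G'm: "G' t \<in> borel_measurable M" if "0 \<le> t" for t using that by (intro V.H_meas V.H_base)
  have Xm: "X t \<in> borel_measurable M" if "0 \<le> t" for t using assms(3) that by (simp add: ornstein_uhlenbeck_def)
  have sk: "skorohod_integral M G X T (V.ou_skorohod T)" if T: "0 \<le> T" for T
    by (rule N.skorohod_integral_AE_cong[OF S(1,2) _ G'm Gm Xm T V.ou_skorohod_skorohod[OF T]]) (use eq in auto)
  have path: "AE \<omega> in M. continuous_on {0..} (\<lambda>T. V.ou_skorohod T \<omega>)"
    by (rule AE_I2) (rule V.ou_skorohod_path)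
  have ex: "skorohod_version M G X V.ou_skorohod" using sk path by (simp add: skorohod_version_def)
  have uniq: "AE \<omega> in M. \<forall>T\<ge>0. I T \<omega> = V.ou_skorohod T \<omega>" if I: "skorohod_version M G X I" for I
  proof -
    have e: "AE \<omega> in M. I T \<omega> = V.ou_skorohod T \<omega>" if T: "0 \<le> T" for T
    proof -
      obtain u where u: "L2_limit (M \<Otimes>\<^sub>M M) (step_process G X T) u" "divergence M G u (I T)"
        using I T by (auto simp: skorohod_version_def skorohod_integral_def)
      obtain u' where u': "L2_limit (M \<Otimes>\<^sub>M M) (step_process G X T) u'" "divergence M G u' (V.ou_skorohod T)"
        using sk[OF T] by (auto simp: skorohod_integral_def)
      show ?thesis by (rule N.divergence_unique[OF gen u(2) u'(2) L2_limit_unique[OF u(1) u'(1)]])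
    qed
    \<comment> \<open>The null set in \<open>e\<close> depends on T: it is collected over the
      nonnegative fractions first, and continuity of both versions covers the other times.\<close>
    have "AE \<omega> in M. \<forall>m n. I (real m / real (Suc n)) \<omega> = V.ou_skorohod (real m / real (Suc n)) \<omega>"
      unfolding AE_all_countable by (intro allI e) simp
    moreover have "AE \<omega> in M. continuous_on {0..} (\<lambda>T. I T \<omega>)" using I by (simp add: skorohod_version_def)
    ultimately show ?thesis using path
    proof eventually_elim
      case (elim \<omega>)
      show ?case
      proof (intro allI impI)
        fix T :: real assume T: "0 \<le> T"
        show "I T \<omega> = V.ou_skorohod T \<omega>"
          by (rule continuous_eq_of_fractions[OF elim(2,3) _ T]) (use elim(1) in blast)
      qed
    qed
  qed
  have energy: "energy X T \<omega> = V.path_energy T \<omega>" if "\<omega> \<in> S" for T \<omega>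
  proof -
    have "continuous_on {0..T} (\<lambda>t. (X' t \<omega>)\<^sup>2)"
      using that S(3) by (intro N.cont_process_path[OF V.X_sq_cont_process]) auto
    then have "(LBINT t:{0..T}. (X' t \<omega>)\<^sup>2) = integral {0..T} (\<lambda>t. (X' t \<omega>)\<^sup>2)"
      by (intro set_borel_integral_eq_integral(2) borel_integrable_atLeastAtMost')
    then show ?thesis using eq[OF that] by (simp add: energy_def V.path_energy_def)
  qed
  have "AE \<omega> in M. ((\<lambda>T. least_squares_estimator \<theta> X I T \<omega>) \<longlongrightarrow> \<theta>) at_top" if I: "skorohod_version M G X I" for I
    using uniq[OF I] S(2) V.path_energy_LLN V.ou_skorohod_over_time
  proof eventually_elim
    case (elim \<omega>)
    have "((\<lambda>T. \<theta> - (V.ou_skorohod T \<omega> / T) / (V.path_energy T \<omega> / T)) \<longlongrightarrow> \<theta> - 0 / V.lim_var) at_top"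
      using V.lim_var_pos by (intro tendsto_intros elim) simp
    \<comment> \<open>The energy is eventually positive because its rate has a positive limit; from
      then on the quotient defining the estimator may be rewritten.\<close>
    moreover have "eventually (\<lambda>T. 0 < V.path_energy T \<omega> / T) at_top"
      using elim(3) V.lim_var_pos by (rule order_tendstoD)
    then have "eventually (\<lambda>T. \<theta> - (V.ou_skorohod T \<omega> / T) / (V.path_energy T \<omega> / T) = least_squares_estimator \<theta> X I T \<omega>) at_top"
      using eventually_gt_at_top[of 0]
    proof eventually_elim
      fix T :: real assume T: "0 < V.path_energy T \<omega> / T" "0 < T"
      then have "0 < V.path_energy T \<omega>" by (simp add: zero_less_divide_iff)
      then show "\<theta> - (V.ou_skorohod T \<omega> / T) / (V.path_energy T \<omega> / T) = least_squares_estimator \<theta> X I T \<omega>"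
        using T elim(1,2) by (simp add: least_squares_estimator_def integral_X_dX_def energy field_simps)
    qed
    ultimately show ?case using Lim_transform_eventually by fastforce
  qed
  moreover have "AE \<omega> in M. ((\<lambda>T. second_moment_estimator \<beta> C X T \<omega>) \<longlongrightarrow> \<theta>) at_top"
    using S(2) V.path_energy_LLN
  proof eventually_elim
    case (elim \<omega>)
    define c where "c = C * Gamma (2 * \<beta> - 1)"
    have c: "0 < c" using V.params Gamma_real_pos[of "2 * \<beta> - 1"] by (simp add: c_def)
    have lv: "V.lim_var = c * \<theta> powr (- (2 * \<beta>))" by (simp add: V.lim_var_def c_def)
    have "((\<lambda>T. (1 / c * (V.path_energy T \<omega> / T)) powr (- (1 / (2 * \<beta>)))) \<longlongrightarrow> (1 / c * V.lim_var) powr (- (1 / (2 * \<beta>)))) at_top"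
      using V.lim_var_pos c by (intro tendsto_intros elim) auto
    moreover have "(1 / c * V.lim_var) powr (- (1 / (2 * \<beta>))) = \<theta>"
      using c V.params assms(1) by (simp add: lv powr_powr)
    moreover have "(1 / c * (V.path_energy T \<omega> / T)) powr (- (1 / (2 * \<beta>))) = second_moment_estimator \<beta> C X T \<omega>" for T
      using elim(1) by (simp add: second_moment_estimator_def energy c_def)
    ultimately show ?case by simp
  qed
  ultimately show ?thesis using ex by blast
qed

end
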